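(* Let $\nu,T>0$, let $\psi\in C([0,T];\mathcal H^\gamma)$ for some $\gamma>0$, and let $\mu_0=\mathcal N(0,\beta A^{-\alpha})$ with $\beta>0$ and $\alpha>1$. Let $\mathcal G:\mathcal H\to\mathbb R^{2JK}$ be the Lagrangian observation map $$\mathcal G(u)=(z_j(t_k))_{1\le j\le J,\,1\le k\le K},$$ where $z_j(t)=z_{j,0}+\int_0^tv(z_j(s),s)\,ds$ with given $z_{j,0}\in\mathbb R^2$, given times $t_k\in(0,T]$, and $v$ the solution of the Stokes equation $\frac{dv}{dt}+\nu Av=\psi$, $v(0)=u$. Let $\Gamma$ be a symmetric positive definite matrix and $y\in\mathbb R^{2JK}$, and let $\mu$ and $\mu^N$ be the probability measures given by $$\frac{d\mu}{d\mu_0}(u)\propto\exp\Bigl(-\tfrac12|y-\mathcal G(u)|_\Gamma^2\Bigr),\qquad\frac{d\mu^N}{d\mu_0}(u)\propto\exp\Bigl(-\tfrac12|y-\mathcal G(P^Nu)|_\Gamma^2\Bigr).$$ Then, for any $q<\alpha-1$, there is a constant $c>0$, independent of $N$, such that $$d_{\rm Hell}(\mu,\mu^N)\le cN^{-q}.$$ Consequently the means of $\mu$ and $\mu^N$ are $\mathcal O(N^{-q})$ close in the $\mathcal H$ norm, and the covariance operators of $\mu$ and $\mu^N$ are $\mathcal O(N^{-q})$ close in the operator norm on $\mathcal H$.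
   Context: $D$ is the unit square with periodic boundary conditions; $\mathcal H=\{u\in L^2_{\rm per}(D)^2:\int_Du\,dx=0,\ \nabla\cdot u=0\}$ with the $L^2$ norm and inner product; $P:L^2_{\rm per}\to\mathcal H$ is the Leray projector and $A=-P\Delta$ the Stokes operator on $\mathcal H$. $\{(\phi_k,\lambda_k)\}_{k\in\mathbb K}$, $\mathbb K=\mathbb Z^2\setminus\{0\}$, is the complete orthonormal set of (Fourier) eigenfunctions and eigenvalues of $A$, with $\phi_k$ the divergence-free mode of wavevector $k$ and $\lambda_k$ proportional to $|k|^2$. $A^au=\sum_k\lambda_k^a\langle u,\phi_k\rangle\phi_k$; $\mathcal H^s=\{u:\|u\|_s^2=\sum_k\lambda_k^s|\langle u,\phi_k\rangle|^2<\infty\}$. $P^N$ is the orthogonal projection in $\mathcal H$ onto the span of $\{\phi_k\}_{|k|\le N}$. In the tracer equation $v(\cdot,s)$ is extended periodically to $\mathbb R^2$; it is known that for $u\in\mathcal H$ and $\psi\in L^2(0,T;\mathcal H)$ the tracer equation has a unique solution $z_j\in C([0,T];\mathbb R^2)$, so $\mathcal G$ is well defined on $\mathcal H$. $|\cdot|$ is the Euclidean norm and $|\cdot|_\Gamma=|\Gamma^{-1/2}\cdot|$. The Hellinger distance between probability measures $\mu,\mu'$ both absolutely continuous with respect to $\nu_0$ is $$d_{\rm Hell}(\mu,\mu')=\Bigl(\tfrac12\int\Bigl(\sqrt{\tfrac{d\mu}{d\nu_0}}-\sqrt{\tfrac{d\mu'}{d\nu_0}}\Bigr)^2d\nu_0\Bigr)^{1/2}.$$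 *)

theory Defs
  imports "HOL-Probability.Probability"
begin

definition unit_square :: "(real^2) set" where
  "unit_square = {x. \<forall>i. 0 \<le> x $ i \<and> x $ i < 1}"

text \<open>\<open>Dm\<close> is Lebesgue measure on the fundamental domain \<open>[0,1)\<^sup>2\<close>.  An element of \<open>L\<^sup>2\<^sub>per(D)\<^sup>2\<close> is an
  a.e.-class of square integrable fields on this domain; periodicity enters through the periodic test
  functions in the weak derivatives and the periodic representative in point evaluation below.\<close>

definition Dm :: "(real^2) measure" where
  "Dm = restrict_space lborel unit_square"

lemma unit_square_borel [measurable]: "unit_square \<in> sets borel"
proof -
  have "unit_square = {x\<in>space borel. \<forall>i. 0 \<le> x $ i \<and> x $ i < 1}"
    by (auto simp: unit_square_def)
  also have "\<dots> \<in> sets borel" by measurable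
  finally show ?thesis .
qed

lemma space_Dm: "space Dm = unit_square"
  by (simp add: Dm_def space_restrict_space)

lemma finite_measure_Dm: "finite_measure Dm"
proof
  have "unit_square \<subseteq> cbox 0 1"
    by (auto simp: unit_square_def mem_box_cart less_imp_le)
  then have "emeasure lborel unit_square \<le> emeasure lborel (cbox 0 (1::real^2))"
    by (intro emeasure_mono) auto
  also have "\<dots> < \<infinity>" using emeasure_lborel_cbox_finite by blast
  finally have "emeasure lborel unit_square < \<infinity>" .
  moreover have "emeasure Dm (space Dm) = emeasure lborel unit_square"
    by (simp add: Dm_def emeasure_restrict_space space_restrict_space)
  ultimately show "emeasure Dm (space Dm) \<noteq> \<infinity>" by simp
qed

interpretation Dm: finite_measure Dm by (rule finite_measure_Dm)

definition sq_int :: "(real^2 \<Rightarrow> real^2) \<Rightarrow> bool" where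
  "sq_int f \<longleftrightarrow> f \<in> borel_measurable Dm \<and> integrable Dm (\<lambda>x. (norm (f x))\<^sup>2)"

definition ae_eq :: "(real^2 \<Rightarrow> real^2) \<Rightarrow> (real^2 \<Rightarrow> real^2) \<Rightarrow> bool" where
  "ae_eq f g \<longleftrightarrow> sq_int f \<and> sq_int g \<and> (AE x in Dm. f x = g x)"

lemma sq_int_zero: "sq_int (\<lambda>x. 0)"
  by (simp add: sq_int_def)

lemma sq_int_inner:
  assumes "sq_int f" "sq_int g"
  shows "integrable Dm (\<lambda>x. f x \<bullet> g x)"
proof (rule Bochner_Integration.integrable_bound)
  show "integrable Dm (\<lambda>x. (norm (f x))\<^sup>2 + (norm (g x))\<^sup>2)"
    using assms by (simp add: sq_int_def)
  show "(\<lambda>x. f x \<bullet> g x) \<in> borel_measurable Dm"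
    using assms by (auto simp: sq_int_def intro: borel_measurable_inner)
  show "AE x in Dm. norm (f x \<bullet> g x) \<le> norm ((norm (f x))\<^sup>2 + (norm (g x))\<^sup>2)"
  proof (rule AE_I2)
    fix x
    have "\<bar>f x \<bullet> g x\<bar> \<le> norm (f x) * norm (g x)" by (rule Cauchy_Schwarz_ineq2)
    also have "\<dots> \<le> (norm (f x))\<^sup>2 + (norm (g x))\<^sup>2"
    proof -
      have "0 \<le> norm (f x) * norm (g x)" by simp
      moreover have "2 * norm (f x) * norm (g x) \<le> (norm (f x))\<^sup>2 + (norm (g x))\<^sup>2"
        by (rule sum_squares_bound)
      ultimately show ?thesis by linarith
    qed
    finally show "norm (f x \<bullet> g x) \<le> norm ((norm (f x))\<^sup>2 + (norm (g x))\<^sup>2)" by simp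
  qed
qed

lemma sq_int_add:
  assumes "sq_int f" "sq_int g"
  shows "sq_int (\<lambda>x. f x + g x)"
proof -
  have "integrable Dm (\<lambda>x. (norm (f x))\<^sup>2 + 2 * (f x \<bullet> g x) + (norm (g x))\<^sup>2)"
    using assms sq_int_inner[OF assms] by (simp add: sq_int_def)
  moreover have "(norm (f x + g x))\<^sup>2 = (norm (f x))\<^sup>2 + 2 * (f x \<bullet> g x) + (norm (g x))\<^sup>2" for x
    by (simp add: power2_norm_eq_inner inner_add_left inner_add_right inner_commute)
  ultimately show ?thesis using assms by (simp add: sq_int_def borel_measurable_add)
qed

lemma sq_int_scaleR: "sq_int f \<Longrightarrow> sq_int (\<lambda>x. c *\<^sub>R f x)"
  by (simp add: sq_int_def power_mult_distrib borel_measurable_scaleR)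

lemma sq_int_minus: "sq_int f \<Longrightarrow> sq_int (\<lambda>x. - f x)"
  using sq_int_scaleR[of f "-1"] by simp

lemma sq_int_diff: "sq_int f \<Longrightarrow> sq_int g \<Longrightarrow> sq_int (\<lambda>x. f x - g x)"
  using sq_int_add[of f "\<lambda>x. - g x"] sq_int_minus[of g] by simp

quotient_type l2per = "real^2 \<Rightarrow> real^2" / partial: ae_eq
proof (rule part_equivpI)
  show "\<exists>f. ae_eq f f" using sq_int_zero by (auto simp: ae_eq_def)
  show "symp ae_eq" by (auto simp: ae_eq_def symp_def elim: eventually_mono)
  show "transp ae_eq"
    unfolding transp_def ae_eq_def by (auto elim: eventually_elim2)
qed

instantiation l2per :: real_inner
begin

lift_definition zero_l2per :: l2per is "\<lambda>x. 0" by (simp add: ae_eq_def sq_int_zero)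
lift_definition plus_l2per :: "l2per \<Rightarrow> l2per \<Rightarrow> l2per" is "\<lambda>f g x. f x + g x"
  by (auto simp: ae_eq_def sq_int_add elim: eventually_elim2)
lift_definition minus_l2per :: "l2per \<Rightarrow> l2per \<Rightarrow> l2per" is "\<lambda>f g x. f x - g x"
  by (auto simp: ae_eq_def sq_int_diff elim: eventually_elim2)
lift_definition uminus_l2per :: "l2per \<Rightarrow> l2per" is "\<lambda>f x. - f x"
  by (auto simp: ae_eq_def sq_int_minus elim: eventually_mono)
lift_definition scaleR_l2per :: "real \<Rightarrow> l2per \<Rightarrow> l2per" is "\<lambda>c f x. c *\<^sub>R f x"
  by (auto simp: ae_eq_def sq_int_scaleR elim: eventually_mono)
lift_definition inner_l2per :: "l2per \<Rightarrow> l2per \<Rightarrow> real" is "\<lambda>f g. \<integral>x. f x \<bullet> g x \<partial>Dm"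
proof -
  fix f1 f2 g1 g2 assume *: "ae_eq f1 f2" "ae_eq g1 g2"
  show "(\<integral>x. f1 x \<bullet> g1 x \<partial>Dm) = (\<integral>x. f2 x \<bullet> g2 x \<partial>Dm)"
  proof (rule integral_cong_AE)
    show "AE x in Dm. f1 x \<bullet> g1 x = f2 x \<bullet> g2 x"
      using * by (auto simp: ae_eq_def elim: eventually_elim2)
  qed (use * in \<open>auto simp: ae_eq_def sq_int_def\<close>)
qed

definition norm_l2per :: "l2per \<Rightarrow> real" where "norm_l2per u = sqrt (inner u u)"
definition sgn_l2per :: "l2per \<Rightarrow> l2per" where "sgn_l2per u = inverse (norm u) *\<^sub>R u"
definition dist_l2per :: "l2per \<Rightarrow> l2per \<Rightarrow> real" where "dist_l2per u v = norm (u - v)"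
definition uniformity_l2per :: "(l2per \<times> l2per) filter" where
  "uniformity_l2per = (INF e\<in>{0 <..}. principal {(x, y). dist x y < e})"
definition open_l2per :: "l2per set \<Rightarrow> bool" where
  "open_l2per U \<longleftrightarrow> (\<forall>x\<in>U. eventually (\<lambda>(x', y). x' = x \<longrightarrow> y \<in> U) uniformity)"

instance
proof
  fix u v w :: l2per and a b r :: real
  show "u + v + w = u + (v + w)"
    by transfer (auto simp: ae_eq_def sq_int_add add.assoc)
  show "u + v = v + u"
    by transfer (auto simp: ae_eq_def sq_int_add add.commute)
  show "0 + u = u" by transfer (auto simp: ae_eq_def)
  show "- u + u = 0" by transfer (auto simp: ae_eq_def sq_int_zero)
  show "u - v = u + - v"
    by transfer (auto simp: ae_eq_def sq_int_diff)
  show "a *\<^sub>R (u + v) = a *\<^sub>R u + a *\<^sub>R v"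
    by transfer (auto simp: ae_eq_def scaleR_add_right intro!: sq_int_add sq_int_scaleR)
  show "(a + b) *\<^sub>R u = a *\<^sub>R u + b *\<^sub>R u"
    by transfer (auto simp: ae_eq_def scaleR_add_left intro!: sq_int_add sq_int_scaleR)
  show "a *\<^sub>R b *\<^sub>R u = (a * b) *\<^sub>R u"
    by transfer (auto simp: ae_eq_def intro!: sq_int_scaleR)
  show "1 *\<^sub>R u = u" by transfer (auto simp: ae_eq_def)
  show "dist u v = norm (u - v)" by (simp add: dist_l2per_def)
  show "sgn u = inverse (norm u) *\<^sub>R u" by (simp add: sgn_l2per_def)
  show "inner u v = inner v u" by transfer (simp add: inner_commute)
  show "inner (u + v) w = inner u w + inner v w"
    by transfer (simp add: ae_eq_def inner_add_left sq_int_inner)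
  show "inner (r *\<^sub>R u) v = r * inner u v"
    by transfer (simp add: ae_eq_def)
  show "0 \<le> inner u u"
    by transfer simp
  show "(inner u u = 0) = (u = 0)"
  proof (transfer)
    fix f assume f: "ae_eq f f"
    have "((\<integral>x. f x \<bullet> f x \<partial>Dm) = 0) = (AE x in Dm. f x \<bullet> f x = 0)"
      using f by (intro integral_nonneg_eq_0_iff_AE) (auto simp: ae_eq_def sq_int_inner)
    then show "((\<integral>x. f x \<bullet> f x \<partial>Dm) = 0) = ae_eq f (\<lambda>x. 0)"
      using f by (simp add: ae_eq_def sq_int_zero)
  qed
  show "norm u = sqrt (inner u u)" by (simp add: norm_l2per_def)
qed (rule uniformity_l2per_def open_l2per_def)+

end

lemma rep_l2per: "sq_int (rep_l2per u)" "abs_l2per (rep_l2per u) = u"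
  using Quotient_rep_reflp[OF Quotient_l2per, of u] Quotient_abs_rep[OF Quotient_l2per, of u]
  by (simp_all add: ae_eq_def)

lemma rep_abs_l2per: "sq_int f \<Longrightarrow> AE x in Dm. rep_l2per (abs_l2per f) x = f x"
  using Quotient_rep_abs[OF Quotient_l2per, of f] by (simp add: ae_eq_def)

lemma abs_l2per_add: "sq_int f \<Longrightarrow> sq_int g \<Longrightarrow> abs_l2per f + abs_l2per g = abs_l2per (\<lambda>x. f x + g x)"
  by (intro plus_l2per.abs_eq) (auto simp: ae_eq_def)

lemma abs_l2per_diff: "sq_int f \<Longrightarrow> sq_int g \<Longrightarrow> abs_l2per f - abs_l2per g = abs_l2per (\<lambda>x. f x - g x)"
  by (intro minus_l2per.abs_eq) (auto simp: ae_eq_def)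

lemma abs_l2per_scaleR: "sq_int f \<Longrightarrow> c *\<^sub>R abs_l2per f = abs_l2per (\<lambda>x. c *\<^sub>R f x)"
  by (intro scaleR_l2per.abs_eq) (auto simp: ae_eq_def)

lemma inner_abs_l2per: "sq_int f \<Longrightarrow> sq_int g \<Longrightarrow> inner (abs_l2per f) (abs_l2per g) = (\<integral>x. f x \<bullet> g x \<partial>Dm)"
  by (intro inner_l2per.abs_eq) (auto simp: ae_eq_def)

lemma inner_l2per_rep: "inner u v = (\<integral>x. rep_l2per u x \<bullet> rep_l2per v x \<partial>Dm)"
  using inner_abs_l2per[OF rep_l2per(1) rep_l2per(1), of u v] by (simp add: rep_l2per(2))

lemma norm_abs_l2per: "sq_int f \<Longrightarrow> (norm (abs_l2per f))\<^sup>2 = (\<integral>x. (norm (f x))\<^sup>2 \<partial>Dm)"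
  by (simp add: power2_norm_eq_inner inner_abs_l2per)

lemma inner_abs_right:
  assumes "sq_int g" shows "inner u (abs_l2per g) = (\<integral>x. rep_l2per u x \<bullet> g x \<partial>Dm)"
  using inner_abs_l2per[OF rep_l2per(1) assms, of u] by (simp add: rep_l2per(2))

lemma sq_int_bounded:
  assumes "f \<in> borel_measurable Dm" "\<And>x. x \<in> unit_square \<Longrightarrow> norm (f x) \<le> B"
  shows "sq_int f"
  unfolding sq_int_def
proof (intro conjI Dm.integrable_const_bound[of _ "B\<^sup>2"])
  show "AE x in Dm. norm ((norm (f x))\<^sup>2) \<le> B\<^sup>2"
    by (rule AE_I2) (auto simp: space_Dm assms intro!: power_mono)
qed (use assms(1) in auto)

lemma sq_int_continuous:
  assumes "continuous_on UNIV f" shows "sq_int f"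
proof -
  have "compact (f ` cbox 0 1)"
    by (intro compact_continuous_image continuous_on_subset[OF assms]) auto
  then obtain B where B: "\<And>x. x \<in> cbox 0 1 \<Longrightarrow> norm (f x) \<le> B"
    using compact_imp_bounded[of "f ` cbox 0 1"] unfolding bounded_iff by auto
  have "unit_square \<subseteq> cbox 0 1"
    by (auto simp: unit_square_def mem_box_cart less_imp_le)
  with B have "\<And>x. x \<in> unit_square \<Longrightarrow> norm (f x) \<le> B" by blast
  moreover have "f \<in> borel_measurable Dm"
    unfolding Dm_def by (intro measurable_restrict_space1) (simp add: borel_measurable_continuous_onI assms)
  ultimately show ?thesis by (rule sq_int_bounded[rotated])
qed

lemma norm_L1_le:
  assumes "sq_int h" "e > 0"
  shows "integrable Dm h" and "(\<integral>x. norm (h x) \<partial>Dm) \<le> e * measure Dm (space Dm) + (\<integral>x. (norm (h x))\<^sup>2 \<partial>Dm) / e"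
proof -
  have bd: "norm (h x) \<le> e + (norm (h x))\<^sup>2 / e" for x
  proof (cases "norm (h x) \<le> e")
    case True then show ?thesis using \<open>e > 0\<close> by (simp add: add_increasing2)
  next
    case False
    then have "norm (h x) * e \<le> (norm (h x))\<^sup>2" unfolding power2_eq_square by (intro mult_left_mono) auto
    then have "norm (h x) \<le> (norm (h x))\<^sup>2 / e" using \<open>e > 0\<close> by (simp add: field_simps)
    then show ?thesis using \<open>e > 0\<close> by linarith
  qed
  have int: "integrable Dm (\<lambda>x. e + (norm (h x))\<^sup>2 / e)"
    using assms by (simp add: sq_int_def)
  have bd': "AE x in Dm. norm (h x) \<le> norm (e + (norm (h x))\<^sup>2 / e)"
    using bd by (intro AE_I2) (metis abs_ge_self order_trans real_norm_def)
  show "integrable Dm h"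
    by (rule Bochner_Integration.integrable_bound[OF int _ bd']) (use assms in \<open>simp add: sq_int_def\<close>)
  then have "(\<integral>x. norm (h x) \<partial>Dm) \<le> (\<integral>x. e + (norm (h x))\<^sup>2 / e \<partial>Dm)"
    using int bd by (intro integral_mono) auto
  also have "\<dots> = e * measure Dm (space Dm) + (\<integral>x. (norm (h x))\<^sup>2 \<partial>Dm) / e"
    using assms by (simp add: sq_int_def)
  finally show "(\<integral>x. norm (h x) \<partial>Dm) \<le> e * measure Dm (space Dm) + (\<integral>x. (norm (h x))\<^sup>2 \<partial>Dm) / e" .
qed

instance l2per :: complete_space
proof
  fix X :: "nat \<Rightarrow> l2per" assume X: "Cauchy X"
  define f where "f n = rep_l2per (X n)" for n
  have f: "sq_int (f n)" "abs_l2per (f n) = X n" for n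
    by (auto simp: f_def rep_l2per)
  have fd: "sq_int (\<lambda>x. f i x - f j x)" for i j by (intro sq_int_diff f)
  have dist2: "(\<integral>x. (norm (f i x - f j x))\<^sup>2 \<partial>Dm) = (dist (X i) (X j))\<^sup>2" for i j
    using norm_abs_l2per[OF fd, of i j] by (simp add: dist_norm f abs_l2per_diff[OF f(1) f(1), symmetric])
  define m where "m = measure Dm (space Dm)"
  have m: "m \<ge> 0" by (simp add: m_def)
  have fi: "integrable Dm (f n)" for n using norm_L1_le(1)[OF f(1), of 1] by simp
  have "\<exists>N. \<forall>i\<ge>N. \<forall>j\<ge>N. (\<integral>x. norm (f i x - f j x) \<partial>Dm) < e" if "e > 0" for e
  proof -
    define d where "d = e / (2 * (m + 1))"
    have d: "d > 0" using that m by (simp add: d_def)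
    have "sqrt (d * e / 2) > 0" using d that by simp
    then obtain N where N: "\<And>i j. i \<ge> N \<Longrightarrow> j \<ge> N \<Longrightarrow> dist (X i) (X j) < sqrt (d * e / 2)"
      using X unfolding Cauchy_def by meson
    have "(\<integral>x. norm (f i x - f j x) \<partial>Dm) < e" if "i \<ge> N" "j \<ge> N" for i j
    proof -
      have "(dist (X i) (X j))\<^sup>2 < (sqrt (d * e / 2))\<^sup>2"
        using N[OF that] by (intro power_strict_mono) auto
      also have "\<dots> = d * e / 2" using d \<open>e > 0\<close> by simp
      finally have "(dist (X i) (X j))\<^sup>2 / d < e / 2" using d by (simp add: field_simps)
      moreover have "d * m \<le> e / 2" using \<open>e > 0\<close> m by (simp add: d_def field_simps)
      moreover have "(\<integral>x. norm (f i x - f j x) \<partial>Dm) \<le> d * m + (dist (X i) (X j))\<^sup>2 / d"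
        using norm_L1_le(2)[OF fd d, of i j] by (simp add: dist2 m_def)
      ultimately show ?thesis by linarith
    qed
    then show ?thesis by blast
  qed
  then obtain r where r: "strict_mono r" "AE x in Dm. Cauchy (\<lambda>i. f (r i) x)"
    using cauchy_L1_AE_cauchy_subseq[of Dm f, OF fi] by blast
  define g where "g x = lim (\<lambda>i. f (r i) x)" for x
  have fm: "f n \<in> borel_measurable Dm" for n using f(1)[of n] by (simp add: sq_int_def)
  have gm: "g \<in> borel_measurable Dm"
    unfolding g_def by (rule borel_measurable_lim_metric) (rule fm)
  have lim: "AE x in Dm. (\<lambda>i. f (r i) x) \<longlonglongrightarrow> g x"
    using r(2) by eventually_elim (simp add: g_def Cauchy_convergent_iff convergent_LIMSEQ_iff)
  have key: "\<exists>N. \<forall>n\<ge>N. sq_int (\<lambda>x. f n x - g x) \<and> (\<integral>x. (norm (f n x - g x))\<^sup>2 \<partial>Dm) \<le> e\<^sup>2" if "e > 0" for e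
  proof -
    obtain N where N: "\<And>i j. i \<ge> N \<Longrightarrow> j \<ge> N \<Longrightarrow> dist (X i) (X j) < e"
      using X \<open>e > 0\<close> unfolding Cauchy_def by meson
    have "sq_int (\<lambda>x. f n x - g x) \<and> (\<integral>x. (norm (f n x - g x))\<^sup>2 \<partial>Dm) \<le> e\<^sup>2" if n: "n \<ge> N" for n
    proof -
      have "(\<integral>\<^sup>+x. ennreal ((norm (f n x - g x))\<^sup>2) \<partial>Dm) =
          (\<integral>\<^sup>+x. liminf (\<lambda>i. ennreal ((norm (f n x - f (r i) x))\<^sup>2)) \<partial>Dm)"
      proof (rule nn_integral_cong_AE)
        show "AE x in Dm. ennreal ((norm (f n x - g x))\<^sup>2) = liminf (\<lambda>i. ennreal ((norm (f n x - f (r i) x))\<^sup>2))"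
          using lim
        proof eventually_elim
          case (elim x)
          have "(\<lambda>i. ennreal ((norm (f n x - f (r i) x))\<^sup>2)) \<longlonglongrightarrow> ennreal ((norm (f n x - g x))\<^sup>2)"
            by (intro tendsto_intros elim)
          from lim_imp_Liminf[OF _ this] show ?case by simp
        qed
      qed
      also have "\<dots> \<le> liminf (\<lambda>i. \<integral>\<^sup>+x. ennreal ((norm (f n x - f (r i) x))\<^sup>2) \<partial>Dm)"
        by (rule nn_integral_liminf) (use fm in \<open>auto intro!: borel_measurable_power borel_measurable_norm borel_measurable_diff\<close>)
      also have "\<dots> \<le> ennreal (e\<^sup>2)"
      proof (rule Liminf_le)
        show "eventually (\<lambda>i. (\<integral>\<^sup>+x. ennreal ((norm (f n x - f (r i) x))\<^sup>2) \<partial>Dm) \<le> ennreal (e\<^sup>2)) sequentially"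
          unfolding eventually_sequentially
        proof (intro exI[of _ N] allI impI)
          fix i assume "i \<ge> N"
          then have "r i \<ge> N" using seq_suble[OF r(1), of i] by linarith
          have "(\<integral>\<^sup>+x. ennreal ((norm (f n x - f (r i) x))\<^sup>2) \<partial>Dm) = ennreal ((dist (X n) (X (r i)))\<^sup>2)"
            using fd[of n "r i"] by (subst nn_integral_eq_integral) (auto simp: sq_int_def dist2)
          also have "\<dots> \<le> ennreal (e\<^sup>2)"
            using N[OF n \<open>r i \<ge> N\<close>] by (intro ennreal_leI power_mono) auto
          finally show "(\<integral>\<^sup>+x. ennreal ((norm (f n x - f (r i) x))\<^sup>2) \<partial>Dm) \<le> ennreal (e\<^sup>2)" .
        qed
      qed simp
      finally have le: "(\<integral>\<^sup>+x. ennreal ((norm (f n x - g x))\<^sup>2) \<partial>Dm) \<le> ennreal (e\<^sup>2)" .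
      have meas: "(\<lambda>x. f n x - g x) \<in> borel_measurable Dm" using fm gm by (intro borel_measurable_diff)
      have int: "integrable Dm (\<lambda>x. (norm (f n x - g x))\<^sup>2)"
        using le meas by (intro integrableI_nonneg) (auto intro: order.strict_trans1)
      have "ennreal (\<integral>x. (norm (f n x - g x))\<^sup>2 \<partial>Dm) \<le> ennreal (e\<^sup>2)"
        using le int by (subst (asm) nn_integral_eq_integral) auto
      then show ?thesis using int meas by (simp add: sq_int_def)
    qed
    then show ?thesis by blast
  qed
  obtain n0 where "sq_int (\<lambda>x. f n0 x - g x)" using key[of 1] by auto
  from sq_int_diff[OF f(1) this, of n0] have g: "sq_int g" by simp
  have "X \<longlonglongrightarrow> abs_l2per g"
  proof (rule metric_LIMSEQ_I)
    fix e :: real assume "e > 0"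
    then obtain N where N: "\<And>n. n \<ge> N \<Longrightarrow> (\<integral>x. (norm (f n x - g x))\<^sup>2 \<partial>Dm) \<le> (e/2)\<^sup>2"
      using key[of "e/2"] by auto
    have "dist (X n) (abs_l2per g) < e" if "n \<ge> N" for n
    proof -
      have "(dist (X n) (abs_l2per g))\<^sup>2 = (\<integral>x. (norm (f n x - g x))\<^sup>2 \<partial>Dm)"
        using norm_abs_l2per[OF sq_int_diff[OF f(1) g], of n]
        by (simp add: dist_norm abs_l2per_diff[OF f(1) g, symmetric] f)
      also have "\<dots> \<le> (e/2)\<^sup>2" by (rule N[OF that])
      finally have "dist (X n) (abs_l2per g) \<le> e/2"
        using \<open>e > 0\<close> by (simp add: power2_le_iff_abs_le)
      then show ?thesis using \<open>e > 0\<close> by simp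
    qed
    then show "\<exists>no. \<forall>n\<ge>no. dist (X n) (abs_l2per g) < e" by blast
  qed
  then show "convergent X" by (auto simp: convergent_def)
qed

lemma second_countable_of_dense:
  fixes Q :: "'a::metric_space set"
  assumes Q: "countable Q" "closure Q = UNIV"
  shows "\<exists>B::'a set set. countable B \<and> open = generate_topology B"
proof -
  define B where "B = (\<lambda>(q, n). ball q (1 / real (Suc n))) ` (Q \<times> UNIV)"
  have "open U = generate_topology B U" for U
  proof
    assume U: "open U"
    have "\<exists>b\<in>B. x \<in> b \<and> b \<subseteq> U" if "x \<in> U" for x
    proof -
      obtain e where e: "e > 0" "ball x e \<subseteq> U" using U \<open>x \<in> U\<close> open_contains_ball by blast
      obtain n where n: "1 / real (Suc n) < e / 2" using nat_approx_posE[of "e/2"] e(1) by auto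
      have "x \<in> closure Q" using Q by simp
      then obtain y where y: "y \<in> Q" "dist y x < 1 / real (Suc n)"
        unfolding closure_approachable by (meson of_nat_0_less_iff zero_less_Suc zero_less_divide_1_iff)
      have "ball y (1 / real (Suc n)) \<subseteq> ball x e"
      proof
        fix z assume "z \<in> ball y (1 / real (Suc n))"
        then have "dist y z < e / 2" using n by (simp add: mem_ball)
        moreover have "dist y x < e / 2" using y n by simp
        ultimately show "z \<in> ball x e"
          using dist_triangle[of x z y] by (simp add: dist_commute)
      qed
      then show ?thesis using y e unfolding B_def
        by (intro bexI[of _ "ball y (1 / real (Suc n))"]) (auto simp: dist_commute)
    qed
    then have "U = \<Union>{b\<in>B. b \<subseteq> U}" by blast
    moreover have "generate_topology B (\<Union>{b\<in>B. b \<subseteq> U})"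
      by (intro generate_topology.UN) (auto intro: generate_topology.Basis)
    ultimately show "generate_topology B U" by simp
  next
    assume "generate_topology B U"
    then show "open U" by induction (auto simp: B_def)
  qed
  moreover have "countable B" using Q(1) by (auto simp: B_def)
  ultimately show ?thesis by blast
qed

lemma countable_dense_of_span:
  fixes S :: "'a::real_normed_vector set"
  assumes S: "countable S" "closure (span S) = UNIV"
  shows "\<exists>Q::'a set. countable Q \<and> closure Q = UNIV"
proof -
  define g where "g = (\<lambda>l. \<Sum>(q::rat, s::'a)\<leftarrow>l. real_of_rat q *\<^sub>R s)"
  define Q where "Q = g ` lists (UNIV \<times> S)"
  have "countable Q" unfolding Q_def using S by auto
  have "x \<in> closure Q" if "x \<in> span S" for x
    using that
  proof (induction rule: span_induct_alt)
    case base
    have "g [] \<in> Q" unfolding Q_def by blast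
    then show ?case using closure_subset by (fastforce simp: g_def)
  next
    case (step c x y)
    obtain yn where yn: "\<And>n. yn n \<in> Q" "yn \<longlonglongrightarrow> y" using step(2) closure_sequential by blast
    have "c \<in> closure (range real_of_rat)"
      using Rats_closure_real by (auto simp: Rats_def)
    then obtain qn where qn: "\<And>n. qn n \<in> range real_of_rat" "qn \<longlonglongrightarrow> c" using closure_sequential by blast
    have "qn n *\<^sub>R x + yn n \<in> Q" for n
    proof -
      obtain q where q: "qn n = real_of_rat q" using qn(1)[of n] by blast
      obtain l where l: "l \<in> lists (UNIV \<times> S)" "yn n = g l" using yn(1)[of n] unfolding Q_def by blast
      have "qn n *\<^sub>R x + yn n = g ((q, x) # l)" by (simp add: g_def l(2)[unfolded g_def] q)
      moreover have "(q, x) # l \<in> lists (UNIV \<times> S)" using l step(1) by auto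
      ultimately show ?thesis unfolding Q_def by blast
    qed
    moreover have "(\<lambda>n. qn n *\<^sub>R x + yn n) \<longlonglongrightarrow> c *\<^sub>R x + y" by (intro tendsto_intros qn yn)
    ultimately show ?case unfolding closure_sequential by (intro exI[of _ "\<lambda>n. qn n *\<^sub>R x + yn n"]) simp
  qed
  then have "closure (span S) \<subseteq> closure Q" by (simp add: closure_minimal subsetI)
  then show ?thesis using \<open>countable Q\<close> S by auto
qed

definition ind_l2 :: "(real^2) set \<Rightarrow> real^2 \<Rightarrow> l2per" where
  "ind_l2 A b = abs_l2per (\<lambda>x. indicator A x *\<^sub>R b)"

lemma sq_int_ind: "A \<in> sets borel \<Longrightarrow> sq_int (\<lambda>x. indicator A x *\<^sub>R b)"
  by (rule sq_int_bounded[of _ "norm b"])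
    (auto simp: Dm_def indicator_def intro!: measurable_restrict_space1 borel_measurable_scaleR)

lemma norm_ind_l2:
  assumes "A \<in> sets borel"
  shows "norm (ind_l2 A b) = sqrt (measure Dm (A \<inter> unit_square)) * norm b"
proof -
  have A: "A \<inter> unit_square \<in> sets Dm" using assms by (auto simp: Dm_def sets_restrict_space)
  have "(norm (ind_l2 A b))\<^sup>2 = (\<integral>x. (norm (indicator A x *\<^sub>R b))\<^sup>2 \<partial>Dm)"
    unfolding ind_l2_def by (rule norm_abs_l2per[OF sq_int_ind[OF assms]])
  also have "\<dots> = (\<integral>x. indicator (A \<inter> unit_square) x * (norm b)\<^sup>2 \<partial>Dm)"
    by (intro Bochner_Integration.integral_cong) (auto simp: space_Dm indicator_def)
  also have "\<dots> = measure Dm (A \<inter> unit_square) * (norm b)\<^sup>2"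
    using A by (simp add: space_Dm Int_absorb2)
  finally have "norm (ind_l2 A b) = sqrt (measure Dm (A \<inter> unit_square) * (norm b)\<^sup>2)"
    by (metis abs_norm_cancel real_sqrt_abs)
  then show ?thesis by (simp add: real_sqrt_mult)
qed

lemma ind_l2_diff:
  assumes "A \<in> sets borel" "B \<in> sets borel" "A \<subseteq> B"
  shows "ind_l2 (B - A) b = ind_l2 B b - ind_l2 A b"
proof -
  have "(\<lambda>x. indicator (B - A) x *\<^sub>R b) = (\<lambda>x. indicator B x *\<^sub>R b - indicator A x *\<^sub>R b)"
    using assms(3) by (intro ext) (auto simp: indicator_def)
  then show ?thesis using assms(1,2)
    by (simp add: ind_l2_def abs_l2per_diff sq_int_ind)
qed

lemma ind_l2_Un:
  assumes "A \<in> sets borel" "B \<in> sets borel" "A \<inter> B = {}"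
  shows "ind_l2 (A \<union> B) b = ind_l2 A b + ind_l2 B b"
proof -
  have "(\<lambda>x. indicator (A \<union> B) x *\<^sub>R b) = (\<lambda>x. indicator A x *\<^sub>R b + indicator B x *\<^sub>R b)"
    using assms(3) by (intro ext) (auto simp: indicator_def)
  then show ?thesis using assms(1,2)
    by (simp add: ind_l2_def abs_l2per_add sq_int_ind)
qed

lemma closure_span_add:
  fixes S :: "'a::real_normed_vector set"
  assumes "x \<in> closure (span S)" "y \<in> closure (span S)" shows "x + y \<in> closure (span S)"
proof -
  obtain f g where "\<forall>n. f n \<in> span S" "f \<longlonglongrightarrow> x" "\<forall>n. g n \<in> span S" "g \<longlonglongrightarrow> y"
    using assms unfolding closure_sequential by blast
  then show ?thesis unfolding closure_sequential
    by (intro exI[of _ "\<lambda>n. f n + g n"]) (auto intro: span_add tendsto_add)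
qed

lemma closure_span_scaleR:
  fixes S :: "'a::real_normed_vector set"
  assumes "x \<in> closure (span S)" shows "c *\<^sub>R x \<in> closure (span S)"
proof -
  obtain f where "\<forall>n. f n \<in> span S" "f \<longlonglongrightarrow> x"
    using assms unfolding closure_sequential by blast
  then show ?thesis unfolding closure_sequential
    by (intro exI[of _ "\<lambda>n. c *\<^sub>R f n"]) (auto intro: span_scale tendsto_scaleR)
qed

lemma closure_span_diff:
  fixes S :: "'a::real_normed_vector set"
  assumes "x \<in> closure (span S)" "y \<in> closure (span S)" shows "x - y \<in> closure (span S)"
  using closure_span_add[OF assms(1) closure_span_scaleR[OF assms(2), of "-1"]] by simp

lemma closure_span_sum:
  fixes S :: "'a::real_normed_vector set"
  assumes "\<And>i. i \<in> I \<Longrightarrow> f i \<in> closure (span S)" shows "sum f I \<in> closure (span S)"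
  using assms
proof (induction I rule: infinite_finite_induct)
  case (insert i I)
  then show ?case by (simp add: closure_span_add)
qed (use span_zero closure_subset in auto)

lemma abs_l2per_sum:
  assumes "finite E" "\<And>y. sq_int (g y)"
  shows "sq_int (\<lambda>x. \<Sum>y\<in>E. g y x) \<and> (\<Sum>y\<in>E. abs_l2per (g y)) = abs_l2per (\<lambda>x. \<Sum>y\<in>E. g y x)"
  using assms(1)
proof induction
  case empty then show ?case by (simp add: sq_int_zero zero_l2per_def)
next
  case (insert b E)
  then show ?case using assms(2) by (simp add: sq_int_add abs_l2per_add)
qed

lemma l2per_countable_span: "\<exists>S::l2per set. countable S \<and> closure (span S) = UNIV"
proof -
  obtain B0 :: "(real^2) set set" where B0: "countable B0" "topological_basis B0"
    using ex_countable_basis by blast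
  define G where "G = Inter ` {F. finite F \<and> F \<subseteq> B0}"
  have "countable G" unfolding G_def using B0(1) by (intro countable_image countable_Collect_finite_subset)
  have Gopen: "open A" if "A \<in> G" for A
    using that topological_basis_open[OF B0(2)] unfolding G_def by (auto intro: open_Inter)
  have Gint: "Int_stable G"
  proof (rule Int_stableI)
    fix a b assume "a \<in> G" "b \<in> G"
    then obtain F1 F2 where F: "a = \<Inter>F1" "b = \<Inter>F2" "finite F1" "F1 \<subseteq> B0" "finite F2" "F2 \<subseteq> B0"
      unfolding G_def by blast
    then have "a \<inter> b = \<Inter>(F1 \<union> F2)" by blast
    then show "a \<inter> b \<in> G" unfolding G_def using F
      by (intro image_eqI[of _ _ "F1 \<union> F2"]) auto
  qed
  have UG: "UNIV \<in> G" unfolding G_def by (intro image_eqI[of _ _ "{}"]) auto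
  have borelG: "sets borel = sigma_sets UNIV G"
  proof
    have "sets (borel :: (real^2) measure) = sigma_sets UNIV B0"
      by (subst borel_eq_countable_basis[OF B0]) (simp add: sets_measure_of)
    also have "\<dots> \<subseteq> sigma_sets UNIV G"
    proof (rule sigma_sets_mono')
      show "B0 \<subseteq> G" 
      proof
        fix b assume "b \<in> B0"
        then show "b \<in> G" unfolding G_def by (intro image_eqI[of _ _ "{b}"]) auto
      qed
    qed
    finally show "sets (borel :: (real^2) measure) \<subseteq> sigma_sets UNIV G" .
    show "sigma_sets UNIV G \<subseteq> sets borel"
      using Gopen sigma_sets_le_sets_iff[of borel G] by auto
  qed
  define S where "S = (\<lambda>(A, b). ind_l2 A b) ` (G \<times> Basis)"
  define V where "V = closure (span S)"
  have "countable S" unfolding S_def using \<open>countable G\<close>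
    by (intro countable_image countable_SIGMA) (auto intro: countable_finite)
  have SV: "x \<in> V" if "x \<in> S" for x
    unfolding V_def using closure_subset span_base[OF that] by blast
  have zeroV: "0 \<in> V" unfolding V_def using closure_subset[of "span S"] span_zero[of S] by blast
  have indV: "ind_l2 A b \<in> V" if "A \<in> sets borel" "b \<in> Basis" for A b
  proof -
    have "Int_stable G" "G \<subseteq> Pow UNIV" "A \<in> sigma_sets UNIV G" using that borelG Gint by auto
    then show ?thesis
    proof (induction rule: sigma_sets_induct_disjoint)
      case (basic A)
      then show ?case using \<open>b \<in> Basis\<close> by (intro SV) (auto simp: S_def)
    next
      case empty
      have "ind_l2 {} b = 0" by (simp add: ind_l2_def zero_l2per_def)
      then show ?case using zeroV by simp
    next
      case (compl A)
      then have "A \<in> sets borel" using borelG by simp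
      then have "ind_l2 (UNIV - A) b = ind_l2 UNIV b - ind_l2 A b" by (intro ind_l2_diff) auto
      moreover have "ind_l2 UNIV b \<in> V" using UG \<open>b \<in> Basis\<close> by (intro SV) (auto simp: S_def)
      ultimately show ?case using compl unfolding V_def by (simp add: closure_span_diff)
    next
      case (union A)
      have Ab: "A i \<in> sets borel" for i using union borelG by auto
      define P where "P n = (\<Union>i<n. A i)" for n
      have Pb: "P n \<in> sets borel" for n using Ab unfolding P_def by auto
      have PV: "ind_l2 (P n) b \<in> V" for n
      proof (induction n)
        case 0
        have "ind_l2 {} b = 0" by (simp add: ind_l2_def zero_l2per_def)
        then show ?case using zeroV by (simp add: P_def)
      next
        case (Suc n)
        have "A i \<inter> A n = {}" if "i < n" for i
          using union(1) that unfolding disjoint_family_on_def by simp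
        then have "P n \<inter> A n = {}" unfolding P_def by blast
        then have "ind_l2 (P n \<union> A n) b = ind_l2 (P n) b + ind_l2 (A n) b"
          using Pb Ab by (intro ind_l2_Un) auto
        moreover have "P (Suc n) = P n \<union> A n" unfolding P_def by (auto simp: lessThan_Suc)
        ultimately show ?case using Suc union(3) unfolding V_def by (simp add: closure_span_add)
      qed
      define W where "W = (\<Union>i. A i)"
      have Wb: "W \<in> sets borel" using Ab unfolding W_def by auto
      have "(\<lambda>n. measure Dm ((W - P n) \<inter> unit_square)) \<longlonglongrightarrow> measure Dm (\<Inter>n. (W - P n) \<inter> unit_square)"
      proof (rule Dm.finite_Lim_measure_decseq)
        show "range (\<lambda>n. (W - P n) \<inter> unit_square) \<subseteq> sets Dm"
          using Wb Pb by (auto simp: Dm_def sets_restrict_space)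
        show "decseq (\<lambda>n. (W - P n) \<inter> unit_square)"
          unfolding decseq_def P_def by (fastforce dest: less_le_trans)
      qed
      moreover have "(\<Inter>n. (W - P n) \<inter> unit_square) = {}" unfolding W_def P_def by auto
      ultimately have "(\<lambda>n. sqrt (measure Dm ((W - P n) \<inter> unit_square)) * norm b) \<longlonglongrightarrow> 0"
        by (auto intro!: tendsto_eq_intros)
      then have "(\<lambda>n. norm (ind_l2 W b - ind_l2 (P n) b)) \<longlonglongrightarrow> 0"
      proof (rule Lim_transform_eventually, intro always_eventually allI)
        fix n
        have "P n \<subseteq> W" unfolding P_def W_def by auto
        then have "ind_l2 (W - P n) b = ind_l2 W b - ind_l2 (P n) b" using Wb Pb by (intro ind_l2_diff)
        then show "sqrt (measure Dm ((W - P n) \<inter> unit_square)) * norm b = norm (ind_l2 W b - ind_l2 (P n) b)"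
          using norm_ind_l2[of "W - P n" b] Wb Pb by auto
      qed
      then have "(\<lambda>n. ind_l2 (P n) b) \<longlonglongrightarrow> ind_l2 W b"
        by (simp add: tendsto_norm_zero_iff LIM_zero_iff norm_minus_commute[of "ind_l2 W b"])
      then have "ind_l2 W b \<in> V"
        using PV closed_sequentially[OF closed_closure[of "span S"], of "\<lambda>n. ind_l2 (P n) b"] unfolding V_def by simp
      then show ?case by (simp add: W_def)
    qed
  qed
  have indV': "ind_l2 A y \<in> V" if A: "A \<in> sets borel" for A y
  proof -
    have "ind_l2 A y = (\<Sum>b\<in>Basis. (y \<bullet> b) *\<^sub>R ind_l2 A b)"
    proof -
      have "sq_int (\<lambda>x. \<Sum>b\<in>F. (y \<bullet> b) *\<^sub>R indicator A x *\<^sub>R b) \<and>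
        (\<Sum>b\<in>F. (y \<bullet> b) *\<^sub>R ind_l2 A b) = abs_l2per (\<lambda>x. \<Sum>b\<in>F. (y \<bullet> b) *\<^sub>R indicator A x *\<^sub>R b)"
        if "finite F" for F
        using that
      proof induction
        case empty then show ?case by (simp add: sq_int_zero zero_l2per_def)
      next
        case (insert b F)
        have "sq_int (\<lambda>x. (y \<bullet> b) *\<^sub>R indicator A x *\<^sub>R b)"
          using sq_int_scaleR[OF sq_int_ind[OF A]] by blast
        then show ?case using insert
          by (simp add: sq_int_add abs_l2per_add ind_l2_def abs_l2per_scaleR sq_int_ind A)
      qed
      from this[of Basis] have "(\<Sum>b\<in>Basis. (y \<bullet> b) *\<^sub>R ind_l2 A b)
          = abs_l2per (\<lambda>x. \<Sum>b\<in>Basis. (y \<bullet> b) *\<^sub>R indicator A x *\<^sub>R b)" by simp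
      also have "(\<lambda>x. \<Sum>b\<in>Basis. (y \<bullet> b) *\<^sub>R indicator A x *\<^sub>R b) = (\<lambda>x. indicator A x *\<^sub>R y)"
      proof
        fix x
        have "(\<Sum>b\<in>Basis. (y \<bullet> b) *\<^sub>R indicator A x *\<^sub>R b) = indicator A x *\<^sub>R (\<Sum>b\<in>Basis. (y \<bullet> b) *\<^sub>R b)"
          by (simp add: scaleR_sum_right mult.commute)
        then show "(\<Sum>b\<in>Basis. (y \<bullet> b) *\<^sub>R indicator A x *\<^sub>R b) = indicator A x *\<^sub>R y"
          by (simp add: euclidean_representation)
      qed
      finally show ?thesis by (simp add: ind_l2_def)
    qed
    also have "\<dots> \<in> V" unfolding V_def
      by (intro closure_span_sum closure_span_scaleR) (use indV[OF A] in \<open>simp add: V_def\<close>)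
    finally show ?thesis .
  qed
  have "u \<in> V" for u
  proof -
    define f where "f = rep_l2per u"
    have f: "sq_int f" "abs_l2per f = u" by (auto simp: f_def rep_l2per)
    have "f \<in> borel_measurable Dm" using f by (simp add: sq_int_def)
    from borel_measurable_implies_sequence_metric[OF this, of 0]
    obtain F where F: "\<And>i. simple_function Dm (F i)" "\<And>x. x \<in> space Dm \<Longrightarrow> (\<lambda>i. F i x) \<longlonglongrightarrow> f x"
      "\<And>i x. x \<in> space Dm \<Longrightarrow> dist (F i x) 0 \<le> 2 * dist (f x) 0"
      by blast
    have Fm: "F i \<in> borel_measurable Dm" for i using F(1) borel_measurable_simple_function by blast
    have bd: "(norm (F i x))\<^sup>2 \<le> 4 * (norm (f x))\<^sup>2" if "x \<in> space Dm" for i x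
      using power_mono[of "norm (F i x)" "2 * norm (f x)" 2] F(3)[OF that, of i] by (simp add: power_mult_distrib)
    have Fsq: "sq_int (F i)" for i
      unfolding sq_int_def
    proof (rule conjI[OF Fm], rule Bochner_Integration.integrable_bound[of Dm "\<lambda>x. 4 * (norm (f x))\<^sup>2"])
      show "integrable Dm (\<lambda>x. 4 * (norm (f x))\<^sup>2)" using f by (simp add: sq_int_def)
      show "AE x in Dm. norm ((norm (F i x))\<^sup>2) \<le> norm (4 * (norm (f x))\<^sup>2)"
        by (rule AE_I2) (use bd in simp)
    qed (use measurable_compose[OF Fm borel_measurable_norm] in simp)
    have FV: "abs_l2per (F i) \<in> V" for i
    proof -
      define R where "R = F i ` space Dm"
      have "finite R" using F(1)[of i] by (simp add: R_def simple_function_def)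
      define A where "A y = F i -` {y} \<inter> space Dm" for y
      have Ab: "A y \<in> sets borel" for y
      proof -
        have "A y \<in> sets Dm" unfolding A_def using Fm[of i] by (intro measurable_sets[OF Fm]) auto
        then show ?thesis by (auto simp: Dm_def sets_restrict_space)
      qed
      have *: "sq_int (\<lambda>x. \<Sum>y\<in>R. indicator (A y) x *\<^sub>R y)"
        "(\<Sum>y\<in>R. ind_l2 (A y) y) = abs_l2per (\<lambda>x. \<Sum>y\<in>R. indicator (A y) x *\<^sub>R y)"
        unfolding ind_l2_def
        using abs_l2per_sum[OF \<open>finite R\<close>, of "\<lambda>y x. indicator (A y) x *\<^sub>R y"] sq_int_ind[OF Ab] by blast+
      have "F i x = (\<Sum>y\<in>R. indicator (A y) x *\<^sub>R y)" if "x \<in> space Dm" for x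
      proof -
        have "(\<Sum>y\<in>R. indicator (A y) x *\<^sub>R y) = (\<Sum>y\<in>R. if y = F i x then y else 0)"
          using that by (intro sum.cong) (auto simp: A_def indicator_def)
        also have "\<dots> = F i x" using \<open>finite R\<close> that by (simp add: R_def)
        finally show ?thesis by simp
      qed
      then have "ae_eq (F i) (\<lambda>x. \<Sum>y\<in>R. indicator (A y) x *\<^sub>R y)"
        unfolding ae_eq_def by (intro conjI Fsq *(1) AE_I2)
      then have "abs_l2per (F i) = (\<Sum>y\<in>R. ind_l2 (A y) y)"
        unfolding *(2) by (rule Quotient_rel_abs[OF Quotient_l2per])
      also have "\<dots> \<in> V" unfolding V_def
        by (intro closure_span_sum) (use indV'[OF Ab] in \<open>simp add: V_def\<close>)
      finally show ?thesis .
    qed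
    have "(\<lambda>i. \<integral>x. (norm (F i x - f x))\<^sup>2 \<partial>Dm) \<longlonglongrightarrow> (\<integral>x. 0 \<partial>Dm)"
    proof (rule integral_dominated_convergence[where w = "\<lambda>x. 9 * (norm (f x))\<^sup>2"])
      show "integrable Dm (\<lambda>x. 9 * (norm (f x))\<^sup>2)" using f by (simp add: sq_int_def)
      show "AE x in Dm. (\<lambda>i. (norm (F i x - f x))\<^sup>2) \<longlonglongrightarrow> 0"
      proof (rule AE_I2)
        fix x assume "x \<in> space Dm"
        from F(2)[OF this] have "(\<lambda>i. norm (F i x - f x)) \<longlonglongrightarrow> 0"
          by (simp add: tendsto_norm_zero_iff LIM_zero_iff)
        from tendsto_power[OF this, of 2] show "(\<lambda>i. (norm (F i x - f x))\<^sup>2) \<longlonglongrightarrow> 0" by simp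
      qed
      show "AE x in Dm. norm ((norm (F i x - f x))\<^sup>2) \<le> 9 * (norm (f x))\<^sup>2" for i
      proof (rule AE_I2)
        fix x assume x: "x \<in> space Dm"
        have "norm (F i x - f x) \<le> 3 * norm (f x)"
          using F(3)[OF x, of i] norm_triangle_ineq4[of "F i x" "f x"] by simp
        from power_mono[OF this, of 2] show "norm ((norm (F i x - f x))\<^sup>2) \<le> 9 * (norm (f x))\<^sup>2"
          by (simp add: power_mult_distrib)
      qed
      show "(\<lambda>x. (norm (F i x - f x))\<^sup>2) \<in> borel_measurable Dm" for i
        using sq_int_diff[OF Fsq f(1), of i] by (auto simp: sq_int_def)
    qed simp
    then have "(\<lambda>i. (norm (abs_l2per (F i) - u))\<^sup>2) \<longlonglongrightarrow> 0"
      using norm_abs_l2per[OF sq_int_diff[OF Fsq f(1)]]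
      by (simp add: f(2)[symmetric] abs_l2per_diff[OF Fsq f(1)])
    from tendsto_real_sqrt[OF this] have "(\<lambda>i. norm (abs_l2per (F i) - u)) \<longlonglongrightarrow> 0" by simp
    then have "(\<lambda>i. abs_l2per (F i)) \<longlonglongrightarrow> u"
      by (simp add: tendsto_norm_zero_iff LIM_zero_iff)
    then show ?thesis
      using FV closed_sequentially[OF closed_closure[of "span S"], of "\<lambda>i. abs_l2per (F i)"] unfolding V_def by simp
  qed
  then show ?thesis using \<open>countable S\<close> unfolding V_def by blast
qed

instance l2per :: second_countable_topology
proof
  show "\<exists>B::l2per set set. countable B \<and> open = generate_topology B"
    using l2per_countable_span countable_dense_of_span second_countable_of_dense by blast
qed


definition periodic :: "(real^2 \<Rightarrow> 'b) \<Rightarrow> bool" where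
  "periodic f \<longleftrightarrow> (\<forall>x i. f (x + axis i 1) = f x)"

definition pd :: "2 \<Rightarrow> (real^2 \<Rightarrow> real) \<Rightarrow> real^2 \<Rightarrow> real" where
  "pd i f x = frechet_derivative f (at x) (axis i 1)"

primrec Ck_per :: "nat \<Rightarrow> (real^2 \<Rightarrow> real) \<Rightarrow> bool" where
  "Ck_per 0 f \<longleftrightarrow> periodic f \<and> continuous_on UNIV f"
| "Ck_per (Suc n) f \<longleftrightarrow> periodic f \<and> (\<forall>x. f differentiable (at x)) \<and> (\<forall>i. Ck_per n (pd i f))"

definition test_fun :: "(real^2 \<Rightarrow> real) \<Rightarrow> bool" where
  "test_fun f \<longleftrightarrow> (\<forall>n. Ck_per n f)"

definition grad :: "(real^2 \<Rightarrow> real) \<Rightarrow> real^2 \<Rightarrow> real^2" where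
  "grad f x = (\<chi> i. pd i f x)"

definition laplacian :: "(real^2 \<Rightarrow> real) \<Rightarrow> real^2 \<Rightarrow> real" where
  "laplacian f x = (\<Sum>i\<in>UNIV. pd i (pd i f) x)"

text \<open>\<open>div_free\<close> is the distributional equation \<open>\<nabla> \<cdot> u = 0\<close> on the torus.\<close>

definition mean_zero :: "l2per \<Rightarrow> bool" where
  "mean_zero u \<longleftrightarrow> (\<integral>x. rep_l2per u x \<partial>Dm) = 0"

definition div_free :: "l2per \<Rightarrow> bool" where
  "div_free u \<longleftrightarrow> (\<forall>f. test_fun f \<longrightarrow> (\<integral>x. rep_l2per u x \<bullet> grad f x \<partial>Dm) = 0)"

lemma mean_zero_iff: "mean_zero u \<longleftrightarrow> (\<forall>b\<in>Basis. inner u (abs_l2per (\<lambda>_. b)) = 0)"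
proof -
  have int: "integrable Dm (rep_l2per u)" using norm_L1_le(1)[OF rep_l2per(1), of 1] by simp
  have "inner u (abs_l2per (\<lambda>_. b)) = (\<integral>x. rep_l2per u x \<partial>Dm) \<bullet> b" for b
    using int by (subst inner_abs_right) (auto intro: sq_int_continuous)
  then show ?thesis unfolding mean_zero_def by (simp add: euclidean_all_zero_iff)
qed

lemma sq_int_grad: "test_fun f \<Longrightarrow> sq_int (grad f)"
proof (rule sq_int_continuous)
  assume "test_fun f"
  then have "Ck_per (Suc 0) f" unfolding test_fun_def by blast
  then show "continuous_on UNIV (grad f)"
    unfolding grad_def by (intro continuous_on_vec_lambda) simp
qed

lemma div_free_iff: "div_free u \<longleftrightarrow> (\<forall>f. test_fun f \<longrightarrow> inner u (abs_l2per (grad f)) = 0)"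
  unfolding div_free_def using inner_abs_right[OF sq_int_grad] by metis

typedef hspace = "{u. mean_zero u \<and> div_free u}" morphisms l2_of Abs_hspace
  by (rule exI[of _ 0]) (simp add: mean_zero_iff div_free_iff)

setup_lifting type_definition_hspace

instantiation hspace :: real_inner
begin

lift_definition zero_hspace :: hspace is 0
  by (simp add: mean_zero_iff div_free_iff)
lift_definition plus_hspace :: "hspace \<Rightarrow> hspace \<Rightarrow> hspace" is "(+)"
  by (simp add: mean_zero_iff div_free_iff inner_add_left)
lift_definition minus_hspace :: "hspace \<Rightarrow> hspace \<Rightarrow> hspace" is "(-)"
  by (simp add: mean_zero_iff div_free_iff inner_diff_left)
lift_definition uminus_hspace :: "hspace \<Rightarrow> hspace" is uminus
  by (simp add: mean_zero_iff div_free_iff)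
lift_definition scaleR_hspace :: "real \<Rightarrow> hspace \<Rightarrow> hspace" is "(*\<^sub>R)"
  by (simp add: mean_zero_iff div_free_iff)
lift_definition inner_hspace :: "hspace \<Rightarrow> hspace \<Rightarrow> real" is inner .
lift_definition norm_hspace :: "hspace \<Rightarrow> real" is norm .

definition sgn_hspace :: "hspace \<Rightarrow> hspace" where "sgn_hspace u = inverse (norm u) *\<^sub>R u"
definition dist_hspace :: "hspace \<Rightarrow> hspace \<Rightarrow> real" where "dist_hspace u v = norm (u - v)"
definition uniformity_hspace :: "(hspace \<times> hspace) filter" where
  "uniformity_hspace = (INF e\<in>{0 <..}. principal {(x, y). dist x y < e})"
definition open_hspace :: "hspace set \<Rightarrow> bool" where
  "open_hspace U \<longleftrightarrow> (\<forall>x\<in>U. eventually (\<lambda>(x', y). x' = x \<longrightarrow> y \<in> U) uniformity)"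

instance
proof
  fix u v w :: hspace and a b r :: real
  show "u + v + w = u + (v + w)" by transfer simp
  show "u + v = v + u" by transfer simp
  show "0 + u = u" by transfer simp
  show "- u + u = 0" by transfer simp
  show "u - v = u + - v" by transfer simp
  show "a *\<^sub>R (u + v) = a *\<^sub>R u + a *\<^sub>R v" by transfer (rule scaleR_add_right)
  show "(a + b) *\<^sub>R u = a *\<^sub>R u + b *\<^sub>R u" by transfer (rule scaleR_add_left)
  show "a *\<^sub>R b *\<^sub>R u = (a * b) *\<^sub>R u" by transfer simp
  show "1 *\<^sub>R u = u" by transfer simp
  show "dist u v = norm (u - v)" by (simp add: dist_hspace_def)
  show "sgn u = inverse (norm u) *\<^sub>R u" by (simp add: sgn_hspace_def)
  show "inner u v = inner v u" by transfer (rule inner_commute)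
  show "inner (u + v) w = inner u w + inner v w" by transfer (rule inner_add_left)
  show "inner (r *\<^sub>R u) v = r * inner u v" by transfer simp
  show "0 \<le> inner u u" by transfer simp
  show "(inner u u = 0) = (u = 0)" by transfer simp
  show "norm u = sqrt (inner u u)" by transfer (rule norm_eq_sqrt_inner)
qed (rule uniformity_hspace_def open_hspace_def)+

end

lemma dist_l2_of: "dist (l2_of u) (l2_of v) = dist u v"
  unfolding dist_norm by transfer simp

lemma closed_hspace: "closed {u. mean_zero u \<and> div_free u}"
proof -
  have "{u. mean_zero u \<and> div_free u} =
      (\<Inter>b\<in>Basis. {u. inner u (abs_l2per (\<lambda>_. b)) = 0}) \<inter>
      (\<Inter>f\<in>Collect test_fun. {u. inner u (abs_l2per (grad f)) = 0})"
    by (auto simp: mean_zero_iff div_free_iff)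
  also have "closed \<dots>"
    by (intro closed_Int closed_INT ballI closed_Collect_eq continuous_intros)
  finally show ?thesis .
qed

instance hspace :: complete_space
proof
  fix X :: "nat \<Rightarrow> hspace" assume "Cauchy X"
  then have "Cauchy (\<lambda>n. l2_of (X n))" by (simp add: Cauchy_def dist_l2_of)
  then obtain l where l: "(\<lambda>n. l2_of (X n)) \<longlonglongrightarrow> l"
    using Cauchy_convergent_iff convergent_def by blast
  have "l \<in> {u. mean_zero u \<and> div_free u}"
    using closed_sequentially[OF closed_hspace _ l] l2_of by blast
  then have "l2_of (Abs_hspace l) = l" by (rule Abs_hspace_inverse)
  with l have "X \<longlonglongrightarrow> Abs_hspace l"
    unfolding lim_sequentially by (simp add: dist_l2_of[symmetric])
  then show "convergent X" by (auto simp: convergent_def)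
qed

instance hspace :: banach ..

instance hspace :: second_countable_topology
proof
  obtain Q where Q: "countable Q" "Q \<subseteq> range l2_of" "range l2_of \<subseteq> closure Q"
    using separable by blast
  have "u \<in> closure (l2_of -` Q)" for u
    unfolding closure_approachable
  proof (intro allI impI)
    fix e :: real assume "e > 0"
    have "l2_of u \<in> closure Q" using Q by blast
    then obtain y where "y \<in> Q" "dist y (l2_of u) < e"
      using \<open>e > 0\<close> unfolding closure_approachable by blast
    moreover then obtain w where "y = l2_of w" using Q by blast
    ultimately show "\<exists>y\<in>l2_of -` Q. dist y u < e" by (auto simp: dist_l2_of)
  qed
  moreover have "countable (l2_of -` Q)"
    using countable_image_inj_Int_vimage[of l2_of UNIV Q] Q(1) by (simp add: inj_def l2_of_inject)
  ultimately show "\<exists>B::hspace set set. countable B \<and> open = generate_topology B"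
    by (intro second_countable_of_dense[of "l2_of -` Q"]) auto
qed

definition orth_proj :: "'a::real_inner set \<Rightarrow> 'a \<Rightarrow> 'a" where
  "orth_proj S u = (THE w. w \<in> S \<and> (\<forall>h\<in>S. inner (u - w) h = 0))"

definition leray :: "l2per \<Rightarrow> hspace" where
  "leray f = Abs_hspace (orth_proj (range l2_of) f)"

definition weak_laplacian :: "l2per \<Rightarrow> l2per \<Rightarrow> bool" where
  "weak_laplacian u w \<longleftrightarrow> (\<forall>f. test_fun f \<longrightarrow>
     (\<integral>x. laplacian f x *\<^sub>R rep_l2per u x \<partial>Dm) = (\<integral>x. f x *\<^sub>R rep_l2per w x \<partial>Dm))"

text \<open>\<open>stokes_dom\<close> is \<open>\<H> \<inter> H\<^sup>2\<^sub>per\<close>, and the Stokes operator is \<open>A = - P \<Delta>\<close> on it.\<close>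

definition stokes_dom :: "hspace set" where
  "stokes_dom = {u. \<exists>w. weak_laplacian (l2_of u) w}"

definition stokes :: "hspace \<Rightarrow> hspace" where
  "stokes u = - leray (THE w. weak_laplacian (l2_of u) w)"

text \<open>Real Fourier eigenfunctions of the Stokes operator: the complex modes
  \<open>(k\<^sup>\<bottom>/|k|) exp(2\<pi>i k\<cdot>x)\<close> for \<open>\<plusminus>k\<close> are replaced by the normalised cosine mode (index \<open>k\<close> in the upper half of
  the lattice) and sine mode (index in the lower half).\<close>

definition kk :: "(int \<times> int) set" where
  "kk = UNIV - {(0, 0)}"

definition kabs :: "int \<times> int \<Rightarrow> real" where
  "kabs k = sqrt ((real_of_int (fst k))\<^sup>2 + (real_of_int (snd k))\<^sup>2)"

definition kvec :: "int \<times> int \<Rightarrow> real^2" where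
  "kvec k = vector [real_of_int (fst k), real_of_int (snd k)]"

definition kperp :: "int \<times> int \<Rightarrow> real^2" where
  "kperp k = vector [- real_of_int (snd k), real_of_int (fst k)]"

definition upper :: "int \<times> int \<Rightarrow> bool" where
  "upper k \<longleftrightarrow> snd k > 0 \<or> snd k = 0 \<and> fst k > 0"

definition mode :: "int \<times> int \<Rightarrow> real^2 \<Rightarrow> real^2" where
  "mode k x = (sqrt 2 * (if upper k then cos (2 * pi * (kvec k \<bullet> x)) else sin (2 * pi * (kvec k \<bullet> x))) / kabs k)
     *\<^sub>R kperp k"

definition phi :: "int \<times> int \<Rightarrow> hspace" where
  "phi k = Abs_hspace (abs_l2per (mode k))"

text \<open>\<open>- \<Delta> (mode k) = lam k * mode k\<close> on the unit torus.\<close>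

definition lam :: "int \<times> int \<Rightarrow> real" where
  "lam k = 4 * pi\<^sup>2 * (kabs k)\<^sup>2"

definition A_pow :: "real \<Rightarrow> hspace \<Rightarrow> hspace" where
  "A_pow a u = (\<Sum>\<^sub>\<infinity>k\<in>kk. (lam k powr a * inner u (phi k)) *\<^sub>R phi k)"

definition Hs :: "real \<Rightarrow> hspace set" where
  "Hs s = {u. (\<lambda>k. lam k powr s * (inner u (phi k))\<^sup>2) summable_on kk}"

definition Hs_norm :: "real \<Rightarrow> hspace \<Rightarrow> real" where
  "Hs_norm s u = sqrt (\<Sum>\<^sub>\<infinity>k\<in>kk. lam k powr s * (inner u (phi k))\<^sup>2)"

definition continuous_Hs :: "real \<Rightarrow> real set \<Rightarrow> (real \<Rightarrow> hspace) \<Rightarrow> bool" where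
  "continuous_Hs s I f \<longleftrightarrow> (\<forall>t\<in>I. f t \<in> Hs s \<and> ((\<lambda>r. Hs_norm s (f r - f t)) \<longlongrightarrow> 0) (at t within I))"

definition PN :: "nat \<Rightarrow> hspace \<Rightarrow> hspace" where
  "PN N = orth_proj (span (phi ` {k\<in>kk. kabs k \<le> real N}))"

text \<open>Point values of \<open>u \<in> \<H>\<close>, as the values of the continuous periodic function on the plane representing \<open>u\<close>
  (unspecified if there is none).  The velocity field at a positive time has such a
  representative; the possibly missing one at time 0 does not affect the integral in \<open>tracer\<close>.\<close>

definition per_ext :: "hspace \<Rightarrow> real^2 \<Rightarrow> real^2" where
  "per_ext u = (THE f. continuous_on UNIV f \<and> periodic f \<and> (AE x in Dm. rep_l2per (l2_of u) x = f x))"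

definition stokes_solution :: "real \<Rightarrow> real \<Rightarrow> (real \<Rightarrow> hspace) \<Rightarrow> hspace \<Rightarrow> (real \<Rightarrow> hspace) \<Rightarrow> bool" where
  "stokes_solution nu T \<psi> u v \<longleftrightarrow>
     continuous_on {0..T} v \<and> v 0 = u \<and>
     (\<forall>t\<in>{0<..T}. v t \<in> stokes_dom \<and>
        (v has_vector_derivative (\<psi> t - nu *\<^sub>R stokes (v t))) (at t within {0..T}))"

definition tracer :: "real \<Rightarrow> (real \<Rightarrow> hspace) \<Rightarrow> real^2 \<Rightarrow> (real \<Rightarrow> real^2) \<Rightarrow> bool" where
  "tracer T v z0 z \<longleftrightarrow>
     continuous_on {0..T} z \<and>
     (\<forall>t\<in>{0..T}. set_integrable lborel {0..t} (\<lambda>s. per_ext (v s) (z s)) \<and>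
        z t = z0 + (LINT s:{0..t}|lborel. per_ext (v s) (z s)))"

text \<open>\<open>tracer_pos nu T \<psi> u z0 t\<close> is \<open>z(t)\<close> for the tracer started at \<open>z0\<close>; the solutions \<open>v\<close> and \<open>z\<close> are
  determined on \<open>[0,T]\<close> only, hence the description of the value instead of the functions.\<close>

definition tracer_pos :: "real \<Rightarrow> real \<Rightarrow> (real \<Rightarrow> hspace) \<Rightarrow> hspace \<Rightarrow> real^2 \<Rightarrow> real \<Rightarrow> real^2" where
  "tracer_pos nu T \<psi> u z0 t =
     (THE p. \<exists>v z. stokes_solution nu T \<psi> u v \<and> tracer T v z0 z \<and> z t = p)"

text \<open>The data space \<open>\<real>\<^sup>2\<^sup>J\<^sup>K\<close> is indexed by tracers \<open>'j\<close>, times \<open>'k\<close> and the two coordinates.\<close>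

definition obs_map :: "real \<Rightarrow> real \<Rightarrow> (real \<Rightarrow> hspace) \<Rightarrow> ('j::finite \<Rightarrow> real^2) \<Rightarrow> ('k::finite \<Rightarrow> real)
    \<Rightarrow> hspace \<Rightarrow> real^('j \<times> 'k \<times> 2)" where
  "obs_map nu T \<psi> z0 t u = (\<chi> p. case p of (j, k, i) \<Rightarrow> tracer_pos nu T \<psi> u (z0 j) (t k) $ i)"

definition sym_pos_def :: "real^'n^'n \<Rightarrow> bool" where
  "sym_pos_def M \<longleftrightarrow> transpose M = M \<and> (\<forall>x. x \<noteq> 0 \<longrightarrow> x \<bullet> (M *v x) > 0)"

definition matrix_sqrt :: "real^'n^'n \<Rightarrow> real^'n^'n" where
  "matrix_sqrt M = (THE S. sym_pos_def S \<and> S ** S = M)"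

definition gamma_norm :: "real^'n^'n \<Rightarrow> real^'n \<Rightarrow> real" where
  "gamma_norm M x = norm (matrix_inv (matrix_sqrt M) *v x)"

text \<open>The parameter of \<^const>\<open>normal_density\<close> is the standard deviation; \<open>v = 0\<close> is the degenerate law.\<close>

definition real_gaussian :: "real \<Rightarrow> real \<Rightarrow> real measure" where
  "real_gaussian m v = (if v = 0 then return borel m else density lborel (normal_density m (sqrt v)))"

definition gaussian :: "'a::real_inner measure \<Rightarrow> 'a \<Rightarrow> ('a \<Rightarrow> 'a) \<Rightarrow> bool" where
  "gaussian M m C \<longleftrightarrow> sets M = sets borel \<and> prob_space M \<and>
     (\<forall>h. inner (C h) h \<ge> 0 \<and> distr M borel (\<lambda>u. inner u h) = real_gaussian (inner m h) (inner (C h) h))"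

definition posterior :: "'a measure \<Rightarrow> ('a \<Rightarrow> real) \<Rightarrow> 'a measure" where
  "posterior M \<Phi> = density M (\<lambda>u. ennreal (exp (- \<Phi> u) / (\<integral>w. exp (- \<Phi> w) \<partial>M)))"

definition hellinger :: "'a measure \<Rightarrow> 'a measure \<Rightarrow> 'a measure \<Rightarrow> real" where
  "hellinger M \<mu> \<mu>' =
     sqrt (1/2 * (\<integral>u. (sqrt (enn2real (RN_deriv M \<mu> u)) - sqrt (enn2real (RN_deriv M \<mu>' u)))\<^sup>2 \<partial>M))"

definition mean :: "hspace measure \<Rightarrow> hspace" where
  "mean \<mu> = (\<integral>u. u \<partial>\<mu>)"

definition cov_op :: "hspace measure \<Rightarrow> hspace \<Rightarrow> hspace" where
  "cov_op \<mu> h = (\<integral>u. inner (u - mean \<mu>) h *\<^sub>R (u - mean \<mu>) \<partial>\<mu>)"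

end

theory Submission
  imports Defs
begin

text \<open>
  Write \<open>u\<close> in the real Fourier basis of \<open>\<H>\<close>.  The Stokes flow is explicit mode by mode, and two facts about
  the velocity field \<open>v\<close> started from \<open>u\<close> drive the proof: \<open>|v(s)|\<close> is of order \<open>s\<^sup>-\<^sup>1\<^sup>/\<^sup>2\<close>, and the spatial
  Lipschitz constant is at most \<open>\<epsilon>/s + L\<close> with \<open>\<epsilon>\<close> as small as desired, because the low modes of \<open>u\<close>
  contribute only to \<open>L\<close>.  Hence the tracer equation is a contraction in the norm with weight
  \<open>\<surd>t exp(2Lt)\<close>; this gives existence, uniqueness and continuous dependence of the tracers on every
  \<open>u \<in> \<H>\<close>, so that \<open>\<G>\<close> is continuous and the posteriors are well defined.  For \<open>u \<in> \<H>\<^sup>s\<close> with \<open>s > 0\<close>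
  the Lipschitz constant of \<open>v\<close> is integrable in time, and Gronwall's argument shows
  \<open>|\<G>(u) - \<G>(P\<^sup>N u)| \<le> C exp(C |u|\<^sub>s) |u - P\<^sup>N u| \<le> C exp(C |u|\<^sub>s) |u|\<^sub>s N\<^sup>-\<^sup>s\<close>.  For \<open>s < \<alpha> - 1\<close> the right-hand side
  has all moments under the prior, by a Fernique type estimate; since \<open>x \<mapsto> exp(-x\<^sup>2/4)\<close> is Lipschitz, the
  densities differ by \<open>O(N\<^sup>-\<^sup>s)\<close> in the required weighted norms.
\<close>

section \<open>Calculus on the torus\<close>

text \<open>For \<open>u\<close> merely in H the Lipschitz constant of the velocity is of order 1/s,
  just not integrable at time zero, so plain Gronwall fails; yet the observation map has to be
  defined and continuous on all of H before the posteriors can be discussed. The threshold for the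
  singular part is 1/4, because the weight w(t) = sqrt t * exp(2 L t) satisfies w'/(2 w) = 1/(4 t) +
  L. In each comparison of two tracers the Lipschitz bound is asked of one field only, that of
  \<open>u\<close>, and the two fields differ by a pure heat flow because the forcing cancels. The
  constants therefore depend on \<open>u\<close> and not on its truncation. On the side of the
  measures, exp(-x^2/4) is the square root of the likelihood. Projection does not increase the norm,
  so one lower bound for the likelihood serves all normalisation constants at once. The quadratic
  exponential moment absorbs exp(C |u|) together with the factor (1 + |u|)^2 that second moments
  require.\<close>

lemma Dm_integral:
  fixes f :: "real^2 \<Rightarrow> 'b::{banach, second_countable_topology}"
  shows "(\<integral>x. f x \<partial>Dm) = (\<integral>x. indicator unit_square x *\<^sub>R f x \<partial>lborel)"
  unfolding Dm_def by (rule integral_restrict_space) simp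

lemma box_subset_unit_square: "box 0 1 \<subseteq> unit_square"
  by (auto simp: unit_square_def mem_box_cart less_imp_le)

lemma unit_square_subset_cbox: "unit_square \<subseteq> cbox 0 1"
  by (auto simp: unit_square_def mem_box_cart less_imp_le)

lemma one_inner_Basis_cart: "b \<in> Basis \<Longrightarrow> (1::real^2) \<bullet> b = 1"
  by (auto simp: Basis_vec_def inner_axis)

lemma emeasure_unit_square: "emeasure lborel unit_square = 1"
proof (rule antisym)
  have "emeasure lborel unit_square \<le> emeasure lborel (cbox 0 (1::real^2))"
    by (intro emeasure_mono unit_square_subset_cbox) auto
  then show "emeasure lborel unit_square \<le> 1"
    by (simp add: emeasure_lborel_cbox_eq one_inner_Basis_cart)
  have "emeasure lborel (box 0 (1::real^2)) \<le> emeasure lborel unit_square"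
    by (intro emeasure_mono box_subset_unit_square) auto
  then show "1 \<le> emeasure lborel unit_square"
    by (simp add: emeasure_lborel_box_eq one_inner_Basis_cart)
qed

lemma measure_Dm: "measure Dm (space Dm) = 1"
  by (simp add: space_Dm measure_def Dm_def emeasure_restrict_space emeasure_unit_square)

lemma integrable_Dm_bounded:
  fixes f :: "real^2 \<Rightarrow> real"
  assumes "continuous_on UNIV f"
  shows "integrable Dm f"
proof -
  have "integrable lborel (\<lambda>x. indicator (cbox 0 1) x *\<^sub>R f x)"
    by (intro borel_integrable_compact continuous_on_subset[OF assms]) auto
  then have "set_integrable lborel unit_square f"
    using set_integrable_subset[of lborel "cbox 0 1" f unit_square] unit_square_subset_cbox
    by (simp add: set_integrable_def)
  then show ?thesis
    by (simp add: Dm_def integrable_restrict_space set_integrable_def)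
qed

lemma lborel_integral_shift:
  fixes g :: "real^2 \<Rightarrow> real"
  assumes "g \<in> borel_measurable borel"
  shows "(\<integral>x. g (x + c) \<partial>lborel) = (\<integral>x. g x \<partial>lborel)"
proof -
  have "(\<integral>x. g x \<partial>lborel) = (\<integral>x. g x \<partial>distr lborel borel ((+) c))"
    by (simp add: lborel_distr_plus)
  also have "\<dots> = (\<integral>x. g (c + x) \<partial>lborel)"
    by (rule integral_distr) (use assms in auto)
  finally show ?thesis by (simp add: add.commute)
qed

text \<open>The translated square is cut at the face where coordinate \<open>i\<close> equals 1:
  \<open>A\<close> is the piece that stays in the square, and \<open>B\<close>, moved back by one
  period, is the strip \<open>A'\<close> that \<open>A\<close> lacks. Periodicity makes the
  integrand blind to that move.\<close>

lemma integral_shift_periodic: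
  fixes f :: "real^2 \<Rightarrow> real"
  assumes f: "continuous_on UNIV f" and per: "periodic f" and h: "0 \<le> h" "h \<le> 1"
  shows "(\<integral>x. f (x + h *\<^sub>R axis i 1) \<partial>Dm) = (\<integral>x. f x \<partial>Dm)"
proof -
  have [measurable]: "f \<in> borel_measurable borel"
    by (rule borel_measurable_continuous_onI[OF f])
  define A where "A = {y\<in>unit_square. h \<le> y $ i}"
  define A' where "A' = {y\<in>unit_square. y $ i < h}"
  define B where "B = {y. (y - axis i 1) \<in> A'}"
  have [measurable]: "A \<in> sets borel" "A' \<in> sets borel"
    unfolding A_def A'_def using unit_square_borel
    by (auto intro!: borel_closed borel_open closed_Collect_le open_Collect_less continuous_intros sets.Int
        simp: Collect_conj_eq)
  have B_eq: "B = (\<lambda>y. y - axis i 1) -` A' \<inter> space borel" by (auto simp: B_def)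
  have [measurable]: "B \<in> sets borel" unfolding B_eq
    by (rule measurable_sets[of _ borel borel]) auto
  have "unit_square \<subseteq> cbox 0 2"
  proof
    fix x :: "real^2" assume "x \<in> unit_square"
    then have 1: "0 \<le> x $ j" "x $ j < 1" for j by (simp_all add: unit_square_def)
    have "0 \<le> x $ j" "x $ j \<le> 2" for j using 1[of j] by linarith+
    then show "x \<in> cbox 0 2" by (simp add: mem_box_cart)
  qed
  then have sub: "A \<subseteq> cbox 0 2" "A' \<subseteq> cbox 0 2"
    by (auto simp: A_def A'_def)
  have "x \<in> B \<Longrightarrow> x \<in> cbox 0 2" for x
  proof -
    assume "x \<in> B"
    then have 1: "0 \<le> x $ j - (axis i 1 :: real^2) $ j" "x $ j - (axis i 1 :: real^2) $ j < 1" for j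
      by (auto simp: B_def A'_def unit_square_def)
    have 2: "0 \<le> (axis i 1 :: real^2) $ j" "(axis i 1 :: real^2) $ j \<le> 1" for j
      by (simp_all add: axis_def)
    have "0 \<le> x $ j" "x $ j \<le> 2" for j using 1[of j] 2[of j] by linarith+
    then show "x \<in> cbox 0 2" unfolding mem_box_cart by simp
  qed
  then have subB: "B \<subseteq> cbox 0 2" by blast
  have int: "integrable lborel (\<lambda>x. indicator S x * f x)" if "S \<in> sets borel" "S \<subseteq> cbox 0 2" for S
  proof -
    have "integrable lborel (\<lambda>x. indicator (cbox 0 2) x *\<^sub>R f x)"
      by (intro borel_integrable_compact continuous_on_subset[OF f]) auto
    then show ?thesis using set_integrable_subset[of lborel "cbox 0 2" f S] that
      by (simp add: set_integrable_def)
  qed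
  have split: "indicator unit_square (y - h *\<^sub>R axis i 1) = (indicator A y + indicator B y :: real)" for y
  proof -
    have e: "(h *\<^sub>R axis i 1 :: real^2) $ j = (if j = i then h else 0)"
      "(axis i 1 :: real^2) $ j = (if j = i then 1 else 0)" for j
      by (auto simp: axis_def)
    have 1: "y - h *\<^sub>R axis i 1 \<in> unit_square \<longleftrightarrow>
        (\<forall>j. j \<noteq> i \<longrightarrow> 0 \<le> y $ j \<and> y $ j < 1) \<and> h \<le> y $ i \<and> y $ i < 1 + h"
      unfolding unit_square_def by (auto simp: e axis_def split: if_splits)
    have 2: "y \<in> A \<longleftrightarrow> (\<forall>j. j \<noteq> i \<longrightarrow> 0 \<le> y $ j \<and> y $ j < 1) \<and> h \<le> y $ i \<and> y $ i < 1"
      unfolding A_def unit_square_def using h by auto (metis order_trans)+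
    have 3: "y \<in> B \<longleftrightarrow> (\<forall>j. j \<noteq> i \<longrightarrow> 0 \<le> y $ j \<and> y $ j < 1) \<and> 1 \<le> y $ i \<and> y $ i < 1 + h"
      unfolding B_def A'_def unit_square_def using h by (auto simp: e axis_def split: if_splits)
    show ?thesis using h unfolding indicator_def 1 2 3 by (cases "y $ i < 1") auto
  qed
  have "(\<integral>x. f (x + h *\<^sub>R axis i 1) \<partial>Dm) =
      (\<integral>x. (\<lambda>y. indicator unit_square (y - h *\<^sub>R axis i 1) * f y) (x + h *\<^sub>R axis i 1) \<partial>lborel)"
    by (simp add: Dm_integral)
  also have "\<dots> = (\<integral>y. indicator unit_square (y - h *\<^sub>R axis i 1) * f y \<partial>lborel)"
    by (rule lborel_integral_shift) measurable
  also have "\<dots> = (\<integral>y. indicator A y * f y + indicator B y * f y \<partial>lborel)"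
    by (simp add: split algebra_simps)
  also have "\<dots> = (\<integral>y. indicator A y * f y \<partial>lborel) + (\<integral>y. indicator B y * f y \<partial>lborel)"
    by (intro Bochner_Integration.integral_add int sub subB) measurable
  also have "(\<integral>y. indicator B y * f y \<partial>lborel) = (\<integral>y. indicator B (y + axis i 1) * f (y + axis i 1) \<partial>lborel)"
    by (rule lborel_integral_shift[symmetric]) measurable
  also have "\<dots> = (\<integral>y. indicator A' y * f y \<partial>lborel)"
    using per by (simp add: periodic_def B_def indicator_def)
  also have "(\<integral>y. indicator A y * f y \<partial>lborel) + \<dots> = (\<integral>y. indicator A y * f y + indicator A' y * f y \<partial>lborel)"
    by (intro Bochner_Integration.integral_add[symmetric] int sub) measurable
  also have "\<dots> = (\<integral>y. indicator unit_square y *\<^sub>R f y \<partial>lborel)"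
    by (intro Bochner_Integration.integral_cong) (auto simp: A_def A'_def indicator_def)
  finally show ?thesis by (simp add: Dm_integral)
qed

section \<open>Partial derivatives and integration by parts on the torus\<close>

lemma pd_line_derivative:
  assumes "f differentiable (at (x + s *\<^sub>R axis i 1))"
  shows "((\<lambda>s. f (x + s *\<^sub>R axis i 1)) has_real_derivative pd i f (x + s *\<^sub>R axis i 1)) (at s)"
proof -
  let ?x = "x + s *\<^sub>R axis i 1"
  have d: "(f has_derivative frechet_derivative f (at ?x)) (at ?x)"
    using assms by (simp add: frechet_derivative_works)
  have "((\<lambda>s. x + s *\<^sub>R axis i 1) has_derivative (\<lambda>d. d *\<^sub>R axis i 1)) (at s)"
    by (auto intro!: derivative_eq_intros)
  from has_derivative_compose[OF this d]
  have "((\<lambda>s. f (x + s *\<^sub>R axis i 1)) has_derivative (\<lambda>d. frechet_derivative f (at ?x) (d *\<^sub>R axis i 1))) (at s)" .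
  moreover have "(\<lambda>d. frechet_derivative f (at ?x) (d *\<^sub>R axis i 1)) = (*) (pd i f ?x)"
    using linear_scale[OF has_derivative_linear[OF d]] by (auto simp: pd_def)
  ultimately show ?thesis by (simp add: has_field_derivative_def)
qed

text \<open>Difference quotients of a periodic function have mean zero by translation invariance, and they are
  dominated; this avoids Fubini's theorem.\<close>

lemma integral_pd_zero:
  fixes i :: 2
  assumes per: "periodic f" and d: "\<And>x. f differentiable (at x)" and c: "continuous_on UNIV (pd i f)"
  shows "(\<integral>x. pd i f x \<partial>Dm) = 0"
proof -
  have fc: "continuous_on UNIV f"
    using d differentiable_imp_continuous_within by (metis continuous_at_imp_continuous_on)
  define h where "h n = inverse (real (Suc n))" for n
  have h: "0 < h n" "h n \<le> 1" for n by (auto simp: h_def field_simps)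
  have hlim: "h \<longlonglongrightarrow> 0" unfolding h_def using LIMSEQ_inverse_real_of_nat by simp
  define s where "s n x = (f (x + h n *\<^sub>R axis i 1) - f x) / h n" for n x
  have cs: "continuous_on UNIV (\<lambda>x. f (x + h n *\<^sub>R axis i 1))" for n
    by (intro continuous_on_compose2[OF fc] continuous_intros) auto
  have s0: "(\<integral>x. s n x \<partial>Dm) = 0" for n
  proof -
    have "(\<integral>x. s n x \<partial>Dm) = ((\<integral>x. f (x + h n *\<^sub>R axis i 1) \<partial>Dm) - (\<integral>x. f x \<partial>Dm)) / h n"
      unfolding s_def using integrable_Dm_bounded[OF cs] integrable_Dm_bounded[OF fc] by simp
    then show ?thesis using integral_shift_periodic[OF fc per, of "h n" i] h[of n] by simp
  qed
  \<comment> \<open>The increments are at most 1, so the mean value points of the difference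
    quotients based in the unit square stay in this larger box.\<close>
  have "compact (pd i f ` cbox 0 2)"
    by (intro compact_continuous_image continuous_on_subset[OF c]) auto
  then obtain B where B: "\<And>x. x \<in> cbox 0 2 \<Longrightarrow> norm (pd i f x) \<le> B"
    using compact_imp_bounded[of "pd i f ` cbox 0 2"] unfolding bounded_iff by auto
  have "(\<lambda>n. \<integral>x. s n x \<partial>Dm) \<longlonglongrightarrow> (\<integral>x. pd i f x \<partial>Dm)"
  proof (rule integral_dominated_convergence[where w = "\<lambda>x. B"])
    show "pd i f \<in> borel_measurable Dm"
      using integrable_Dm_bounded[OF c] by (rule borel_measurable_integrable)
    show "s n \<in> borel_measurable Dm" for n
      unfolding s_def using integrable_Dm_bounded[OF cs] integrable_Dm_bounded[OF fc]
      by (intro borel_measurable_divide borel_measurable_diff borel_measurable_integrable) auto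
    show "AE x in Dm. (\<lambda>n. s n x) \<longlonglongrightarrow> pd i f x"
    proof (rule AE_I2)
      fix x
      have "((\<lambda>s. f (x + s *\<^sub>R axis i 1)) has_real_derivative pd i f x) (at 0)"
        using pd_line_derivative[OF d, where x = x and s = 0 and i = i] by simp
      then have "((\<lambda>s. (f (x + s *\<^sub>R axis i 1) - f x) / s) \<longlongrightarrow> pd i f x) (at 0)"
        by (simp add: has_field_derivative_iff)
      moreover have "filterlim h (at 0) sequentially"
        unfolding filterlim_at using hlim h by (simp add: less_le)
      ultimately show "(\<lambda>n. s n x) \<longlonglongrightarrow> pd i f x"
        unfolding s_def by (rule filterlim_compose)
    qed
    show "AE x in Dm. norm (s n x) \<le> B" for n
    proof (rule AE_I2)
      fix x assume "x \<in> space Dm"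
      then have x: "x \<in> unit_square" by (simp add: space_Dm)
      have "\<exists>z>0. z < h n \<and> f (x + h n *\<^sub>R axis i 1) - f (x + 0 *\<^sub>R axis i 1) = (h n - 0) * pd i f (x + z *\<^sub>R axis i 1)"
        by (rule MVT2[OF h(1)]) (rule pd_line_derivative[OF d])
      then obtain z where z: "z > 0" "z < h n" "f (x + h n *\<^sub>R axis i 1) - f x = h n * pd i f (x + z *\<^sub>R axis i 1)"
        by auto
      have "x + z *\<^sub>R axis i 1 \<in> cbox 0 2"
      proof -
        have "z < 1" using z h[of n] by linarith
        moreover have "0 \<le> x $ j" "x $ j < 1" for j using x by (simp_all add: unit_square_def)
        moreover have "0 \<le> (axis i 1 :: real^2) $ j" "(axis i 1 :: real^2) $ j \<le> 1" for j by (simp_all add: axis_def)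
        ultimately have "0 \<le> x $ j + z * (axis i 1 :: real^2) $ j" "x $ j + z * (axis i 1 :: real^2) $ j \<le> 1 + 1 * 1" for j
          using z(1) by (intro add_nonneg_nonneg mult_nonneg_nonneg add_mono mult_mono; simp add: less_imp_le)+
        then show ?thesis unfolding mem_box_cart by simp
      qed
      moreover have "s n x = pd i f (x + z *\<^sub>R axis i 1)" using z h(1)[of n] by (simp add: s_def)
      ultimately show "norm (s n x) \<le> B" using B by simp
    qed
  qed simp
  then show ?thesis by (simp add: s0 LIMSEQ_const_iff)
qed

lemma pd_mult:
  assumes "f differentiable (at x)" "g differentiable (at x)"
  shows "pd i (\<lambda>x. f x * g x) x = f x * pd i g x + pd i f x * g x"
proof -
  have "((\<lambda>x. f x * g x) has_derivative
      (\<lambda>h. f x * frechet_derivative g (at x) h + frechet_derivative f (at x) h * g x)) (at x)"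
    using assms by (intro has_derivative_mult) (simp_all add: frechet_derivative_works)
  from frechet_derivative_at[OF this, symmetric] show ?thesis by (simp add: pd_def)
qed

lemma integral_by_parts_Dm:
  assumes "periodic f" "\<And>x. f differentiable (at x)" "continuous_on UNIV (pd i f)"
    and "periodic g" "\<And>x. g differentiable (at x)" "continuous_on UNIV (pd i g)"
  shows "(\<integral>x. f x * pd i g x \<partial>Dm) = - (\<integral>x. pd i f x * g x \<partial>Dm)"
proof -
  have fc: "continuous_on UNIV f" "continuous_on UNIV g"
    using assms differentiable_imp_continuous_within by (metis continuous_at_imp_continuous_on)+
  have eq: "pd i (\<lambda>x. f x * g x) = (\<lambda>x. f x * pd i g x + pd i f x * g x)"
    by (intro ext pd_mult assms)
  have "(\<integral>x. f x * pd i g x + pd i f x * g x \<partial>Dm) = 0"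
    unfolding eq[symmetric]
  proof (rule integral_pd_zero)
    show "continuous_on UNIV (pd i (\<lambda>x. f x * g x))"
      unfolding eq by (intro continuous_intros fc assms)
  qed (use assms in \<open>auto simp: periodic_def intro: differentiable_mult\<close>)
  moreover have "integrable Dm (\<lambda>x. f x * pd i g x)" "integrable Dm (\<lambda>x. pd i f x * g x)"
    by (intro integrable_Dm_bounded continuous_intros fc assms)+
  ultimately show ?thesis by simp
qed

section \<open>Test functions, trigonometric functions and the divergence-free modes\<close>

lemma test_fun_D:
  assumes "test_fun f"
  shows "periodic f" "f differentiable (at x)" "continuous_on UNIV (pd i f)" "continuous_on UNIV f" "test_fun (pd i f)"
proof -
  have "Ck_per (Suc 0) f" "Ck_per 0 f" using assms unfolding test_fun_def by blast+
  then show "periodic f" "f differentiable (at x)" "continuous_on UNIV (pd i f)" "continuous_on UNIV f" by auto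
  have "Ck_per (Suc n) f" for n using assms unfolding test_fun_def by blast
  then show "test_fun (pd i f)" unfolding test_fun_def by simp
qed

text \<open>Both phases are kept in one family so that it is closed under \<open>pd\<close>.
  Smoothness is then an induction over the coefficients, and products and means can be computed
  inside the family.\<close>

definition trig :: "real \<Rightarrow> real \<Rightarrow> int \<times> int \<Rightarrow> real^2 \<Rightarrow> real" where
  "trig a b k x = a * cos (2 * pi * (kvec k \<bullet> x)) + b * sin (2 * pi * (kvec k \<bullet> x))"

lemma trig_has_derivative:
  "(trig a b k has_derivative (\<lambda>h. 2 * pi * (kvec k \<bullet> h) *
     (b * cos (2 * pi * (kvec k \<bullet> x)) - a * sin (2 * pi * (kvec k \<bullet> x))))) (at x)"
  unfolding trig_def[abs_def]
  by (auto intro!: derivative_eq_intros simp: algebra_simps)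

lemma pd_trig: "pd i (trig a b k) = trig (2 * pi * kvec k $ i * b) (- (2 * pi * kvec k $ i * a)) k"
proof
  fix x
  show "pd i (trig a b k) x = trig (2 * pi * kvec k $ i * b) (- (2 * pi * kvec k $ i * a)) k x"
    unfolding pd_def frechet_derivative_at[OF trig_has_derivative, symmetric]
    by (simp add: trig_def inner_axis algebra_simps)
qed

lemma kvec_component: "kvec k $ 1 = real_of_int (fst k)" "kvec k $ 2 = real_of_int (snd k)"
  by (simp_all add: kvec_def)

lemma kperp_component: "kperp k $ 1 = - real_of_int (snd k)" "kperp k $ 2 = real_of_int (fst k)"
  by (simp_all add: kperp_def)

lemma periodic_trig: "periodic (trig a b k)"
  unfolding periodic_def
proof (intro allI)
  fix x :: "real^2" and i :: 2
  have "\<exists>n::int. kvec k $ i = of_int n"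
    using exhaust_2[of i] kvec_component by metis
  then obtain n :: int where n: "kvec k $ i = of_int n" by blast
  have "2 * pi * (kvec k \<bullet> (x + axis i 1)) = 2 * pi * (kvec k \<bullet> x) + (2 * pi) * of_int n"
    by (simp add: inner_add_right inner_axis n algebra_simps)
  then show "trig a b k (x + axis i 1) = trig a b k x"
    by (simp only: trig_def cos_add sin_add cos_int_2pin sin_int_2pin) simp
qed

lemma continuous_on_trig: "continuous_on S (trig a b k)"
  unfolding trig_def[abs_def] by (intro continuous_intros)

lemma test_fun_trig: "test_fun (trig a b k)"
proof -
  have "Ck_per n (trig a b k)" for n
  proof (induction n arbitrary: a b)
    case 0 then show ?case by (simp add: periodic_trig continuous_on_trig)
  next
    case (Suc n)
    then show ?case
      using trig_has_derivative unfolding Ck_per.simps pd_trig differentiable_def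
      by (blast intro: periodic_trig)
  qed
  then show ?thesis by (simp add: test_fun_def)
qed

lemma kk_iff: "k \<in> kk \<longleftrightarrow> k \<noteq> 0"
  by (simp add: kk_def zero_prod_def)

text \<open>A nonzero frequency has a nonzero component \<open>i\<close>, and then the function is
  itself \<open>pd i\<close> of another member of the family, hence has mean zero.\<close>

lemma integral_trig: "(\<integral>x. trig a b k x \<partial>Dm) = (if k = 0 then a else 0)"
proof (cases "k = 0")
  case True
  then have "trig a b k x = a" for x
    by (simp add: trig_def kvec_def inner_vec_def sum_2)
  then show ?thesis using True measure_Dm by simp
next
  case False
  then have "\<exists>i. kvec k $ i \<noteq> 0"
    by (metis kvec_component of_int_eq_0_iff prod_eq_iff fst_zero snd_zero)
  then obtain i where i: "kvec k $ i \<noteq> 0" by blast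
  have "trig a b k = pd i (trig (- b / (2 * pi * kvec k $ i)) (a / (2 * pi * kvec k $ i)) k)"
    unfolding pd_trig using i by simp
  then have "(\<integral>x. trig a b k x \<partial>Dm) = (\<integral>x. pd i (trig (- b / (2 * pi * kvec k $ i)) (a / (2 * pi * kvec k $ i)) k) x \<partial>Dm)"
    by simp
  also have "\<dots> = 0"
    by (intro integral_pd_zero test_fun_D test_fun_trig)
  finally show ?thesis using False by simp
qed

lemma integrable_trig: "integrable Dm (trig a b k)"
  by (intro integrable_Dm_bounded continuous_on_trig)

definition tmode :: "int \<times> int \<Rightarrow> real^2 \<Rightarrow> real" where
  "tmode k = trig (if upper k then 1 else 0) (if upper k then 0 else 1) k"

lemma mode_tmode: "mode k x = (sqrt 2 * tmode k x / kabs k) *\<^sub>R kperp k"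
  by (simp add: mode_def tmode_def trig_def)

lemma mode_component:
  "mode k x $ i = trig (if upper k then sqrt 2 / kabs k * kperp k $ i else 0) (if upper k then 0 else sqrt 2 / kabs k * kperp k $ i) k x"
  by (simp add: mode_def trig_def)

lemma continuous_on_mode: "continuous_on S (mode k)"
  unfolding mode_tmode[abs_def] tmode_def divide_inverse
  by (intro continuous_intros continuous_on_trig)

lemma sq_int_mode: "sq_int (mode k)"
  by (intro sq_int_continuous continuous_on_mode)

lemma kvec_add: "kvec (k + l) = kvec k + kvec l" and kvec_diff: "kvec (k - l) = kvec k - kvec l"
  by (simp_all add: vec_eq_iff forall_2 kvec_component)

lemma tmode_mult:
  "tmode k x * tmode l x =
     (if upper k \<and> upper l then trig (1/2) 0 (k - l) x + trig (1/2) 0 (k + l) x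
      else if upper k then trig 0 (1/2) (k + l) x + trig 0 (- 1/2) (k - l) x
      else if upper l then trig 0 (1/2) (k + l) x + trig 0 (1/2) (k - l) x
      else trig (1/2) 0 (k - l) x + trig (- 1/2) 0 (k + l) x)"
  by (simp add: tmode_def trig_def kvec_add kvec_diff inner_add_left inner_diff_left distrib_left right_diff_distrib
      cos_add cos_diff sin_add sin_diff)

text \<open>Each half of the lattice is closed under addition and avoids 0. So in
  \<open>tmode_mult\<close> a product of two cosines or of two sines has a constant part only
  through the frequency \<open>k - l\<close>; mixed products consist of sines, whose mean is zero at
  every frequency.\<close>

lemma upper_sum_nonzero: "upper k \<Longrightarrow> upper l \<Longrightarrow> k + l \<noteq> 0"
  "k \<in> kk \<Longrightarrow> l \<in> kk \<Longrightarrow> \<not> upper k \<Longrightarrow> \<not> upper l \<Longrightarrow> k + l \<noteq> 0"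
  by (auto simp: upper_def prod_eq_iff kk_iff)

lemma integral_tmode_mult:
  assumes "k \<in> kk" "l \<in> kk"
  shows "(\<integral>x. tmode k x * tmode l x \<partial>Dm) = (if k = l then 1/2 else 0)"
proof -
  have [simp]: "trig c d (0::int \<times> int) x = c" for c d x
    by (simp add: trig_def kvec_def inner_vec_def sum_2)
  have "k - l = 0 \<longleftrightarrow> k = l" by simp
  then show ?thesis
    unfolding tmode_mult using upper_sum_nonzero[of k l] assms measure_Dm
    by (cases "upper k"; cases "upper l") (auto simp: integrable_trig integral_trig)
qed

lemma kabs_pos: "k \<in> kk \<Longrightarrow> kabs k > 0"
  by (auto simp: kabs_def kk_iff prod_eq_iff sum_power2_gt_zero_iff)

lemma kabs_sq: "(kabs k)\<^sup>2 = (real_of_int (fst k))\<^sup>2 + (real_of_int (snd k))\<^sup>2"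
  by (simp add: kabs_def)

lemma kperp_inner_self: "kperp k \<bullet> kperp k = (kabs k)\<^sup>2"
  by (simp add: inner_vec_def sum_2 kperp_component kabs_sq flip: power2_eq_square)

lemma kvec_inner_self: "kvec k \<bullet> kvec k = (kabs k)\<^sup>2"
  by (simp add: inner_vec_def sum_2 kvec_component kabs_sq flip: power2_eq_square)

lemma norm_kperp: "norm (kperp k) = kabs k" and norm_kvec: "norm (kvec k) = kabs k"
  by (simp_all add: norm_eq_sqrt_inner kperp_inner_self kvec_inner_self) (simp_all add: kabs_def)

lemma integral_mode_inner:
  assumes "k \<in> kk" "l \<in> kk"
  shows "(\<integral>x. mode k x \<bullet> mode l x \<partial>Dm) = (if k = l then 1 else 0)"
proof -
  have "(\<integral>x. mode k x \<bullet> mode l x \<partial>Dm) = (\<integral>x. (2 * (kperp k \<bullet> kperp l) / (kabs k * kabs l)) * (tmode k x * tmode l x) \<partial>Dm)"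
    by (intro Bochner_Integration.integral_cong) (auto simp: mode_tmode algebra_simps inner_commute)
  also have "\<dots> = (2 * (kperp k \<bullet> kperp l) / (kabs k * kabs l)) * (\<integral>x. tmode k x * tmode l x \<partial>Dm)"
    by simp
  also have "\<dots> = (if k = l then 1 else 0)"
    unfolding integral_tmode_mult[OF assms] using kabs_pos[OF assms(1)]
    by (auto simp: kperp_inner_self power2_eq_square)
  finally show ?thesis .
qed

lemma norm_mode_le: "norm (mode k x) \<le> sqrt 2"
proof (cases "kabs k = 0")
  case False
  then have k: "kabs k > 0" by (simp add: kabs_def less_le)
  have "\<bar>tmode k x\<bar> \<le> 1" by (simp add: tmode_def trig_def)
  then show ?thesis using k by (simp add: mode_tmode norm_kperp abs_mult)
qed (simp add: mode_tmode)

lemma mode_lipschitz: "norm (mode k x - mode k y) \<le> 2 * pi * sqrt 2 * kabs k * norm (x - y)"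
proof (cases "kabs k = 0")
  case False
  then have k: "kabs k > 0" by (simp add: kabs_def less_le)
  have sinl: "\<bar>sin a - sin b\<bar> \<le> \<bar>a - b\<bar>" and cosl: "\<bar>cos a - cos b\<bar> \<le> \<bar>a - b\<bar>" for a b :: real
  proof -
    have s: "\<bar>sin z\<bar> \<le> \<bar>z\<bar>" for z :: real by (rule abs_sin_x_le_abs_x)
    have "\<bar>sin a - sin b\<bar> = 2 * \<bar>sin ((a - b) / 2)\<bar> * \<bar>cos ((a + b) / 2)\<bar>"
      by (simp add: sin_diff_sin abs_mult)
    also have "\<dots> \<le> 2 * \<bar>(a - b) / 2\<bar> * 1"
      by (intro mult_mono s) auto
    finally show "\<bar>sin a - sin b\<bar> \<le> \<bar>a - b\<bar>" by simp
    have "\<bar>cos a - cos b\<bar> = 2 * \<bar>sin ((a + b) / 2)\<bar> * \<bar>sin ((b - a) / 2)\<bar>"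
      by (simp add: cos_diff_cos abs_mult)
    also have "\<dots> \<le> 2 * 1 * \<bar>(b - a) / 2\<bar>"
      by (intro mult_mono s) auto
    finally show "\<bar>cos a - cos b\<bar> \<le> \<bar>a - b\<bar>" by simp
  qed
  have "\<bar>tmode k x - tmode k y\<bar> \<le> \<bar>2 * pi * (kvec k \<bullet> x) - 2 * pi * (kvec k \<bullet> y)\<bar>"
    unfolding tmode_def trig_def using sinl cosl by auto
  also have "\<dots> = 2 * pi * \<bar>kvec k \<bullet> (x - y)\<bar>"
    by (simp add: inner_diff_right right_diff_distrib[symmetric] abs_mult)
  also have "\<dots> \<le> 2 * pi * (kabs k * norm (x - y))"
    using Cauchy_Schwarz_ineq2[of "kvec k" "x - y"] by (intro mult_left_mono) (auto simp: norm_kvec)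
  finally have *: "\<bar>tmode k x - tmode k y\<bar> \<le> 2 * pi * (kabs k * norm (x - y))" .
  have "norm (mode k x - mode k y) = sqrt 2 * \<bar>tmode k x - tmode k y\<bar>"
    using k by (simp add: mode_tmode scaleR_left_diff_distrib[symmetric] norm_kperp diff_divide_distrib[symmetric]
        right_diff_distrib[symmetric] abs_mult)
  with * show ?thesis using mult_left_mono[OF *, of "sqrt 2"] by (simp add: algebra_simps)
qed (simp add: mode_tmode)

lemma periodic_mode: "periodic (mode k)"
  using periodic_trig unfolding periodic_def mode_tmode tmode_def by metis

lemma mean_zero_mode: assumes "k \<in> kk" shows "mean_zero (abs_l2per (mode k))"
  unfolding mean_zero_iff
proof
  fix b :: "real^2" assume "b \<in> Basis"
  have "sq_int (\<lambda>_. b)" by (intro sq_int_continuous continuous_intros)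
  then have "inner (abs_l2per (mode k)) (abs_l2per (\<lambda>_. b)) = (\<integral>x. mode k x \<bullet> b \<partial>Dm)"
    by (intro inner_abs_l2per sq_int_mode)
  also have "\<dots> = (\<integral>x. (sqrt 2 * (kperp k \<bullet> b) / kabs k) * tmode k x \<partial>Dm)"
    by (intro Bochner_Integration.integral_cong) (auto simp: mode_tmode)
  also have "\<dots> = 0" using assms by (simp add: tmode_def integral_trig kk_iff)
  finally show "inner (abs_l2per (mode k)) (abs_l2per (\<lambda>_. b)) = 0" .
qed

lemma mode_component_test_fun: "test_fun (\<lambda>x. mode k x $ i)"
  unfolding mode_component by (rule test_fun_trig)

text \<open>Orthogonality of \<open>kvec k\<close> and \<open>kperp k\<close>.\<close>

lemma div_mode_zero: "(\<Sum>i\<in>UNIV. pd i (\<lambda>x. mode k x $ i) x) = 0"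
  unfolding mode_component pd_trig
  by (simp add: sum_2 trig_def kvec_component kperp_component)

lemma div_free_mode: "div_free (abs_l2per (mode k))"
  unfolding div_free_iff
proof (intro allI impI)
  fix f assume f: "test_fun f"
  have "inner (abs_l2per (mode k)) (abs_l2per (grad f)) = (\<integral>x. mode k x \<bullet> grad f x \<partial>Dm)"
    by (intro inner_abs_l2per sq_int_mode sq_int_grad f)
  also have "\<dots> = (\<integral>x. (\<Sum>i\<in>UNIV. mode k x $ i * pd i f x) \<partial>Dm)"
    by (simp add: inner_vec_def grad_def)
  also have "\<dots> = (\<Sum>i\<in>UNIV. \<integral>x. mode k x $ i * pd i f x \<partial>Dm)"
    using test_fun_D[OF f] test_fun_D(4)[OF mode_component_test_fun]
    by (intro Bochner_Integration.integral_sum integrable_Dm_bounded continuous_on_mult) auto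
  also have "\<dots> = (\<Sum>i\<in>UNIV. - (\<integral>x. pd i (\<lambda>x. mode k x $ i) x * f x \<partial>Dm))"
    using test_fun_D[OF f] test_fun_D[OF mode_component_test_fun]
    by (intro sum.cong refl integral_by_parts_Dm) auto
  also have "\<dots> = - (\<integral>x. (\<Sum>i\<in>UNIV. pd i (\<lambda>x. mode k x $ i) x * f x) \<partial>Dm)"
    by (subst Bochner_Integration.integral_sum)
      (simp_all add: sum_negf integrable_Dm_bounded continuous_on_mult test_fun_D[OF f] test_fun_D(3)[OF mode_component_test_fun])
  also have "\<dots> = 0"
    by (simp add: sum_distrib_right[symmetric] div_mode_zero)
  finally show "inner (abs_l2per (mode k)) (abs_l2per (grad f)) = 0" .
qed

lemma laplacian_mode_component: "pd j (pd j (\<lambda>x. mode k x $ i)) x = - (4 * pi\<^sup>2 * (kvec k $ j)\<^sup>2) * mode k x $ i"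
  unfolding mode_component pd_trig by (simp add: trig_def power2_eq_square algebra_simps)

text \<open>Two integrations by parts move the derivatives from the test function to the mode. This
  is the eigenvalue equation in the weak form that \<open>weak_laplacian\<close> asks for.\<close>

lemma integral_laplacian_mode:
  assumes f: "test_fun f"
  shows "(\<integral>x. laplacian f x * mode k x $ i \<partial>Dm) = - lam k * (\<integral>x. f x * mode k x $ i \<partial>Dm)"
proof -
  let ?m = "\<lambda>x. mode k x $ i"
  note m = test_fun_D[OF mode_component_test_fun[of k i]]
  note m' = test_fun_D[OF m(5)]
  note fd = test_fun_D[OF f] and fd' = test_fun_D[OF test_fun_D(5)[OF f]]
  have step: "(\<integral>x. pd j (pd j f) x * ?m x \<partial>Dm) = - (4 * pi\<^sup>2 * (kvec k $ j)\<^sup>2) * (\<integral>x. f x * ?m x \<partial>Dm)" for j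
  proof -
    have "(\<integral>x. ?m x * pd j (pd j f) x \<partial>Dm) = - (\<integral>x. pd j ?m x * pd j f x \<partial>Dm)"
      by (intro integral_by_parts_Dm m fd fd')
    also have "\<dots> = (\<integral>x. pd j (pd j ?m) x * f x \<partial>Dm)"
      using integral_by_parts_Dm[OF m'(1-3) fd(1-3), of j j] by simp
    also have "\<dots> = (\<integral>x. - (4 * pi\<^sup>2 * (kvec k $ j)\<^sup>2) * (f x * ?m x) \<partial>Dm)"
      by (intro Bochner_Integration.integral_cong) (auto simp: laplacian_mode_component)
    finally show ?thesis by (simp add: mult.commute)
  qed
  have "(\<integral>x. laplacian f x * ?m x \<partial>Dm) = (\<integral>x. (\<Sum>j\<in>UNIV. pd j (pd j f) x * ?m x) \<partial>Dm)"
    by (simp add: laplacian_def sum_distrib_right)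
  also have "\<dots> = (\<Sum>j\<in>UNIV. \<integral>x. pd j (pd j f) x * ?m x \<partial>Dm)"
    by (intro Bochner_Integration.integral_sum integrable_Dm_bounded continuous_on_mult fd' m)
  also have "\<dots> = - lam k * (\<integral>x. f x * ?m x \<partial>Dm)"
    unfolding step sum_2 lam_def kabs_sq by (simp add: kvec_component algebra_simps)
  finally show ?thesis .
qed

section \<open>The Fourier basis\<close>

inductive trigpoly :: "(real^2 \<Rightarrow> real) \<Rightarrow> bool" where
  trig: "trigpoly (trig a b k)"
| add: "trigpoly f \<Longrightarrow> trigpoly g \<Longrightarrow> trigpoly (\<lambda>x. f x + g x)"

lemma trig_mult_trig:
  "trig a b k x * trig c d l x =
    trig ((a * c - b * d) / 2) ((a * d + b * c) / 2) (k + l) x + trig ((a * c + b * d) / 2) ((b * c - a * d) / 2) (k - l) x"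
proof -
  define s where "s = 2 * pi * (kvec k \<bullet> x)"
  define t where "t = 2 * pi * (kvec l \<bullet> x)"
  have "trig e f (k + l) x = e * (cos s * cos t - sin s * sin t) + f * (sin s * cos t + cos s * sin t)" for e f
    by (simp add: trig_def kvec_add inner_add_left distrib_left sin_add cos_add s_def t_def)
  moreover have "trig e f (k - l) x = e * (cos s * cos t + sin s * sin t) + f * (sin s * cos t - cos s * sin t)" for e f
    by (simp add: trig_def kvec_diff inner_diff_left right_diff_distrib sin_diff cos_diff s_def t_def)
  moreover have "trig a b k x = a * cos s + b * sin s" "trig c d l x = c * cos t + d * sin t"
    by (simp_all add: trig_def s_def t_def)
  ultimately show ?thesis
    by (simp only:) (simp add: field_simps)
qed

text \<open>Closure under products is what turns a polynomial in the coordinates of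
  \<open>torus_map\<close> into a trigonometric polynomial. Scalars need no rule of their own, since
  \<open>a\<close> and \<open>b\<close> absorb them.\<close>

lemma trigpoly_mult:
  assumes "trigpoly f" "trigpoly g" shows "trigpoly (\<lambda>x. f x * g x)"
  using assms
proof (induction arbitrary: g)
  case (trig a b k)
  from \<open>trigpoly g\<close> show ?case
  proof induction
    case (trig c d l)
    then show ?case unfolding trig_mult_trig by (intro trigpoly.intros)
  next
    case (add f g)
    then show ?case unfolding distrib_left by (intro trigpoly.add)
  qed
next
  case (add f h)
  then show ?case unfolding distrib_right by (intro trigpoly.add) auto
qed

text \<open>The flat torus embedded in four-dimensional space. It replaces approximation of periodic
  functions by polynomial approximation on a compact set.\<close>

definition torus_map :: "real^2 \<Rightarrow> (real \<times> real) \<times> (real \<times> real)" where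
  "torus_map x = ((cos (2 * pi * x $ 1), sin (2 * pi * x $ 1)), (cos (2 * pi * x $ 2), sin (2 * pi * x $ 2)))"

lemma continuous_on_torus_map: "continuous_on S torus_map"
  unfolding torus_map_def[abs_def] by (intro continuous_intros)

lemma trigpoly_polynomial_torus_map:
  assumes "real_polynomial_function p" shows "trigpoly (\<lambda>x. p (torus_map x))"
  using assms
proof induction
  case (linear f)
  interpret f: bounded_linear f by fact
  have eq: "f ((a, b), (c, d)) = a * f ((1,0),(0,0)) + b * f ((0,1),(0,0)) + (c * f ((0,0),(1,0)) + d * f ((0,0),(0,1)))" for a b c d
  proof -
    have "((a, b), (c, d)) = a *\<^sub>R ((1,0),(0,0)) + b *\<^sub>R ((0,1),(0,0)) + (c *\<^sub>R ((0,0),(1,0)) + d *\<^sub>R ((0,0),(0,1)))"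
      by simp
    then have "f ((a, b), (c, d)) = f (a *\<^sub>R ((1,0),(0,0)) + b *\<^sub>R ((0,1),(0,0)) + (c *\<^sub>R ((0,0),(1,0)) + d *\<^sub>R ((0,0),(0,1))))"
      by (rule arg_cong)
    then show ?thesis by (simp only: f.add f.scaleR real_scaleR_def)
  qed
  have "(\<lambda>x. f (torus_map x)) =
      (\<lambda>x. trig (f ((1,0),(0,0))) (f ((0,1),(0,0))) (1,0) x + trig (f ((0,0),(1,0))) (f ((0,0),(0,1))) (0,1) x)"
    unfolding torus_map_def
    by (intro ext, subst eq) (simp add: trig_def kvec_def inner_vec_def sum_2 mult.commute)
  then show ?case by (auto intro: trigpoly.intros)
next
  case (const c)
  have "(\<lambda>x. c) = trig c 0 0" by (auto simp: trig_def kvec_def inner_vec_def sum_2)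
  then show ?case by (auto intro: trigpoly.intros)
qed (auto intro: trigpoly.intros trigpoly_mult)

lemma torus_map_inj: "inj_on torus_map unit_square"
proof
  fix x y assume xy: "x \<in> unit_square" "y \<in> unit_square" "torus_map x = torus_map y"
  have "s = t" if "0 \<le> s" "s < 1" "0 \<le> t" "t < 1" "cos (2 * pi * s) = cos (2 * pi * t)" "sin (2 * pi * s) = sin (2 * pi * t)" for s t
  proof -
    have "\<exists>n::int. 2 * pi * s = 2 * pi * t + 2 * pi * n"
      using that(5,6) sin_cos_eq_iff[of "2 * pi * s" "2 * pi * t"] by blast
    then obtain n :: int where "2 * pi * s = 2 * pi * t + 2 * pi * n" by blast
    then have "2 * pi * s = 2 * pi * (t + n)" by (simp add: distrib_left)
    then have "s = t + n" by simp
    with that have "-1 < real_of_int n" "real_of_int n < 1" by linarith+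
    then have "n = 0" by linarith
    with \<open>s = t + n\<close> show ?thesis by simp
  qed
  with xy have "x $ 1 = y $ 1" "x $ 2 = y $ 2" by (auto simp: torus_map_def unit_square_def)
  then show "x = y" by (simp add: vec_eq_iff forall_2)
qed

text \<open>Completeness of the trigonometric system: by Stone-Weierstrass on the image of the torus in \<open>\<real>\<^sup>4\<close>, \<open>g\<close> is
  orthogonal to all continuous functions of \<open>torus_map\<close>, hence to the indicators of the lower boxes.\<close>

context
  fixes g :: "real^2 \<Rightarrow> real"
  assumes g: "integrable Dm g" and orth: "\<And>a b k. (\<integral>x. trig a b k x * g x \<partial>Dm) = 0"
begin

lemma integrable_bounded_mult:
  assumes "h \<in> borel_measurable Dm" "\<And>x. x \<in> unit_square \<Longrightarrow> \<bar>h x\<bar> \<le> B"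
  shows "integrable Dm (\<lambda>x. h x * g x)"
proof (rule Bochner_Integration.integrable_bound)
  show "integrable Dm (\<lambda>x. B * g x)" using g by simp
  show "(\<lambda>x. h x * g x) \<in> borel_measurable Dm"
    using assms(1) borel_measurable_integrable[OF g] by (rule borel_measurable_times)
  show "AE x in Dm. norm (h x * g x) \<le> norm (B * g x)"
  proof (rule AE_I2)
    fix x assume "x \<in> space Dm"
    then have "\<bar>h x\<bar> \<le> \<bar>B\<bar>" using assms(2)[of x] by (simp add: space_Dm)
    then show "norm (h x * g x) \<le> norm (B * g x)" by (simp add: abs_mult mult_right_mono)
  qed
qed

lemma integrable_continuous_mult:
  assumes "continuous_on UNIV h" shows "integrable Dm (\<lambda>x. h x * g x)"
proof -
  have "bounded (h ` cbox 0 1)"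
    by (intro compact_imp_bounded compact_continuous_image continuous_on_subset[OF assms]) auto
  then obtain B where "\<And>x. x \<in> cbox 0 1 \<Longrightarrow> \<bar>h x\<bar> \<le> B" unfolding bounded_iff by auto
  then show ?thesis using unit_square_subset_cbox
    by (intro integrable_bounded_mult[of _ B] borel_measurable_integrable[OF integrable_Dm_bounded[OF assms]]) auto
qed

lemma orth_trigpoly: "trigpoly h \<Longrightarrow> continuous_on UNIV h \<and> (\<integral>x. h x * g x \<partial>Dm) = 0"
proof (induction rule: trigpoly.induct)
  case (add f h)
  then show ?case
    by (simp add: distrib_right integrable_continuous_mult continuous_on_add)
qed (simp_all add: continuous_on_trig orth)

lemma orth_continuous:
  fixes F :: "(real \<times> real) \<times> (real \<times> real) \<Rightarrow> real"
  assumes F: "continuous_on UNIV F"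
  shows "(\<integral>x. F (torus_map x) * g x \<partial>Dm) = 0"
proof -
  have FT: "continuous_on UNIV (\<lambda>x. F (torus_map x))"
    by (rule continuous_on_compose2[OF F continuous_on_torus_map]) auto
  have bd: "\<bar>\<integral>x. F (torus_map x) * g x \<partial>Dm\<bar> \<le> e * (\<integral>x. \<bar>g x\<bar> \<partial>Dm)" if e: "e > 0" for e
  proof -
    have "compact (torus_map ` cbox 0 1)"
      by (intro compact_continuous_image continuous_on_torus_map compact_cbox)
    then obtain p where p: "real_polynomial_function p"
      and p': "\<And>z. z \<in> torus_map ` cbox 0 1 \<Longrightarrow> \<bar>F z - p z\<bar> < e"
      by (rule Stone_Weierstrass_real_polynomial_function[OF _ continuous_on_subset[OF F subset_UNIV] e]) blast
    note op = orth_trigpoly[OF trigpoly_polynomial_torus_map[OF p]]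
    have "(\<integral>x. F (torus_map x) * g x \<partial>Dm) = (\<integral>x. F (torus_map x) * g x \<partial>Dm) - (\<integral>x. p (torus_map x) * g x \<partial>Dm)"
      using op by simp
    also have "\<dots> = (\<integral>x. (F (torus_map x) - p (torus_map x)) * g x \<partial>Dm)"
      using op by (subst Bochner_Integration.integral_diff[symmetric])
        (auto simp: left_diff_distrib intro!: integrable_continuous_mult FT)
    also have "\<bar>\<dots>\<bar> \<le> (\<integral>x. e * \<bar>g x\<bar> \<partial>Dm)"
    proof (rule order_trans[OF integral_abs_bound integral_mono])
      show "integrable Dm (\<lambda>x. \<bar>(F (torus_map x) - p (torus_map x)) * g x\<bar>)"
        using op by (intro integrable_abs integrable_continuous_mult continuous_on_diff FT) auto
      fix x assume "x \<in> space Dm"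
      then have "x \<in> cbox 0 1" using unit_square_subset_cbox by (auto simp: space_Dm)
      from p'[OF imageI[OF this]] show "\<bar>(F (torus_map x) - p (torus_map x)) * g x\<bar> \<le> e * \<bar>g x\<bar>"
        by (auto simp: abs_mult intro!: mult_right_mono)
    qed (use g in auto)
    finally show ?thesis by simp
  qed
  have "\<bar>\<integral>x. F (torus_map x) * g x \<partial>Dm\<bar> \<le> 0"
  proof (rule field_le_epsilon)
    fix e :: real assume "e > 0"
    define G where "G = (\<integral>x. \<bar>g x\<bar> \<partial>Dm)"
    have "G \<ge> 0" by (simp add: G_def)
    have "e / (G + 1) * G \<le> e" using \<open>G \<ge> 0\<close> \<open>e > 0\<close> by (simp add: field_simps)
    then show "\<bar>\<integral>x. F (torus_map x) * g x \<partial>Dm\<bar> \<le> 0 + e"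
      using bd[of "e / (G + 1)"] \<open>G \<ge> 0\<close> \<open>e > 0\<close> unfolding G_def[symmetric] by auto
  qed
  then show ?thesis by simp
qed

lemma orth_dct:
  assumes lim: "\<And>x. x \<in> unit_square \<Longrightarrow> (\<lambda>n. h n x) \<longlonglongrightarrow> h' x"
    and bd: "\<And>n x. x \<in> unit_square \<Longrightarrow> \<bar>h n x\<bar> \<le> B"
    and m: "\<And>n. h n \<in> borel_measurable Dm" and h': "h' \<in> borel_measurable Dm"
    and z: "\<And>n. (\<integral>x. h n x * g x \<partial>Dm) = 0"
  shows "(\<integral>x. h' x * g x \<partial>Dm) = (0::real)"
proof -
  have "(\<lambda>n. \<integral>x. h n x * g x \<partial>Dm) \<longlonglongrightarrow> (\<integral>x. h' x * g x \<partial>Dm)"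
  proof (rule integral_dominated_convergence[where w = "\<lambda>x. B * \<bar>g x\<bar>"])
    show "AE x in Dm. (\<lambda>n. h n x * g x) \<longlonglongrightarrow> h' x * g x"
      using lim by (intro AE_I2 tendsto_intros) (auto simp: space_Dm)
    show "AE x in Dm. norm (h n x * g x) \<le> B * \<bar>g x\<bar>" for n
      using bd by (intro AE_I2) (auto simp: abs_mult space_Dm intro!: mult_right_mono)
  qed (use g m h' borel_measurable_integrable[OF g] in auto)
  then show ?thesis by (simp add: z LIMSEQ_const_iff)
qed

lemma Dm_measurable_borel: "f \<in> borel_measurable borel \<Longrightarrow> f \<in> borel_measurable Dm"
  unfolding Dm_def by (intro measurable_restrict_space1) simp

text \<open>The bound \<open>c $ i < 1\<close> keeps \<open>cbox 0 c\<close> inside the half-open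
  square, where \<open>torus_map\<close> is injective. Membership in the box is then decided by the
  distance of \<open>torus_map x\<close> to the closed set \<open>C\<close>, so the indicator is a
  bounded pointwise limit of continuous functions of \<open>torus_map\<close>.\<close>

lemma orth_box:
  assumes c: "\<And>i. c $ i < 1"
  shows "(\<integral>x. indicator {..c} x * g x \<partial>Dm) = 0"
proof (cases "\<forall>i. 0 \<le> c $ i")
  case False
  then have "indicator {..c} x = (0::real)" if "x \<in> unit_square" for x
    using that by (auto simp: indicator_def less_eq_vec_def unit_square_def) (metis order_trans)
  then have "(\<integral>x. indicator {..c} x * g x \<partial>Dm) = (\<integral>x. 0 \<partial>Dm)"
    by (intro Bochner_Integration.integral_cong) (auto simp: space_Dm)
  then show ?thesis by simp
next
  case True
  define C where "C = torus_map ` cbox 0 c"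
  have sub: "cbox 0 c \<subseteq> unit_square" using c by (auto simp: unit_square_def mem_box_cart) (meson c le_less_trans)
  have "compact C" unfolding C_def by (intro compact_continuous_image continuous_on_torus_map compact_cbox)
  moreover have "0 \<in> cbox 0 c" using True by (simp add: mem_box_cart)
  ultimately have C: "closed C" "C \<noteq> {}" unfolding C_def by (auto dest: compact_imp_closed)
  have inC: "torus_map x \<in> C \<longleftrightarrow> x \<in> {..c}" if "x \<in> unit_square" for x
  proof -
    have "torus_map x \<in> C \<longleftrightarrow> x \<in> cbox 0 c"
      unfolding C_def using inj_on_image_mem_iff[OF torus_map_inj that sub] .
    also have "\<dots> \<longleftrightarrow> x \<in> {..c}" using that by (auto simp: mem_box_cart unit_square_def less_eq_vec_def)
    finally show ?thesis .
  qed
  define F where "F n p = max 0 (1 - real n * infdist p C)" for n p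
  have Fc: "continuous_on UNIV (F n)" for n
    unfolding F_def by (intro continuous_intros)
  show ?thesis
  proof (rule orth_dct[where h = "\<lambda>n x. F n (torus_map x)" and B = 1])
    fix x assume x: "x \<in> unit_square"
    show "(\<lambda>n. F n (torus_map x)) \<longlonglongrightarrow> indicator {..c} x"
    proof (cases "torus_map x \<in> C")
      case True
      then show ?thesis using inC[OF x] by (simp add: F_def)
    next
      case False
      then have d: "infdist (torus_map x) C > 0"
        using C in_closed_iff_infdist_zero[OF C] infdist_nonneg[of "torus_map x" C] by (simp add: less_le)
      obtain m :: nat where m: "real m * infdist (torus_map x) C > 1"
        using reals_Archimedean3[OF d] by blast
      have "eventually (\<lambda>n. F n (torus_map x) = 0) sequentially"
        unfolding eventually_sequentially
      proof (intro exI[of _ m] allI impI)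
        fix n assume "n \<ge> m"
        then have "real m * infdist (torus_map x) C \<le> real n * infdist (torus_map x) C"
          using d by (intro mult_right_mono) auto
        then show "F n (torus_map x) = 0" using m by (simp add: F_def)
      qed
      then show ?thesis using inC[OF x] False by (simp add: tendsto_eventually)
    qed
    show "\<bar>F n (torus_map x)\<bar> \<le> 1" for n by (auto simp: F_def infdist_nonneg)
  next
    show "(\<lambda>x. F n (torus_map x)) \<in> borel_measurable Dm" for n
      by (intro Dm_measurable_borel borel_measurable_continuous_onI continuous_on_compose2[OF Fc continuous_on_torus_map]) auto
    show "indicator {..c} \<in> borel_measurable Dm" by (intro Dm_measurable_borel) simp
    show "(\<integral>x. F n (torus_map x) * g x \<partial>Dm) = 0" for n by (rule orth_continuous[OF Fc])
  qed
qed

text \<open>The corner is lowered below 1 in each coordinate and raised again. Every point of the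
  half-open square has coordinates strictly below 1, so at each point the indicators are eventually
  constant and dominated convergence applies.\<close>

lemma orth_atMost: "(\<integral>x. indicator {..c} x * g x \<partial>Dm) = 0"
proof (rule orth_dct[where h = "\<lambda>n. indicator {..(\<chi> i. min (c $ i) (1 - 1 / real (n + 1)))}" and B = 1])
  fix x assume x: "x \<in> unit_square"
  have "\<forall>\<^sub>F n in sequentially. (\<forall>i. x $ i \<le> 1 - 1 / real (n + 1))"
  proof -
    have "\<forall>\<^sub>F n in sequentially. x $ i \<le> 1 - 1 / real (n + 1)" for i
    proof -
      have "(\<lambda>n. 1 - inverse (real (Suc n))) \<longlonglongrightarrow> 1 - 0"
        by (intro tendsto_intros LIMSEQ_inverse_real_of_nat)
      moreover have "x $ i < 1 - 0" using x by (simp add: unit_square_def)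
      ultimately have "\<forall>\<^sub>F n in sequentially. x $ i < 1 - inverse (real (Suc n))" by (rule order_tendstoD)
      then show ?thesis by eventually_elim (simp add: inverse_eq_divide)
    qed
    then show ?thesis by (simp add: eventually_all_finite)
  qed
  then have "\<forall>\<^sub>F n in sequentially. indicator {..(\<chi> i. min (c $ i) (1 - 1 / real (n + 1)))} x = (indicator {..c} x :: real)"
    by eventually_elim (auto simp: indicator_def less_eq_vec_def)
  then show "(\<lambda>n. indicator {..(\<chi> i. min (c $ i) (1 - 1 / real (n + 1)))} x :: real) \<longlonglongrightarrow> indicator {..c} x"
    by (rule tendsto_eventually)
next
  show "(\<integral>x. indicator {..(\<chi> i. min (c $ i) (1 - 1 / real (n + 1)))} x * g x \<partial>Dm) = 0" for n
    by (rule orth_box) (auto simp: min_less_iff_disj)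
qed (auto intro!: Dm_measurable_borel simp: indicator_def)

text \<open>Dynkin's argument: the sets \<open>{..a}\<close> generate the Borel sets and are stable
  under intersection. Complements are handled by the mean of \<open>g\<close>, which vanishes
  because \<open>trig 1 0 0\<close> is the constant 1.\<close>

lemma orth_borel:
  assumes "A \<in> sets borel" shows "(\<integral>x. indicator A x * g x \<partial>Dm) = 0"
proof -
  have "Int_stable (range (\<lambda>a. {..a::real^2}))" 
  proof (rule Int_stableI_image)
    show "\<exists>k\<in>UNIV. {..a} \<inter> {..b} = {..k}" for a b :: "real^2"
      by (intro bexI[of _ "inf a b"]) auto
  qed
  moreover have "range (\<lambda>a. {..a::real^2}) \<subseteq> Pow UNIV" by simp
  moreover have "A \<in> sigma_sets UNIV (range (\<lambda>a. {..a::real^2}))"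
    using assms by (simp add: borel_eq_atMost sets_measure_of)
  ultimately show ?thesis
  proof (induction rule: sigma_sets_induct_disjoint)
    case (basic A)
    then show ?case using orth_atMost by auto
  next
    case empty
    then show ?case by simp
  next
    case (compl A)
    have Ab: "A \<in> sets borel" using compl(1) by (simp add: borel_eq_atMost sets_measure_of)
    have "(\<integral>x. trig 1 0 0 x * g x \<partial>Dm) = 0" by (rule orth)
    then have g0: "(\<integral>x. g x \<partial>Dm) = 0" by (simp add: trig_def kvec_def inner_vec_def sum_2)
    have "(\<integral>x. indicator (UNIV - A) x * g x \<partial>Dm) = (\<integral>x. g x - indicator A x * g x \<partial>Dm)"
      by (intro Bochner_Integration.integral_cong) (auto simp: indicator_def)
    also have "\<dots> = (\<integral>x. g x \<partial>Dm) - (\<integral>x. indicator A x * g x \<partial>Dm)"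
      using Ab by (intro Bochner_Integration.integral_diff g integrable_bounded_mult[of _ 1] Dm_measurable_borel)
        (auto simp: indicator_def)
    also have "\<dots> = 0" by (simp add: g0 compl(2))
    finally show ?case .
  next
    case (union A)
    have Ab: "A i \<in> sets borel" for i using union(2) by (auto simp: borel_eq_atMost sets_measure_of)
    define P where "P n = (\<Union>i<n. A i)" for n
    have Pb: "P n \<in> sets borel" for n using Ab unfolding P_def by auto
    have z: "(\<integral>x. indicator (P n) x * g x \<partial>Dm) = 0" for n
    proof (induction n)
      case (Suc n)
      have "A i \<inter> A n = {}" if "i < n" for i
        using union(1) that unfolding disjoint_family_on_def by simp
      then have "P n \<inter> A n = {}" unfolding P_def by blast
      moreover have "P (Suc n) = P n \<union> A n" unfolding P_def by (auto simp: lessThan_Suc)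
      ultimately have "(\<integral>x. indicator (P (Suc n)) x * g x \<partial>Dm) = (\<integral>x. indicator (P n) x * g x + indicator (A n) x * g x \<partial>Dm)"
        by (intro Bochner_Integration.integral_cong) (auto simp: indicator_def)
      also have "\<dots> = (\<integral>x. indicator (P n) x * g x \<partial>Dm) + (\<integral>x. indicator (A n) x * g x \<partial>Dm)"
        using Ab Pb by (intro Bochner_Integration.integral_add integrable_bounded_mult[of _ 1] Dm_measurable_borel)
          (auto simp: indicator_def)
      also have "\<dots> = 0" by (simp add: Suc union(3))
      finally show ?case .
    qed (simp add: P_def)
    show ?case
    proof (rule orth_dct[where h = "\<lambda>n. indicator (P n)" and B = 1])
      fix x :: "real^2"
      show "(\<lambda>n. indicator (P n) x :: real) \<longlonglongrightarrow> indicator (\<Union>i. A i) x"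
        unfolding P_def by (rule LIMSEQ_indicator_UN)
    qed (use Ab Pb z in \<open>auto intro!: Dm_measurable_borel simp: indicator_def\<close>)
  qed
qed

lemma AE_zero_of_orthogonal_trig: "AE x in Dm. g x = 0"
proof (rule density_unique_real[OF g])
  fix A assume "A \<in> sets Dm"
  then have "A \<in> sets borel" by (auto simp: Dm_def sets_restrict_space)
  from orth_borel[OF this] show "(\<integral>x\<in>A. g x \<partial>Dm) = (\<integral>x\<in>A. 0 \<partial>Dm)"
    by (simp add: set_lebesgue_integral_def)
qed simp

end


section \<open>The modes as an orthonormal basis of the solenoidal space\<close>

lemma l2_of_phi: "k \<in> kk \<Longrightarrow> l2_of (phi k) = abs_l2per (mode k)"
  unfolding phi_def by (rule Abs_hspace_inverse) (simp add: mean_zero_mode div_free_mode)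

lemma inner_l2_of: "inner (l2_of u) (l2_of v) = inner u v" and norm_l2_of: "norm (l2_of u) = norm u"
  by (simp_all add: inner_hspace.rep_eq norm_hspace.rep_eq)

lemma inner_phi_integral: "k \<in> kk \<Longrightarrow> inner u (phi k) = (\<integral>x. rep_l2per (l2_of u) x \<bullet> mode k x \<partial>Dm)"
  by (simp add: inner_l2_of[symmetric] l2_of_phi inner_abs_right sq_int_mode)

lemma inner_phi: "k \<in> kk \<Longrightarrow> l \<in> kk \<Longrightarrow> inner (phi k) (phi l) = (if k = l then 1 else 0)"
  by (simp add: inner_l2_of[symmetric] l2_of_phi inner_abs_l2per sq_int_mode integral_mode_inner)

lemma upper_uminus: "k \<in> kk \<Longrightarrow> upper (- k) \<longleftrightarrow> \<not> upper k" and uminus_in_kk: "k \<in> kk \<Longrightarrow> - k \<in> kk"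
  by (auto simp: upper_def kk_iff prod_eq_iff)

lemma kvec_uminus: "kvec (- k) = - kvec k" and kperp_uminus: "kperp (- k) = - kperp k"
  by (simp_all add: vec_eq_iff forall_2 kvec_component kperp_component)

lemma component_integrable:
  assumes "sq_int f" shows "integrable Dm (\<lambda>x. f x $ i)"
proof (rule Bochner_Integration.integrable_bound)
  show "integrable Dm f" by (rule norm_L1_le(1)[OF assms, of 1]) simp
  have "(\<lambda>v::real^2. v $ i) \<in> borel_measurable borel"
    by (rule borel_measurable_continuous_onI[OF linear_continuous_on[OF bounded_linear_vec_nth]])
  from measurable_compose[OF borel_measurable_integrable[OF \<open>integrable Dm f\<close>] this]
  show "(\<lambda>x. f x $ i) \<in> borel_measurable Dm" .
  show "AE x in Dm. norm (f x $ i) \<le> norm (f x)" by (simp add: component_le_norm_cart)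
qed

lemma vec_decompose:
  assumes "k \<in> kk"
  shows "(w::real^2) $ i = (kvec k $ i / (kabs k)\<^sup>2) * (kvec k \<bullet> w) + (kperp k $ i / (kabs k)\<^sup>2) * (kperp k \<bullet> w)"
proof -
  have "(kabs k)\<^sup>2 * w $ i = kvec k $ i * (kvec k \<bullet> w) + kperp k $ i * (kperp k \<bullet> w)"
    unfolding kabs_sq using exhaust_2[of i]
    by (auto simp: inner_vec_def sum_2 kvec_component kperp_component power2_eq_square algebra_simps)
  then have "w $ i = (kvec k $ i * (kvec k \<bullet> w) + kperp k $ i * (kperp k \<bullet> w)) / (kabs k)\<^sup>2"
    using kabs_pos[OF assms] by (simp add: eq_divide_eq mult.commute)
  then show ?thesis by (simp add: add_divide_distrib)
qed

lemma grad_trig: "grad (trig a b k) x = trig (2 * pi * b) (- (2 * pi * a)) k x *\<^sub>R kvec k"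
  by (simp add: grad_def pd_trig vec_eq_iff trig_def algebra_simps)

text \<open>The three conditions on \<open>u\<close> exhaust its Fourier coefficients: vanishing
  divergence kills the part along \<open>kvec k\<close>, orthogonality to the modes kills the part
  along \<open>kperp k\<close>, and the zero mean kills frequency 0. Both components are then
  orthogonal to all trigonometric functions.\<close>

lemma phi_complete:
  assumes orth: "\<And>k. k \<in> kk \<Longrightarrow> inner u (phi k) = 0"
  shows "u = 0"
proof -
  define f where "f = rep_l2per (l2_of u)"
  have f: "sq_int f" "abs_l2per f = l2_of u" by (simp_all add: f_def rep_l2per)
  have fi: "integrable Dm f" by (rule norm_L1_le(1)[OF f(1), of 1]) simp
  have mz: "mean_zero (l2_of u)" and df: "div_free (l2_of u)" using l2_of[of u] by auto
  have ci: "integrable Dm (\<lambda>x. trig a b k x * (w \<bullet> f x))" for a b k w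
  proof -
    have "sq_int (\<lambda>x. trig a b k x *\<^sub>R w)"
      by (intro sq_int_continuous continuous_intros continuous_on_trig)
    from sq_int_inner[OF this f(1)] show ?thesis by simp
  qed
  \<comment> \<open>The test function is chosen so that its gradient is \<open>trig a b k\<close>
    times \<open>kvec k\<close>.\<close>
  have par: "(\<integral>x. trig a b k x * (kvec k \<bullet> f x) \<partial>Dm) = 0" for a b k
  proof -
    have "(\<integral>x. f x \<bullet> grad (trig (- b / (2 * pi)) (a / (2 * pi)) k) x \<partial>Dm) = 0"
      using df unfolding div_free_def f_def by (blast intro: test_fun_trig)
    then show ?thesis by (simp add: grad_trig inner_commute)
  qed
  have mo: "(\<integral>x. tmode k x * (kperp k \<bullet> f x) \<partial>Dm) = 0" if k: "k \<in> kk" for k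
  proof -
    have "0 = (\<integral>x. (sqrt 2 / kabs k) * (tmode k x * (kperp k \<bullet> f x)) \<partial>Dm)"
      using orth[OF k] by (simp add: inner_phi_integral[OF k] f_def mode_tmode inner_commute mult.assoc del: integral_divide_zero)
    also have "\<dots> = (sqrt 2 / kabs k) * (\<integral>x. tmode k x * (kperp k \<bullet> f x) \<partial>Dm)" by (rule integral_mult_right_zero)
    finally show ?thesis using kabs_pos[OF k] by simp
  qed
  \<comment> \<open>The mode at \<open>k\<close> supplies only one of the two phases, cosine or
    sine. The other one comes from the mode at \<open>- k\<close>, which lies in the opposite half
    of the lattice.\<close>
  have perp: "(\<integral>x. trig a b k x * (kperp k \<bullet> f x) \<partial>Dm) = 0" if k: "k \<in> kk" for a b k
  proof -
    have "trig 1 0 k = tmode k \<and> trig 0 1 k = (\<lambda>x. - tmode (- k) x) \<or>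
          trig 1 0 k = tmode (- k) \<and> trig 0 1 k = tmode k"
      using upper_uminus[OF k] by (auto simp: tmode_def trig_def kvec_uminus)
    then have "(\<integral>x. trig 1 0 k x * (kperp k \<bullet> f x) \<partial>Dm) = 0" "(\<integral>x. trig 0 1 k x * (kperp k \<bullet> f x) \<partial>Dm) = 0"
      using mo[OF k] mo[OF uminus_in_kk[OF k]] by (auto simp: kperp_uminus)
    then have "a * (\<integral>x. trig 1 0 k x * (kperp k \<bullet> f x) \<partial>Dm) + b * (\<integral>x. trig 0 1 k x * (kperp k \<bullet> f x) \<partial>Dm) = 0" by simp
    also have "a * (\<integral>x. trig 1 0 k x * (kperp k \<bullet> f x) \<partial>Dm) + b * (\<integral>x. trig 0 1 k x * (kperp k \<bullet> f x) \<partial>Dm)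
        = (\<integral>x. a * (trig 1 0 k x * (kperp k \<bullet> f x)) + b * (trig 0 1 k x * (kperp k \<bullet> f x)) \<partial>Dm)"
      by (simp add: ci)
    also have "\<dots> = (\<integral>x. trig a b k x * (kperp k \<bullet> f x) \<partial>Dm)"
      by (intro Bochner_Integration.integral_cong) (auto simp: trig_def algebra_simps)
    finally show ?thesis .
  qed
  have all: "(\<integral>x. trig a b k x * f x $ i \<partial>Dm) = 0" for a b k i
  proof (cases "k = 0")
    case True
    have "(\<integral>x. f x \<partial>Dm) = 0" using mz by (simp add: mean_zero_def f_def)
    then have "(\<integral>x. f x \<partial>Dm) $ i = 0" by simp
    then have "(\<integral>x. f x $ i \<partial>Dm) = 0"
      using integral_bounded_linear[OF bounded_linear_vec_nth fi, of i] by simp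
    then show ?thesis by (simp add: True trig_def kvec_def inner_vec_def sum_2)
  next
    case False
    then have k: "k \<in> kk" by (simp add: kk_iff)
    have "(\<integral>x. trig a b k x * f x $ i \<partial>Dm) =
        (\<integral>x. (kvec k $ i / (kabs k)\<^sup>2) * (trig a b k x * (kvec k \<bullet> f x)) + (kperp k $ i / (kabs k)\<^sup>2) * (trig a b k x * (kperp k \<bullet> f x)) \<partial>Dm)"
      by (subst vec_decompose[OF k]) (simp add: algebra_simps)
    also have "\<dots> = 0" using par perp[OF k] by (simp add: ci)
    finally show ?thesis .
  qed
  have "AE x in Dm. f x $ i = 0" for i
    by (intro AE_zero_of_orthogonal_trig component_integrable f all)
  then have "AE x in Dm. f x = 0" by (auto simp: vec_eq_iff forall_2 elim: eventually_elim2)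
  then have "ae_eq f (\<lambda>x. 0)" using f(1) sq_int_zero by (simp add: ae_eq_def)
  then have "l2_of u = 0"
    using Quotient_rel_abs[OF Quotient_l2per] by (simp add: f(2)[symmetric] zero_l2per_def)
  then show ?thesis by (metis l2_of_inject zero_hspace.rep_eq)
qed

lemma hspace_eqI:
  assumes "\<And>k. k \<in> kk \<Longrightarrow> inner u (phi k) = inner v (phi k)" shows "u = v"
  using phi_complete[of "u - v"] assms by (simp add: inner_diff_left)

section \<open>Fourier series summed over discs of wavevectors\<close>

definition kball :: "nat \<Rightarrow> (int \<times> int) set" where
  "kball n = {k\<in>kk. kabs k \<le> real n}"

lemma kball_subset: "kball n \<subseteq> kk" by (auto simp: kball_def)

lemma kabs_components: "\<bar>real_of_int (fst k)\<bar> \<le> kabs k" "\<bar>real_of_int (snd k)\<bar> \<le> kabs k"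
  unfolding kabs_def by (auto intro!: real_le_rsqrt)

lemma finite_kball: "finite (kball n)"
proof (rule finite_subset)
  show "kball n \<subseteq> {- int n..int n} \<times> {- int n..int n}"
  proof
    fix k assume "k \<in> kball n"
    then have "\<bar>real_of_int (fst k)\<bar> \<le> real n" "\<bar>real_of_int (snd k)\<bar> \<le> real n"
      using kabs_components[of k] by (auto simp: kball_def)
    then have "\<bar>fst k\<bar> \<le> int n" "\<bar>snd k\<bar> \<le> int n" by linarith+
    then show "k \<in> {- int n..int n} \<times> {- int n..int n}" by (auto simp: mem_Times_iff)
  qed
qed simp

lemma kball_mono: "m \<le> n \<Longrightarrow> kball m \<subseteq> kball n"
  by (auto simp: kball_def)

text \<open>Unordered sums over \<open>kk\<close> thereby become limits of sequences of partial
  sums. The discs are also the index sets of the Galerkin projections, so the partial sums of the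
  series of \<open>u\<close> are exactly the \<open>PN n u\<close>.\<close>

lemma filterlim_kball: "filterlim kball (finite_subsets_at_top kk) sequentially"
  unfolding filterlim_finite_subsets_at_top
proof (intro allI impI)
  fix X assume X: "finite X \<and> X \<subseteq> kk"
  obtain n :: nat where n: "\<And>k. k \<in> X \<Longrightarrow> kabs k \<le> real n"
  proof -
    obtain n where "Max (insert 0 (kabs ` X)) \<le> real n" using real_arch_simple by blast
    then show ?thesis using X that[of n] by (simp add: Max_le_iff)
  qed
  have "X \<subseteq> kball m" if "m \<ge> n" for m
  proof
    fix k assume k: "k \<in> X"
    have "kabs k \<le> real m" using n[OF k] that by linarith
    then show "k \<in> kball m" using k X by (auto simp: kball_def)
  qed
  then show "\<forall>\<^sub>F y in sequentially. finite (kball y) \<and> X \<subseteq> kball y \<and> kball y \<subseteq> kk"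
    using finite_kball kball_subset by (auto simp: eventually_sequentially)
qed

lemma has_sum_kball: "(f has_sum s) kk \<Longrightarrow> (\<lambda>n. \<Sum>k\<in>kball n. f k) \<longlonglongrightarrow> s"
  unfolding has_sum_def by (rule filterlim_compose[OF _ filterlim_kball])

lemma inner_sum_phi:
  assumes "finite F" "F \<subseteq> kk" "l \<in> kk"
  shows "inner (\<Sum>k\<in>F. c k *\<^sub>R phi k) (phi l) = (if l \<in> F then c l else 0)"
proof -
  have "inner (\<Sum>k\<in>F. c k *\<^sub>R phi k) (phi l) = (\<Sum>k\<in>F. if k = l then c k else 0)"
    unfolding inner_sum_left using assms by (intro sum.cong) (auto simp: inner_phi subset_eq)
  then show ?thesis using assms(1) by simp
qed

lemma norm_sum_phi:
  assumes "finite F" "F \<subseteq> kk"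
  shows "(norm (\<Sum>k\<in>F. c k *\<^sub>R phi k))\<^sup>2 = (\<Sum>k\<in>F. (c k)\<^sup>2)"
proof -
  have "(norm (\<Sum>k\<in>F. c k *\<^sub>R phi k))\<^sup>2 = (\<Sum>l\<in>F. c l * inner (\<Sum>k\<in>F. c k *\<^sub>R phi k) (phi l))"
    unfolding power2_norm_eq_inner by (subst inner_sum_right) simp
  also have "\<dots> = (\<Sum>l\<in>F. (c l)\<^sup>2)"
    using assms by (intro sum.cong) (auto simp: inner_sum_phi subset_eq power2_eq_square)
  finally show ?thesis .
qed

lemma bessel:
  assumes "finite F" "F \<subseteq> kk"
  shows "(\<Sum>k\<in>F. (inner u (phi k))\<^sup>2) \<le> (norm u)\<^sup>2"
proof -
  define s where "s = (\<Sum>k\<in>F. inner u (phi k) *\<^sub>R phi k)"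
  have "inner u s = (\<Sum>k\<in>F. (inner u (phi k))\<^sup>2)"
    by (simp add: s_def inner_sum_right power2_eq_square)
  moreover have "(norm s)\<^sup>2 = (\<Sum>k\<in>F. (inner u (phi k))\<^sup>2)"
    unfolding s_def by (rule norm_sum_phi[OF assms])
  moreover have "0 \<le> (norm (u - s))\<^sup>2" by simp
  moreover have "(norm (u - s))\<^sup>2 = (norm u)\<^sup>2 - 2 * inner u s + (norm s)\<^sup>2"
    by (simp add: power2_norm_eq_inner inner_diff_left inner_diff_right inner_commute)
  ultimately show ?thesis by linarith
qed

lemma coefficients_summable: "(\<lambda>k. (inner u (phi k))\<^sup>2) summable_on kk"
  by (rule nonneg_bdd_above_summable_on) (auto intro!: bdd_aboveI2[of _ _ "(norm u)\<^sup>2"] bessel)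

lemma summable_kball_Cauchy:
  fixes c :: "int \<times> int \<Rightarrow> real"
  assumes "(\<lambda>k. (c k)\<^sup>2) summable_on kk"
  shows "Cauchy (\<lambda>n. \<Sum>k\<in>kball n. c k *\<^sub>R phi k)"
proof (rule metric_CauchyI)
  fix e :: real assume e: "e > 0"
  have "(\<lambda>n. \<Sum>k\<in>kball n. (c k)\<^sup>2) \<longlonglongrightarrow> infsum (\<lambda>k. (c k)\<^sup>2) kk"
    by (intro has_sum_kball has_sum_infsum assms)
  then have "Cauchy (\<lambda>n. \<Sum>k\<in>kball n. (c k)\<^sup>2)" by (rule LIMSEQ_imp_Cauchy)
  then obtain M where M: "\<And>m n. m \<ge> M \<Longrightarrow> n \<ge> M \<Longrightarrow> \<bar>(\<Sum>k\<in>kball m. (c k)\<^sup>2) - (\<Sum>k\<in>kball n. (c k)\<^sup>2)\<bar> < e\<^sup>2"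
    using e unfolding Cauchy_def dist_real_def by (metis zero_less_power)
  have key: "norm ((\<Sum>k\<in>kball n. c k *\<^sub>R phi k) - (\<Sum>k\<in>kball m. c k *\<^sub>R phi k)) < e" if "M \<le> m" "m \<le> n" for m n
  proof -
    have d: "(\<Sum>k\<in>kball n. h k) - (\<Sum>k\<in>kball m. h k) = (\<Sum>k\<in>kball n - kball m. h k)" for h :: "_ \<Rightarrow> 'a::ab_group_add"
      using sum_diff[OF finite_kball kball_mono[OF that(2)], of h] by simp
    have "(norm ((\<Sum>k\<in>kball n. c k *\<^sub>R phi k) - (\<Sum>k\<in>kball m. c k *\<^sub>R phi k)))\<^sup>2 = (\<Sum>k\<in>kball n - kball m. (c k)\<^sup>2)"
      unfolding d by (rule norm_sum_phi) (use finite_kball kball_subset in auto)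
    also have "\<dots> < e\<^sup>2" using M[of n m] that d[of "\<lambda>k. (c k)\<^sup>2"] by simp
    finally show ?thesis using e by (simp add: power2_less_imp_less)
  qed
  then have "dist (\<Sum>k\<in>kball m. c k *\<^sub>R phi k) (\<Sum>k\<in>kball n. c k *\<^sub>R phi k) < e" if "M \<le> m" "M \<le> n" for m n
    using that key[of m n] key[of n m]
    by (cases "m \<le> n") (simp_all add: dist_norm norm_minus_commute)
  then show "\<exists>M. \<forall>m\<ge>M. \<forall>n\<ge>M. dist (\<Sum>k\<in>kball m. c k *\<^sub>R phi k) (\<Sum>k\<in>kball n. c k *\<^sub>R phi k) < e" by blast
qed

text \<open>Riesz-Fischer synthesis, inverse to taking coefficients. It is meaningful for square
  summable \<open>c\<close>; for other families \<open>lim\<close> returns an unspecified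
  value.\<close>

definition four :: "(int \<times> int \<Rightarrow> real) \<Rightarrow> hspace" where
  "four c = lim (\<lambda>n. \<Sum>k\<in>kball n. c k *\<^sub>R phi k)"

lemma four_LIMSEQ:
  assumes "(\<lambda>k. (c k)\<^sup>2) summable_on kk"
  shows "(\<lambda>n. \<Sum>k\<in>kball n. c k *\<^sub>R phi k) \<longlonglongrightarrow> four c"
  unfolding four_def using summable_kball_Cauchy[OF assms]
  by (simp add: Cauchy_convergent_iff convergent_LIMSEQ_iff)

lemma inner_four:
  assumes "(\<lambda>k. (c k)\<^sup>2) summable_on kk" "l \<in> kk"
  shows "inner (four c) (phi l) = c l"
proof -
  have "(\<lambda>n. inner (\<Sum>k\<in>kball n. c k *\<^sub>R phi k) (phi l)) \<longlonglongrightarrow> inner (four c) (phi l)"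
    by (intro tendsto_intros four_LIMSEQ assms)
  moreover obtain N :: nat where N: "kabs l \<le> real N" using real_arch_simple by blast
  have "\<forall>\<^sub>F n in sequentially. inner (\<Sum>k\<in>kball n. c k *\<^sub>R phi k) (phi l) = c l"
    unfolding eventually_sequentially
  proof (intro exI[of _ N] allI impI)
    fix n assume "n \<ge> N"
    then have "l \<in> kball n" using N assms(2) by (simp add: kball_def)
    then show "inner (\<Sum>k\<in>kball n. c k *\<^sub>R phi k) (phi l) = c l"
      by (simp add: inner_sum_phi finite_kball kball_subset assms(2))
  qed
  then have "(\<lambda>n. inner (\<Sum>k\<in>kball n. c k *\<^sub>R phi k) (phi l)) \<longlonglongrightarrow> c l" by (rule tendsto_eventually)
  ultimately show ?thesis by (rule LIMSEQ_unique)
qed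

lemma four_inner: "four (\<lambda>k. inner u (phi k)) = u"
  by (rule hspace_eqI) (rule inner_four[OF coefficients_summable])

lemma fourier_LIMSEQ: "(\<lambda>n. \<Sum>k\<in>kball n. inner u (phi k) *\<^sub>R phi k) \<longlonglongrightarrow> u"
  using four_LIMSEQ[OF coefficients_summable, of u] by (simp add: four_inner)

lemma parseval: "((\<lambda>k. (inner u (phi k))\<^sup>2) has_sum (norm u)\<^sup>2) kk"
proof -
  have "(\<lambda>n. (norm (\<Sum>k\<in>kball n. inner u (phi k) *\<^sub>R phi k))\<^sup>2) \<longlonglongrightarrow> (norm u)\<^sup>2"
    by (intro tendsto_intros fourier_LIMSEQ)
  then have "(\<lambda>n. \<Sum>k\<in>kball n. (inner u (phi k))\<^sup>2) \<longlonglongrightarrow> (norm u)\<^sup>2"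
    by (simp add: norm_sum_phi finite_kball kball_subset)
  moreover have "(\<lambda>n. \<Sum>k\<in>kball n. (inner u (phi k))\<^sup>2) \<longlonglongrightarrow> infsum (\<lambda>k. (inner u (phi k))\<^sup>2) kk"
    by (intro has_sum_kball has_sum_infsum coefficients_summable)
  ultimately show ?thesis
    using LIMSEQ_unique has_sum_infsum[OF coefficients_summable] by metis
qed

section \<open>Point values\<close>

lemma periodic_int_shift:
  assumes "periodic f" shows "f (x + of_int n *\<^sub>R axis i 1) = f x"
proof -
  have nat: "f (x + real m *\<^sub>R axis i 1) = f x" for x and m :: nat
  proof (induction m)
    case (Suc m)
    have "f (x + real (Suc m) *\<^sub>R axis i 1) = f ((x + real m *\<^sub>R axis i 1) + axis i 1)"
      by (simp add: algebra_simps)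
    then show ?case using assms Suc by (simp add: periodic_def)
  qed simp
  show ?thesis
  proof (cases "n \<ge> 0")
    case True
    then show ?thesis using nat[of x "nat n"] by simp
  next
    case False
    then show ?thesis using nat[of "x + of_int n *\<^sub>R axis i 1" "nat (- n)"] by simp
  qed
qed

lemma periodic_representative:
  obtains y where "y \<in> unit_square" "\<And>f::real^2 \<Rightarrow> 'a. periodic f \<Longrightarrow> f x = f y"
proof
  define y where "y = x + of_int (- \<lfloor>x $ 1\<rfloor>) *\<^sub>R axis 1 1 + of_int (- \<lfloor>x $ 2\<rfloor>) *\<^sub>R axis 2 1"
  have "y $ i = frac (x $ i)" for i
    using exhaust_2[of i] by (auto simp: y_def axis_def frac_def)
  then show "y \<in> unit_square" by (simp add: unit_square_def frac_lt_1)
  show "f x = f y" if "periodic f" for f :: "real^2 \<Rightarrow> 'a"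
    unfolding y_def by (simp only: periodic_int_shift[OF that])
qed

text \<open>The set of disagreement is open, and its part in the open square is null, hence empty
  there. Closure extends the equality to the boundary and periodicity to the plane. This makes the
  description in \<open>per_ext\<close> unique.\<close>

lemma continuous_periodic_AE_eq:
  fixes f g :: "real^2 \<Rightarrow> real^2"
  assumes f: "continuous_on UNIV f" "periodic f" and g: "continuous_on UNIV g" "periodic g"
    and ae: "AE x in Dm. f x = g x"
  shows "f = g"
proof -
  define U where "U = {x. f x \<noteq> g x}"
  have U: "open U" unfolding U_def by (intro open_Collect_neq f g)
  have "AE x in lborel. x \<in> unit_square \<longrightarrow> f x = g x"
    using ae unfolding Dm_def by (subst (asm) AE_restrict_space_iff) simp_all
  then have "AE x in lborel. x \<notin> U \<inter> box 0 1"
    by eventually_elim (use box_subset_unit_square in \<open>auto simp: U_def\<close>)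
  then have "U \<inter> box 0 1 \<in> null_sets lborel"
    using U by (subst AE_iff_null_sets) (auto intro!: borel_open)
  then have "negligible (U \<inter> box 0 1)"
    by (simp add: negligible_iff_null_sets null_sets_completionI)
  then have "U \<inter> box 0 1 = {}"
    using open_not_negligible[of "U \<inter> box 0 1"] U by (auto intro: open_Int)
  then have "box 0 1 \<subseteq> {x. f x = g x}" by (auto simp: U_def)
  moreover have "closed {x. f x = g x}" by (intro closed_Collect_eq f g)
  ultimately have "closure (box 0 1) \<subseteq> {x. f x = g x}" by (rule closure_minimal)
  moreover have "box 0 (1::real^2) \<noteq> {}"
    by (auto simp: box_ne_empty one_inner_Basis_cart)
  ultimately have eq: "f y = g y" if "y \<in> unit_square" for y
    using that unit_square_subset_cbox by (auto simp: closure_box)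
  show ?thesis
  proof
    fix x
    obtain y where "y \<in> unit_square" "\<And>f::real^2 \<Rightarrow> real^2. periodic f \<Longrightarrow> f x = f y"
      using periodic_representative by blast
    then show "f x = g x" using eq f g by metis
  qed
qed

text \<open>The Fourier series evaluated pointwise: the candidate for the continuous
  representative.\<close>

definition field :: "hspace \<Rightarrow> real^2 \<Rightarrow> real^2" where
  "field u x = (\<Sum>\<^sub>\<infinity>k\<in>kk. inner u (phi k) *\<^sub>R mode k x)"

lemma l2_of_sum: "l2_of (\<Sum>k\<in>F. g k) = (\<Sum>k\<in>F. l2_of (g k))"
  by (induction F rule: infinite_finite_induct) (simp_all add: zero_hspace.rep_eq plus_hspace.rep_eq)

lemma tendsto_l2_of: "X \<longlonglongrightarrow> u \<Longrightarrow> (\<lambda>n. l2_of (X n)) \<longlonglongrightarrow> l2_of u"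
  unfolding lim_sequentially by (simp add: dist_l2_of)

lemma l2_of_sum_phi:
  assumes "finite F" "F \<subseteq> kk"
  shows "sq_int (\<lambda>x. \<Sum>k\<in>F. c k *\<^sub>R mode k x)"
    and "l2_of (\<Sum>k\<in>F. c k *\<^sub>R phi k) = abs_l2per (\<lambda>x. \<Sum>k\<in>F. c k *\<^sub>R mode k x)"
proof -
  have *: "sq_int (\<lambda>x. \<Sum>k\<in>F. c k *\<^sub>R mode k x) \<and>
      (\<Sum>k\<in>F. abs_l2per (\<lambda>x. c k *\<^sub>R mode k x)) = abs_l2per (\<lambda>x. \<Sum>k\<in>F. c k *\<^sub>R mode k x)"
    by (intro abs_l2per_sum assms sq_int_scaleR sq_int_mode)
  then show "sq_int (\<lambda>x. \<Sum>k\<in>F. c k *\<^sub>R mode k x)" by simp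
  have "l2_of (\<Sum>k\<in>F. c k *\<^sub>R phi k) = (\<Sum>k\<in>F. abs_l2per (\<lambda>x. c k *\<^sub>R mode k x))"
    unfolding l2_of_sum using assms
    by (intro sum.cong) (auto simp: scaleR_hspace.rep_eq l2_of_phi abs_l2per_scaleR sq_int_mode)
  with * show "l2_of (\<Sum>k\<in>F. c k *\<^sub>R phi k) = abs_l2per (\<lambda>x. \<Sum>k\<in>F. c k *\<^sub>R mode k x)" by simp
qed

context
  fixes u :: hspace
  assumes sm: "(\<lambda>k. \<bar>inner u (phi k)\<bar>) summable_on kk"
begin

lemma field_term_le: "norm (inner u (phi k) *\<^sub>R mode k x) \<le> sqrt 2 * \<bar>inner u (phi k)\<bar>"
  using mult_left_mono[OF norm_mode_le[of k x], of "\<bar>inner u (phi k)\<bar>"] by (simp add: mult.commute)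

lemma field_uniform_limit:
  "uniform_limit UNIV (\<lambda>X x. \<Sum>k\<in>X. inner u (phi k) *\<^sub>R mode k x) (field u) (finite_subsets_at_top kk)"
  unfolding field_def[abs_def]
  by (rule Weierstrass_m_test_general[OF field_term_le summable_on_cmult_right[OF sm]])

lemma field_abs_summable: "(\<lambda>k. norm (inner u (phi k) *\<^sub>R mode k x)) summable_on kk"
  by (rule summable_on_comparison_test[OF summable_on_cmult_right[OF sm, of "sqrt 2"]])
    (use field_term_le in auto)

lemma field_summable: "(\<lambda>k. inner u (phi k) *\<^sub>R mode k x) summable_on kk"
  by (rule abs_summable_summable[OF field_abs_summable])

lemma continuous_on_field: "continuous_on UNIV (field u)"
proof (rule uniform_limit_theorem[OF _ field_uniform_limit])
  show "\<forall>\<^sub>F X in finite_subsets_at_top kk. continuous_on UNIV (\<lambda>x. \<Sum>k\<in>X. inner u (phi k) *\<^sub>R mode k x)"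
    by (intro always_eventually allI continuous_intros continuous_on_mode)
qed simp

lemma periodic_field: "periodic (field u)"
  using periodic_mode by (simp add: periodic_def field_def)

text \<open>The partial sums have two limits in mean square: \<open>u\<close> by the Fourier
  expansion, and \<open>field u\<close> because they converge uniformly on a domain of measure
  one.\<close>

lemma abs_l2per_field: "abs_l2per (field u) = l2_of u"
proof -
  define S where "S n x = (\<Sum>k\<in>kball n. inner u (phi k) *\<^sub>R mode k x)" for n x
  have S: "sq_int (S n)" "l2_of (\<Sum>k\<in>kball n. inner u (phi k) *\<^sub>R phi k) = abs_l2per (S n)" for n
    using l2_of_sum_phi[OF finite_kball kball_subset] by (simp_all add: S_def[abs_def])
  have fs: "sq_int (field u)" by (intro sq_int_continuous continuous_on_field)
  have l1: "(\<lambda>n. abs_l2per (S n)) \<longlonglongrightarrow> l2_of u"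
    using tendsto_l2_of[OF fourier_LIMSEQ, of u] by (simp add: S)
  have ul: "uniform_limit UNIV S (field u) sequentially"
    unfolding S_def[abs_def] by (rule filterlim_compose[OF field_uniform_limit filterlim_kball])
  have l2: "(\<lambda>n. abs_l2per (S n)) \<longlonglongrightarrow> abs_l2per (field u)"
  proof (rule metric_LIMSEQ_I)
    fix e :: real assume e: "e > 0"
    from uniform_limitD[OF ul, of "e/2"] e obtain N where N: "\<And>n x. n \<ge> N \<Longrightarrow> dist (S n x) (field u x) < e/2"
      by (auto simp: eventually_sequentially)
    have "dist (abs_l2per (S n)) (abs_l2per (field u)) < e" if "n \<ge> N" for n
    proof -
      have sd: "sq_int (\<lambda>x. S n x - field u x)" by (intro sq_int_diff S fs)
      have "(dist (abs_l2per (S n)) (abs_l2per (field u)))\<^sup>2 = (\<integral>x. (norm (S n x - field u x))\<^sup>2 \<partial>Dm)"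
        by (simp add: dist_norm abs_l2per_diff[OF S(1) fs] norm_abs_l2per[OF sd])
      also have "\<dots> \<le> (\<integral>x. (e/2)\<^sup>2 \<partial>Dm)"
        using sd N[OF that, unfolded dist_norm, THEN less_imp_le] by (intro integral_mono power_mono) (auto simp: sq_int_def)
      also have "\<dots> < e\<^sup>2" using e measure_Dm by (simp add: power_divide)
      finally show ?thesis using e by (simp add: power2_less_imp_less)
    qed
    then show "\<exists>no. \<forall>n\<ge>no. dist (abs_l2per (S n)) (abs_l2per (field u)) < e" by blast
  qed
  show ?thesis by (rule LIMSEQ_unique[OF l2 l1])
qed

lemma per_ext_eq_field: "per_ext u = field u"
  unfolding per_ext_def
proof (rule the_equality)
  have ae: "AE x in Dm. rep_l2per (l2_of u) x = field u x"
    unfolding abs_l2per_field[symmetric] by (intro rep_abs_l2per sq_int_continuous continuous_on_field)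
  then show "continuous_on UNIV (field u) \<and> periodic (field u) \<and> (AE x in Dm. rep_l2per (l2_of u) x = field u x)"
    by (simp add: continuous_on_field periodic_field)
  fix f assume f: "continuous_on UNIV f \<and> periodic f \<and> (AE x in Dm. rep_l2per (l2_of u) x = f x)"
  then have "AE x in Dm. f x = field u x" using ae by (auto elim: eventually_elim2)
  with f show "f = field u" by (intro continuous_periodic_AE_eq continuous_on_field periodic_field) auto
qed

lemma norm_field_le: "norm (field u x) \<le> sqrt 2 * (\<Sum>\<^sub>\<infinity>k\<in>kk. \<bar>inner u (phi k)\<bar>)"
proof -
  have "norm (field u x) \<le> (\<Sum>\<^sub>\<infinity>k\<in>kk. sqrt 2 * \<bar>inner u (phi k)\<bar>)"
    unfolding field_def
    by (rule norm_infsum_le[OF has_sum_infsum[OF field_summable] has_sum_infsum[OF summable_on_cmult_right[OF sm]] field_term_le])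
  also have "\<dots> = sqrt 2 * (\<Sum>\<^sub>\<infinity>k\<in>kk. \<bar>inner u (phi k)\<bar>)" by (rule infsum_cmult_right')
  finally show ?thesis .
qed

lemma field_lipschitz:
  assumes sm1: "(\<lambda>k. kabs k * \<bar>inner u (phi k)\<bar>) summable_on kk"
  shows "norm (field u x - field u y) \<le> 2 * pi * sqrt 2 * (\<Sum>\<^sub>\<infinity>k\<in>kk. kabs k * \<bar>inner u (phi k)\<bar>) * norm (x - y)"
proof -
  let ?C = "2 * pi * sqrt 2 * norm (x - y)"
  have d: "((\<lambda>k. inner u (phi k) *\<^sub>R mode k x - inner u (phi k) *\<^sub>R mode k y) has_sum (field u x - field u y)) kk"
  proof -
    have "((\<lambda>k. - (inner u (phi k) *\<^sub>R mode k y)) has_sum - field u y) kk"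
      unfolding has_sum_uminus using has_sum_infsum[OF field_summable[of y]] by (simp add: field_def)
    from has_sum_add[OF has_sum_infsum[OF field_summable[of x]] this]
    show ?thesis by (simp add: field_def)
  qed
  have "norm (field u x - field u y) \<le> (\<Sum>\<^sub>\<infinity>k\<in>kk. ?C * (kabs k * \<bar>inner u (phi k)\<bar>))"
  proof (rule norm_infsum_le[OF d has_sum_infsum[OF summable_on_cmult_right[OF sm1]]])
    fix k
    have "norm (inner u (phi k) *\<^sub>R mode k x - inner u (phi k) *\<^sub>R mode k y) = \<bar>inner u (phi k)\<bar> * norm (mode k x - mode k y)"
      by (simp add: scaleR_diff_right[symmetric])
    also have "\<dots> \<le> \<bar>inner u (phi k)\<bar> * (2 * pi * sqrt 2 * kabs k * norm (x - y))"
      by (intro mult_left_mono mode_lipschitz) simp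
    finally show "norm (inner u (phi k) *\<^sub>R mode k x - inner u (phi k) *\<^sub>R mode k y) \<le> ?C * (kabs k * \<bar>inner u (phi k)\<bar>)"
      by (simp add: mult_ac)
  qed
  also have "\<dots> = ?C * (\<Sum>\<^sub>\<infinity>k\<in>kk. kabs k * \<bar>inner u (phi k)\<bar>)" by (rule infsum_cmult_right')
  finally show ?thesis by (simp add: mult_ac)
qed

end

section \<open>The Stokes operator in Fourier coordinates\<close>

lemma inner_component: 
  assumes "continuous_on UNIV f"
  shows "inner u (abs_l2per (\<lambda>x. f x *\<^sub>R axis i 1)) = (\<integral>x. f x * rep_l2per u x $ i \<partial>Dm)"
proof -
  have "sq_int (\<lambda>x. f x *\<^sub>R axis i 1)" by (intro sq_int_continuous continuous_intros assms)
  then show ?thesis by (simp add: inner_abs_right inner_axis)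
qed

lemma integrable_continuous_scaleR:
  assumes "continuous_on UNIV (f :: real^2 \<Rightarrow> real)" "sq_int g"
  shows "integrable Dm (\<lambda>x. f x *\<^sub>R g x)"
proof -
  have "bounded (f ` cbox 0 1)"
    by (intro compact_imp_bounded compact_continuous_image continuous_on_subset[OF assms(1)]) auto
  then obtain B where B: "\<And>x. x \<in> cbox 0 1 \<Longrightarrow> \<bar>f x\<bar> \<le> B" unfolding bounded_iff by auto
  have g: "integrable Dm g" by (rule norm_L1_le(1)[OF assms(2), of 1]) simp
  show ?thesis
  proof (rule Bochner_Integration.integrable_bound)
    show "integrable Dm (\<lambda>x. B *\<^sub>R g x)" using g by simp
    show "(\<lambda>x. f x *\<^sub>R g x) \<in> borel_measurable Dm"
      using borel_measurable_integrable[OF integrable_Dm_bounded[OF assms(1)]] borel_measurable_integrable[OF g]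
      by (rule borel_measurable_scaleR)
    show "AE x in Dm. norm (f x *\<^sub>R g x) \<le> norm (B *\<^sub>R g x)"
    proof (rule AE_I2)
      fix x assume "x \<in> space Dm"
      then have "x \<in> cbox 0 1" using unit_square_subset_cbox by (auto simp: space_Dm)
      from B[OF this] show "norm (f x *\<^sub>R g x) \<le> norm (B *\<^sub>R g x)"
        by (simp add: mult_right_mono)
    qed
  qed
qed

lemma integral_scaleR_component:
  assumes "continuous_on UNIV (f :: real^2 \<Rightarrow> real)" "sq_int g"
  shows "(\<integral>x. f x *\<^sub>R g x \<partial>Dm) $ i = (\<integral>x. f x * g x $ i \<partial>Dm)"
  using integral_bounded_linear[OF bounded_linear_vec_nth integrable_continuous_scaleR[OF assms], of i]
  by simp

lemma continuous_on_laplacian: "test_fun f \<Longrightarrow> continuous_on UNIV (laplacian f)"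
  unfolding laplacian_def[abs_def] by (intro continuous_intros test_fun_D(3) test_fun_D(5))

text \<open>Written as inner products, the weak equation is stable under limits and can be tested
  component by component.\<close>

lemma weak_laplacian_iff:
  "weak_laplacian u w \<longleftrightarrow> (\<forall>f i. test_fun f \<longrightarrow>
     inner u (abs_l2per (\<lambda>x. laplacian f x *\<^sub>R axis i 1)) = inner w (abs_l2per (\<lambda>x. f x *\<^sub>R axis i 1)))"
  unfolding weak_laplacian_def
  by (auto simp: vec_eq_iff integral_scaleR_component inner_component continuous_on_laplacian test_fun_D(4) rep_l2per)

lemma l2per_eqI_test_fun:
  assumes "\<And>f i. test_fun f \<Longrightarrow> inner w (abs_l2per (\<lambda>x. f x *\<^sub>R axis i 1)) = inner w' (abs_l2per (\<lambda>x. f x *\<^sub>R axis i 1))"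
  shows "w = w'"
proof -
  define g where "g = rep_l2per (w - w')"
  have g: "sq_int g" "abs_l2per g = w - w'" by (simp_all add: g_def rep_l2per)
  have "(\<integral>x. trig a b k x * g x $ i \<partial>Dm) = 0" for a b k i
    using assms[OF test_fun_trig[of a b k], of i] unfolding g_def
    by (simp add: inner_component[OF continuous_on_trig, symmetric] inner_diff_left)
  then have "AE x in Dm. g x $ i = 0" for i
    by (intro AE_zero_of_orthogonal_trig component_integrable g)
  then have "AE x in Dm. g x = 0" by (auto simp: vec_eq_iff forall_2 elim: eventually_elim2)
  then have "ae_eq g (\<lambda>x. 0)" using g(1) sq_int_zero by (simp add: ae_eq_def)
  then have "w - w' = 0"
    using Quotient_rel_abs[OF Quotient_l2per] by (simp add: g(2)[symmetric] zero_l2per_def)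
  then show ?thesis by simp
qed

lemma weak_laplacian_unique: "weak_laplacian u w \<Longrightarrow> weak_laplacian u w' \<Longrightarrow> w = w'"
  unfolding weak_laplacian_iff by (intro l2per_eqI_test_fun) metis

lemma laplacian_mode: "laplacian (\<lambda>x. mode k x $ i) x = - lam k * mode k x $ i"
  unfolding laplacian_def laplacian_mode_component sum_2 lam_def kabs_sq kvec_component by (simp add: algebra_simps)

lemma mode_sum_axis: "mode k = (\<lambda>x. \<Sum>i\<in>UNIV. mode k x $ i *\<^sub>R axis i 1)"
  by (simp add: fun_eq_iff vec_eq_iff axis_def if_distrib cong: if_cong)

lemma weak_laplacian_mode:
  assumes "weak_laplacian u w"
  shows "inner w (abs_l2per (mode k)) = - lam k * inner u (abs_l2per (mode k))"
proof -
  have sq: "sq_int (\<lambda>x. (c * mode k x $ i) *\<^sub>R axis i 1)" for c i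
    by (intro sq_int_continuous continuous_intros test_fun_D(4) mode_component_test_fun)
  have s: "abs_l2per (\<lambda>x. \<Sum>i\<in>UNIV. (c * mode k x $ i) *\<^sub>R axis i 1) = (\<Sum>i\<in>UNIV. abs_l2per (\<lambda>x. (c * mode k x $ i) *\<^sub>R axis i 1))" for c
    using abs_l2per_sum[of UNIV "\<lambda>i x. (c * mode k x $ i) *\<^sub>R axis i 1"] sq by simp
  have "inner w (abs_l2per (mode k)) = (\<Sum>i\<in>UNIV. inner w (abs_l2per (\<lambda>x. mode k x $ i *\<^sub>R axis i 1)))"
    by (subst mode_sum_axis) (use s[of 1] in \<open>simp add: inner_sum_right\<close>)
  also have "\<dots> = (\<Sum>i\<in>UNIV. inner u (abs_l2per (\<lambda>x. (- lam k * mode k x $ i) *\<^sub>R axis i 1)))"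
  proof (intro sum.cong refl)
    fix i
    have "inner w (abs_l2per (\<lambda>x. mode k x $ i *\<^sub>R axis i 1)) = inner u (abs_l2per (\<lambda>x. laplacian (\<lambda>x. mode k x $ i) x *\<^sub>R axis i 1))"
      using assms mode_component_test_fun[of k i] unfolding weak_laplacian_iff by simp
    then show "inner w (abs_l2per (\<lambda>x. mode k x $ i *\<^sub>R axis i 1)) = inner u (abs_l2per (\<lambda>x. (- lam k * mode k x $ i) *\<^sub>R axis i 1))"
      by (simp only: laplacian_mode)
  qed
  also have "\<dots> = inner u (abs_l2per (\<lambda>x. \<Sum>i\<in>UNIV. (- lam k * mode k x $ i) *\<^sub>R axis i 1))"
    by (simp only: s inner_sum_right)
  also have "(\<lambda>x. \<Sum>i\<in>UNIV. (- lam k * mode k x $ i) *\<^sub>R axis i 1) = (\<lambda>x. (- lam k) *\<^sub>R mode k x)"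
    by (subst (2) mode_sum_axis) (simp add: scaleR_sum_right)
  also have "abs_l2per (\<lambda>x. (- lam k) *\<^sub>R mode k x) = (- lam k) *\<^sub>R abs_l2per (mode k)"
    by (rule abs_l2per_scaleR[symmetric, OF sq_int_mode])
  finally show ?thesis by simp
qed

lemma l2per_coefficients_summable: "(\<lambda>k. (inner f (l2_of (phi k)))\<^sup>2) summable_on kk"
proof (rule nonneg_bdd_above_summable_on)
  show "bdd_above (sum (\<lambda>k. (inner f (l2_of (phi k)))\<^sup>2) ` {F. F \<subseteq> kk \<and> finite F})"
  proof (rule bdd_aboveI2[of _ _ "(norm f)\<^sup>2"], clarify)
    fix F assume F: "F \<subseteq> kk" "finite F"
    define S where "S = (\<Sum>k\<in>F. (inner f (l2_of (phi k)))\<^sup>2)"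
    define s where "s = (\<Sum>k\<in>F. inner f (l2_of (phi k)) *\<^sub>R phi k)"
    have ns: "(norm s)\<^sup>2 = S" unfolding s_def S_def by (rule norm_sum_phi) fact+
    have "S = inner f (l2_of s)"
      by (simp add: S_def s_def l2_of_sum inner_sum_right scaleR_hspace.rep_eq power2_eq_square)
    also have "\<dots> \<le> norm f * norm s" using norm_cauchy_schwarz[of f "l2_of s"] by (simp add: norm_l2_of)
    finally have "norm s * norm s \<le> norm f * norm s" using ns by (simp add: power2_eq_square)
    then have "norm s \<le> norm f" by (cases "norm s = 0") (auto simp: mult_le_cancel_right)
    then show "(\<Sum>k\<in>F. (inner f (l2_of (phi k)))\<^sup>2) \<le> (norm f)\<^sup>2"
      unfolding S_def[symmetric] ns[symmetric] by (intro power_mono) auto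
  qed
qed simp

text \<open>A square integrable field acts on the solenoidal space only through its coefficients
  against the modes. Resynthesising these coefficients therefore gives its orthogonal projection,
  which identifies \<open>leray\<close> below.\<close>

lemma inner_l2_of_four: "inner f (l2_of u) = inner (four (\<lambda>k. inner f (l2_of (phi k)))) u"
proof -
  have "(\<lambda>n. inner f (l2_of (\<Sum>k\<in>kball n. inner u (phi k) *\<^sub>R phi k))) \<longlonglongrightarrow> inner f (l2_of u)"
    by (intro tendsto_intros tendsto_l2_of fourier_LIMSEQ)
  moreover have "inner f (l2_of (\<Sum>k\<in>kball n. inner u (phi k) *\<^sub>R phi k)) =
      inner (four (\<lambda>k. inner f (l2_of (phi k)))) (\<Sum>k\<in>kball n. inner u (phi k) *\<^sub>R phi k)" for n
    using kball_subset[of n] unfolding l2_of_sum inner_sum_right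
    by (intro sum.cong) (auto simp: scaleR_hspace.rep_eq inner_four[OF l2per_coefficients_summable])
  moreover have "(\<lambda>n. inner (four (\<lambda>k. inner f (l2_of (phi k)))) (\<Sum>k\<in>kball n. inner u (phi k) *\<^sub>R phi k))
      \<longlonglongrightarrow> inner (four (\<lambda>k. inner f (l2_of (phi k)))) u"
    by (intro tendsto_intros fourier_LIMSEQ)
  ultimately show ?thesis using LIMSEQ_unique by simp
qed

lemma orth_proj_eqI:
  fixes S :: "'a::real_inner set"
  assumes "w \<in> S" "\<And>h. h \<in> S \<Longrightarrow> inner (u - w) h = 0" "\<And>x y. x \<in> S \<Longrightarrow> y \<in> S \<Longrightarrow> x - y \<in> S"
  shows "orth_proj S u = w"
  unfolding orth_proj_def
proof (rule the_equality)
  fix w' assume w': "w' \<in> S \<and> (\<forall>h\<in>S. inner (u - w') h = 0)"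
  have "inner (w' - w) (w' - w) = inner (u - w) (w' - w) - inner (u - w') (w' - w)"
    by (simp add: inner_diff_left)
  also have "\<dots> = 0" using w' assms by simp
  finally show "w' = w" by simp
qed (use assms in auto)

lemma leray_eq_four: "leray f = four (\<lambda>k. inner f (l2_of (phi k)))"
proof -
  have "orth_proj (range l2_of) f = l2_of (four (\<lambda>k. inner f (l2_of (phi k))))"
  proof (rule orth_proj_eqI)
    show "inner (f - l2_of (four (\<lambda>k. inner f (l2_of (phi k))))) h = 0" if "h \<in> range l2_of" for h
    proof -
      from that obtain u where u: "h = l2_of u" by blast
      show ?thesis unfolding u inner_diff_left inner_l2_of by (subst inner_l2_of_four) simp
    qed
    show "x - y \<in> range l2_of" if "x \<in> range l2_of" "y \<in> range l2_of" for x y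
    proof -
      from that obtain a b where "x = l2_of a" "y = l2_of b" by blast
      then have "x - y = l2_of (a - b)" by (simp add: minus_hspace.rep_eq)
      then show ?thesis by simp
    qed
  qed simp
  then show ?thesis by (simp add: leray_def l2_of_inverse)
qed

lemma stokes_coefficient:
  assumes "u \<in> stokes_dom" "k \<in> kk"
  shows "inner (stokes u) (phi k) = lam k * inner u (phi k)"
proof -
  obtain w where w: "weak_laplacian (l2_of u) w" using assms by (auto simp: stokes_dom_def)
  then have "(THE w. weak_laplacian (l2_of u) w) = w"
    using weak_laplacian_unique by blast
  then have "inner (stokes u) (phi k) = - inner w (l2_of (phi k))"
    by (simp add: stokes_def leray_eq_four inner_four[OF l2per_coefficients_summable assms(2)])
  then show ?thesis
    using weak_laplacian_mode[OF w, of k] assms(2) by (simp add: l2_of_phi[symmetric] inner_l2_of)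
qed

text \<open>The weak Laplacian is built from the coefficients multiplied by \<open>- lam k\<close>.
  The weak equation holds for each partial sum by \<open>integral_laplacian_mode\<close> and
  survives the limit on both sides.\<close>

lemma stokes_domI:
  assumes sm: "(\<lambda>k. (lam k * inner u (phi k))\<^sup>2) summable_on kk"
  shows "u \<in> stokes_dom"
proof -
  define c where "c k = - lam k * inner u (phi k)" for k
  have c: "(\<lambda>k. (c k)\<^sup>2) summable_on kk" using sm by (simp add: c_def power_mult_distrib)
  have "weak_laplacian (l2_of u) (l2_of (four c))"
    unfolding weak_laplacian_iff
  proof (intro allI impI)
    fix f and i :: 2 assume f: "test_fun f"
    let ?a = "abs_l2per (\<lambda>x. laplacian f x *\<^sub>R axis i 1)" and ?b = "abs_l2per (\<lambda>x. f x *\<^sub>R axis i 1)"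
    have m: "inner (abs_l2per (mode k)) (abs_l2per (\<lambda>x. h x *\<^sub>R axis i 1)) = (\<integral>x. h x * mode k x $ i \<partial>Dm)"
      if "continuous_on UNIV h" for h k
    proof -
      have "sq_int (\<lambda>x. h x *\<^sub>R axis i 1)" by (intro sq_int_continuous continuous_intros that)
      then show ?thesis by (simp add: inner_abs_l2per sq_int_mode inner_axis)
    qed
    have md: "inner (l2_of (phi k)) ?a = - lam k * inner (l2_of (phi k)) ?b" if "k \<in> kk" for k
      using that f by (simp add: l2_of_phi m continuous_on_laplacian test_fun_D(4) integral_laplacian_mode)
    have "(\<lambda>n. inner (l2_of (\<Sum>k\<in>kball n. inner u (phi k) *\<^sub>R phi k)) ?a) \<longlonglongrightarrow> inner (l2_of u) ?a"
      by (intro tendsto_intros tendsto_l2_of fourier_LIMSEQ)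
    moreover have "inner (l2_of (\<Sum>k\<in>kball n. inner u (phi k) *\<^sub>R phi k)) ?a = inner (l2_of (\<Sum>k\<in>kball n. c k *\<^sub>R phi k)) ?b" for n
      unfolding l2_of_sum inner_sum_left
    proof (intro sum.cong refl)
      fix k assume "k \<in> kball n"
      then have "k \<in> kk" using kball_subset by blast
      then show "inner (l2_of (inner u (phi k) *\<^sub>R phi k)) ?a = inner (l2_of (c k *\<^sub>R phi k)) ?b"
        by (simp only: scaleR_hspace.rep_eq inner_scaleR_left md) (simp add: c_def)
    qed
    moreover have "(\<lambda>n. inner (l2_of (\<Sum>k\<in>kball n. c k *\<^sub>R phi k)) ?b) \<longlonglongrightarrow> inner (l2_of (four c)) ?b"
      by (intro tendsto_intros tendsto_l2_of four_LIMSEQ c)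
    ultimately show "inner (l2_of u) ?a = inner (l2_of (four c)) ?b"
      using LIMSEQ_unique by simp
  qed
  then show ?thesis by (auto simp: stokes_dom_def)
qed

lemma span_phi_eq:
  assumes "finite F"
  shows "x \<in> span (phi ` F) \<Longrightarrow> \<exists>c. x = (\<Sum>k\<in>F. c k *\<^sub>R phi k)"
proof (induction rule: span_induct_alt)
  case base
  then show ?case by (intro exI[of _ "\<lambda>_. 0"]) simp
next
  case (step a x y)
  then obtain k c where k: "k \<in> F" "x = phi k" "y = (\<Sum>k\<in>F. c k *\<^sub>R phi k)" by blast
  have "(\<Sum>j\<in>F. (c j + (if j = k then a else 0)) *\<^sub>R phi j) = a *\<^sub>R x + y"
    using assms k by (simp add: scaleR_add_left sum.distrib if_distrib[of "\<lambda>r. r *\<^sub>R _"] cong: if_cong)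
  then show ?case by metis
qed

lemma PN_eq: "PN N u = (\<Sum>k\<in>kball N. inner u (phi k) *\<^sub>R phi k)"
  unfolding PN_def kball_def[symmetric]
proof (rule orth_proj_eqI)
  show "(\<Sum>k\<in>kball N. inner u (phi k) *\<^sub>R phi k) \<in> span (phi ` kball N)"
    by (intro span_sum span_scale span_base) auto
  fix h assume "h \<in> span (phi ` kball N)"
  then obtain c where h: "h = (\<Sum>k\<in>kball N. c k *\<^sub>R phi k)" using span_phi_eq finite_kball by blast
  have "inner (u - (\<Sum>k\<in>kball N. inner u (phi k) *\<^sub>R phi k)) (phi l) = 0" if "l \<in> kball N" for l
    using that subsetD[OF kball_subset that] by (simp add: inner_diff_left inner_sum_phi[OF finite_kball kball_subset])
  then show "inner (u - (\<Sum>k\<in>kball N. inner u (phi k) *\<^sub>R phi k)) h = 0"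
    by (simp add: h inner_sum_right)
qed (rule span_diff)

lemma PN_coefficient: "k \<in> kk \<Longrightarrow> inner (PN N u) (phi k) = (if kabs k \<le> real N then inner u (phi k) else 0)"
  by (simp add: PN_eq inner_sum_phi[OF finite_kball kball_subset]) (simp add: kball_def)

section \<open>Sums over the lattice\<close>

lemma kabs_ge_1: assumes "k \<in> kk" shows "kabs k \<ge> 1"
proof -
  have "fst k \<noteq> 0 \<or> snd k \<noteq> 0" using assms by (auto simp: kk_iff prod_eq_iff)
  then have "1 \<le> \<bar>fst k\<bar> \<or> 1 \<le> \<bar>snd k\<bar>" by linarith
  then have "1 \<le> \<bar>real_of_int (fst k)\<bar> \<or> 1 \<le> \<bar>real_of_int (snd k)\<bar>" by linarith
  then show ?thesis using kabs_components[of k] by linarith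
qed

lemma kabs_nonneg [simp]: "0 \<le> kabs k" by (simp add: kabs_def)

lemma kabs_sq_le_lam: "(kabs k)\<^sup>2 \<le> lam k"
proof -
  have "1 * 1 \<le> pi * pi" using pi_gt3 by (intro mult_mono) auto
  then have "1 * (kabs k)\<^sup>2 \<le> 4 * pi\<^sup>2 * (kabs k)\<^sup>2"
    by (intro mult_right_mono) (auto simp: power2_eq_square)
  then show ?thesis by (simp add: lam_def)
qed

lemma lam_ge_1: "k \<in> kk \<Longrightarrow> lam k \<ge> 1"
  using kabs_sq_le_lam[of k] kabs_ge_1[of k] one_le_power[of "kabs k" 2] by linarith

lemma lam_nonneg [simp]: "0 \<le> lam k" by (simp add: lam_def)

lemma sum_int_even_le:
  fixes g :: "int \<Rightarrow> real"
  assumes "\<And>m. g m \<ge> 0" "\<And>m. g (- m) = g m" "finite M" "\<And>N. (\<Sum>n=1..N. g (int n)) \<le> S"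
  shows "sum g M \<le> g 0 + 2 * S"
proof -
  have eq: "sum g {- int N..int N} = g 0 + 2 * (\<Sum>n=1..N. g (int n))" for N
  proof (induction N)
    case (Suc N)
    have "{- int (Suc N)..int (Suc N)} = insert (int (Suc N)) (insert (- int (Suc N)) {- int N..int N})" by auto
    then show ?case using Suc assms(2)[of "int (Suc N)"] by simp
  qed simp
  define N where "N = nat (Max (insert 0 (abs ` M)))"
  have "\<bar>m\<bar> \<le> int N" if "m \<in> M" for m
    using Max_ge[of "insert 0 (abs ` M)" "\<bar>m\<bar>"] assms(3) that by (auto simp: N_def)
  then have "M \<subseteq> {- int N..int N}" by force
  then have "sum g M \<le> sum g {- int N..int N}" using assms(1) by (intro sum_mono2) auto
  then show ?thesis using eq[of N] assms(4)[of N] by linarith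
qed

text \<open>Enlarging \<open>F\<close> to the product of its two projections separates the
  variables; this reduces every lattice sum below to a one-dimensional one.\<close>

lemma sum_product_le:
  fixes g :: "int \<Rightarrow> real"
  assumes g: "\<And>m. g m \<ge> 0" and F: "finite F" and S: "\<And>M. finite M \<Longrightarrow> sum g M \<le> S"
  shows "(\<Sum>k\<in>F. g (fst k) * g (snd k)) \<le> S\<^sup>2"
proof -
  have "(\<Sum>k\<in>F. g (fst k) * g (snd k)) \<le> (\<Sum>k\<in>fst ` F \<times> snd ` F. g (fst k) * g (snd k))"
    using F g by (intro sum_mono2 subset_fst_snd) auto
  also have "\<dots> = sum g (fst ` F) * sum g (snd ` F)"
    by (simp add: sum_product sum.cartesian_product case_prod_beta)
  also have "\<dots> \<le> S * S"
    using F S S[of "{}"] g by (intro mult_mono sum_nonneg) auto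
  finally show ?thesis by (simp add: power2_eq_square)
qed

text \<open>Since (1 + x)^2 is at most 2 (1 + x^2), each term is bounded by a difference of
  consecutive values of (2/r) / (1 + r n), and the sum telescopes. The explicit dependence on
  \<open>r\<close> is what the heat kernel estimates need.\<close>

lemma sum_inverse_quadratic_le:
  assumes r: "r > 0" and M: "finite M"
  shows "(\<Sum>m\<in>M. 1 / (1 + (r * real_of_int m)\<^sup>2)) \<le> 1 + 4 / r"
proof -
  have "(\<Sum>n=1..N. 1 / (1 + (r * real_of_int (int n))\<^sup>2)) \<le> 2 / r" for N
  proof -
    have le: "1 / (1 + (r * real n)\<^sup>2) \<le> (2 / r) * (1 / (1 + r * (real n - 1)) - 1 / (1 + r * real n))" if "n \<ge> 1" for n :: nat
    proof -
      have p: "1 + r * (real n - 1) > 0" "1 + r * real n > 0" using r that by (auto intro!: add_pos_nonneg)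
      have "(1 + r * real n) - (1 + r * (real n - 1)) = r" by (simp add: algebra_simps)
      then have "1 / (1 + r * (real n - 1)) - 1 / (1 + r * real n) = r / ((1 + r * (real n - 1)) * (1 + r * real n))"
        using p by (subst diff_frac_eq) auto
      then have A: "(2 / r) * (1 / (1 + r * (real n - 1)) - 1 / (1 + r * real n)) = 2 / ((1 + r * (real n - 1)) * (1 + r * real n))"
        using r by simp
      have "(1 + r * (real n - 1)) * (1 + r * real n) \<le> 2 * (1 + (r * real n)\<^sup>2)"
      proof -
        have "(1 + r * (real n - 1)) * (1 + r * real n) \<le> (1 + r * real n) * (1 + r * real n)"
          using r p by (intro mult_right_mono) (auto simp: algebra_simps)
        also have "\<dots> \<le> 2 * (1 + (r * real n)\<^sup>2)"
          using zero_le_power2[of "1 - r * real n"] by (simp add: power2_eq_square algebra_simps)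
        finally show ?thesis .
      qed
      then have X: "2 / (2 * (1 + (r * real n)\<^sup>2)) \<le> 2 / ((1 + r * (real n - 1)) * (1 + r * real n))"
        using p by (intro divide_left_mono mult_pos_pos) (auto intro: add_pos_nonneg)
      have H: "2 / (2 * (1 + (r * real n)\<^sup>2)) = 1 / (1 + (r * real n)\<^sup>2)"
      proof -
        have "2 / (2 * E) = 1 / E" for E :: real by simp
        then show ?thesis .
      qed
      show ?thesis using X unfolding H A .
    qed
    have "(\<Sum>n=1..N. 1 / (1 + (r * real_of_int (int n))\<^sup>2)) \<le> (\<Sum>n=1..N. (2 / r) * (1 / (1 + r * (real n - 1)) - 1 / (1 + r * real n)))"
      using le by (intro sum_mono) auto
    also have "\<dots> = (2 / r) * (1 - 1 / (1 + r * real N))"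
    proof (induction N)
      case (Suc N)
      then show ?case by (simp add: algebra_simps)
    qed simp
    also have "\<dots> \<le> 2 / r" using r by (intro mult_left_le) auto
    finally show ?thesis .
  qed
  from sum_int_even_le[of "\<lambda>m. 1 / (1 + (r * real_of_int m)\<^sup>2)", OF _ _ M this] show ?thesis
    by simp
qed

lemma exp_minus_le_inverse: "x \<ge> 0 \<Longrightarrow> exp (- x) \<le> 1 / (1 + (x::real))"
  using exp_ge_add_one_self[of x] by (simp add: exp_minus inverse_eq_divide frac_le)

text \<open>The heat trace in two dimensions is of order 1/a. The bound exp(-x) \<le> 1/(1+x) is
  applied in each coordinate separately. The upper limit \<open>A\<close> on \<open>a\<close> serves
  to absorb the summand 1 of \<open>1 + 4 / r\<close> into a multiple of 1 / sqrt a.\<close>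

lemma sum_exp_lam_le:
  assumes a: "0 < a" "a \<le> A" and F: "finite F"
  shows "(\<Sum>k\<in>F. exp (- a * lam k)) \<le> (sqrt A + 4)\<^sup>2 / a"
proof -
  define r where "r = 2 * pi * sqrt a"
  have "1 * sqrt a \<le> 2 * pi * sqrt a" using pi_gt3 a by (intro mult_right_mono) auto
  then have r: "r \<ge> sqrt a" "r > 0" "sqrt a > 0" using a by (auto simp: r_def)
  have r2: "r\<^sup>2 = 4 * pi\<^sup>2 * a" using a by (simp add: r_def power_mult_distrib)
  have "(\<Sum>k\<in>F. exp (- a * lam k)) \<le> (\<Sum>k\<in>F. 1 / (1 + (r * real_of_int (fst k))\<^sup>2) * (1 / (1 + (r * real_of_int (snd k))\<^sup>2)))"
  proof (rule sum_mono)
    fix k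
    have "- a * lam k = - ((r * real_of_int (fst k))\<^sup>2) + - ((r * real_of_int (snd k))\<^sup>2)"
      by (simp add: lam_def kabs_sq power_mult_distrib r2 algebra_simps)
    then have "exp (- a * lam k) = exp (- ((r * real_of_int (fst k))\<^sup>2)) * exp (- ((r * real_of_int (snd k))\<^sup>2))"
      by (simp only: exp_add)
    also have "\<dots> \<le> 1 / (1 + (r * real_of_int (fst k))\<^sup>2) * (1 / (1 + (r * real_of_int (snd k))\<^sup>2))"
      by (intro mult_mono exp_minus_le_inverse) auto
    finally show "exp (- a * lam k) \<le> 1 / (1 + (r * real_of_int (fst k))\<^sup>2) * (1 / (1 + (r * real_of_int (snd k))\<^sup>2))" .
  qed
  also have "\<dots> \<le> (1 + 4 / r)\<^sup>2"
    by (rule sum_product_le[where g = "\<lambda>m. 1 / (1 + (r * real_of_int m)\<^sup>2)"])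
      (use F sum_inverse_quadratic_le[OF r(2)] in auto)
  also have "\<dots> \<le> ((sqrt A + 4) / sqrt a)\<^sup>2"
  proof (rule power_mono)
    have "1 \<le> sqrt A / sqrt a" using a by simp
    moreover have "4 / r \<le> 4 / sqrt a" by (intro divide_left_mono mult_pos_pos r) simp
    ultimately show "1 + 4 / r \<le> (sqrt A + 4) / sqrt a" by (simp add: add_divide_distrib)
    show "0 \<le> 1 + 4 / r" using r(2) by simp
  qed
  also have "\<dots> = (sqrt A + 4)\<^sup>2 / a" using a by (simp add: power_divide)
  finally show ?thesis .
qed

text \<open>Half of the exponential decay is traded for the factor \<open>lam k\<close>, at the
  price of another 1/a, using y exp(-y) \<le> 1 with y = a lam / 2.\<close>

lemma sum_lam_exp_lam_le:
  assumes a: "0 < a" "a \<le> A" and F: "finite F"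
  shows "(\<Sum>k\<in>F. lam k * exp (- a * lam k)) \<le> (2 * (sqrt A + 4) / a)\<^sup>2"
proof -
  have "lam k * exp (- a * lam k) \<le> 2 / a * exp (- (a / 2) * lam k)" for k
  proof -
    define y where "y = a / 2 * lam k"
    have "y * exp (- y) \<le> 1"
    proof -
      have "y \<le> exp y" using exp_ge_add_one_self[of y] by linarith
      then show ?thesis by (simp add: exp_minus field_simps)
    qed
    then have *: "y * exp (- y) * exp (- y) \<le> 1 * exp (- y)" by (intro mult_right_mono) auto
    have "lam k = 2 / a * y" using a by (simp add: y_def)
    moreover have "exp (- a * lam k) = exp (- y) * exp (- y)"
      by (simp add: y_def flip: exp_add)
    ultimately have "lam k * exp (- a * lam k) = 2 / a * (y * exp (- y) * exp (- y))" by (simp only: mult.assoc)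
    also have "\<dots> \<le> 2 / a * (1 * exp (- y))"
      using a * by (intro mult_left_mono) auto
    finally show ?thesis by (simp add: y_def)
  qed
  then have "(\<Sum>k\<in>F. lam k * exp (- a * lam k)) \<le> (\<Sum>k\<in>F. 2 / a * exp (- (a / 2) * lam k))"
    by (rule sum_mono)
  also have "\<dots> = 2 / a * (\<Sum>k\<in>F. exp (- (a / 2) * lam k))"
    by (simp add: sum_distrib_left)
  also have "\<dots> \<le> 2 / a * ((sqrt A + 4)\<^sup>2 / (a / 2))"
    using a F by (intro mult_left_mono sum_exp_lam_le) auto
  also have "\<dots> = (2 * (sqrt A + 4) / a)\<^sup>2"
    by (simp only: power_divide power_mult_distrib) (simp add: power2_eq_square)
  finally show ?thesis .
qed

text \<open>The inequality (1 + m^2)(1 + n^2) \<le> \<open>lam\<close> squared splits the double sum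
  into a product of two one-dimensional series comparable with the p-series. This is the place where
  the dimension enters the condition on the prior.\<close>

lemma lam_powr_summable:
  assumes p: "p > 1" shows "(\<lambda>k. lam k powr (- p)) summable_on kk"
proof -
  define g where "g m = (1 + (real_of_int m)\<^sup>2) powr (- (p / 2))" for m
  define S where "S = (\<Sum>n. real n powr (- p))"
  have sm: "summable (\<lambda>n. real n powr (- p))" using p by (simp add: summable_real_powr_iff)
  have gn: "(\<Sum>n=1..N. g (int n)) \<le> S" for N
  proof -
    have "(\<Sum>n=1..N. g (int n)) \<le> (\<Sum>n=1..N. real n powr (- p))"
    proof (rule sum_mono)
      fix n assume "n \<in> {1..N}"
      then have n: "real n > 0" by auto
      have "g (int n) \<le> ((real n)\<^sup>2) powr (- (p / 2))"
        unfolding g_def using n p by (intro powr_mono2') auto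
      also have "\<dots> = real n powr (- p)" using n by (simp add: powr_powr flip: powr_numeral)
      finally show "g (int n) \<le> real n powr (- p)" .
    qed
    also have "\<dots> \<le> S" unfolding S_def by (intro sum_le_suminf sm) auto
    finally show ?thesis .
  qed
  have S: "sum g M \<le> 1 + 2 * S" if "finite M" for M
    using sum_int_even_le[of g, OF _ _ that gn] by (simp add: g_def)
  have le: "lam k powr (- p) \<le> g (fst k) * g (snd k)" if k: "k \<in> kk" for k
  proof -
    let ?a = "(real_of_int (fst k))\<^sup>2" and ?b = "(real_of_int (snd k))\<^sup>2"
    have ab: "?a + ?b \<ge> 1" using one_le_power[OF kabs_ge_1[OF k], of 2] by (simp add: kabs_sq)
    have "(1 + ?a) * (1 + ?b) = 1 + (?a + ?b) + ?a * ?b" by (simp add: algebra_simps)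
    also have "\<dots> \<le> (?a + ?b)\<^sup>2 + (?a + ?b)\<^sup>2 + (?a + ?b)\<^sup>2"
    proof (intro add_mono)
      show "1 \<le> (?a + ?b)\<^sup>2" using one_le_power[OF ab, of 2] by simp
      show "?a + ?b \<le> (?a + ?b)\<^sup>2" using mult_right_mono[OF ab, of "?a + ?b"] by (simp add: power2_eq_square)
      show "?a * ?b \<le> (?a + ?b)\<^sup>2"
        by (simp add: power2_sum)
    qed
    also have "\<dots> \<le> (4 * pi\<^sup>2 * (?a + ?b))\<^sup>2"
    proof -
      have "3 * 1 \<le> pi * pi" using pi_gt3 by (intro mult_mono) auto
      then have "3 \<le> 4 * pi\<^sup>2" by (simp add: power2_eq_square)
      then have "3 * 1 \<le> (4 * pi\<^sup>2) * (4 * pi\<^sup>2)" by (intro mult_mono) auto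
      then have "3 * (?a + ?b)\<^sup>2 \<le> ((4 * pi\<^sup>2) * (4 * pi\<^sup>2)) * (?a + ?b)\<^sup>2" by (intro mult_right_mono) auto
      then show ?thesis by (simp add: power_mult_distrib power2_eq_square[of "4::real"] power2_eq_square[of "pi\<^sup>2"])
    qed
    finally have "(1 + ?a) * (1 + ?b) \<le> (lam k)\<^sup>2" by (simp add: lam_def kabs_sq)
    then have "((lam k)\<^sup>2) powr (- (p / 2)) \<le> ((1 + ?a) * (1 + ?b)) powr (- (p / 2))"
      using p by (intro powr_mono2') (auto intro!: mult_pos_pos add_pos_nonneg)
    moreover have "((lam k)\<^sup>2) powr (- (p / 2)) = lam k powr (- p)"
      using lam_ge_1[OF k] by (simp add: powr_powr flip: powr_numeral)
    ultimately show ?thesis by (simp add: g_def powr_mult)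
  qed
  show ?thesis
  proof (rule nonneg_bdd_above_summable_on)
    show "bdd_above (sum (\<lambda>k. lam k powr (- p)) ` {F. F \<subseteq> kk \<and> finite F})"
    proof (rule bdd_aboveI2[of _ _ "(1 + 2 * S)\<^sup>2"], clarify)
      fix F assume F: "F \<subseteq> kk" "finite F"
      have "(\<Sum>k\<in>F. lam k powr (- p)) \<le> (\<Sum>k\<in>F. g (fst k) * g (snd k))"
        using F le by (intro sum_mono) auto
      also have "\<dots> \<le> (1 + 2 * S)\<^sup>2" by (rule sum_product_le) (use F S in \<open>auto simp: g_def\<close>)
      finally show "(\<Sum>k\<in>F. lam k powr (- p)) \<le> (1 + 2 * S)\<^sup>2" .
    qed
  qed simp
qed

text \<open>Stated with bounds on finite partial sums, so that summability and the estimate of the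
  sum come out together. It turns bounds in mean square on coefficients into absolute summability of
  series evaluated pointwise.\<close>

lemma Cauchy_Schwarz_kk:
  fixes a b :: "int \<times> int \<Rightarrow> real"
  assumes a: "\<And>F. finite F \<Longrightarrow> F \<subseteq> kk \<Longrightarrow> (\<Sum>k\<in>F. (a k)\<^sup>2) \<le> A\<^sup>2" and "A \<ge> 0"
    and b: "\<And>F. finite F \<Longrightarrow> F \<subseteq> kk \<Longrightarrow> (\<Sum>k\<in>F. (b k)\<^sup>2) \<le> B\<^sup>2" and "B \<ge> 0"
    and c: "\<And>k. k \<in> kk \<Longrightarrow> 0 \<le> c k \<and> c k \<le> \<bar>a k * b k\<bar>"
  shows "c summable_on kk" and "infsum c kk \<le> A * B"
proof -
  have le: "sum c F \<le> A * B" if F: "finite F" "F \<subseteq> kk" for F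
  proof -
    have "(\<Sum>k\<in>F. \<bar>a k\<bar> * \<bar>b k\<bar>)\<^sup>2 \<le> (\<Sum>k\<in>F. \<bar>a k\<bar>\<^sup>2) * (\<Sum>k\<in>F. \<bar>b k\<bar>\<^sup>2)"
      by (rule Cauchy_Schwarz_ineq_sum)
    also have "\<dots> \<le> A\<^sup>2 * B\<^sup>2"
      using a[OF F] b[OF F] by (intro mult_mono) (auto intro: sum_nonneg)
    finally have "(\<Sum>k\<in>F. \<bar>a k\<bar> * \<bar>b k\<bar>)\<^sup>2 \<le> (A * B)\<^sup>2" by (simp add: power_mult_distrib)
    then have "(\<Sum>k\<in>F. \<bar>a k\<bar> * \<bar>b k\<bar>) \<le> A * B" 
      by (rule power2_le_imp_le) (use \<open>A \<ge> 0\<close> \<open>B \<ge> 0\<close> in simp)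
    moreover have "sum c F \<le> (\<Sum>k\<in>F. \<bar>a k\<bar> * \<bar>b k\<bar>)"
      using c F by (intro sum_mono) (auto simp: abs_mult)
    ultimately show ?thesis by linarith
  qed
  show s: "c summable_on kk"
    by (rule nonneg_bdd_above_summable_on) (use c le in \<open>auto intro!: bdd_aboveI2[of _ _ "A * B"]\<close>)
  show "infsum c kk \<le> A * B"
    by (rule infsum_le_finite_sums[OF s le])
qed

text \<open>The smoothing effect of the heat semigroup: powers of \<open>lam\<close> are bought with
  negative powers of time. One constant serves all exponents up to 2, because \<open>exp x\<close>
  is at least x^2 / 2.\<close>

lemma exp_minus_le_powr:
  fixes x p :: real
  assumes "x > 0" "0 \<le> p" "p \<le> 2"
  shows "exp (- x) \<le> 2 * x powr (- p)"
proof -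
  have "x powr p \<le> 2 * exp x"
  proof (cases "x \<le> 1")
    case True
    then have "x powr p \<le> 1" using assms by (simp add: powr_le1)
    also have "\<dots> \<le> 2 * exp x" using exp_ge_add_one_self[of x] assms by linarith
    finally show ?thesis .
  next
    case False
    then have "x powr p \<le> x powr 2" using assms by (intro powr_mono) auto
    also have "\<dots> = x\<^sup>2" using assms by simp
    also have "\<dots> \<le> 2 * exp x" using exp_lower_Taylor_quadratic[of x] assms by simp
    finally show ?thesis .
  qed
  then show ?thesis using assms by (simp add: exp_minus powr_minus field_simps)
qed

section \<open>Time evolution of the Stokes flow\<close>

text \<open>Square summability with tails small uniformly in time. This is what makes
  \<open>four (c t)\<close> continuous in \<open>t\<close> once each single coefficient is
  continuous.\<close>

definition utail :: "real set \<Rightarrow> (real \<Rightarrow> int \<times> int \<Rightarrow> real) \<Rightarrow> bool" where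
  "utail I c \<longleftrightarrow> (\<forall>e>0. \<exists>n. \<forall>t\<in>I. \<forall>F. finite F \<longrightarrow> F \<subseteq> kk - kball n \<longrightarrow> (\<Sum>k\<in>F. (c t k)\<^sup>2) \<le> e)"

lemma utailE:
  assumes "utail I c" "e > 0"
  obtains n where "\<And>t F. t \<in> I \<Longrightarrow> finite F \<Longrightarrow> F \<subseteq> kk - kball n \<Longrightarrow> (\<Sum>k\<in>F. (c t k)\<^sup>2) \<le> e"
  using assms unfolding utail_def by metis

lemma utail_summable:
  assumes "utail I c" "t \<in> I"
  shows "(\<lambda>k. (c t k)\<^sup>2) summable_on kk"
proof -
  obtain n where n: "\<And>F. finite F \<Longrightarrow> F \<subseteq> kk - kball n \<Longrightarrow> (\<Sum>k\<in>F. (c t k)\<^sup>2) \<le> 1"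
    using utailE[OF assms(1), of 1] assms(2) by (metis zero_less_one)
  show ?thesis
  proof (rule nonneg_bdd_above_summable_on)
    show "bdd_above (sum (\<lambda>k. (c t k)\<^sup>2) ` {F. F \<subseteq> kk \<and> finite F})"
    proof (rule bdd_aboveI2[of _ _ "(\<Sum>k\<in>kball n. (c t k)\<^sup>2) + 1"], clarify)
      fix F assume F: "F \<subseteq> kk" "finite F"
      have "(\<Sum>k\<in>F. (c t k)\<^sup>2) = (\<Sum>k\<in>F \<inter> kball n. (c t k)\<^sup>2) + (\<Sum>k\<in>F - kball n. (c t k)\<^sup>2)"
        by (rule sum.Int_Diff[OF F(2)])
      also have "\<dots> \<le> (\<Sum>k\<in>kball n. (c t k)\<^sup>2) + 1"
        using F n[of "F - kball n"] finite_kball by (intro add_mono sum_mono2) auto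
      finally show "(\<Sum>k\<in>F. (c t k)\<^sup>2) \<le> (\<Sum>k\<in>kball n. (c t k)\<^sup>2) + 1" .
    qed
  qed simp
qed

lemma utail_add:
  assumes "utail I c" "utail I d" shows "utail I (\<lambda>t k. c t k + d t k)"
  unfolding utail_def
proof (intro allI impI)
  fix e :: real assume "e > 0"
  then have e: "e / 4 > 0" by simp
  obtain n where n: "\<And>t F. t \<in> I \<Longrightarrow> finite F \<Longrightarrow> F \<subseteq> kk - kball n \<Longrightarrow> (\<Sum>k\<in>F. (c t k)\<^sup>2) \<le> e / 4"
    using utailE[OF assms(1) e] by metis
  obtain m where m: "\<And>t F. t \<in> I \<Longrightarrow> finite F \<Longrightarrow> F \<subseteq> kk - kball m \<Longrightarrow> (\<Sum>k\<in>F. (d t k)\<^sup>2) \<le> e / 4"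
    using utailE[OF assms(2) e] by metis
  have "(\<Sum>k\<in>F. (c t k + d t k)\<^sup>2) \<le> e" if "t \<in> I" "finite F" "F \<subseteq> kk - kball (max n m)" for t F
  proof -
    have F: "F \<subseteq> kk - kball n" "F \<subseteq> kk - kball m" using that(3) kball_mono[of n "max n m"] kball_mono[of m "max n m"] by auto
    have "(\<Sum>k\<in>F. (c t k + d t k)\<^sup>2) \<le> (\<Sum>k\<in>F. 2 * (c t k)\<^sup>2 + 2 * (d t k)\<^sup>2)"
    proof (rule sum_mono)
      fix k
      show "(c t k + d t k)\<^sup>2 \<le> 2 * (c t k)\<^sup>2 + 2 * (d t k)\<^sup>2"
        using zero_le_power2[of "c t k - d t k"] by (simp add: power2_eq_square algebra_simps)
    qed
    also have "\<dots> = 2 * (\<Sum>k\<in>F. (c t k)\<^sup>2) + 2 * (\<Sum>k\<in>F. (d t k)\<^sup>2)"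
      by (simp add: sum.distrib sum_distrib_left)
    also have "\<dots> \<le> 2 * (e / 4) + 2 * (e / 4)"
      using n[OF that(1,2) F(1)] m[OF that(1,2) F(2)] by (intro add_mono mult_left_mono) auto
    finally show ?thesis by simp
  qed
  then show "\<exists>n. \<forall>t\<in>I. \<forall>F. finite F \<longrightarrow> F \<subseteq> kk - kball n \<longrightarrow> (\<Sum>k\<in>F. (c t k + d t k)\<^sup>2) \<le> e" by blast
qed

lemma utail_weight:
  assumes d: "d > 0" and B: "\<And>t F. t \<in> I \<Longrightarrow> finite F \<Longrightarrow> F \<subseteq> kk \<Longrightarrow> (\<Sum>k\<in>F. (lam k powr d * c t k)\<^sup>2) \<le> B"
  shows "utail I c"
  unfolding utail_def
proof (intro allI impI)
  fix e :: real assume e: "e > 0"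
  \<comment> \<open>\<open>R\<close> is the factor that the weight must gain outside the disc.
    Taking it at least 1 lets the estimate \<open>R \<le> lam k powr d\<close> pass to the square of
    the right-hand side.\<close>
  define R where "R = max 1 (B / e)"
  obtain n :: nat where n: "R powr (1 / (2 * d)) \<le> real n" using real_arch_simple by blast
  have R: "R \<ge> 1" "R \<ge> B / e" by (auto simp: R_def)
  have lamR: "R \<le> (lam k powr d)\<^sup>2" if "k \<in> kk - kball n" for k
  proof -
    have "real n \<le> kabs k" using that by (auto simp: kball_def)
    then have 1: "R powr (1 / (2 * d)) \<le> kabs k" using n by linarith
    have "R = (R powr (1 / (2 * d))) powr (2 * d)" using R d by (simp add: powr_powr)
    also have "\<dots> \<le> kabs k powr (2 * d)" using 1 d by (intro powr_mono2) auto
    also have "\<dots> = (kabs k powr 2) powr d" by (simp only: powr_powr)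
    also have "\<dots> = ((kabs k)\<^sup>2) powr d" by simp
    also have "\<dots> \<le> lam k powr d" using kabs_sq_le_lam d by (intro powr_mono2) auto
    finally have *: "R \<le> lam k powr d" .
    then have "1 * R \<le> lam k powr d * lam k powr d" using R by (intro mult_mono) auto
    then show ?thesis by (simp add: power2_eq_square)
  qed
  have "(\<Sum>k\<in>F. (c t k)\<^sup>2) \<le> e" if "t \<in> I" "finite F" "F \<subseteq> kk - kball n" for t F
  proof -
    have "R * (\<Sum>k\<in>F. (c t k)\<^sup>2) \<le> (\<Sum>k\<in>F. (lam k powr d * c t k)\<^sup>2)"
      unfolding sum_distrib_left power_mult_distrib using that lamR by (intro sum_mono mult_right_mono) auto
    also have "\<dots> \<le> B" using that by (intro B) auto
    also have "\<dots> \<le> R * e" using R e by (simp add: field_simps)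
    finally show ?thesis using R by (simp add: mult_le_cancel_left)
  qed
  then show "\<exists>n. \<forall>t\<in>I. \<forall>F. finite F \<longrightarrow> F \<subseteq> kk - kball n \<longrightarrow> (\<Sum>k\<in>F. (c t k)\<^sup>2) \<le> e" by blast
qed

lemma utail_dominated:
  assumes sm: "(\<lambda>k. (d k)\<^sup>2) summable_on kk" and le: "\<And>t k. t \<in> I \<Longrightarrow> k \<in> kk \<Longrightarrow> (c t k)\<^sup>2 \<le> (d k)\<^sup>2"
  shows "utail I c"
  unfolding utail_def
proof (intro allI impI)
  fix e :: real assume e: "e > 0"
  define L where "L = infsum (\<lambda>k. (d k)\<^sup>2) kk"
  have "(\<lambda>n. \<Sum>k\<in>kball n. (d k)\<^sup>2) \<longlonglongrightarrow> L"
    unfolding L_def by (intro has_sum_kball has_sum_infsum sm)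
  then have "\<forall>\<^sub>F n in sequentially. L - e < (\<Sum>k\<in>kball n. (d k)\<^sup>2)"
    using e by (intro order_tendstoD) auto
  then obtain n where n: "L - e < (\<Sum>k\<in>kball n. (d k)\<^sup>2)" by (auto simp: eventually_sequentially)
  have "(\<Sum>k\<in>F. (c t k)\<^sup>2) \<le> e" if "t \<in> I" "finite F" "F \<subseteq> kk - kball n" for t F
  proof -
    have "(\<Sum>k\<in>F. (c t k)\<^sup>2) \<le> (\<Sum>k\<in>F. (d k)\<^sup>2)" using that le by (intro sum_mono) auto
    moreover have "(\<Sum>k\<in>F. (d k)\<^sup>2) + (\<Sum>k\<in>kball n. (d k)\<^sup>2) = (\<Sum>k\<in>F \<union> kball n. (d k)\<^sup>2)"
      using that finite_kball by (intro sum.union_disjoint[symmetric]) auto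
    moreover have "\<dots> \<le> L"
      unfolding L_def using that finite_kball kball_subset sm by (intro finite_sum_le_infsum) auto
    ultimately show ?thesis using n by linarith
  qed
  then show "\<exists>n. \<forall>t\<in>I. \<forall>F. finite F \<longrightarrow> F \<subseteq> kk - kball n \<longrightarrow> (\<Sum>k\<in>F. (c t k)\<^sup>2) \<le> e" by blast
qed

lemma continuous_on_four:
  assumes c: "\<And>k. k \<in> kk \<Longrightarrow> continuous_on I (\<lambda>t. c t k)" and ut: "utail I c"
  shows "continuous_on I (\<lambda>t. four (c t))"
proof (rule uniform_limit_theorem)
  show "\<forall>\<^sub>F n in sequentially. continuous_on I (\<lambda>t. \<Sum>k\<in>kball n. c t k *\<^sub>R phi k)"
    using kball_subset c by (intro always_eventually allI continuous_intros) auto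
  show "uniform_limit I (\<lambda>n t. \<Sum>k\<in>kball n. c t k *\<^sub>R phi k) (\<lambda>t. four (c t)) sequentially"
  proof (rule uniform_limitI)
    fix e :: real assume e: "e > 0"
    obtain n where n: "\<And>t F. t \<in> I \<Longrightarrow> finite F \<Longrightarrow> F \<subseteq> kk - kball n \<Longrightarrow> (\<Sum>k\<in>F. (c t k)\<^sup>2) \<le> (e / 2)\<^sup>2"
      using utailE[OF ut, of "(e/2)\<^sup>2"] e by (metis half_gt_zero zero_less_power)
    have "dist (\<Sum>k\<in>kball m. c t k *\<^sub>R phi k) (four (c t)) < e" if m: "m \<ge> n" and t: "t \<in> I" for m t
    proof -
      have lim: "(\<lambda>j. \<Sum>k\<in>kball j. c t k *\<^sub>R phi k) \<longlonglongrightarrow> four (c t)"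
        by (intro four_LIMSEQ utail_summable[OF ut t])
      have "(\<lambda>j. norm ((\<Sum>k\<in>kball j. c t k *\<^sub>R phi k) - (\<Sum>k\<in>kball m. c t k *\<^sub>R phi k))) \<longlonglongrightarrow>
          norm (four (c t) - (\<Sum>k\<in>kball m. c t k *\<^sub>R phi k))"
        by (intro tendsto_intros lim)
      moreover have "norm ((\<Sum>k\<in>kball j. c t k *\<^sub>R phi k) - (\<Sum>k\<in>kball m. c t k *\<^sub>R phi k)) \<le> e / 2" if "j \<ge> m" for j
      proof -
        have "(\<Sum>k\<in>kball j. c t k *\<^sub>R phi k) - (\<Sum>k\<in>kball m. c t k *\<^sub>R phi k) = (\<Sum>k\<in>kball j - kball m. c t k *\<^sub>R phi k)"
          by (rule sum_diff[OF finite_kball kball_mono[OF that], symmetric])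
        then have "(norm ((\<Sum>k\<in>kball j. c t k *\<^sub>R phi k) - (\<Sum>k\<in>kball m. c t k *\<^sub>R phi k)))\<^sup>2 = (\<Sum>k\<in>kball j - kball m. (c t k)\<^sup>2)"
          using finite_kball kball_subset by (simp add: norm_sum_phi Diff_subset[THEN subset_trans])
        also have "\<dots> \<le> (e / 2)\<^sup>2"
          using finite_kball kball_subset kball_mono[OF m] by (intro n t) auto
        finally show ?thesis by (rule power2_le_imp_le) (use e in simp)
      qed
      ultimately have "norm (four (c t) - (\<Sum>k\<in>kball m. c t k *\<^sub>R phi k)) \<le> e / 2"
        by (intro LIMSEQ_le_const2) auto
      then show ?thesis using e by (simp add: dist_norm norm_minus_commute)
    qed
    then show "\<forall>\<^sub>F m in sequentially. \<forall>t\<in>I. dist (\<Sum>k\<in>kball m. c t k *\<^sub>R phi k) (four (c t)) < e"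
      by (auto simp: eventually_sequentially)
  qed
qed simp

section \<open>Sobolev norms and the forced flow\<close>

lemma Hs_diff: "u \<in> Hs s \<Longrightarrow> v \<in> Hs s \<Longrightarrow> u - v \<in> Hs s"
proof -
  assume "u \<in> Hs s" "v \<in> Hs s"
  then have "(\<lambda>k. 2 * (lam k powr s * (inner u (phi k))\<^sup>2) + 2 * (lam k powr s * (inner v (phi k))\<^sup>2)) summable_on kk"
    unfolding Hs_def by (intro summable_on_add summable_on_cmult_right) auto
  moreover have "lam k powr s * (inner (u - v) (phi k))\<^sup>2 \<le> 2 * (lam k powr s * (inner u (phi k))\<^sup>2) + 2 * (lam k powr s * (inner v (phi k))\<^sup>2)" for k
  proof -
    have "(inner (u - v) (phi k))\<^sup>2 \<le> 2 * (inner u (phi k))\<^sup>2 + 2 * (inner v (phi k))\<^sup>2"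
      using zero_le_power2[of "inner u (phi k) + inner v (phi k)"]
      by (simp add: inner_diff_left power2_eq_square algebra_simps)
    from mult_left_mono[OF this, of "lam k powr s"] show ?thesis by (simp add: algebra_simps)
  qed
  ultimately show ?thesis unfolding Hs_def
    by (auto intro: summable_on_comparison_test)
qed

text \<open>The power \<open>s / 2\<close> of the Stokes operator, isometric from the Sobolev space
  into H. It converts continuity of the forcing in the stronger norm into ordinary continuity, so
  that compactness of the time interval bounds it.\<close>

definition Hs_embed :: "real \<Rightarrow> hspace \<Rightarrow> hspace" where
  "Hs_embed s u = four (\<lambda>k. lam k powr (s / 2) * inner u (phi k))"

lemma powr_half_sq: "(x powr (s / 2))\<^sup>2 = x powr (s::real)"
  by (simp add: power2_eq_square flip: powr_add)

lemma Hs_embed: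
  assumes "u \<in> Hs s"
  shows inner_Hs_embed: "k \<in> kk \<Longrightarrow> inner (Hs_embed s u) (phi k) = lam k powr (s / 2) * inner u (phi k)"
    and norm_Hs_embed: "norm (Hs_embed s u) = Hs_norm s u"
proof -
  have sm: "(\<lambda>k. (lam k powr (s / 2) * inner u (phi k))\<^sup>2) summable_on kk"
    using assms by (simp add: Hs_def power_mult_distrib powr_half_sq)
  show 1: "inner (Hs_embed s u) (phi k) = lam k powr (s / 2) * inner u (phi k)" if "k \<in> kk" for k
    unfolding Hs_embed_def by (rule inner_four[OF sm that])
  have "(norm (Hs_embed s u))\<^sup>2 = (\<Sum>\<^sub>\<infinity>k\<in>kk. (inner (Hs_embed s u) (phi k))\<^sup>2)"
    by (rule infsumI[OF parseval, symmetric])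
  also have "\<dots> = (\<Sum>\<^sub>\<infinity>k\<in>kk. lam k powr s * (inner u (phi k))\<^sup>2)"
    by (intro infsum_cong) (simp add: 1 power_mult_distrib powr_half_sq)
  finally show "norm (Hs_embed s u) = Hs_norm s u"
    by (simp add: Hs_norm_def real_sqrt_unique)
qed

lemma Hs_sum_le:
  assumes "u \<in> Hs s" "finite F" "F \<subseteq> kk"
  shows "(\<Sum>k\<in>F. (lam k powr (s / 2) * inner u (phi k))\<^sup>2) \<le> (Hs_norm s u)\<^sup>2"
proof -
  have "(\<Sum>k\<in>F. (lam k powr (s / 2) * inner u (phi k))\<^sup>2) = (\<Sum>k\<in>F. (inner (Hs_embed s u) (phi k))\<^sup>2)"
    using assms by (intro sum.cong) (auto simp: inner_Hs_embed subset_iff)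
  also have "\<dots> \<le> (norm (Hs_embed s u))\<^sup>2" by (rule bessel[OF assms(2,3)])
  finally show ?thesis by (simp add: norm_Hs_embed assms(1))
qed

lemma Hs_norm_nonneg: "0 \<le> Hs_norm s u"
  unfolding Hs_norm_def by (intro real_sqrt_ge_zero infsum_nonneg) auto

locale stokes_forcing =
  fixes nu T \<gamma> :: real and \<psi> :: "real \<Rightarrow> hspace"
  assumes nu: "nu > 0" and T: "T > 0" and \<gamma>: "\<gamma> > 0" and \<psi>: "continuous_Hs \<gamma> {0..T} \<psi>"
begin

text \<open>The cap at 1 keeps the exponents \<open>1 - reg / 4\<close> and
  \<open>1 + reg / 4\<close> within the range of \<open>exp_minus_le_powr\<close>; the power
  \<open>reg / 2\<close> of \<open>lam\<close> is then still controlled by the forcing.\<close>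

definition reg where "reg = min \<gamma> 1"

lemma reg: "0 < reg" "reg \<le> 1" "reg \<le> \<gamma>" using \<gamma> by (auto simp: reg_def)

lemma psi_Hs: "t \<in> {0..T} \<Longrightarrow> \<psi> t \<in> Hs \<gamma>"
  using \<psi> by (simp add: continuous_Hs_def)

lemma continuous_on_embed_psi: "continuous_on {0..T} (\<lambda>t. Hs_embed \<gamma> (\<psi> t))"
  unfolding continuous_on_def
proof
  fix t assume t: "t \<in> {0..T}"
  have "((\<lambda>r. Hs_norm \<gamma> (\<psi> r - \<psi> t)) \<longlongrightarrow> 0) (at t within {0..T})"
    using \<psi> t by (simp add: continuous_Hs_def)
  moreover have "Hs_norm \<gamma> (\<psi> r - \<psi> t) = norm (Hs_embed \<gamma> (\<psi> r) - Hs_embed \<gamma> (\<psi> t))" if "r \<in> {0..T}" for r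
  proof -
    have "Hs_embed \<gamma> (\<psi> r) - Hs_embed \<gamma> (\<psi> t) = Hs_embed \<gamma> (\<psi> r - \<psi> t)"
      using psi_Hs[OF that] psi_Hs[OF t]
      by (intro hspace_eqI) (simp add: inner_Hs_embed Hs_diff inner_diff_left right_diff_distrib)
    then show ?thesis using psi_Hs[OF that] psi_Hs[OF t] by (simp add: norm_Hs_embed Hs_diff)
  qed
  ultimately have "((\<lambda>r. norm (Hs_embed \<gamma> (\<psi> r) - Hs_embed \<gamma> (\<psi> t))) \<longlongrightarrow> 0) (at t within {0..T})"
    by (elim Lim_transform_eventually) (auto simp: eventually_at_filter)
  then show "((\<lambda>t. Hs_embed \<gamma> (\<psi> t)) \<longlongrightarrow> Hs_embed \<gamma> (\<psi> t)) (at t within {0..T})"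
    by (simp add: tendsto_norm_zero_iff LIM_zero_iff)
qed

definition psi_sup where "psi_sup = (SOME b. b \<ge> 0 \<and> (\<forall>t\<in>{0..T}. Hs_norm \<gamma> (\<psi> t) \<le> b))"

lemma psi_sup: "psi_sup \<ge> 0" "t \<in> {0..T} \<Longrightarrow> Hs_norm \<gamma> (\<psi> t) \<le> psi_sup"
proof -
  have "bounded ((\<lambda>t. Hs_embed \<gamma> (\<psi> t)) ` {0..T})"
    by (intro compact_imp_bounded compact_continuous_image continuous_on_embed_psi) auto
  then obtain B where B: "\<forall>t\<in>{0..T}. norm (Hs_embed \<gamma> (\<psi> t)) \<le> B" unfolding bounded_iff by auto
  then have "\<bar>B\<bar> \<ge> 0 \<and> (\<forall>t\<in>{0..T}. Hs_norm \<gamma> (\<psi> t) \<le> \<bar>B\<bar>)"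
    using psi_Hs by (auto simp: norm_Hs_embed intro: order_trans[OF _ abs_ge_self])
  then have "psi_sup \<ge> 0 \<and> (\<forall>t\<in>{0..T}. Hs_norm \<gamma> (\<psi> t) \<le> psi_sup)"
    unfolding psi_sup_def by (rule someI)
  then show "psi_sup \<ge> 0" "t \<in> {0..T} \<Longrightarrow> Hs_norm \<gamma> (\<psi> t) \<le> psi_sup" by auto
qed

lemma psi_weight:
  assumes "t \<in> {0..T}" "finite F" "F \<subseteq> kk"
  shows "(\<Sum>k\<in>F. (lam k powr (reg / 2) * inner (\<psi> t) (phi k))\<^sup>2) \<le> psi_sup\<^sup>2"
proof -
  have "(\<Sum>k\<in>F. (lam k powr (reg / 2) * inner (\<psi> t) (phi k))\<^sup>2) \<le> (\<Sum>k\<in>F. (lam k powr (\<gamma> / 2) * inner (\<psi> t) (phi k))\<^sup>2)"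
    unfolding power_mult_distrib using assms reg lam_ge_1
    by (intro sum_mono mult_right_mono power_mono powr_mono) auto
  also have "\<dots> \<le> (Hs_norm \<gamma> (\<psi> t))\<^sup>2" by (intro Hs_sum_le psi_Hs assms)
  also have "\<dots> \<le> psi_sup\<^sup>2" using psi_sup(2)[OF assms(1)] by (intro power_mono Hs_norm_nonneg)
  finally show ?thesis .
qed

lemma continuous_on_psi_coeff:
  assumes "k \<in> kk" shows "continuous_on {0..T} (\<lambda>t. inner (\<psi> t) (phi k))"
proof -
  have "continuous_on {0..T} (\<lambda>t. inner (Hs_embed \<gamma> (\<psi> t)) (phi k) / lam k powr (\<gamma> / 2))"
    using lam_ge_1[OF assms] by (intro continuous_intros continuous_on_embed_psi) auto
  moreover have "inner (Hs_embed \<gamma> (\<psi> t)) (phi k) / lam k powr (\<gamma> / 2) = inner (\<psi> t) (phi k)" if "t \<in> {0..T}" for t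
    using lam_ge_1[OF assms] by (simp add: inner_Hs_embed[OF psi_Hs[OF that] assms])
  ultimately show ?thesis by (rule continuous_on_eq)
qed

text \<open>Variation of constants, mode by mode. Only \<open>heat\<close> depends on the initial
  value, so the forcing drops out of the difference of two solutions.\<close>

definition heat :: "hspace \<Rightarrow> int \<times> int \<Rightarrow> real \<Rightarrow> real" where
  "heat u k t = exp (- (nu * lam k * t)) * inner u (phi k)"

definition duhamel :: "int \<times> int \<Rightarrow> real \<Rightarrow> real" where
  "duhamel k t = exp (- (nu * lam k * t)) * integral {0..t} (\<lambda>r. exp (nu * lam k * r) * inner (\<psi> r) (phi k))"

lemma integral_exp_psi_derivative:
  assumes "k \<in> kk" "t \<in> {0..T}"
  shows "((\<lambda>t. integral {0..t} (\<lambda>r. exp (nu * lam k * r) * inner (\<psi> r) (phi k))) has_real_derivative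
     exp (nu * lam k * t) * inner (\<psi> t) (phi k)) (at t within {0..T})"
  by (rule integral_has_real_derivative) (auto intro!: continuous_intros continuous_on_psi_coeff assms(1) simp: assms(2)[simplified])

lemma duhamel_derivative:
  assumes "k \<in> kk" "t \<in> {0..T}"
  shows "(duhamel k has_real_derivative (inner (\<psi> t) (phi k) - nu * lam k * duhamel k t)) (at t within {0..T})"
  unfolding duhamel_def[abs_def]
  by (rule derivative_eq_intros integral_exp_psi_derivative assms refl)+ (simp add: algebra_simps exp_minus_inverse flip: exp_add)

text \<open>Pairing the vector of weighted coefficients with itself turns Minkowski's integral inequality into the
  scalar differential inequality \<open>|f'| \<le> D (t - r)\<^bsup>reg/4 - 1\<^esup>\<close>.\<close>

lemma duhamel_weight:
  assumes t: "t \<in> {0..T}" and F: "finite F" "F \<subseteq> kk"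
  shows "(\<Sum>k\<in>F. (lam k powr (1 + reg / 4) * duhamel k t)\<^sup>2) \<le> (8 * nu powr (reg / 4 - 1) * T powr (reg / 4) / reg * psi_sup)\<^sup>2"
proof (cases "t = 0")
  case True
  then show ?thesis by (simp add: duhamel_def)
next
  case False
  then have t0: "0 < t" "t \<le> T" using t by auto
  define W where "W = (\<Sum>k\<in>F. (lam k powr (1 + reg / 4) * duhamel k t)\<^sup>2)"
  \<comment> \<open>The dual vector: the weighted coefficients at the final time \<open>t\<close>,
    frozen while \<open>r\<close> varies. With it the scalar function \<open>f\<close> rises from 0
    at \<open>r = 0\<close> to exactly \<open>W\<close> at \<open>r = t\<close>.\<close>
  define b where "b k = lam k powr (1 + reg / 4) * duhamel k t" for k
  define a where "a k = b k * lam k powr (1 + reg / 4) * exp (- (nu * lam k * t))" for k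
  define f where "f r = (\<Sum>k\<in>F. a k * integral {0..r} (\<lambda>r. exp (nu * lam k * r) * inner (\<psi> r) (phi k)))" for r
  define f' where "f' r = (\<Sum>k\<in>F. a k * (exp (nu * lam k * r) * inner (\<psi> r) (phi k)))" for r
  define D where "D = 2 * nu powr (reg / 4 - 1) * sqrt W * psi_sup"
  have W0: "W \<ge> 0" unfolding W_def by (intro sum_nonneg) auto
  have fd: "(f has_real_derivative f' r) (at r within {0..T})" if "r \<in> {0..T}" for r
    unfolding f_def[abs_def] f'_def using F that
    by (intro DERIV_sum DERIV_cmult integral_exp_psi_derivative) auto
  \<comment> \<open>The comparison function is an antiderivative of the bound
    \<open>D * (t - r) powr (reg / 4 - 1)\<close>. It stays continuous at \<open>r = t\<close>,
    where its derivative blows up, and derivatives are needed only inside the interval.\<close>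
  have "norm (f t - f 0) \<le> (- (D / (reg / 4) * (t - t) powr (reg / 4))) - (- (D / (reg / 4) * (t - 0) powr (reg / 4)))"
  proof (rule differentiable_bound_general[where f = f and \<phi> = "\<lambda>r. - (D / (reg / 4) * (t - r) powr (reg / 4))"
        and f' = f' and \<phi>' = "\<lambda>r. D * (t - r) powr (reg / 4 - 1)"])
    show "continuous_on {0..t} f"
      using fd t0 by (intro continuous_on_subset[OF DERIV_continuous_on[of "{0..T}" f f']]) auto
    show "continuous_on {0..t} (\<lambda>r. - (D / (reg / 4) * (t - r) powr (reg / 4)))"
      using reg by (intro continuous_intros continuous_on_powr') auto
    fix r assume r: "0 < r" "r < t"
    have "(f has_real_derivative f' r) (at r within {0<..<T})"
      using fd[of r] r t0 by (auto intro: DERIV_subset)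
    moreover have "at r within {0<..<T} = at r" using r t0 by (intro at_within_open) auto
    ultimately show "(f has_vector_derivative f' r) (at r)"
      by (simp only: has_real_derivative_iff_has_vector_derivative)
    have "((\<lambda>r. - (D / (reg / 4) * (t - r) powr (reg / 4))) has_real_derivative D * (t - r) powr (reg / 4 - 1)) (at r)"
    proof -
      have "((\<lambda>r. (t - r) powr (reg / 4)) has_real_derivative (reg / 4 * (t - r) powr (reg / 4 - 1)) * (- 1)) (at r)"
        using r by (intro DERIV_chain2[OF has_real_derivative_powr]) (auto intro!: derivative_eq_intros)
      from DERIV_cmult[OF this, of "- (D / (reg / 4))"] show ?thesis using reg by simp
    qed
    then show "((\<lambda>r. - (D / (reg / 4) * (t - r) powr (reg / 4))) has_vector_derivative D * (t - r) powr (reg / 4 - 1)) (at r)"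
      by (simp add: has_real_derivative_iff_has_vector_derivative)
    have "\<bar>f' r\<bar> \<le> (\<Sum>k\<in>F. \<bar>b k\<bar> * (2 * (nu * (t - r)) powr (reg / 4 - 1) * \<bar>lam k powr (reg / 2) * inner (\<psi> r) (phi k)\<bar>))"
      unfolding f'_def
    proof (rule order_trans[OF sum_abs sum_mono])
      fix k assume "k \<in> F"
      then have l: "lam k > 0" using lam_ge_1[of k] F by force
      \<comment> \<open>Of the power \<open>1 + reg / 4\<close> the forcing provides
        \<open>reg / 2\<close>; the remaining \<open>1 - reg / 4\<close> is taken from the heat
        semigroup and leaves a singularity in time that is integrable.\<close>
      have "lam k powr (1 + reg / 4) * exp (- (nu * lam k * (t - r))) \<le> lam k powr (1 + reg / 4) * (2 * (nu * lam k * (t - r)) powr (- (1 - reg / 4)))"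
        using reg nu l r by (intro mult_left_mono exp_minus_le_powr) auto
      also have "\<dots> = 2 * (nu * (t - r)) powr (reg / 4 - 1) * (lam k powr (1 + reg / 4) * lam k powr (reg / 4 - 1))"
        using nu l r by (simp add: powr_mult mult_ac)
      also have "lam k powr (1 + reg / 4) * lam k powr (reg / 4 - 1) = lam k powr (reg / 2)"
        by (simp flip: powr_add)
      finally have e: "lam k powr (1 + reg / 4) * exp (- (nu * lam k * (t - r))) \<le> 2 * (nu * (t - r)) powr (reg / 4 - 1) * lam k powr (reg / 2)" .
      have "a k * (exp (nu * lam k * r) * inner (\<psi> r) (phi k)) = b k * (lam k powr (1 + reg / 4) * exp (- (nu * lam k * (t - r)))) * inner (\<psi> r) (phi k)"
        by (simp add: a_def algebra_simps flip: exp_add)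
      then have "\<bar>a k * (exp (nu * lam k * r) * inner (\<psi> r) (phi k))\<bar> = \<bar>b k\<bar> * (lam k powr (1 + reg / 4) * exp (- (nu * lam k * (t - r)))) * \<bar>inner (\<psi> r) (phi k)\<bar>"
        by (simp only: abs_mult abs_exp_cancel abs_of_nonneg[OF powr_ge_zero])
      also have "\<dots> \<le> \<bar>b k\<bar> * (2 * (nu * (t - r)) powr (reg / 4 - 1) * lam k powr (reg / 2)) * \<bar>inner (\<psi> r) (phi k)\<bar>"
        by (intro mult_right_mono mult_left_mono e) auto
      finally show "\<bar>a k * (exp (nu * lam k * r) * inner (\<psi> r) (phi k))\<bar>
          \<le> \<bar>b k\<bar> * (2 * (nu * (t - r)) powr (reg / 4 - 1) * \<bar>lam k powr (reg / 2) * inner (\<psi> r) (phi k)\<bar>)"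
        by (simp add: abs_mult mult_ac)
    qed
    also have "\<dots> = 2 * (nu * (t - r)) powr (reg / 4 - 1) * (\<Sum>k\<in>F. \<bar>b k\<bar> * \<bar>lam k powr (reg / 2) * inner (\<psi> r) (phi k)\<bar>)"
      by (simp add: sum_distrib_left mult_ac)
    also have "\<dots> \<le> 2 * (nu * (t - r)) powr (reg / 4 - 1) * (sqrt W * psi_sup)"
    proof (rule mult_left_mono)
      have "(\<Sum>k\<in>F. \<bar>b k\<bar> * \<bar>lam k powr (reg / 2) * inner (\<psi> r) (phi k)\<bar>)\<^sup>2 \<le> (\<Sum>k\<in>F. \<bar>b k\<bar>\<^sup>2) * (\<Sum>k\<in>F. \<bar>lam k powr (reg / 2) * inner (\<psi> r) (phi k)\<bar>\<^sup>2)"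
        by (rule Cauchy_Schwarz_ineq_sum)
      also have "\<dots> \<le> W * psi_sup\<^sup>2"
        using psi_weight[of r F] r t0 F W0 by (intro mult_mono) (auto simp: W_def b_def intro: sum_nonneg)
      also have "\<dots> = (sqrt W * psi_sup)\<^sup>2" using W0 by (simp add: power_mult_distrib)
      finally show "(\<Sum>k\<in>F. \<bar>b k\<bar> * \<bar>lam k powr (reg / 2) * inner (\<psi> r) (phi k)\<bar>) \<le> sqrt W * psi_sup"
        by (rule power2_le_imp_le) (use W0 psi_sup(1) in simp)
    qed simp
    also have "\<dots> = D * (t - r) powr (reg / 4 - 1)"
      using nu r by (simp add: D_def powr_mult)
    finally show "norm (f' r) \<le> D * (t - r) powr (reg / 4 - 1)" by simp
  qed (use t0 in auto)
  moreover have "f t = W"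
    by (simp add: f_def a_def W_def b_def duhamel_def power2_eq_square mult_ac)
  moreover have "f 0 = 0" by (simp add: f_def)
  ultimately have "W \<le> D / (reg / 4) * t powr (reg / 4)" using W0 by simp
  also have "\<dots> \<le> D / (reg / 4) * T powr (reg / 4)"
    using t0 reg psi_sup(1) W0 by (intro mult_left_mono powr_mono2) (auto simp: D_def)
  also have "\<dots> = sqrt W * (8 * nu powr (reg / 4 - 1) * T powr (reg / 4) / reg * psi_sup)"
    by (simp add: D_def)
  finally have *: "sqrt W * sqrt W \<le> sqrt W * (8 * nu powr (reg / 4 - 1) * T powr (reg / 4) / reg * psi_sup)" using W0 by simp
  then have "sqrt W \<le> 8 * nu powr (reg / 4 - 1) * T powr (reg / 4) / reg * psi_sup"
  proof (cases "W = 0")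
    case True
    then show ?thesis using reg psi_sup(1) by simp
  next
    case False
    then have "sqrt W > 0" using W0 by simp
    with * show ?thesis by (rule mult_left_le_imp_le)
  qed
  then have "(sqrt W)\<^sup>2 \<le> (8 * nu powr (reg / 4 - 1) * T powr (reg / 4) / reg * psi_sup)\<^sup>2"
    using W0 by (intro power_mono) auto
  then show ?thesis using W0 by (simp add: W_def[symmetric])
qed

end

lemma utail_cmult:
  assumes "utail I c" shows "utail I (\<lambda>t k. x * c t k)"
  unfolding utail_def
proof (intro allI impI)
  fix e :: real assume e: "e > 0"
  define y where "y = x\<^sup>2 + 1"
  have y: "y > 0" "x\<^sup>2 \<le> y" by (auto simp: y_def add_nonneg_pos)
  obtain n where n: "\<And>t F. t \<in> I \<Longrightarrow> finite F \<Longrightarrow> F \<subseteq> kk - kball n \<Longrightarrow> (\<Sum>k\<in>F. (c t k)\<^sup>2) \<le> e / y"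
    using utailE[OF assms, of "e / y"] e y by (metis divide_pos_pos)
  have "(\<Sum>k\<in>F. (x * c t k)\<^sup>2) \<le> e" if "t \<in> I" "finite F" "F \<subseteq> kk - kball n" for t F
  proof -
    have "(\<Sum>k\<in>F. (x * c t k)\<^sup>2) = x\<^sup>2 * (\<Sum>k\<in>F. (c t k)\<^sup>2)" by (simp add: power_mult_distrib sum_distrib_left)
    also have "\<dots> \<le> y * (e / y)" using n[OF that] y by (intro mult_mono) (auto intro: sum_nonneg)
    finally show ?thesis using y by simp
  qed
  then show "\<exists>n. \<forall>t\<in>I. \<forall>F. finite F \<longrightarrow> F \<subseteq> kk - kball n \<longrightarrow> (\<Sum>k\<in>F. (x * c t k)\<^sup>2) \<le> e" by blast
qed

lemma utail_subset: "utail J c \<Longrightarrow> I \<subseteq> J \<Longrightarrow> utail I c"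
  unfolding utail_def by (meson subsetD)

section \<open>The solution of the Stokes equation and its uniqueness\<close>

context stokes_forcing
begin

definition vcoef :: "hspace \<Rightarrow> real \<Rightarrow> int \<times> int \<Rightarrow> real" where
  "vcoef u t k = heat u k t + duhamel k t"

definition vs :: "hspace \<Rightarrow> real \<Rightarrow> hspace" where
  "vs u t = four (vcoef u t)"

lemma utail_heat: "utail {0..T} (\<lambda>t k. heat u k t)"
proof (rule utail_dominated[OF coefficients_summable[of u]])
  fix t k assume t: "t \<in> {0..T}"
  have "exp (- (nu * lam k * t)) \<le> 1" using nu t by simp
  then have "(exp (- (nu * lam k * t)))\<^sup>2 \<le> 1" by (intro power_le_one) auto
  then have "(exp (- (nu * lam k * t)))\<^sup>2 * (inner u (phi k))\<^sup>2 \<le> 1 * (inner u (phi k))\<^sup>2"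
    by (intro mult_right_mono) auto
  then show "(heat u k t)\<^sup>2 \<le> (inner u (phi k))\<^sup>2" by (simp only: heat_def power_mult_distrib)
qed

lemma utail_duhamel: "utail {0..T} (\<lambda>t k. duhamel k t)"
  by (rule utail_weight[of "1 + reg / 4"]) (use reg duhamel_weight in auto)

lemma utail_vcoef: "utail {0..T} (vcoef u)"
  unfolding vcoef_def[abs_def] by (intro utail_add utail_heat utail_duhamel)

lemma inner_vs: "t \<in> {0..T} \<Longrightarrow> k \<in> kk \<Longrightarrow> inner (vs u t) (phi k) = vcoef u t k"
  unfolding vs_def by (intro inner_four utail_summable[OF utail_vcoef])

lemma vcoef_derivative:
  assumes "k \<in> kk" "t \<in> {0..T}"
  shows "((\<lambda>t. vcoef u t k) has_real_derivative (inner (\<psi> t) (phi k) - nu * (lam k * vcoef u t k))) (at t within {0..T})"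
  unfolding vcoef_def heat_def
  by (rule derivative_eq_intros duhamel_derivative assms refl)+ (simp add: algebra_simps)

lemma continuous_on_vcoef: "k \<in> kk \<Longrightarrow> continuous_on {0..T} (\<lambda>t. vcoef u t k)"
  by (rule DERIV_continuous_on[OF vcoef_derivative])

lemma continuous_on_vs: "continuous_on {0..T} (vs u)"
  unfolding vs_def[abs_def] by (intro continuous_on_four continuous_on_vcoef utail_vcoef)

lemma utail_lam_duhamel: "utail {0..T} (\<lambda>t k. lam k * duhamel k t)"
proof (rule utail_weight[of "reg / 4"])
  fix t F assume t: "t \<in> {0..T}" and F: "finite F" "F \<subseteq> kk"
  have "(\<Sum>k\<in>F. (lam k powr (reg / 4) * (lam k * duhamel k t))\<^sup>2) = (\<Sum>k\<in>F. (lam k powr (1 + reg / 4) * duhamel k t)\<^sup>2)"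
  proof (intro sum.cong refl)
    fix k assume "k \<in> F"
    then have "lam k \<ge> 1" using F by (intro lam_ge_1) auto
    then show "(lam k powr (reg / 4) * (lam k * duhamel k t))\<^sup>2 = (lam k powr (1 + reg / 4) * duhamel k t)\<^sup>2"
      by (simp add: powr_add mult_ac)
  qed
  then show "(\<Sum>k\<in>F. (lam k powr (reg / 4) * (lam k * duhamel k t))\<^sup>2) \<le> (8 * nu powr (reg / 4 - 1) * T powr (reg / 4) / reg * psi_sup)\<^sup>2"
    using duhamel_weight[OF t F] by simp
qed (use reg in simp)

text \<open>Here the times stay above \<open>a > 0\<close>: the initial value is only in H, and the
  factor gained by smoothing blows up as time tends to 0.\<close>

lemma utail_lam_heat:
  assumes a: "a > 0" shows "utail {a..T} (\<lambda>t k. lam k * heat u k t)"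
proof (rule utail_weight[of "reg / 4"])
  let ?p = "1 + reg / 4"
  define D where "D = 2 * (nu * a) powr (- ?p)"
  fix t F assume t: "t \<in> {a..T}" and F: "finite F" "F \<subseteq> kk"
  have le: "\<bar>lam k powr (reg / 4) * (lam k * heat u k t)\<bar> \<le> D * \<bar>inner u (phi k)\<bar>" if "k \<in> F" for k
  proof -
    have l: "lam k \<ge> 1" using that F by (intro lam_ge_1) auto
    have "lam k powr ?p * exp (- (nu * lam k * t)) \<le> lam k powr ?p * (2 * (nu * lam k * t) powr (- ?p))"
      using reg nu l t a by (intro mult_left_mono exp_minus_le_powr) auto
    also have "\<dots> = 2 * (nu * t) powr (- ?p) * (lam k powr ?p * lam k powr (- ?p))"
      using nu l t a by (simp add: powr_mult mult_ac)
    also have "lam k powr ?p * lam k powr (- ?p) = 1"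
      using l by (subst powr_add[symmetric]) simp
    also have "2 * (nu * t) powr (- ?p) * 1 \<le> D"
      unfolding D_def using t a nu reg by (auto intro!: powr_mono2')
    finally have *: "lam k powr ?p * exp (- (nu * lam k * t)) \<le> D" .
    have "lam k powr (reg / 4) * (lam k * heat u k t) = (lam k powr ?p * exp (- (nu * lam k * t))) * inner u (phi k)"
      using l by (simp add: heat_def powr_add mult_ac)
    then have "\<bar>lam k powr (reg / 4) * (lam k * heat u k t)\<bar> = (lam k powr ?p * exp (- (nu * lam k * t))) * \<bar>inner u (phi k)\<bar>"
      by (simp only: abs_mult abs_exp_cancel abs_of_nonneg[OF powr_ge_zero])
    also have "\<dots> \<le> D * \<bar>inner u (phi k)\<bar>" by (intro mult_right_mono *) auto
    finally show ?thesis .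
  qed
  have "(\<Sum>k\<in>F. (lam k powr (reg / 4) * (lam k * heat u k t))\<^sup>2) \<le> (\<Sum>k\<in>F. (D * \<bar>inner u (phi k)\<bar>)\<^sup>2)"
    using power_mono[OF le, of _ 2] by (intro sum_mono) auto
  also have "\<dots> = D\<^sup>2 * (\<Sum>k\<in>F. (inner u (phi k))\<^sup>2)" by (simp add: power_mult_distrib sum_distrib_left)
  also have "\<dots> \<le> D\<^sup>2 * (norm u)\<^sup>2" by (intro mult_left_mono bessel F) auto
  finally show "(\<Sum>k\<in>F. (lam k powr (reg / 4) * (lam k * heat u k t))\<^sup>2) \<le> (2 * (nu * a) powr (- ?p))\<^sup>2 * (norm u)\<^sup>2"
    by (simp add: D_def)
qed (use reg in simp)

definition vrate :: "hspace \<Rightarrow> real \<Rightarrow> int \<times> int \<Rightarrow> real" where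
  "vrate u t k = inner (\<psi> t) (phi k) - nu * (lam k * vcoef u t k)"

lemma utail_lam_vcoef:
  assumes "a > 0" shows "utail {a..T} (\<lambda>t k. lam k * vcoef u t k)"
  unfolding vcoef_def distrib_left using assms
  by (intro utail_add utail_lam_heat utail_subset[OF utail_lam_duhamel]) auto

lemma utail_vrate:
  assumes "a > 0" shows "utail {a..T} (vrate u)"
proof -
  have "utail {0..T} (\<lambda>t k. inner (\<psi> t) (phi k))"
    by (rule utail_weight[of "reg / 2"]) (use reg psi_weight in auto)
  then have "utail {a..T} (\<lambda>t k. inner (\<psi> t) (phi k))" using assms by (elim utail_subset) auto
  then have "utail {a..T} (\<lambda>t k. inner (\<psi> t) (phi k) + (- nu) * (lam k * vcoef u t k))"
    by (intro utail_add utail_cmult utail_lam_vcoef assms)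
  then show ?thesis by (simp add: vrate_def[abs_def])
qed

lemma vs_in_stokes_dom: assumes "t \<in> {0<..T}" shows "vs u t \<in> stokes_dom"
proof (rule stokes_domI)
  have "(\<lambda>k. (lam k * vcoef u t k)\<^sup>2) summable_on kk"
    by (rule utail_summable[OF utail_lam_vcoef[of t]]) (use assms in auto)
  then show "(\<lambda>k. (lam k * inner (vs u t) (phi k))\<^sup>2) summable_on kk"
    using assms by (elim summable_on_cong[THEN iffD1, rotated]) (simp add: inner_vs)
qed

lemma continuous_on_vrate: "k \<in> kk \<Longrightarrow> continuous_on {0..T} (\<lambda>t. vrate u t k)"
  unfolding vrate_def by (intro continuous_intros continuous_on_psi_coeff continuous_on_vcoef)

text \<open>The candidate derivative is integrated from the intermediate time t/2, away from the
  singularity at 0. Comparing coefficients shows that the integral recovers the increment of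
  \<open>vs u\<close>, and the fundamental theorem of calculus then gives differentiability in
  H.\<close>

lemma vs_derivative:
  assumes t: "t \<in> {0<..T}"
  shows "(vs u has_vector_derivative four (vrate u t)) (at t within {0..T})"
proof -
  define a where "a = t / 2"
  have a: "0 < a" "a < t" "a \<le> T" using t by (auto simp: a_def)
  have c: "continuous_on {a..T} (\<lambda>s. four (vrate u s))"
    using a by (intro continuous_on_four utail_vrate continuous_on_subset[OF continuous_on_vrate]) auto
  have eq: "vs u s = vs u a + integral {a..s} (\<lambda>r. four (vrate u r))" if s: "s \<in> {a..T}" for s
  proof (rule hspace_eqI)
    fix k assume k: "k \<in> kk"
    have "inner (integral {a..s} (\<lambda>r. four (vrate u r))) (phi k) = integral {a..s} (\<lambda>r. inner (four (vrate u r)) (phi k))"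
      using integral_linear[OF integrable_continuous_interval[OF continuous_on_subset[OF c]] bounded_linear_inner_left, of a s "phi k"] s
      by (simp add: o_def)
    also have "\<dots> = integral {a..s} (\<lambda>r. vrate u r k)"
      using s a by (intro integral_cong inner_four[OF utail_summable[OF utail_vrate[of a]] k]) auto
    also have "\<dots> = vcoef u s k - vcoef u a k"
    proof (rule integral_unique, rule fundamental_theorem_of_calculus)
      fix r assume r: "r \<in> {a..s}"
      then have "((\<lambda>t. vcoef u t k) has_real_derivative vrate u r k) (at r within {a..s})"
        unfolding vrate_def using s a by (intro DERIV_subset[OF vcoef_derivative[OF k]]) auto
      then show "((\<lambda>t. vcoef u t k) has_vector_derivative vrate u r k) (at r within {a..s})"
        by (simp only: has_real_derivative_iff_has_vector_derivative)
    qed (use s in auto)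
    finally show "inner (vs u s) (phi k) = inner (vs u a + integral {a..s} (\<lambda>r. four (vrate u r))) (phi k)"
      using s a k by (simp add: inner_add_left inner_vs)
  qed
  have "((\<lambda>s. vs u a + integral {a..s} (\<lambda>r. four (vrate u r))) has_vector_derivative 0 + four (vrate u t)) (at t within {a..T})"
    using a t by (intro has_vector_derivative_add has_vector_derivative_const integral_has_vector_derivative c) auto
  then have "(vs u has_vector_derivative four (vrate u t)) (at t within {a..T})"
    by (intro has_vector_derivative_transform[OF _ eq]) (use a t in auto)
  moreover have "at t within {a..T} = at t within {0..T}"
    using a t by (intro at_within_nhd[of _ "{a<..}"]) auto
  ultimately show ?thesis by simp
qed

lemma vrate_eq:
  assumes "t \<in> {0<..T}" shows "four (vrate u t) = \<psi> t - nu *\<^sub>R stokes (vs u t)"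
proof (rule hspace_eqI)
  fix k assume k: "k \<in> kk"
  have "inner (four (vrate u t)) (phi k) = vrate u t k"
    using assms by (intro inner_four[OF utail_summable[OF utail_vrate[of t]] k]) auto
  then show "inner (four (vrate u t)) (phi k) = inner (\<psi> t - nu *\<^sub>R stokes (vs u t)) (phi k)"
    using assms k by (simp add: inner_diff_left stokes_coefficient vs_in_stokes_dom inner_vs vrate_def)
qed

lemma vs_0: "vs u 0 = u"
proof -
  have "vcoef u 0 = (\<lambda>k. inner u (phi k))" by (simp add: vcoef_def heat_def duhamel_def fun_eq_iff)
  then show ?thesis by (simp add: vs_def four_inner)
qed

lemma stokes_solution_vs: "stokes_solution nu T \<psi> u (vs u)"
  unfolding stokes_solution_def
  using continuous_on_vs vs_0 vs_in_stokes_dom vs_derivative by (simp add: vrate_eq)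

text \<open>Any solution satisfies the scalar equation of each mode, so with the integrating factor
  the difference from \<open>vcoef\<close> has zero derivative on the open interval. Continuity
  carries this down to time 0, where the equation itself is not imposed.\<close>

lemma stokes_solution_unique:
  assumes v: "stokes_solution nu T \<psi> u v" and t: "t \<in> {0..T}"
  shows "v t = vs u t"
proof (rule hspace_eqI)
  fix k assume k: "k \<in> kk"
  define d where "d r = exp (nu * lam k * r) * (inner (v r) (phi k) - vcoef u r k)" for r
  have "norm (d t - d 0) \<le> 0"
  proof (cases "t = 0")
    case False
    then have t0: "0 < t" "t \<le> T" using t by auto
    have "norm (d t - d 0) \<le> (0::real) - 0"
    proof (rule differentiable_bound_general[where f = d and \<phi> = "\<lambda>_. 0" and \<phi>' = "\<lambda>_. 0" and f' = "\<lambda>_. 0", OF t0(1)])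
      show "continuous_on {0..t} d"
        unfolding d_def[abs_def] using v t0 k
        by (intro continuous_intros continuous_on_subset[OF continuous_on_vcoef]) (auto simp: stokes_solution_def intro: continuous_on_subset)
      fix r assume r: "0 < r" "r < t"
      then have rT: "r \<in> {0<..T}" "r \<in> {0..T}" using t0 by auto
      have at: "at r within {0..T} = at r" using r t0 by (intro at_within_interior) auto
      have dom: "v r \<in> stokes_dom" using v rT by (auto simp: stokes_solution_def)
      have "(v has_vector_derivative (\<psi> r - nu *\<^sub>R stokes (v r))) (at r)"
        using v rT at unfolding stokes_solution_def by metis
      from has_derivative_inner_left[OF this[unfolded has_vector_derivative_def], of "phi k"]
      have "((\<lambda>r. inner (v r) (phi k)) has_real_derivative (inner (\<psi> r) (phi k) - nu * (lam k * inner (v r) (phi k)))) (at r)"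
        by (simp add: has_field_derivative_def inner_diff_left stokes_coefficient[OF dom k] mult_commute_abs)
      moreover have "((\<lambda>t. vcoef u t k) has_real_derivative (inner (\<psi> r) (phi k) - nu * (lam k * vcoef u r k))) (at r)"
        using vcoef_derivative[OF k rT(2)] at by simp
      ultimately have "((\<lambda>r. inner (v r) (phi k) - vcoef u r k) has_real_derivative
          (inner (\<psi> r) (phi k) - nu * (lam k * inner (v r) (phi k))) - (inner (\<psi> r) (phi k) - nu * (lam k * vcoef u r k))) (at r)"
        by (rule DERIV_diff)
      moreover have "((\<lambda>r. exp (nu * lam k * r)) has_real_derivative exp (nu * lam k * r) * (nu * lam k)) (at r)"
        by (auto intro!: derivative_eq_intros)
      ultimately have "(d has_real_derivative (exp (nu * lam k * r) * (nu * lam k)) * (inner (v r) (phi k) - vcoef u r k) +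
          ((inner (\<psi> r) (phi k) - nu * (lam k * inner (v r) (phi k))) - (inner (\<psi> r) (phi k) - nu * (lam k * vcoef u r k))) * exp (nu * lam k * r)) (at r)"
        unfolding d_def[abs_def] by (intro DERIV_mult)
      then have "(d has_real_derivative 0) (at r)"
        by (rule DERIV_cong) (simp add: algebra_simps)
      then show "(d has_vector_derivative 0) (at r)"
        by (simp only: has_real_derivative_iff_has_vector_derivative)
    qed auto
    then show ?thesis by simp
  qed simp
  moreover have "d 0 = 0"
    using v by (simp add: d_def stokes_solution_def vcoef_def heat_def duhamel_def)
  ultimately have "d t = 0" by simp
  then show "inner (v t) (phi k) = inner (vs u t) (phi k)"
    by (simp add: d_def inner_vs[OF t k])
qed

end

section \<open>Size and spatial Lipschitz constant of the velocity field\<close>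

context stokes_forcing
begin

lemma kabs_le_sqrt_lam: "kabs k \<le> sqrt (lam k)"
  using kabs_sq_le_lam by (intro real_le_rsqrt) simp

text \<open>\<open>Ch\<close> and \<open>CH\<close> come from the square roots of the bounds in
  \<open>sum_exp_lam_le\<close> and \<open>sum_lam_exp_lam_le\<close> with a = 2 nu s and A = 2 nu
  T; the powers of s are split off.\<close>

definition CH where "CH = 2 * (sqrt (2 * nu * T) + 4) / (2 * nu)"
definition Ch where "Ch = (sqrt (2 * nu * T) + 4) / sqrt (2 * nu)"

lemma CH_nonneg: "CH \<ge> 0" and Ch_nonneg: "Ch \<ge> 0"
  using nu T by (auto simp: CH_def Ch_def)

lemma exp_sq: "(exp (- (nu * lam k * s)))\<^sup>2 = exp (- (2 * nu * s) * lam k)"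
  by (simp add: power2_eq_square flip: exp_add)

lemma heat_abs:
  assumes s: "s \<in> {0<..T}"
  shows "(\<lambda>k. \<bar>heat u k s\<bar>) summable_on kk" and "(\<Sum>\<^sub>\<infinity>k\<in>kk. \<bar>heat u k s\<bar>) \<le> Ch / sqrt s * norm u"
proof -
  have a: "(\<Sum>k\<in>F. (exp (- (nu * lam k * s)))\<^sup>2) \<le> (Ch / sqrt s)\<^sup>2" if "finite F" "F \<subseteq> kk" for F
  proof -
    have "(\<Sum>k\<in>F. (exp (- (nu * lam k * s)))\<^sup>2) \<le> (sqrt (2 * nu * T) + 4)\<^sup>2 / (2 * nu * s)"
      unfolding exp_sq using that s nu by (intro sum_exp_lam_le) auto
    also have "\<dots> = (Ch / sqrt s)\<^sup>2" using nu s by (simp add: Ch_def power_divide power_mult_distrib)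
    finally show ?thesis .
  qed
  have n: "Ch / sqrt s \<ge> 0" using Ch_nonneg s by simp
  show "(\<lambda>k. \<bar>heat u k s\<bar>) summable_on kk" "(\<Sum>\<^sub>\<infinity>k\<in>kk. \<bar>heat u k s\<bar>) \<le> Ch / sqrt s * norm u"
    by (rule Cauchy_Schwarz_kk[OF a n, where b = "\<lambda>k. inner u (phi k)" and B = "norm u"];
        auto simp: heat_def abs_mult intro: bessel)+
qed

text \<open>The critical estimate: the bound CH/s is not integrable at 0, but it is proportional to
  \<open>norm u\<close>, so it can be made small on the high modes.\<close>

lemma heat_kabs:
  assumes s: "s \<in> {0<..T}"
  shows "(\<lambda>k. kabs k * \<bar>heat u k s\<bar>) summable_on kk" and "(\<Sum>\<^sub>\<infinity>k\<in>kk. kabs k * \<bar>heat u k s\<bar>) \<le> CH / s * norm u"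
proof -
  have a: "(\<Sum>k\<in>F. (sqrt (lam k) * exp (- (nu * lam k * s)))\<^sup>2) \<le> (CH / s)\<^sup>2" if "finite F" "F \<subseteq> kk" for F
  proof -
    have "(\<Sum>k\<in>F. (sqrt (lam k) * exp (- (nu * lam k * s)))\<^sup>2) = (\<Sum>k\<in>F. lam k * exp (- (2 * nu * s) * lam k))"
      by (intro sum.cong refl) (simp only: power_mult_distrib exp_sq real_sqrt_pow2[OF lam_nonneg])
    also have "\<dots> \<le> (2 * (sqrt (2 * nu * T) + 4) / (2 * nu * s))\<^sup>2"
      using that s nu by (intro sum_lam_exp_lam_le) auto
    also have "\<dots> = (CH / s)\<^sup>2" by (simp add: CH_def mult_ac)
    finally show ?thesis .
  qed
  have n: "CH / s \<ge> 0" using CH_nonneg s by simp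
  have c: "0 \<le> kabs k * \<bar>heat u k s\<bar> \<and> kabs k * \<bar>heat u k s\<bar> \<le> \<bar>sqrt (lam k) * exp (- (nu * lam k * s)) * inner u (phi k)\<bar>" for k
    using kabs_le_sqrt_lam[of k] by (simp add: heat_def abs_mult mult.assoc mult_right_mono)
  show "(\<lambda>k. kabs k * \<bar>heat u k s\<bar>) summable_on kk" "(\<Sum>\<^sub>\<infinity>k\<in>kk. kabs k * \<bar>heat u k s\<bar>) \<le> CH / s * norm u"
    by (rule Cauchy_Schwarz_kk[OF a n, where b = "\<lambda>k. inner u (phi k)" and B = "norm u"];
        use c in \<open>auto intro: bessel\<close>)+
qed

text \<open>With \<sigma> derivatives on the initial value the Lipschitz bound becomes integrable in
  time. Cauchy-Schwarz pairs the Sobolev coefficients with a kernel whose exponent is shared between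
  summability over the lattice and decay in time.\<close>

lemma heat_kabs_Hs:
  assumes \<sigma>: "0 < \<sigma>" "\<sigma> \<le> 1"
  shows "\<exists>C\<ge>0. \<forall>u\<in>Hs \<sigma>. \<forall>s\<in>{0<..T}. (\<Sum>\<^sub>\<infinity>k\<in>kk. kabs k * \<bar>heat u k s\<bar>) \<le> C * s powr (\<sigma> / 4 - 1) * Hs_norm \<sigma> u"
proof -
  define Z where "Z = (\<Sum>\<^sub>\<infinity>k\<in>kk. lam k powr (- (1 + \<sigma> / 2)))"
  have Zs: "(\<lambda>k. lam k powr (- (1 + \<sigma> / 2))) summable_on kk" using \<sigma> by (intro lam_powr_summable) auto
  have Z: "Z \<ge> 0" unfolding Z_def by (intro infsum_nonneg) auto
  \<comment> \<open>This exponent leaves \<open>lam k powr (- (1 + \<sigma> / 2))\<close>, which is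
    still summable, while the square root of s to the power -p is s to the power \<sigma>/4 -
    1.\<close>
  define p where "p = 2 - \<sigma> / 2"
  define C where "C = sqrt (2 * (2 * nu) powr (- p) * Z)"
  have C: "C \<ge> 0" using Z by (simp add: C_def)
  have "(\<Sum>\<^sub>\<infinity>k\<in>kk. kabs k * \<bar>heat u k s\<bar>) \<le> C * s powr (\<sigma> / 4 - 1) * Hs_norm \<sigma> u" if u: "u \<in> Hs \<sigma>" and s: "s \<in> {0<..T}" for u s
  proof -
    let ?a = "\<lambda>k. lam k powr ((1 - \<sigma>) / 2) * exp (- (nu * lam k * s))"
    have a: "(\<Sum>k\<in>F. (?a k)\<^sup>2) \<le> (C * s powr (\<sigma> / 4 - 1))\<^sup>2" if F: "finite F" "F \<subseteq> kk" for F
    proof -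
      have "(\<Sum>k\<in>F. (?a k)\<^sup>2) \<le> (\<Sum>k\<in>F. 2 * (2 * nu * s) powr (- p) * lam k powr (- (1 + \<sigma> / 2)))"
      proof (rule sum_mono)
        fix k assume "k \<in> F"
        then have l: "lam k \<ge> 1" using F by (intro lam_ge_1) auto
        have "(?a k)\<^sup>2 = lam k powr (1 - \<sigma>) * exp (- (2 * nu * s * lam k))"
          by (simp only: power_mult_distrib powr_half_sq exp_sq) simp
        also have "\<dots> \<le> lam k powr (1 - \<sigma>) * (2 * (2 * nu * s * lam k) powr (- p))"
          using nu s l \<sigma> by (intro mult_left_mono exp_minus_le_powr) (auto simp: p_def)
        also have "\<dots> = 2 * (2 * nu * s) powr (- p) * (lam k powr (1 - \<sigma>) * lam k powr (- p))"
          using nu s l by (simp add: powr_mult mult_ac)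
        also have "lam k powr (1 - \<sigma>) * lam k powr (- p) = lam k powr (- (1 + \<sigma> / 2))"
          by (subst powr_add[symmetric]) (rule arg_cong[of _ _ "(powr) (lam k)"], simp add: p_def)
        finally show "(?a k)\<^sup>2 \<le> 2 * (2 * nu * s) powr (- p) * lam k powr (- (1 + \<sigma> / 2))" .
      qed
      also have "\<dots> = 2 * (2 * nu * s) powr (- p) * (\<Sum>k\<in>F. lam k powr (- (1 + \<sigma> / 2)))"
        by (simp add: sum_distrib_left)
      also have "\<dots> \<le> 2 * (2 * nu * s) powr (- p) * Z"
        unfolding Z_def using F by (intro mult_left_mono finite_sum_le_infsum Zs) auto
      also have "\<dots> = (C * s powr (\<sigma> / 4 - 1))\<^sup>2"
      proof -
        have "(s powr (\<sigma> / 4 - 1))\<^sup>2 = s powr (- p)" by (simp add: power2_eq_square p_def flip: powr_add)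
        then show ?thesis using nu s Z by (simp add: C_def power_mult_distrib powr_mult)
      qed
      finally show ?thesis .
    qed
    have n: "C * s powr (\<sigma> / 4 - 1) \<ge> 0" using C by simp
    have c: "0 \<le> kabs k * \<bar>heat u k s\<bar> \<and> kabs k * \<bar>heat u k s\<bar> \<le> \<bar>?a k * (lam k powr (\<sigma> / 2) * inner u (phi k))\<bar>" if "k \<in> kk" for k
    proof -
      have l: "lam k \<ge> 1" by (rule lam_ge_1[OF that])
      have "sqrt (lam k) = lam k powr ((1 - \<sigma>) / 2 + \<sigma> / 2)"
        using l by (simp add: powr_half_sqrt flip: add_divide_distrib)
      then have "kabs k \<le> lam k powr ((1 - \<sigma>) / 2) * lam k powr (\<sigma> / 2)"
        using kabs_le_sqrt_lam[of k] by (simp only: powr_add)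
      then have "kabs k * \<bar>heat u k s\<bar> \<le> (lam k powr ((1 - \<sigma>) / 2) * lam k powr (\<sigma> / 2)) * \<bar>heat u k s\<bar>"
        by (intro mult_right_mono) auto
      then show ?thesis by (simp add: heat_def abs_mult mult_ac)
    qed
    show ?thesis
      by (rule Cauchy_Schwarz_kk(2)[OF a n Hs_sum_le[OF u] Hs_norm_nonneg c])
  qed
  then show ?thesis using C by blast
qed

text \<open>The weight \<open>1 + reg / 4\<close> in \<open>duhamel_weight\<close> exceeds what a
  Lipschitz bound costs by enough to leave a summable kernel. So the forced part of the velocity is
  Lipschitz in space uniformly up to time 0.\<close>

lemma duhamel_kabs:
  "\<exists>C\<ge>0. \<forall>t\<in>{0..T}. (\<lambda>k. kabs k * \<bar>duhamel k t\<bar>) summable_on kk \<and> (\<Sum>\<^sub>\<infinity>k\<in>kk. kabs k * \<bar>duhamel k t\<bar>) \<le> C"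
proof -
  define Z where "Z = (\<Sum>\<^sub>\<infinity>k\<in>kk. lam k powr (- (1 + reg / 2)))"
  have Zs: "(\<lambda>k. lam k powr (- (1 + reg / 2))) summable_on kk" using reg by (intro lam_powr_summable) auto
  have Z: "Z \<ge> 0" unfolding Z_def by (intro infsum_nonneg) auto
  define B where "B = 8 * nu powr (reg / 4 - 1) * T powr (reg / 4) / reg * psi_sup"
  have B: "B \<ge> 0" using reg psi_sup(1) by (simp add: B_def)
  let ?a = "\<lambda>k. lam k powr (- (1 + reg / 2) / 2)"
  have a: "(\<Sum>k\<in>F. (?a k)\<^sup>2) \<le> (sqrt Z)\<^sup>2" if F: "finite F" "F \<subseteq> kk" for F
    using finite_sum_le_infsum[OF Zs F] Z by (simp only: powr_half_sq) (simp add: Z_def)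
  have c: "0 \<le> kabs k * \<bar>duhamel k t\<bar> \<and> kabs k * \<bar>duhamel k t\<bar> \<le> \<bar>?a k * (lam k powr (1 + reg / 4) * duhamel k t)\<bar>" if "k \<in> kk" for k t
  proof -
    have l: "lam k \<ge> 1" by (rule lam_ge_1[OF that])
    have "?a k * lam k powr (1 + reg / 4) = lam k powr (1 / 2)"
      by (subst powr_add[symmetric]) (simp add: field_simps)
    then have "kabs k \<le> ?a k * lam k powr (1 + reg / 4)"
      using kabs_le_sqrt_lam[of k] l by (simp add: powr_half_sqrt)
    then have "kabs k * \<bar>duhamel k t\<bar> \<le> (?a k * lam k powr (1 + reg / 4)) * \<bar>duhamel k t\<bar>"
      by (intro mult_right_mono) auto
    then show ?thesis by (simp add: abs_mult mult_ac)
  qed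
  have "(\<lambda>k. kabs k * \<bar>duhamel k t\<bar>) summable_on kk \<and> (\<Sum>\<^sub>\<infinity>k\<in>kk. kabs k * \<bar>duhamel k t\<bar>) \<le> sqrt Z * B" if t: "t \<in> {0..T}" for t
    using Cauchy_Schwarz_kk[OF a _ duhamel_weight[OF t, folded B_def] B c] Z by simp
  moreover have "sqrt Z * B \<ge> 0" using Z B by simp
  ultimately show ?thesis by blast
qed

definition Cd where "Cd = (SOME C. C \<ge> 0 \<and> (\<forall>t\<in>{0..T}. (\<lambda>k. kabs k * \<bar>duhamel k t\<bar>) summable_on kk \<and> (\<Sum>\<^sub>\<infinity>k\<in>kk. kabs k * \<bar>duhamel k t\<bar>) \<le> C))"

lemma Cd: "Cd \<ge> 0"
  "t \<in> {0..T} \<Longrightarrow> (\<lambda>k. kabs k * \<bar>duhamel k t\<bar>) summable_on kk"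
  "t \<in> {0..T} \<Longrightarrow> (\<Sum>\<^sub>\<infinity>k\<in>kk. kabs k * \<bar>duhamel k t\<bar>) \<le> Cd"
proof -
  have "Cd \<ge> 0 \<and> (\<forall>t\<in>{0..T}. (\<lambda>k. kabs k * \<bar>duhamel k t\<bar>) summable_on kk \<and> (\<Sum>\<^sub>\<infinity>k\<in>kk. kabs k * \<bar>duhamel k t\<bar>) \<le> Cd)"
    unfolding Cd_def by (rule someI_ex) (use duhamel_kabs in blast)
  then show "Cd \<ge> 0"
    "t \<in> {0..T} \<Longrightarrow> (\<lambda>k. kabs k * \<bar>duhamel k t\<bar>) summable_on kk"
    "t \<in> {0..T} \<Longrightarrow> (\<Sum>\<^sub>\<infinity>k\<in>kk. kabs k * \<bar>duhamel k t\<bar>) \<le> Cd"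
    by blast+
qed

lemma duhamel_abs:
  assumes "t \<in> {0..T}"
  shows "(\<lambda>k. \<bar>duhamel k t\<bar>) summable_on kk" "(\<Sum>\<^sub>\<infinity>k\<in>kk. \<bar>duhamel k t\<bar>) \<le> Cd"
proof -
  have le: "\<bar>duhamel k t\<bar> \<le> kabs k * \<bar>duhamel k t\<bar>" if "k \<in> kk" for k
    using mult_right_mono[OF kabs_ge_1[OF that], of "\<bar>duhamel k t\<bar>"] by simp
  show s: "(\<lambda>k. \<bar>duhamel k t\<bar>) summable_on kk"
    by (rule summable_on_comparison_test[OF Cd(2)[OF assms]]) (use le in auto)
  show "(\<Sum>\<^sub>\<infinity>k\<in>kk. \<bar>duhamel k t\<bar>) \<le> Cd"
    using infsum_mono[OF s Cd(2)[OF assms] le] Cd(3)[OF assms] by linarith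
qed

definition lip :: "hspace \<Rightarrow> real \<Rightarrow> real" where
  "lip u s = 2 * pi * sqrt 2 * ((\<Sum>\<^sub>\<infinity>k\<in>kk. kabs k * \<bar>heat u k s\<bar>) + Cd)"

definition vel :: "hspace \<Rightarrow> real \<Rightarrow> real^2 \<Rightarrow> real^2" where
  "vel u s = per_ext (vs u s)"

lemma vs_summable:
  assumes s: "s \<in> {0<..T}"
  shows "(\<lambda>k. \<bar>inner (vs u s) (phi k)\<bar>) summable_on kk"
    and "(\<Sum>\<^sub>\<infinity>k\<in>kk. \<bar>inner (vs u s) (phi k)\<bar>) \<le> Ch / sqrt s * norm u + Cd"
    and "(\<lambda>k. kabs k * \<bar>inner (vs u s) (phi k)\<bar>) summable_on kk"
    and "2 * pi * sqrt 2 * (\<Sum>\<^sub>\<infinity>k\<in>kk. kabs k * \<bar>inner (vs u s) (phi k)\<bar>) \<le> lip u s"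
proof -
  have s': "s \<in> {0..T}" using s by auto
  have i: "inner (vs u s) (phi k) = heat u k s + duhamel k s" if "k \<in> kk" for k
    using inner_vs[OF s' that] by (simp add: vcoef_def)
  have sm: "(\<lambda>k. \<bar>heat u k s\<bar> + \<bar>duhamel k s\<bar>) summable_on kk"
    by (intro summable_on_add heat_abs duhamel_abs s s')
  have le: "\<bar>inner (vs u s) (phi k)\<bar> \<le> \<bar>heat u k s\<bar> + \<bar>duhamel k s\<bar>" if "k \<in> kk" for k
    using i[OF that] by simp
  show 1: "(\<lambda>k. \<bar>inner (vs u s) (phi k)\<bar>) summable_on kk"
    by (rule summable_on_comparison_test[OF sm]) (use le in auto)
  have "(\<Sum>\<^sub>\<infinity>k\<in>kk. \<bar>inner (vs u s) (phi k)\<bar>) \<le> (\<Sum>\<^sub>\<infinity>k\<in>kk. \<bar>heat u k s\<bar> + \<bar>duhamel k s\<bar>)"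
    by (rule infsum_mono[OF 1 sm le])
  also have "\<dots> = (\<Sum>\<^sub>\<infinity>k\<in>kk. \<bar>heat u k s\<bar>) + (\<Sum>\<^sub>\<infinity>k\<in>kk. \<bar>duhamel k s\<bar>)"
    by (intro infsum_add heat_abs duhamel_abs s s')
  also have "\<dots> \<le> Ch / sqrt s * norm u + Cd"
    by (intro add_mono heat_abs duhamel_abs s s')
  finally show "(\<Sum>\<^sub>\<infinity>k\<in>kk. \<bar>inner (vs u s) (phi k)\<bar>) \<le> Ch / sqrt s * norm u + Cd" .
  have sm2: "(\<lambda>k. kabs k * \<bar>heat u k s\<bar> + kabs k * \<bar>duhamel k s\<bar>) summable_on kk"
    by (intro summable_on_add heat_kabs Cd s s')
  have le2: "kabs k * \<bar>inner (vs u s) (phi k)\<bar> \<le> kabs k * \<bar>heat u k s\<bar> + kabs k * \<bar>duhamel k s\<bar>" if "k \<in> kk" for k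
    using mult_left_mono[OF le[OF that], of "kabs k"] by (simp add: distrib_left)
  show 2: "(\<lambda>k. kabs k * \<bar>inner (vs u s) (phi k)\<bar>) summable_on kk"
    by (rule summable_on_comparison_test[OF sm2]) (use le2 in auto)
  have "(\<Sum>\<^sub>\<infinity>k\<in>kk. kabs k * \<bar>inner (vs u s) (phi k)\<bar>) \<le> (\<Sum>\<^sub>\<infinity>k\<in>kk. kabs k * \<bar>heat u k s\<bar> + kabs k * \<bar>duhamel k s\<bar>)"
    by (rule infsum_mono[OF 2 sm2 le2])
  also have "\<dots> = (\<Sum>\<^sub>\<infinity>k\<in>kk. kabs k * \<bar>heat u k s\<bar>) + (\<Sum>\<^sub>\<infinity>k\<in>kk. kabs k * \<bar>duhamel k s\<bar>)"
    by (intro infsum_add heat_kabs Cd s s')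
  also have "\<dots> \<le> (\<Sum>\<^sub>\<infinity>k\<in>kk. kabs k * \<bar>heat u k s\<bar>) + Cd"
    by (intro add_left_mono Cd s')
  finally show "2 * pi * sqrt 2 * (\<Sum>\<^sub>\<infinity>k\<in>kk. kabs k * \<bar>inner (vs u s) (phi k)\<bar>) \<le> lip u s"
    unfolding lip_def by (intro mult_left_mono) auto
qed

lemma vel_eq_field: "s \<in> {0<..T} \<Longrightarrow> vel u s = field (vs u s)"
  unfolding vel_def by (rule per_ext_eq_field[OF vs_summable(1)])

lemma vel_bound:
  assumes s: "s \<in> {0<..T}"
  shows "norm (vel u s x) \<le> (sqrt 2 * (Ch * norm u + Cd * sqrt T)) / sqrt s"
proof -
  have "norm (vel u s x) \<le> sqrt 2 * (\<Sum>\<^sub>\<infinity>k\<in>kk. \<bar>inner (vs u s) (phi k)\<bar>)"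
    unfolding vel_eq_field[OF s] by (rule norm_field_le[OF vs_summable(1)[OF s]])
  also have "\<dots> \<le> sqrt 2 * (Ch / sqrt s * norm u + Cd)"
    by (intro mult_left_mono vs_summable(2)[OF s]) simp
  \<comment> \<open>The bounded contribution of the forcing is inflated to the same singular
    profile, so that the whole velocity fits the form M / sqrt s.\<close>
  also have "\<dots> \<le> sqrt 2 * (Ch / sqrt s * norm u + Cd * (sqrt T / sqrt s))"
  proof -
    have "1 \<le> sqrt T / sqrt s" using s by simp
    from mult_left_mono[OF this Cd(1)] show ?thesis by simp
  qed
  finally show ?thesis using s by (simp add: add_divide_distrib distrib_left)
qed

lemma vel_lipschitz:
  assumes s: "s \<in> {0<..T}"
  shows "norm (vel u s x - vel u s y) \<le> lip u s * norm (x - y)"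
  unfolding vel_eq_field[OF s]
  by (rule order_trans[OF field_lipschitz[OF vs_summable(1,3)[OF s]] mult_right_mono[OF vs_summable(4)[OF s]]]) simp

lemma field_diff:
  assumes "(\<lambda>k. \<bar>inner u (phi k)\<bar>) summable_on kk" "(\<lambda>k. \<bar>inner v (phi k)\<bar>) summable_on kk"
  shows "field u x - field v x = field (u - v) x"
proof -
  have "((\<lambda>k. - (inner v (phi k) *\<^sub>R mode k x)) has_sum - field v x) kk"
    unfolding has_sum_uminus using has_sum_infsum[OF field_summable[OF assms(2), of x]] by (simp add: field_def)
  from has_sum_add[OF has_sum_infsum[OF field_summable[OF assms(1), of x]] this]
  have "((\<lambda>k. inner (u - v) (phi k) *\<^sub>R mode k x) has_sum (field u x - field v x)) kk"
    by (simp add: field_def inner_diff_left scaleR_left_diff_distrib)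
  then show ?thesis unfolding field_def[of "u - v"] by (rule infsumI[symmetric])
qed

text \<open>The forced parts cancel, leaving the heat flow of \<open>u - u'\<close>. The bound is
  linear in \<open>norm (u - u')\<close> and its singularity 1 / sqrt s is integrable, for initial
  values that are merely in H.\<close>

lemma vel_diff:
  assumes s: "s \<in> {0<..T}"
  shows "norm (vel u s x - vel u' s x) \<le> (sqrt 2 * Ch * norm (u - u')) / sqrt s"
proof -
  have i: "inner (vs u s - vs u' s) (phi k) = heat (u - u') k s" if "k \<in> kk" for k
    using s inner_vs[of s k] that by (simp add: inner_diff_left vcoef_def heat_def right_diff_distrib)
  have sm: "(\<lambda>k. \<bar>inner (vs u s - vs u' s) (phi k)\<bar>) summable_on kk"
    using heat_abs(1)[OF s, of "u - u'"] by (elim summable_on_cong[THEN iffD1, rotated]) (simp add: i)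
  have "vel u s x - vel u' s x = field (vs u s - vs u' s) x"
    unfolding vel_eq_field[OF s] by (intro field_diff vs_summable(1)[OF s])
  also have "norm \<dots> \<le> sqrt 2 * (\<Sum>\<^sub>\<infinity>k\<in>kk. \<bar>inner (vs u s - vs u' s) (phi k)\<bar>)"
    by (rule norm_field_le[OF sm])
  also have "(\<Sum>\<^sub>\<infinity>k\<in>kk. \<bar>inner (vs u s - vs u' s) (phi k)\<bar>) = (\<Sum>\<^sub>\<infinity>k\<in>kk. \<bar>heat (u - u') k s\<bar>)"
    by (intro infsum_cong) (simp add: i)
  also have "sqrt 2 * \<dots> \<le> sqrt 2 * (Ch / sqrt s * norm (u - u'))"
    by (intro mult_left_mono heat_abs(2)[OF s]) simp
  finally show ?thesis by simp
qed

lemma vel_measurable: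
  assumes z: "continuous_on {0..T} z"
  shows "set_borel_measurable lborel {0<..T} (\<lambda>s. vel u s (z s))"
  unfolding set_borel_measurable_def
proof (rule borel_measurable_LIMSEQ_metric)
  let ?f = "\<lambda>n s. \<Sum>k\<in>kball n. vcoef u s k *\<^sub>R mode k (z s)"
  have "continuous_on {0<..T} (?f n)" for n
  proof (intro continuous_on_sum continuous_on_scaleR)
    fix k assume "k \<in> kball n"
    then have k: "k \<in> kk" using kball_subset by blast
    show "continuous_on {0<..T} (\<lambda>s. vcoef u s k)" by (rule continuous_on_subset[OF continuous_on_vcoef[OF k]]) auto
    show "continuous_on {0<..T} (\<lambda>s. mode k (z s))"
      by (rule continuous_on_compose2[OF continuous_on_mode[of UNIV] continuous_on_subset[OF z]]) auto
  qed
  then show "(\<lambda>s. indicator {0<..T} s *\<^sub>R ?f n s) \<in> borel_measurable lborel" for n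
    using borel_measurable_continuous_on_indicator[of "{0<..T}" "?f n"] by simp
  fix s
  show "(\<lambda>n. indicator {0<..T} s *\<^sub>R ?f n s) \<longlonglongrightarrow> indicator {0<..T} s *\<^sub>R vel u s (z s)"
  proof (cases "s \<in> {0<..T}")
    case True
    have "(\<lambda>n. \<Sum>k\<in>kball n. inner (vs u s) (phi k) *\<^sub>R mode k (z s)) \<longlonglongrightarrow> vel u s (z s)"
      unfolding vel_eq_field[OF True] field_def
      by (intro has_sum_kball has_sum_infsum field_summable vs_summable(1)[OF True])
    moreover have "(\<Sum>k\<in>kball n. inner (vs u s) (phi k) *\<^sub>R mode k (z s)) = ?f n s" for n
      using True by (intro sum.cong refl) (simp add: inner_vs subsetD[OF kball_subset])
    ultimately show ?thesis by (intro tendsto_intros) simp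
  qed simp
qed

end

section \<open>Tracers in a velocity field that is singular at time zero\<close>

text \<open>The majorant \<phi>' may be unbounded at both ends. The fundamental theorem for
  nonnegative derivatives makes it integrable over the open interval, and the integrability of
  \<open>f\<close> follows by domination.\<close>

lemma integral_bound_FTC:
  fixes f :: "real \<Rightarrow> 'b::{banach, second_countable_topology}"
  assumes ab: "a \<le> b" and \<phi>: "continuous_on {a..b} \<phi>"
    and d: "\<And>s. a < s \<Longrightarrow> s < b \<Longrightarrow> (\<phi> has_real_derivative \<phi>' s) (at s)"
    and c: "\<And>s. a < s \<Longrightarrow> s < b \<Longrightarrow> isCont \<phi>' s"
    and m: "set_borel_measurable lborel {a<..<b} f"
    and le: "\<And>s. a < s \<Longrightarrow> s < b \<Longrightarrow> norm (f s) \<le> \<phi>' s"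
  shows "set_integrable lborel {a<..<b} f" and "norm (LINT s:{a<..<b}|lborel. f s) \<le> \<phi> b - \<phi> a"
proof -
  have "set_integrable lborel {a<..<b} f \<and> norm (LINT s:{a<..<b}|lborel. f s) \<le> \<phi> b - \<phi> a"
  proof (cases "a = b")
    case True
    then show ?thesis by (simp add: set_integrable_def set_lebesgue_integral_def)
  next
    case False
    then have ab: "a < b" using ab by simp
    have E: "einterval (ereal a) (ereal b) = {a<..<b}" by (auto simp: einterval_def)
    have lims: "((\<phi> \<circ> real_of_ereal) \<longlongrightarrow> \<phi> a) (at_right (ereal a))" "((\<phi> \<circ> real_of_ereal) \<longlongrightarrow> \<phi> b) (at_left (ereal b))"
      using continuous_on_Icc_at_rightD[OF \<phi> ab] continuous_on_Icc_at_leftD[OF \<phi> ab] by (simp_all add: ereal_tendsto_simps)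
    have nn: "0 \<le> \<phi>' s" if "a < s" "s < b" for s using le[OF that] norm_ge_zero order_trans by blast
    have i: "set_integrable lborel {a<..<b} \<phi>'" and v: "(LBINT s=ereal a..ereal b. \<phi>' s) = \<phi> b - \<phi> a"
      using interval_integral_FTC_nonneg[of "ereal a" "ereal b" \<phi> \<phi>', OF _ _ _ _ lims] ab d c nn unfolding E by auto
    have v': "(LINT s:{a<..<b}|lborel. \<phi>' s) = \<phi> b - \<phi> a"
      using v ab by (simp add: interval_lebesgue_integral_def E)
    have fi: "set_integrable lborel {a<..<b} f"
      by (rule set_integrable_bound[OF i m]) (use le in \<open>auto intro!: AE_I2 order_trans[OF _ abs_ge_self]\<close>)
    have "norm (LINT s:{a<..<b}|lborel. f s) \<le> (LINT s:{a<..<b}|lborel. norm (f s))"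
      by (rule set_integral_norm_bound[OF fi])
    also have "\<dots> \<le> (LINT s:{a<..<b}|lborel. \<phi>' s)"
      by (rule set_integral_mono[OF set_integrable_norm[OF fi] i]) (use le in auto)
    finally show ?thesis using fi v' by simp
  qed
  then show "set_integrable lborel {a<..<b} f" "norm (LINT s:{a<..<b}|lborel. f s) \<le> \<phi> b - \<phi> a" by auto
qed

lemma set_borel_measurable_subset_interval:
  fixes f :: "real \<Rightarrow> 'b::{banach, second_countable_topology}"
  assumes "set_borel_measurable lborel A f" "B \<in> sets borel" "B \<subseteq> A"
  shows "set_borel_measurable lborel B f"
proof -
  have "(\<lambda>x. indicator B x *\<^sub>R (indicator A x *\<^sub>R f x)) \<in> borel_measurable lborel"
    by (rule borel_measurable_scaleR) (use assms(1,2) in \<open>simp_all add: set_borel_measurable_def\<close>)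
  moreover have "indicator B x *\<^sub>R (indicator A x *\<^sub>R f x) = indicator B x *\<^sub>R f x" for x
    using assms(3) by (auto simp: indicator_def)
  ultimately show ?thesis unfolding set_borel_measurable_def by (simp only:)
qed

text \<open>Velocity fields are described on positive times only, with the singularity 1 / sqrt s.
  The Lipschitz condition is left to the individual results, because they use it with different
  weights and for one of two fields. Integrals run over open intervals, so the value at time 0 never
  enters.\<close>

locale tracer_field =
  fixes T M :: real and V :: "real \<Rightarrow> real^2 \<Rightarrow> real^2"
  assumes T_pos: "T > 0" and M_nonneg: "M \<ge> 0"
    and V_bound: "\<And>s x. s \<in> {0<..T} \<Longrightarrow> norm (V s x) \<le> M / sqrt s"
    and V_measurable: "\<And>z. continuous_on {0..T} z \<Longrightarrow> set_borel_measurable lborel {0<..T} (\<lambda>s. V s (z s))"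
begin

definition drift :: "(real \<Rightarrow> real^2) \<Rightarrow> real \<Rightarrow> real^2" where
  "drift z t = (LINT s:{0<..<t}|lborel. V s (z s))"

definition solves :: "real^2 \<Rightarrow> (real \<Rightarrow> real^2) \<Rightarrow> bool" where
  "solves z0 z \<longleftrightarrow> continuous_on {0..T} z \<and> (\<forall>t\<in>{0..T}. z t = z0 + drift z t)"

lemma V_interval:
  assumes z: "continuous_on {0..T} z" and ab: "0 \<le> a" "a \<le> b" "b \<le> T"
  shows "set_borel_measurable lborel {a<..<b} (\<lambda>s. V s (z s))"
    and "set_integrable lborel {a<..<b} (\<lambda>s. V s (z s))"
    and "norm (LINT s:{a<..<b}|lborel. V s (z s)) \<le> 2 * M * sqrt b - 2 * M * sqrt a"
proof -
  show m: "set_borel_measurable lborel {a<..<b} (\<lambda>s. V s (z s))"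
    by (rule set_borel_measurable_subset_interval[OF V_measurable[OF z]]) (use ab in auto)
  have d: "((\<lambda>s. 2 * M * sqrt s) has_real_derivative M / sqrt s) (at s)" if "a < s" for s
    using that ab by (auto intro!: derivative_eq_intros simp: field_simps)
  have c: "isCont (\<lambda>s. M / sqrt s) s" if "a < s" for s
    using that ab by (intro continuous_intros) auto
  have cc: "continuous_on {a..b} (\<lambda>s. 2 * M * sqrt s)" by (intro continuous_intros)
  show "set_integrable lborel {a<..<b} (\<lambda>s. V s (z s))"
    and "norm (LINT s:{a<..<b}|lborel. V s (z s)) \<le> 2 * M * sqrt b - 2 * M * sqrt a"
    using integral_bound_FTC[OF ab(2) cc d c m V_bound] ab by auto
qed

lemma drift_diff:
  assumes z: "continuous_on {0..T} z" and ab: "0 \<le> a" "a \<le> b" "b \<le> T"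
  shows "drift z b - drift z a = (LINT s:{a<..<b}|lborel. V s (z s))"
proof -
  have "(LINT s:{0<..<b}|lborel. V s (z s)) = (LINT s:{0<..<a} \<union> {a<..<b}|lborel. V s (z s))"
    by (rule set_integral_discrete_difference[of "{a}"]) (use ab in auto)
  also have "\<dots> = (LINT s:{0<..<a}|lborel. V s (z s)) + (LINT s:{a<..<b}|lborel. V s (z s))"
    by (rule set_integral_Un) (use ab in \<open>auto intro!: V_interval z\<close>)
  finally show ?thesis by (simp add: drift_def)
qed

lemma norm_drift_le:
  assumes "continuous_on {0..T} z" "t \<in> {0..T}"
  shows "norm (drift z t) \<le> 2 * M * sqrt t"
  using V_interval(3)[OF assms(1), of 0 t] assms(2) by (simp add: drift_def)

lemma continuous_on_drift:
  assumes z: "continuous_on {0..T} z" shows "continuous_on {0..T} (drift z)"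
proof -
  have *: "norm (drift z b - drift z a) \<le> \<bar>2 * M * sqrt b - 2 * M * sqrt a\<bar>" if "a \<in> {0..T}" "b \<in> {0..T}" for a b
  proof -
    have le: "norm (drift z b - drift z a) \<le> \<bar>2 * M * sqrt b - 2 * M * sqrt a\<bar>" if "a \<in> {0..T}" "b \<in> {0..T}" "a \<le> b" for a b
      using V_interval(3)[OF z, of a b] drift_diff[OF z, of a b] that by simp
    show ?thesis
    proof (cases "a \<le> b")
      case False
      then have "norm (drift z a - drift z b) \<le> \<bar>2 * M * sqrt a - 2 * M * sqrt b\<bar>" using le[of b a] that by simp
      then show ?thesis by (simp only: norm_minus_commute[of "drift z a"] abs_minus_commute[of "2 * M * sqrt a"])
    qed (use le that in auto)
  qed
  show ?thesis unfolding continuous_on_def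
  proof
    fix t assume t: "t \<in> {0..T}"
    have "((\<lambda>s. \<bar>2 * M * sqrt s - 2 * M * sqrt t\<bar>) \<longlongrightarrow> \<bar>2 * M * sqrt t - 2 * M * sqrt t\<bar>) (at t within {0..T})"
      by (intro tendsto_intros)
    then have "((\<lambda>s. drift z s - drift z t) \<longlongrightarrow> 0) (at t within {0..T})"
      by (intro Lim_null_comparison[of "\<lambda>s. drift z s - drift z t" "\<lambda>s. \<bar>2 * M * sqrt s - 2 * M * sqrt t\<bar>"])
        (use * t in \<open>auto simp: eventually_at_filter\<close>)
    then show "(drift z \<longlongrightarrow> drift z t) (at t within {0..T})" by (simp add: LIM_zero_iff)
  qed
qed

end

text \<open>The condition \<open>l w \<le> w'/2\<close> makes the integral operator a contraction with factor \<open>1/2\<close> for the norm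
  \<open>sup |z|/w\<close>.\<close>

lemma drift_difference_bound:
  assumes "tracer_field T M V" "tracer_field T M' V'"
    and z: "continuous_on {0..T} z" "continuous_on {0..T} z'" and t: "t \<in> {0..T}"
    and lip: "\<And>s x y. s \<in> {0<..<T} \<Longrightarrow> norm (V s x - V s y) \<le> l s * norm (x - y)"
    and D: "\<And>s x. s \<in> {0<..<T} \<Longrightarrow> norm (V s x - V' s x) \<le> D / sqrt s"
    and w: "continuous_on {0..T} w" "\<And>t. t \<in> {0..T} \<Longrightarrow> 0 \<le> w t"
    and w': "\<And>s. s \<in> {0<..<T} \<Longrightarrow> (w has_real_derivative w' s) (at s)" "\<And>s. s \<in> {0<..<T} \<Longrightarrow> isCont w' s"
    and lw: "\<And>s. s \<in> {0<..<T} \<Longrightarrow> 0 \<le> l s \<and> l s * w s \<le> w' s / 2"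
    and S: "S \<ge> 0" "\<And>s. s \<in> {0<..<T} \<Longrightarrow> norm (z s - z' s) \<le> S * w s"
  shows "norm (tracer_field.drift V z t - tracer_field.drift V' z' t) \<le> S / 2 * w t + 2 * D * sqrt t"
proof -
  interpret V: tracer_field T M V by fact
  interpret V': tracer_field T M' V' by fact
  have t': "0 \<le> t" "t \<le> T" using t by auto
  have i: "set_integrable lborel {0<..<t} (\<lambda>s. V s (z s))" "set_integrable lborel {0<..<t} (\<lambda>s. V' s (z' s))"
    using V.V_interval(2)[OF z(1), of 0 t] V'.V_interval(2)[OF z(2), of 0 t] t' by auto
  have m: "set_borel_measurable lborel {0<..<t} (\<lambda>s. V s (z s) - V' s (z' s))"
    using set_integral_diff(1)[OF i] unfolding set_integrable_def set_borel_measurable_def by (rule borel_measurable_integrable)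
  have eq: "V.drift z t - V'.drift z' t = (LINT s:{0<..<t}|lborel. V s (z s) - V' s (z' s))"
    unfolding V.drift_def V'.drift_def using i by (rule set_integral_diff(2)[symmetric])
  have "norm (LINT s:{0<..<t}|lborel. V s (z s) - V' s (z' s)) \<le> (S / 2 * w t + 2 * D * sqrt t) - (S / 2 * w 0 + 2 * D * sqrt 0)"
  proof (rule integral_bound_FTC(2)[OF t'(1) _ _ _ m, where \<phi>' = "\<lambda>s. S / 2 * w' s + D / sqrt s"])
    show "continuous_on {0..t} (\<lambda>t. S / 2 * w t + 2 * D * sqrt t)"
      using t' by (intro continuous_intros continuous_on_subset[OF w(1)]) auto
    fix s assume s: "0 < s" "s < t"
    then have sT: "s \<in> {0<..<T}" using t' by auto
    have "((\<lambda>s. S / 2 * w s) has_real_derivative S / 2 * w' s) (at s)" by (intro DERIV_cmult w' sT)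
    moreover have "((\<lambda>s. 2 * D * sqrt s) has_real_derivative D / sqrt s) (at s)"
      using s by (auto intro!: derivative_eq_intros simp: field_simps)
    ultimately show "((\<lambda>t. S / 2 * w t + 2 * D * sqrt t) has_real_derivative S / 2 * w' s + D / sqrt s) (at s)"
      by (rule DERIV_add)
    show "isCont (\<lambda>s. S / 2 * w' s + D / sqrt s) s"
      using s by (intro continuous_intros w' sT) auto
    have "norm (V s (z s) - V' s (z' s)) \<le> norm (V s (z s) - V s (z' s)) + norm (V s (z' s) - V' s (z' s))"
      using norm_triangle_ineq[of "V s (z s) - V s (z' s)" "V s (z' s) - V' s (z' s)"] by simp
    also have "\<dots> \<le> l s * (S * w s) + D / sqrt s"
      using lip[OF sT, of "z s" "z' s"] mult_left_mono[OF S(2)[OF sT], of "l s"] lw[OF sT] D[OF sT, of "z' s"] by linarith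
    also have "l s * (S * w s) \<le> S / 2 * w' s"
      using mult_left_mono[OF conjunct2[OF lw[OF sT]] S(1)] by (simp add: mult_ac)
    finally show "norm (V s (z s) - V' s (z' s)) \<le> S / 2 * w' s + D / sqrt s" by simp
  qed
  also have "\<dots> \<le> S / 2 * w t + 2 * D * sqrt t" using S(1) w(2)[of 0] V.T_pos by simp
  finally show ?thesis unfolding eq .
qed

text \<open>A bound by \<open>C * w\<close> improves itself to one by
  \<open>(C / 2 + B) * w\<close>, whose fixed point is \<open>2 * B\<close>. The iteration starts
  from the crude bound that the speeds provide. Only \<open>V\<close> carries a Lipschitz condition,
  so \<open>V'\<close> may belong to any other initial value.\<close>

lemma tracer_difference_bound:
  assumes V: "tracer_field T M V" and V': "tracer_field T M' V'"
    and z: "tracer_field.solves T V z0 z" "tracer_field.solves T V' z0 z'"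
    and lip: "\<And>s x y. s \<in> {0<..<T} \<Longrightarrow> norm (V s x - V s y) \<le> l s * norm (x - y)"
    and D: "\<And>s x. s \<in> {0<..<T} \<Longrightarrow> norm (V s x - V' s x) \<le> D / sqrt s"
    and w: "continuous_on {0..T} w" "\<And>t. t \<in> {0..T} \<Longrightarrow> 0 \<le> w t"
    and w': "\<And>s. s \<in> {0<..<T} \<Longrightarrow> (w has_real_derivative w' s) (at s)" "\<And>s. s \<in> {0<..<T} \<Longrightarrow> isCont w' s"
    and lw: "\<And>s. s \<in> {0<..<T} \<Longrightarrow> 0 \<le> l s \<and> l s * w s \<le> w' s / 2"
    and B: "B \<ge> 0" "\<And>t. t \<in> {0..T} \<Longrightarrow> 2 * D * sqrt t \<le> B * w t"
    and C0: "C0 \<ge> 0" "\<And>t. t \<in> {0..T} \<Longrightarrow> 2 * (M + M') * sqrt t \<le> C0 * w t"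
    and t: "t \<in> {0..T}"
  shows "norm (z t - z' t) \<le> 2 * B * w t"
proof -
  interpret V: tracer_field T M V by fact
  interpret V': tracer_field T M' V' by fact
  have c: "continuous_on {0..T} z" "continuous_on {0..T} z'" using z by (auto simp: V.solves_def V'.solves_def)
  have zd: "z t - z' t = V.drift z t - V'.drift z' t" if "t \<in> {0..T}" for t
    using z that by (simp add: V.solves_def V'.solves_def)
  have le: "norm (z t - z' t) \<le> (2 * B + C0 / 2 ^ n) * w t" if "t \<in> {0..T}" for n t
    using that
  proof (induction n arbitrary: t)
    case 0
    have "norm (z t - z' t) \<le> norm (V.drift z t) + norm (V'.drift z' t)"
      unfolding zd[OF 0] by (rule norm_triangle_ineq4)
    also have "\<dots> \<le> 2 * (M + M') * sqrt t"
      using V.norm_drift_le[OF c(1) 0] V'.norm_drift_le[OF c(2) 0] by (simp add: algebra_simps)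
    also have "\<dots> \<le> C0 * w t" by (rule C0(2)[OF 0])
    also have "\<dots> \<le> (2 * B + C0 / 2 ^ 0) * w t" using B(1) w(2)[OF 0] by (intro mult_right_mono) auto
    finally show ?case .
  next
    case (Suc n)
    have "norm (V.drift z t - V'.drift z' t) \<le> (2 * B + C0 / 2 ^ n) / 2 * w t + 2 * D * sqrt t"
      by (rule drift_difference_bound[OF V V' c Suc.prems lip D w w' lw])
        (use Suc.IH B(1) C0(1) in auto)
    also have "\<dots> \<le> (2 * B + C0 / 2 ^ n) / 2 * w t + B * w t" using B(2)[OF Suc.prems] by simp
    also have "\<dots> = (2 * B + C0 / 2 ^ Suc n) * w t" by (simp add: algebra_simps add_divide_distrib)
    finally show ?case unfolding zd[OF Suc.prems] .
  qed
  have "(\<lambda>n. (2 * B + C0 * (1 / 2) ^ n) * w t) \<longlonglongrightarrow> (2 * B + C0 * 0) * w t"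
    by (intro tendsto_intros LIMSEQ_power_zero) auto
  then have "(\<lambda>n. (2 * B + C0 / 2 ^ n) * w t) \<longlonglongrightarrow> 2 * B * w t"
    by (simp add: power_one_over)
  then show ?thesis by (rule LIMSEQ_le_const) (use le[OF t] in auto)
qed

text \<open>Picard iteration from the constant curve. Relative to \<open>w\<close> the increments
  halve in each step; since \<open>w\<close> is bounded on the interval the series converges
  uniformly, and \<open>dd\<close> lets the limit pass through the integral equation.\<close>

lemma tracer_exists:
  assumes V: "tracer_field T M V"
    and lip: "\<And>s x y. s \<in> {0<..<T} \<Longrightarrow> norm (V s x - V s y) \<le> l s * norm (x - y)"
    and w: "continuous_on {0..T} w" "\<And>t. t \<in> {0..T} \<Longrightarrow> 0 \<le> w t"
    and w': "\<And>s. s \<in> {0<..<T} \<Longrightarrow> (w has_real_derivative w' s) (at s)" "\<And>s. s \<in> {0<..<T} \<Longrightarrow> isCont w' s"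
    and lw: "\<And>s. s \<in> {0<..<T} \<Longrightarrow> 0 \<le> l s \<and> l s * w s \<le> w' s / 2"
    and C0: "C0 \<ge> 0" "\<And>t. t \<in> {0..T} \<Longrightarrow> 2 * M * sqrt t \<le> C0 * w t"
  shows "\<exists>z. tracer_field.solves T V z0 z"
proof -
  interpret V: tracer_field T M V by fact
  define Z where "Z = rec_nat (\<lambda>_. z0) (\<lambda>_ z t. z0 + V.drift z t)"
  have Z: "Z 0 = (\<lambda>_. z0)" "Z (Suc n) = (\<lambda>t. z0 + V.drift (Z n) t)" for n by (simp_all add: Z_def)
  have Zc: "continuous_on {0..T} (Z n)" for n
    by (induction n) (auto simp: Z intro!: continuous_intros V.continuous_on_drift)
  have dd: "norm (V.drift z t - V.drift z' t) \<le> R / 2 * w t"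
    if "continuous_on {0..T} z" "continuous_on {0..T} z'" "t \<in> {0..T}" "R \<ge> 0"
      "\<And>s. s \<in> {0..T} \<Longrightarrow> norm (z s - z' s) \<le> R * w s" for z z' t R
    using drift_difference_bound[OF V V that(1-3) lip _ w w' lw that(4), of 0] that(5) by auto
  have step: "norm (Z (Suc n) t - Z n t) \<le> C0 * (1 / 2) ^ n * w t" if "t \<in> {0..T}" for n t
    using that
  proof (induction n arbitrary: t)
    case 0
    then show ?case using V.norm_drift_le[OF Zc[of 0] 0] C0(2)[OF 0] by (simp add: Z)
  next
    case (Suc n)
    have "norm (V.drift (Z (Suc n)) t - V.drift (Z n) t) \<le> C0 * (1 / 2) ^ n / 2 * w t"
      by (rule dd[OF Zc Zc Suc.prems]) (use Suc.IH C0(1) in auto)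
    then show ?case by (simp add: Z(2)[of "Suc n"] Z(2)[of n])
  qed
  obtain K where K: "\<And>t. t \<in> {0..T} \<Longrightarrow> w t \<le> K"
  proof -
    have "bounded (w ` {0..T})" by (intro compact_imp_bounded compact_continuous_image w) auto
    then obtain K where "\<forall>t\<in>{0..T}. norm (w t) \<le> K" unfolding bounded_iff by auto
    then have "w t \<le> K" if "t \<in> {0..T}" for t using that abs_ge_self[of "w t"] by fastforce
    then show ?thesis by (rule that)
  qed
  define z where "z t = z0 + (\<Sum>i. Z (Suc i) t - Z i t)" for t
  have tele: "(\<Sum>i<n. Z (Suc i) t - Z i t) = Z n t - z0" for n t
    using sum_lessThan_telescope[of "\<lambda>i. Z i t" n] by (simp add: Z(1))
  have "uniform_limit {0..T} (\<lambda>n t. \<Sum>i<n. Z (Suc i) t - Z i t) (\<lambda>t. \<Sum>i. Z (Suc i) t - Z i t) sequentially"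
  proof (rule Weierstrass_m_test)
    show "norm (Z (Suc n) t - Z n t) \<le> C0 * (1 / 2) ^ n * K" if "t \<in> {0..T}" for n t
      using step[OF that, of n] mult_left_mono[OF K[OF that], of "C0 * (1 / 2) ^ n"] C0(1) by simp
    show "summable (\<lambda>n. C0 * (1 / 2) ^ n * K)"
      by (intro summable_mult summable_mult2 summable_geometric) auto
  qed
  then have ul: "uniform_limit {0..T} (\<lambda>n t. Z n t - z0) (\<lambda>t. z t - z0) sequentially"
    by (simp add: tele z_def)
  have Zlim: "(\<lambda>n. Z n t) \<longlonglongrightarrow> z t" if "t \<in> {0..T}" for t
    using tendsto_add[OF tendsto_uniform_limitI[OF ul that] tendsto_const[of z0]] by simp
  have zc: "continuous_on {0..T} z"
  proof -
    have "continuous_on {0..T} (\<lambda>t. z t - z0)"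
      by (rule uniform_limit_theorem[OF _ ul]) (auto intro!: always_eventually continuous_intros Zc)
    from continuous_on_add[OF this continuous_on_const[of _ z0]] show ?thesis by simp
  qed
  \<comment> \<open>The factor \<open>2 - 2 * (1 / 2) ^ j\<close> used below is the partial sum of
    the geometric series of increments from the n-th iterate on.\<close>
  have tail: "norm (z t - Z n t) \<le> C0 * (1 / 2) ^ n * 2 * w t" if t: "t \<in> {0..T}" for n t
  proof (rule LIMSEQ_le_const2)
    show "(\<lambda>m. norm (Z m t - Z n t)) \<longlonglongrightarrow> norm (z t - Z n t)" by (intro tendsto_intros Zlim t)
    have "norm (Z (n + j) t - Z n t) \<le> C0 * (1 / 2) ^ n * (2 - 2 * (1 / 2) ^ j) * w t" for j
    proof (induction j)
      case (Suc j)
      have "norm (Z (n + Suc j) t - Z n t) \<le> norm (Z (Suc (n + j)) t - Z (n + j) t) + norm (Z (n + j) t - Z n t)"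
        using norm_triangle_ineq[of "Z (Suc (n + j)) t - Z (n + j) t" "Z (n + j) t - Z n t"] by simp
      also have "\<dots> \<le> C0 * (1 / 2) ^ (n + j) * w t + C0 * (1 / 2) ^ n * (2 - 2 * (1 / 2) ^ j) * w t"
        by (intro add_mono step[OF t] Suc)
      also have "\<dots> = C0 * (1 / 2) ^ n * (2 - 2 * (1 / 2) ^ Suc j) * w t"
        by (simp add: power_add algebra_simps)
      finally show ?case .
    qed simp
    moreover have "C0 * (1 / 2) ^ n * (2 - 2 * (1 / 2) ^ j) * w t \<le> C0 * (1 / 2) ^ n * 2 * w t" for j
      using C0(1) w(2)[OF t] by (intro mult_right_mono mult_left_mono) auto
    ultimately have "norm (Z (n + j) t - Z n t) \<le> C0 * (1 / 2) ^ n * 2 * w t" for j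
      using order_trans by blast
    then show "\<exists>N. \<forall>m\<ge>N. norm (Z m t - Z n t) \<le> C0 * (1 / 2) ^ n * 2 * w t"
      by (metis le_add_diff_inverse)
  qed
  have "z t = z0 + V.drift z t" if t: "t \<in> {0..T}" for t
  proof -
    have "norm (V.drift z t - V.drift (Z n) t) \<le> C0 * (1 / 2) ^ n * 2 / 2 * w t" for n
      by (rule dd[OF zc Zc t _ tail]) (use C0(1) in auto)
    then have le: "norm (V.drift (Z n) t - V.drift z t) \<le> C0 * (1 / 2) ^ n * w t" for n
      by (simp add: norm_minus_commute)
    have "(\<lambda>n. C0 * (1 / 2) ^ n * w t) \<longlonglongrightarrow> C0 * 0 * w t"
      by (intro tendsto_intros LIMSEQ_power_zero) auto
    then have "(\<lambda>n. C0 * (1 / 2) ^ n * w t) \<longlonglongrightarrow> 0" by simp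
    from Lim_null_comparison[OF always_eventually[OF allI[OF le]] this]
    have "(\<lambda>n. V.drift (Z n) t - V.drift z t) \<longlonglongrightarrow> 0" .
    then have "(\<lambda>n. z0 + V.drift (Z n) t) \<longlonglongrightarrow> z0 + V.drift z t"
      by (intro tendsto_intros) (simp add: LIM_zero_iff)
    moreover have "(\<lambda>n. Z (Suc n) t) \<longlonglongrightarrow> z t" by (rule LIMSEQ_Suc[OF Zlim[OF t]])
    ultimately show ?thesis using LIMSEQ_unique by (simp add: Z(2))
  qed
  then show ?thesis using zc by (auto simp: V.solves_def)
qed

section \<open>Tracers in the Stokes flow: existence, uniqueness and stability\<close>

context stokes_forcing
begin

definition Mv :: "hspace \<Rightarrow> real" where "Mv u = sqrt 2 * (Ch * norm u + Cd * sqrt T)"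

lemma Mv_nonneg: "Mv u \<ge> 0"
  using Ch_nonneg Cd(1) T by (simp add: Mv_def)

lemma tracer_field_vel: "tracer_field T (Mv u) (vel u)"
  by unfold_locales (use T Mv_nonneg vel_bound vel_measurable in \<open>auto simp: Mv_def\<close>)

lemma tracer_iff_solves: "tracer T (vs u) z0 z \<longleftrightarrow> tracer_field.solves T (vel u) z0 z"
proof -
  interpret tracer_field T "Mv u" "vel u" by (rule tracer_field_vel)
  have eq: "(LINT s:{0..t}|lborel. per_ext (vs u s) (z s)) = drift z t" for t
    unfolding drift_def vel_def by (rule set_integral_discrete_difference[of "{0, t}"]) auto
  have int: "set_integrable lborel {0..t} (\<lambda>s. per_ext (vs u s) (z s))" if "continuous_on {0..T} z" "t \<in> {0..T}" for t
  proof -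
    have "integrable lborel (\<lambda>s. indicator {0<..<t} s *\<^sub>R per_ext (vs u s) (z s))"
      using V_interval(2)[OF that(1), of 0 t] that(2) by (simp add: set_integrable_def vel_def)
    moreover have "integrable lborel (\<lambda>s. indicator {0<..<t} s *\<^sub>R per_ext (vs u s) (z s)) \<longleftrightarrow>
        integrable lborel (\<lambda>s. indicator {0..t} s *\<^sub>R per_ext (vs u s) (z s))"
      by (rule integrable_discrete_difference[of "{0, t}"]) (auto simp: indicator_def)
    ultimately show ?thesis by (simp add: set_integrable_def)
  qed
  show ?thesis unfolding tracer_def solves_def eq using int by blast
qed

lemma lip_nonneg: "lip u s \<ge> 0"
  unfolding lip_def using Cd(1) by (intro mult_nonneg_nonneg add_nonneg_nonneg infsum_nonneg) auto

text \<open>\<open>heat_kabs\<close> is applied to the tail \<open>u - PN n u\<close> alone, whose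
  norm can be made as small as desired by the choice of \<open>n\<close>; the finitely many modes in
  \<open>PN n u\<close> are Lipschitz uniformly in time. \<open>L\<close> depends on
  \<open>u\<close> itself and not only on its norm.\<close>

lemma lip_le:
  "\<exists>L\<ge>0. \<forall>s\<in>{0<..T}. lip u s \<le> (1 / 4) / s + L"
proof -
  define c where "c = 2 * pi * sqrt 2"
  have c: "c \<ge> 0" by (simp add: c_def)
  have "(\<lambda>n. c * CH * norm (u - PN n u)) \<longlonglongrightarrow> c * CH * norm (u - u)"
    unfolding PN_eq by (intro tendsto_intros fourier_LIMSEQ)
  then have "\<forall>\<^sub>F n in sequentially. c * CH * norm (u - PN n u) < 1 / 4"
    by (intro order_tendstoD) auto
  then obtain n where n: "c * CH * norm (u - PN n u) < 1 / 4" by (auto simp: eventually_sequentially)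
  define L0 where "L0 = (\<Sum>k\<in>kball n. kabs k * \<bar>inner u (phi k)\<bar>)"
  have L0: "L0 \<ge> 0" by (auto simp: L0_def intro: sum_nonneg)
  have "lip u s \<le> (1 / 4) / s + (c * L0 + c * Cd)" if s: "s \<in> {0<..T}" for s
  proof -
    have split: "heat u k s = heat (PN n u) k s + heat (u - PN n u) k s" for k
      by (simp add: heat_def inner_diff_left algebra_simps)
    have "(\<Sum>\<^sub>\<infinity>k\<in>kk. kabs k * \<bar>heat u k s\<bar>) \<le> (\<Sum>\<^sub>\<infinity>k\<in>kk. kabs k * \<bar>heat (PN n u) k s\<bar> + kabs k * \<bar>heat (u - PN n u) k s\<bar>)"
      by (intro infsum_mono heat_kabs summable_on_add s)
        (simp add: split abs_triangle_ineq mult_left_mono flip: distrib_left)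
    also have "\<dots> = (\<Sum>\<^sub>\<infinity>k\<in>kk. kabs k * \<bar>heat (PN n u) k s\<bar>) + (\<Sum>\<^sub>\<infinity>k\<in>kk. kabs k * \<bar>heat (u - PN n u) k s\<bar>)"
      by (intro infsum_add heat_kabs s)
    also have "(\<Sum>\<^sub>\<infinity>k\<in>kk. kabs k * \<bar>heat (PN n u) k s\<bar>) = (\<Sum>\<^sub>\<infinity>k\<in>kball n. kabs k * \<bar>heat (PN n u) k s\<bar>)"
      by (rule infsum_cong_neutral) (auto simp: heat_def PN_coefficient kball_def)
    also have "\<dots> = (\<Sum>k\<in>kball n. kabs k * \<bar>heat (PN n u) k s\<bar>)" by (simp add: finite_kball)
    also have "\<dots> \<le> L0" unfolding L0_def
    proof (intro sum_mono mult_left_mono)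
      fix k assume "k \<in> kball n"
      then have "inner (PN n u) (phi k) = inner u (phi k)" by (auto simp: PN_coefficient kball_def)
      moreover have "exp (- (nu * lam k * s)) \<le> 1" using nu s by simp
      ultimately show "\<bar>heat (PN n u) k s\<bar> \<le> \<bar>inner u (phi k)\<bar>"
        by (simp add: heat_def abs_mult mult_left_le_one_le)
    qed simp
    also have "(\<Sum>\<^sub>\<infinity>k\<in>kk. kabs k * \<bar>heat (u - PN n u) k s\<bar>) \<le> CH / s * norm (u - PN n u)"
      by (rule heat_kabs(2)[OF s])
    finally have "(\<Sum>\<^sub>\<infinity>k\<in>kk. kabs k * \<bar>heat u k s\<bar>) \<le> L0 + CH / s * norm (u - PN n u)" by simp
    then have "lip u s \<le> c * (L0 + CH / s * norm (u - PN n u) + Cd)"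
      unfolding lip_def c_def[symmetric] using c by (intro mult_left_mono) auto
    also have "\<dots> = (c * CH * norm (u - PN n u)) / s + (c * L0 + c * Cd)" by (simp add: algebra_simps)
    also have "\<dots> \<le> (1 / 4) / s + (c * L0 + c * Cd)"
      using n s by (intro add_right_mono divide_right_mono) auto
    finally show ?thesis .
  qed
  moreover have "c * L0 + c * Cd \<ge> 0" using c L0 Cd(1) by simp
  ultimately show ?thesis by blast
qed

text \<open>Half its logarithmic derivative is 1/(4 t) + L, precisely the bound of
  \<open>lip_le\<close>; this is where the 1/4 comes from. It vanishes at 0 like sqrt t, no faster
  than the drift of a tracer, so crude speed bounds are multiples of it.\<close>

definition singular_weight :: "real \<Rightarrow> real \<Rightarrow> real" where
  "singular_weight L t = sqrt t * exp (2 * L * t)"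

lemma singular_weight:
  assumes L: "L \<ge> 0"
  shows "continuous_on {0..T} (singular_weight L)" "\<And>t. t \<in> {0..T} \<Longrightarrow> 0 \<le> singular_weight L t"
    and "\<And>s. s \<in> {0<..<T} \<Longrightarrow> (singular_weight L has_real_derivative exp (2 * L * s) * (1 / (2 * sqrt s) + 2 * L * sqrt s)) (at s)"
    and "\<And>s. s \<in> {0<..<T} \<Longrightarrow> isCont (\<lambda>s. exp (2 * L * s) * (1 / (2 * sqrt s) + 2 * L * sqrt s)) s"
    and "\<And>s. s \<in> {0<..<T} \<Longrightarrow> ((1 / 4) / s + L) * singular_weight L s = exp (2 * L * s) * (1 / (2 * sqrt s) + 2 * L * sqrt s) / 2"
    and "\<And>t. t \<in> {0..T} \<Longrightarrow> sqrt t \<le> singular_weight L t"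
    and "\<And>t. t \<in> {0..T} \<Longrightarrow> singular_weight L t \<le> sqrt T * exp (2 * L * T)"
proof -
  show "continuous_on {0..T} (singular_weight L)"
    unfolding singular_weight_def[abs_def] by (intro continuous_intros)
  show "0 \<le> singular_weight L t" if "t \<in> {0..T}" for t using that by (simp add: singular_weight_def)
  show "(singular_weight L has_real_derivative exp (2 * L * s) * (1 / (2 * sqrt s) + 2 * L * sqrt s)) (at s)" if "s \<in> {0<..<T}" for s
    unfolding singular_weight_def[abs_def] using that
    by (auto intro!: derivative_eq_intros simp: field_simps)
  show "isCont (\<lambda>s. exp (2 * L * s) * (1 / (2 * sqrt s) + 2 * L * sqrt s)) s" if "s \<in> {0<..<T}" for s
    using that by (intro continuous_intros) auto
  show "((1 / 4) / s + L) * singular_weight L s = exp (2 * L * s) * (1 / (2 * sqrt s) + 2 * L * sqrt s) / 2" if "s \<in> {0<..<T}" for s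
  proof -
    have "sqrt s / s = 1 / sqrt s" using that by (simp add: real_div_sqrt divide_simps)
    define E where "E = exp (2 * L * s)"
    have "((1 / 4) / s + L) * (sqrt s * E) = (1 / 4) * (sqrt s / s) * E + L * sqrt s * E"
      by (simp add: distrib_right)
    also have "\<dots> = (1 / 4) * (1 / sqrt s) * E + L * sqrt s * E" by (simp only: \<open>sqrt s / s = 1 / sqrt s\<close>)
    also have "\<dots> = E * (1 / (2 * sqrt s) + 2 * L * sqrt s) / 2"
      by (simp add: distrib_left add_divide_distrib)
    finally show ?thesis unfolding singular_weight_def E_def .
  qed
  show "sqrt t \<le> singular_weight L t" if "t \<in> {0..T}" for t
  proof -
    have "1 \<le> exp (2 * L * t)" using L that by simp
    then have "sqrt t * 1 \<le> sqrt t * exp (2 * L * t)" using that by (intro mult_left_mono) auto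
    then show ?thesis by (simp add: singular_weight_def)
  qed
  show "singular_weight L t \<le> sqrt T * exp (2 * L * T)" if "t \<in> {0..T}" for t
    unfolding singular_weight_def using that L by (intro mult_mono) (auto intro: mult_left_mono)
qed

lemma lip_weight:
  assumes "L \<ge> 0" "\<forall>s\<in>{0<..T}. lip u s \<le> (1 / 4) / s + L" "s \<in> {0<..<T}"
  shows "0 \<le> lip u s \<and> lip u s * singular_weight L s \<le> exp (2 * L * s) * (1 / (2 * sqrt s) + 2 * L * sqrt s) / 2"
proof -
  have "lip u s * singular_weight L s \<le> ((1 / 4) / s + L) * singular_weight L s"
    using assms singular_weight(2)[of L s] by (intro mult_right_mono) auto
  then show ?thesis using singular_weight(5)[OF assms(1,3)] lip_nonneg by simp
qed

lemma vel_lip: "s \<in> {0<..<T} \<Longrightarrow> norm (vel u s x - vel u s y) \<le> lip u s * norm (x - y)"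
  by (rule vel_lipschitz) auto

lemma tracer_solution_exists: "\<exists>z. tracer_field.solves T (vel u) z0 z"
proof -
  obtain L where L: "L \<ge> 0" "\<forall>s\<in>{0<..T}. lip u s \<le> (1 / 4) / s + L" using lip_le by blast
  note w = singular_weight[OF L(1)]
  show ?thesis
  proof (rule tracer_exists[OF tracer_field_vel vel_lip w(1,2,3,4) lip_weight[OF L]])
    show "2 * Mv u * sqrt t \<le> 2 * Mv u * singular_weight L t" if "t \<in> {0..T}" for t
      using w(6)[OF that] Mv_nonneg[of u] by (intro mult_left_mono) auto
  qed (use Mv_nonneg[of u] in auto)
qed

text \<open>The constant belongs to \<open>u\<close>, while \<open>u'\<close> is arbitrary:
  Lipschitz dependence centred at each point of H. The case \<open>u' = u\<close> is uniqueness, and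
  letting \<open>u'\<close> tend to \<open>u\<close> gives continuity of the observations.\<close>

lemma tracer_lipschitz_at:
  "\<exists>L'\<ge>0. \<forall>u' z0 z z'. \<forall>t\<in>{0..T}. tracer_field.solves T (vel u) z0 z \<longrightarrow> tracer_field.solves T (vel u') z0 z'
     \<longrightarrow> norm (z t - z' t) \<le> L' * norm (u - u')"
proof -
  obtain L where L: "L \<ge> 0" "\<forall>s\<in>{0<..T}. lip u s \<le> (1 / 4) / s + L" using lip_le by blast
  note w = singular_weight[OF L(1)]
  have "norm (z t - z' t) \<le> 4 * sqrt 2 * Ch * (sqrt T * exp (2 * L * T)) * norm (u - u')"
    if t: "t \<in> {0..T}" and z: "tracer_field.solves T (vel u) z0 z" "tracer_field.solves T (vel u') z0 z'" for u' z0 z z' t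
  proof -
    let ?D = "sqrt 2 * Ch * norm (u - u')"
    have D: "?D \<ge> 0" using Ch_nonneg by simp
    have "norm (z t - z' t) \<le> 2 * (2 * ?D) * singular_weight L t"
    proof (rule tracer_difference_bound[OF tracer_field_vel[of u] tracer_field_vel[of u'] z vel_lip vel_diff w(1,2,3,4) lip_weight[OF L] _ _ _ _ t])
      show "2 * ?D * sqrt t \<le> 2 * ?D * singular_weight L t" if "t \<in> {0..T}" for t
        using w(6)[OF that] D by (intro mult_left_mono) auto
      show "2 * (Mv u + Mv u') * sqrt t \<le> 2 * (Mv u + Mv u') * singular_weight L t" if "t \<in> {0..T}" for t
        using w(6)[OF that] Mv_nonneg[of u] Mv_nonneg[of u'] by (intro mult_left_mono) auto
    qed (use D Mv_nonneg[of u] Mv_nonneg[of u'] in auto)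
    also have "\<dots> \<le> 2 * (2 * ?D) * (sqrt T * exp (2 * L * T))"
      using D by (intro mult_left_mono w(7)[OF t]) auto
    finally show ?thesis by (simp add: mult_ac)
  qed
  moreover have "4 * sqrt 2 * Ch * (sqrt T * exp (2 * L * T)) \<ge> 0" using Ch_nonneg T by simp
  ultimately show ?thesis by blast
qed

lemma tracer_unique:
  assumes "tracer_field.solves T (vel u) z0 z" "tracer_field.solves T (vel u) z0 z'" "t \<in> {0..T}"
  shows "z t = z' t"
  using tracer_lipschitz_at[of u] assms by (metis (no_types, lifting) cancel_comm_monoid_add_class.diff_cancel mult_zero_right norm_le_zero_iff norm_zero right_minus_eq)

text \<open>Needed because the Stokes solution in \<open>tracer_pos\<close> is an arbitrary function
  agreeing with \<open>vs u\<close> on the time interval only.\<close>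

lemma tracer_cong:
  assumes "\<And>t. t \<in> {0..T} \<Longrightarrow> v t = v' t" shows "tracer T v z0 z \<longleftrightarrow> tracer T v' z0 z"
proof -
  have "set_integrable lborel {0..t} (\<lambda>s. per_ext (v s) (z s)) \<longleftrightarrow> set_integrable lborel {0..t} (\<lambda>s. per_ext (v' s) (z s))"
    "(LINT s:{0..t}|lborel. per_ext (v s) (z s)) = (LINT s:{0..t}|lborel. per_ext (v' s) (z s))" if "t \<in> {0..T}" for t
    using assms that by (intro set_integrable_cong set_lebesgue_integral_cong refl; auto)+
  then show ?thesis unfolding tracer_def by auto
qed

lemma tracer_pos_eq:
  assumes z: "tracer_field.solves T (vel u) z0 z" and t: "t \<in> {0..T}"
  shows "tracer_pos nu T \<psi> u z0 t = z t"
  unfolding tracer_pos_def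
proof (rule the_equality)
  show "\<exists>v y. stokes_solution nu T \<psi> u v \<and> tracer T v z0 y \<and> y t = z t"
    using stokes_solution_vs tracer_iff_solves z by blast
  fix p assume "\<exists>v y. stokes_solution nu T \<psi> u v \<and> tracer T v z0 y \<and> y t = p"
  then obtain v y where v: "stokes_solution nu T \<psi> u v" "tracer T v z0 y" "y t = p" by blast
  then have "tracer T (vs u) z0 y"
    using tracer_cong[of v "vs u"] stokes_solution_unique[OF v(1)] by blast
  then show "p = z t" using tracer_unique[OF _ z t, of y] v(3) by (simp add: tracer_iff_solves)
qed

lemma tracer_pos_lipschitz_at:
  "\<exists>L\<ge>0. \<forall>u' z0. \<forall>t\<in>{0..T}. norm (tracer_pos nu T \<psi> u z0 t - tracer_pos nu T \<psi> u' z0 t) \<le> L * norm (u - u')"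
proof -
  obtain L where L: "L \<ge> 0" "\<And>u' z0 z z' t. t \<in> {0..T} \<Longrightarrow> tracer_field.solves T (vel u) z0 z \<Longrightarrow>
      tracer_field.solves T (vel u') z0 z' \<Longrightarrow> norm (z t - z' t) \<le> L * norm (u - u')"
    using tracer_lipschitz_at[of u] by blast
  have "norm (tracer_pos nu T \<psi> u z0 t - tracer_pos nu T \<psi> u' z0 t) \<le> L * norm (u - u')" if t: "t \<in> {0..T}" for u' z0 t
  proof -
    obtain z z' where z: "tracer_field.solves T (vel u) z0 z" "tracer_field.solves T (vel u') z0 z'"
      using tracer_solution_exists by metis
    show ?thesis using L(2)[OF t z] by (simp add: tracer_pos_eq[OF z(1) t] tracer_pos_eq[OF z(2) t])
  qed
  then show ?thesis using L(1) by blast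
qed

lemma norm_tracer_pos_le:
  assumes t: "t \<in> {0..T}"
  shows "norm (tracer_pos nu T \<psi> u z0 t) \<le> norm z0 + 2 * Mv u * sqrt T"
proof -
  interpret tracer_field T "Mv u" "vel u" by (rule tracer_field_vel)
  obtain z where z: "solves z0 z" using tracer_solution_exists by metis
  have "norm (z t) \<le> norm z0 + norm (drift z t)"
    using z t norm_triangle_ineq[of z0 "drift z t"] by (simp add: solves_def)
  also have "norm (drift z t) \<le> 2 * Mv u * sqrt t"
    using z by (intro norm_drift_le t) (simp add: solves_def)
  also have "\<dots> \<le> 2 * Mv u * sqrt T" using t M_nonneg by (intro mult_left_mono) auto
  finally show ?thesis by (simp add: tracer_pos_eq[OF z t])
qed

text \<open>For Sobolev data the Lipschitz bound has a continuous antiderivative \<Lambda>, and the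
  weight exp(2 \<Lambda>) yields the usual Gronwall estimate. The constant depends on
  \<open>u\<close> through its Sobolev norm only, and \<open>u'\<close> need not lie in the Sobolev
  space.\<close>

lemma tracer_pos_lipschitz_Hs:
  assumes \<sigma>: "0 < \<sigma>" "\<sigma> \<le> 1"
  shows "\<exists>C\<ge>0. \<forall>u\<in>Hs \<sigma>. \<forall>u' z0. \<forall>t\<in>{0..T}.
     norm (tracer_pos nu T \<psi> u z0 t - tracer_pos nu T \<psi> u' z0 t) \<le> C * exp (C * Hs_norm \<sigma> u) * norm (u - u')"
proof -
  obtain c0 where c0: "c0 \<ge> 0" "\<And>u s. u \<in> Hs \<sigma> \<Longrightarrow> s \<in> {0<..T} \<Longrightarrow>
      (\<Sum>\<^sub>\<infinity>k\<in>kk. kabs k * \<bar>heat u k s\<bar>) \<le> c0 * s powr (\<sigma> / 4 - 1) * Hs_norm \<sigma> u"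
    using heat_kabs_Hs[OF \<sigma>] by blast
  \<comment> \<open>\<open>c1\<close> comes from the singular part of the Lipschitz bound,
    \<open>c2\<close> from the forcing. \<open>a\<close> collects what multiplies the Sobolev norm
    in the exponent and \<open>b\<close> the prefactor; their sum serves in both places.\<close>
  define c1 where "c1 = 2 * pi * sqrt 2 * c0"
  define c2 where "c2 = 2 * pi * sqrt 2 * Cd"
  define a where "a = 2 * (c1 * (4 / \<sigma>) * T powr (\<sigma> / 4))"
  define b where "b = 4 * sqrt 2 * Ch * sqrt T * exp (2 * (c2 * T))"
  have c12: "c1 \<ge> 0" "c2 \<ge> 0" using c0(1) Cd(1) by (auto simp: c1_def c2_def)
  have ab: "a \<ge> 0" "b \<ge> 0" using c12 \<sigma> Ch_nonneg T by (auto simp: a_def b_def)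
  have "norm (tracer_pos nu T \<psi> u z0 t - tracer_pos nu T \<psi> u' z0 t) \<le> (a + b) * exp ((a + b) * Hs_norm \<sigma> u) * norm (u - u')"
    if u: "u \<in> Hs \<sigma>" and t: "t \<in> {0..T}" for u u' z0 t
  proof -
    let ?q = "Hs_norm \<sigma> u"
    let ?D = "sqrt 2 * Ch * norm (u - u')"
    have q: "?q \<ge> 0" by (rule Hs_norm_nonneg)
    have D: "?D \<ge> 0" using Ch_nonneg by simp
    \<comment> \<open>The antiderivative, vanishing at 0, of the bound for
      \<open>lip u\<close>.\<close>
    define \<Lambda> where "\<Lambda> s = c1 * ?q * (4 / \<sigma>) * s powr (\<sigma> / 4) + c2 * s" for s
    define w where "w s = exp (2 * \<Lambda> s)" for s
    define w' where "w' s = exp (2 * \<Lambda> s) * (2 * (c1 * ?q * s powr (\<sigma> / 4 - 1) + c2))" for s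
    have \<Lambda>0: "\<Lambda> s \<ge> 0" if "s \<ge> 0" for s
      using c12 q \<sigma> that by (auto simp: \<Lambda>_def intro!: add_nonneg_nonneg mult_nonneg_nonneg)
    have w1: "w s \<ge> 1" if "s \<in> {0..T}" for s using \<Lambda>0[of s] that by (simp add: w_def)
    have \<Lambda>d: "(\<Lambda> has_real_derivative c1 * ?q * s powr (\<sigma> / 4 - 1) + c2) (at s)" if "s > 0" for s
    proof -
      have "((\<lambda>s. c1 * ?q * (4 / \<sigma>) * s powr (\<sigma> / 4) + c2 * s) has_real_derivative
          c1 * ?q * (4 / \<sigma>) * ((\<sigma> / 4) * s powr (\<sigma> / 4 - 1)) + c2 * 1) (at s)"
        using that by (intro DERIV_add DERIV_cmult has_real_derivative_powr DERIV_ident)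
      then have "(\<Lambda> has_real_derivative c1 * ?q * (4 / \<sigma>) * ((\<sigma> / 4) * s powr (\<sigma> / 4 - 1)) + c2 * 1) (at s)"
        unfolding \<Lambda>_def[abs_def] .
      then show ?thesis by (rule DERIV_cong) (use \<sigma> in simp)
    qed
    obtain z z' where z: "tracer_field.solves T (vel u) z0 z" "tracer_field.solves T (vel u') z0 z'"
      using tracer_solution_exists by metis
    have "norm (z t - z' t) \<le> 2 * (2 * ?D * sqrt T) * w t"
    proof (rule tracer_difference_bound[OF tracer_field_vel[of u] tracer_field_vel[of u'] z vel_lip vel_diff _ _ _ _ _ _ _ _ _ t])
      show "continuous_on {0..T} w" unfolding w_def[abs_def] \<Lambda>_def[abs_def]
        using \<sigma> by (intro continuous_intros continuous_on_powr') auto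
      show "0 \<le> w t" for t by (simp add: w_def)
      show "(w has_real_derivative w' s) (at s)" if "s \<in> {0<..<T}" for s
        unfolding w_def[abs_def] w'_def using that
        by (intro DERIV_chain2[OF DERIV_exp] DERIV_cmult \<Lambda>d) auto
      show "isCont w' s" if "s \<in> {0<..<T}" for s
        unfolding w'_def[abs_def] \<Lambda>_def[abs_def] using that by (intro continuous_intros) auto
      show "0 \<le> lip u s \<and> lip u s * w s \<le> w' s / 2" if "s \<in> {0<..<T}" for s
      proof -
        have "lip u s \<le> 2 * pi * sqrt 2 * (c0 * s powr (\<sigma> / 4 - 1) * ?q + Cd)"
          unfolding lip_def using c0(2)[OF u, of s] that by (intro mult_left_mono add_right_mono) auto
        also have "\<dots> = c1 * ?q * s powr (\<sigma> / 4 - 1) + c2" by (simp add: c1_def c2_def algebra_simps)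
        finally have "lip u s * w s \<le> (c1 * ?q * s powr (\<sigma> / 4 - 1) + c2) * w s"
          by (intro mult_right_mono) (auto simp: w_def)
        also have "\<dots> = w' s / 2" by (simp add: w'_def w_def)
        finally show ?thesis using lip_nonneg by simp
      qed
      show "2 * ?D * sqrt t \<le> 2 * ?D * sqrt T * w t" if t: "t \<in> {0..T}" for t
      proof -
        have "2 * ?D * sqrt t * 1 \<le> 2 * ?D * sqrt T * w t"
          using w1[OF t] t D by (intro mult_mono mult_left_mono) auto
        then show ?thesis by simp
      qed
      show "2 * (Mv u + Mv u') * sqrt t \<le> 2 * (Mv u + Mv u') * sqrt T * w t" if t: "t \<in> {0..T}" for t
      proof -
        have "2 * (Mv u + Mv u') * sqrt t * 1 \<le> 2 * (Mv u + Mv u') * sqrt T * w t"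
          using w1[OF t] t Mv_nonneg[of u] Mv_nonneg[of u'] by (intro mult_mono mult_left_mono) auto
        then show ?thesis by simp
      qed
    qed (use D T Mv_nonneg[of u] Mv_nonneg[of u'] in auto)
    also have "w t \<le> exp (2 * (c2 * T)) * exp (a * ?q)"
    proof -
      have "2 * \<Lambda> t \<le> 2 * (c1 * ?q * (4 / \<sigma>) * T powr (\<sigma> / 4) + c2 * T)"
        unfolding \<Lambda>_def using t c12 q \<sigma>
        by (intro mult_left_mono add_mono powr_mono2 mult_nonneg_nonneg) auto
      also have "\<dots> = 2 * (c2 * T) + a * ?q" by (simp add: a_def algebra_simps)
      finally show ?thesis unfolding w_def by (simp flip: exp_add)
    qed
    then have "2 * (2 * ?D * sqrt T) * w t \<le> 2 * (2 * ?D * sqrt T) * (exp (2 * (c2 * T)) * exp (a * ?q))"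
      using T Ch_nonneg by (intro mult_left_mono mult_nonneg_nonneg) auto
    also have "\<dots> = b * exp (a * ?q) * norm (u - u')" by (simp add: b_def mult_ac)
    also have "\<dots> \<le> (a + b) * exp ((a + b) * ?q) * norm (u - u')"
      using ab q by (intro mult_right_mono mult_mono) (auto intro!: mult_right_mono)
    finally show ?thesis by (simp add: tracer_pos_eq[OF z(1) t] tracer_pos_eq[OF z(2) t])
  qed
  then show ?thesis using ab by (intro exI[of _ "a + b"]) auto
qed

end

section \<open>Exponential moments under the Gaussian prior\<close>

lemma A_pow_phi: assumes "k \<in> kk" shows "A_pow a (phi k) = (lam k powr a) *\<^sub>R phi k"
proof -
  have "A_pow a (phi k) = (\<Sum>\<^sub>\<infinity>l\<in>{k}. (lam l powr a * inner (phi k) (phi l)) *\<^sub>R phi l)"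
    unfolding A_pow_def by (rule infsum_cong_neutral) (use assms in \<open>auto simp: inner_phi\<close>)
  then show ?thesis using assms by (simp add: inner_phi)
qed

text \<open>The exponent is half the critical one for the variance
  \<open>\<beta> * lam k powr (- \<alpha>)\<close>, so the value is the same finite number for every
  mode. This uniformity is what allows averaging over the modes.\<close>

lemma gaussian_coefficient_moment:
  assumes G: "gaussian M 0 (\<lambda>u. \<beta> *\<^sub>R A_pow (- \<alpha>) u)" and \<beta>: "\<beta> > 0" and k: "k \<in> kk"
  shows "(\<integral>\<^sup>+u. ennreal (exp (lam k powr \<alpha> * (inner u (phi k))\<^sup>2 / (4 * \<beta>))) \<partial>M) = ennreal (sqrt 2)"
proof -
  have M: "sets M = sets borel" using G by (simp add: gaussian_def)
  define v where "v = \<beta> * lam k powr (- \<alpha>)"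
  have l: "lam k \<ge> 1" by (rule lam_ge_1[OF k])
  have v: "v > 0" using \<beta> l by (simp add: v_def)
  have "distr M borel (\<lambda>u. inner u (phi k)) = real_gaussian 0 v"
    using G k by (simp add: gaussian_def A_pow_phi inner_phi v_def)
  then have D: "distr M borel (\<lambda>u. inner u (phi k)) = density lborel (normal_density 0 (sqrt v))"
    using v by (simp add: real_gaussian_def)
  have c: "lam k powr \<alpha> * x\<^sup>2 / (4 * \<beta>) = x\<^sup>2 / (4 * v)" for x
    using l by (simp add: v_def powr_minus field_simps)
  have m: "(\<lambda>u. inner u (phi k)) \<in> measurable M borel"
    by (subst measurable_cong_sets[OF M refl]) (intro borel_measurable_continuous_onI continuous_intros)
  have "(\<integral>\<^sup>+u. ennreal (exp ((inner u (phi k))\<^sup>2 / (4 * v))) \<partial>M) =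
      (\<integral>\<^sup>+x. ennreal (exp (x\<^sup>2 / (4 * v))) \<partial>distr M borel (\<lambda>u. inner u (phi k)))"
    by (subst nn_integral_distr[OF m]) auto
  also have "\<dots> = (\<integral>\<^sup>+x. ennreal (normal_density 0 (sqrt v) x) * ennreal (exp (x\<^sup>2 / (4 * v))) \<partial>lborel)"
    unfolding D by (subst nn_integral_density) auto
  \<comment> \<open>Multiplying the Gaussian density by the exponential halves the exponent, which
    is again a Gaussian density, of twice the variance, up to the factor sqrt 2.\<close>
  also have "\<dots> = (\<integral>\<^sup>+x. ennreal (sqrt 2) * ennreal (normal_density 0 (sqrt (2 * v)) x) \<partial>lborel)"
  proof (rule nn_integral_cong)
    fix x :: real
    have e: "exp (- (x\<^sup>2 / (2 * v))) * exp (x\<^sup>2 / (4 * v)) = exp (- (x\<^sup>2 / (4 * v)))"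
      using v by (simp flip: exp_add)
    have s: "1 / sqrt (2 * pi * v) = sqrt 2 * (1 / sqrt (2 * pi * (2 * v)))"
    proof -
      have "sqrt (2 * pi * (2 * v)) = sqrt 2 * sqrt (2 * pi * v)" by (simp flip: real_sqrt_mult)
      then show ?thesis by (simp only:) simp
    qed
    have "normal_density 0 (sqrt v) x * exp (x\<^sup>2 / (4 * v)) = 1 / sqrt (2 * pi * v) * (exp (- (x\<^sup>2 / (2 * v))) * exp (x\<^sup>2 / (4 * v)))"
      using v by (simp add: normal_density_def)
    also have "\<dots> = sqrt 2 * normal_density 0 (sqrt (2 * v)) x"
      unfolding e s using v by (simp add: normal_density_def)
    finally show "ennreal (normal_density 0 (sqrt v) x) * ennreal (exp (x\<^sup>2 / (4 * v))) = ennreal (sqrt 2) * ennreal (normal_density 0 (sqrt (2 * v)) x)"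
      by (simp flip: ennreal_mult)
  qed
  also have "\<dots> = ennreal (sqrt 2) * (\<integral>\<^sup>+x. ennreal (normal_density 0 (sqrt (2 * v)) x) \<partial>lborel)"
    by (intro nn_integral_cmult) auto
  also have "(\<integral>\<^sup>+x. ennreal (normal_density 0 (sqrt (2 * v)) x) \<partial>lborel) = 1"
    using v by (subst nn_integral_eq_integral) (auto simp: integral_normal_density integrable_normal_density)
  finally show ?thesis by (simp add: c)
qed

text \<open>Jensen's inequality for subprobability weights: the missing mass
  \<open>1 - sum w F\<close> is placed at the value 0. The proof averages the tangent line of
  \<open>exp\<close> at the weighted mean \<open>m\<close>.\<close>

lemma exp_weighted_sum_le:
  fixes w x :: "'a \<Rightarrow> real"
  assumes w: "\<And>k. k \<in> F \<Longrightarrow> 0 \<le> w k" "sum w F \<le> 1"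
  shows "exp (\<Sum>k\<in>F. w k * x k) \<le> (\<Sum>k\<in>F. w k * exp (x k)) + (1 - sum w F)"
proof -
  define m where "m = (\<Sum>k\<in>F. w k * x k)"
  have tangent: "exp m * (1 + (y - m)) \<le> exp y" for y
    using mult_left_mono[OF exp_ge_add_one_self[of "y - m"], of "exp m"] by (simp flip: exp_add)
  have "exp m = (\<Sum>k\<in>F. w k * (exp m * (1 + (x k - m)))) + (1 - sum w F) * (exp m * (1 + (0 - m)))"
  proof -
    have "(\<Sum>k\<in>F. w k * (exp m * (1 + (x k - m)))) = exp m * (\<Sum>k\<in>F. w k * (1 - m) + w k * x k)"
      by (simp add: sum_distrib_left algebra_simps)
    also have "\<dots> = exp m * (sum w F * (1 - m) + m)"
      by (simp add: sum.distrib sum_distrib_right m_def)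
    finally show ?thesis by (simp add: algebra_simps)
  qed
  also have "\<dots> \<le> (\<Sum>k\<in>F. w k * exp (x k)) + (1 - sum w F) * exp 0"
    using w tangent tangent[of 0] by (intro add_mono sum_mono mult_left_mono) auto
  finally show ?thesis by (simp add: m_def)
qed

text \<open>Jensen's inequality for the weights \<open>lam k powr (s - \<alpha>)\<close> reduces the exponential moment to
  one-dimensional marginals, so that independence of the coefficients is not needed.\<close>

lemma gaussian_exponential_moment:
  assumes G: "gaussian M 0 (\<lambda>u. \<beta> *\<^sub>R A_pow (- \<alpha>) u)" and \<beta>: "\<beta> > 0" and s: "s < \<alpha> - 1"
  obtains \<delta> Y where "\<delta> > 0" "integrable M Y" "\<And>u. Y u \<ge> 1"
    "AE u in M. u \<in> Hs s \<and> exp (\<delta> * (Hs_norm s u)\<^sup>2) \<le> Y u"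
proof -
  have M: "sets M = sets borel" and "prob_space M" using G by (auto simp: gaussian_def)
  then interpret prob_space M by simp
  define Z where "Z = (\<Sum>\<^sub>\<infinity>k\<in>kk. lam k powr (s - \<alpha>))"
  \<comment> \<open>The hypothesis on \<open>s\<close> enters here: the exponent
    \<open>s - \<alpha>\<close> lies below -1.\<close>
  have sm: "(\<lambda>k. lam k powr (s - \<alpha>)) summable_on kk"
    using lam_powr_summable[of "\<alpha> - s"] s by simp
  have Z_ge: "(\<Sum>k\<in>F. lam k powr (s - \<alpha>)) \<le> Z" if "finite F" "F \<subseteq> kk" for F
    unfolding Z_def using that by (intro finite_sum_le_infsum sm) auto
  have k1: "(1, 0) \<in> kk" by (simp add: kk_def)
  have "0 < lam (1, 0) powr (s - \<alpha>)" using lam_ge_1[OF k1] by simp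
  moreover have "lam (1, 0) powr (s - \<alpha>) \<le> Z" using Z_ge[of "{(1, 0)}"] k1 by simp
  ultimately have Z: "Z > 0" by (rule less_le_trans)
  \<comment> \<open>Chosen so that the weighted exponents \<open>w k * x k u\<close> are exactly
    \<delta> times the terms of the squared Sobolev norm.\<close>
  define \<delta> where "\<delta> = 1 / (4 * \<beta> * Z)"
  have \<delta>: "\<delta> > 0" using \<beta> Z by (simp add: \<delta>_def)
  define w where "w k = lam k powr (s - \<alpha>) / Z" for k
  define x where "x k u = lam k powr \<alpha> * (inner u (phi k))\<^sup>2 / (4 * \<beta>)" for k u
  have w0: "w k \<ge> 0" for k using Z by (simp add: w_def)
  have w1: "sum w F \<le> 1" if "finite F" "F \<subseteq> kk" for F
    using Z_ge[OF that] Z by (simp add: w_def flip: sum_divide_distrib)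
  have wx: "w k * x k u = \<delta> * (lam k powr (s / 2) * inner u (phi k))\<^sup>2" if "k \<in> kk" for k u
  proof -
    have "lam k powr (s - \<alpha>) * lam k powr \<alpha> = lam k powr s" by (simp flip: powr_add)
    then have "lam k powr (s - \<alpha>) * (lam k powr \<alpha> * (inner u (phi k))\<^sup>2) = lam k powr s * (inner u (phi k))\<^sup>2"
      by (simp only: mult.assoc[symmetric])
    then show ?thesis by (simp add: w_def x_def \<delta>_def power_mult_distrib powr_half_sq mult_ac)
  qed
  define \<Xi> where "\<Xi> n u = (\<Sum>k\<in>kball n. ennreal (w k) * ennreal (exp (x k u)))" for n u
  have xm: "(\<lambda>u. ennreal (exp (x k u))) \<in> borel_measurable M" for k
    unfolding x_def by (subst measurable_cong_sets[OF M refl])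
      (intro measurable_compose[OF _ measurable_ennreal] borel_measurable_continuous_onI continuous_intros, use \<beta> in simp)
  have \<Xi>m: "\<Xi> n \<in> borel_measurable M" for n
    unfolding \<Xi>_def[abs_def] using xm by measurable
  have \<Xi>e: "\<Xi> n u = ennreal (\<Sum>k\<in>kball n. w k * exp (x k u))" for n u
    unfolding \<Xi>_def using w0 by (simp add: sum_ennreal flip: ennreal_mult)
  have "integral\<^sup>N M (\<Xi> n) \<le> ennreal (sqrt 2)" for n
  proof -
    have "integral\<^sup>N M (\<Xi> n) = (\<Sum>k\<in>kball n. ennreal (w k) * (\<integral>\<^sup>+u. ennreal (exp (x k u)) \<partial>M))"
      unfolding \<Xi>_def[abs_def] using xm by (subst nn_integral_sum) (auto intro!: sum.cong nn_integral_cmult)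
    also have "\<dots> = (\<Sum>k\<in>kball n. ennreal (w k) * ennreal (sqrt 2))"
      unfolding x_def using kball_subset by (intro sum.cong refl arg_cong2[where f = "(*)"] gaussian_coefficient_moment[OF G \<beta>]) auto
    also have "\<dots> = ennreal (sum w (kball n) * sqrt 2)"
      using w0 by (simp add: sum_ennreal sum_distrib_right flip: ennreal_mult)
    also have "\<dots> \<le> ennreal (1 * sqrt 2)"
      using w1[OF finite_kball kball_subset] by (intro ennreal_leI mult_right_mono) auto
    finally show ?thesis by simp
  qed
  \<comment> \<open>Monotone convergence carries the uniform bound over to all modes at once, so the
    supremum is integrable and finite almost everywhere.\<close>
  then have "(SUP n. integral\<^sup>N M (\<Xi> n)) \<le> ennreal (sqrt 2)" by (rule SUP_least)
  moreover have "(\<integral>\<^sup>+u. (SUP n. \<Xi> n u) \<partial>M) = (SUP n. integral\<^sup>N M (\<Xi> n))"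
  proof (rule nn_integral_monotone_convergence_SUP[OF _ \<Xi>m])
    show "incseq \<Xi>"
      unfolding incseq_def le_fun_def \<Xi>_def using kball_mono finite_kball by (auto intro!: sum_mono2)
  qed
  ultimately have int: "(\<integral>\<^sup>+u. (SUP n. \<Xi> n u) \<partial>M) \<le> ennreal (sqrt 2)" by simp
  have Sm: "(\<lambda>u. SUP n. \<Xi> n u) \<in> borel_measurable M" using \<Xi>m by (intro borel_measurable_SUP) auto
  have fin: "(\<integral>\<^sup>+u. (SUP n. \<Xi> n u) \<partial>M) \<noteq> \<infinity>" using int by (auto simp: top_unique)
  have ae: "AE u in M. (SUP n. \<Xi> n u) \<noteq> \<infinity>" by (rule nn_integral_PInf_AE[OF Sm fin])
  \<comment> \<open>The added 1 pays for the missing mass in Jensen's inequality and makes the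
    logarithm of \<open>Y u\<close> nonnegative.\<close>
  define Y where "Y u = enn2real (SUP n. \<Xi> n u) + 1" for u
  have "integrable M (\<lambda>u. enn2real (SUP n. \<Xi> n u))"
  proof (rule integrableI_nonneg)
    show "(\<lambda>u. enn2real (SUP n. \<Xi> n u)) \<in> borel_measurable M" using Sm by measurable
    have "(\<integral>\<^sup>+u. ennreal (enn2real (SUP n. \<Xi> n u)) \<partial>M) \<le> (\<integral>\<^sup>+u. (SUP n. \<Xi> n u) \<partial>M)"
      by (intro nn_integral_mono ennreal_enn2real_if[THEN eq_refl, THEN order_trans]) auto
    then show "(\<integral>\<^sup>+u. ennreal (enn2real (SUP n. \<Xi> n u)) \<partial>M) < \<infinity>" using fin by (simp add: less_top le_less_trans)
  qed auto
  then have Yi: "integrable M Y" unfolding Y_def[abs_def] by simp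
  have Y1: "Y u \<ge> 1" for u by (simp add: Y_def)
  have main: "u \<in> Hs s \<and> exp (\<delta> * (Hs_norm s u)\<^sup>2) \<le> Y u" if u: "(SUP n. \<Xi> n u) \<noteq> \<infinity>" for u
  proof -
    have le: "(\<Sum>k\<in>F. (lam k powr (s / 2) * inner u (phi k))\<^sup>2) \<le> ln (Y u) / \<delta>" if F: "finite F" "F \<subseteq> kk" for F
    proof -
      have "\<forall>\<^sub>F n in sequentially. finite (kball n) \<and> F \<subseteq> kball n \<and> kball n \<subseteq> kk"
        using filterlim_kball F unfolding filterlim_finite_subsets_at_top by blast
      then obtain n where n: "F \<subseteq> kball n" by (auto simp: eventually_sequentially)
      have "ennreal (\<Sum>k\<in>F. w k * exp (x k u)) \<le> ennreal (\<Sum>k\<in>kball n. w k * exp (x k u))"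
        using n finite_kball w0 by (intro ennreal_leI sum_mono2) auto
      also have "\<dots> \<le> (SUP n. \<Xi> n u)" unfolding \<Xi>e[symmetric] by (rule SUP_upper) simp
      also have "\<dots> = ennreal (enn2real (SUP n. \<Xi> n u))" 
        using u unfolding infinity_ennreal_def less_top by (rule ennreal_enn2real[symmetric])
      finally have "(\<Sum>k\<in>F. w k * exp (x k u)) \<le> enn2real (SUP n. \<Xi> n u)" by (simp add: ennreal_le_iff)
      moreover have "0 \<le> sum w F" using w0 by (intro sum_nonneg)
      moreover have "exp (\<Sum>k\<in>F. w k * x k u) \<le> (\<Sum>k\<in>F. w k * exp (x k u)) + (1 - sum w F)"
        by (rule exp_weighted_sum_le[OF w0 w1[OF F]])
      ultimately have "exp (\<Sum>k\<in>F. w k * x k u) \<le> Y u" unfolding Y_def by linarith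
      then have "(\<Sum>k\<in>F. w k * x k u) \<le> ln (Y u)" using Y1[of u] by (simp add: ln_ge_iff)
      moreover have "(\<Sum>k\<in>F. w k * x k u) = \<delta> * (\<Sum>k\<in>F. (lam k powr (s / 2) * inner u (phi k))\<^sup>2)"
        unfolding sum_distrib_left using F wx by (intro sum.cong refl) auto
      ultimately show ?thesis using \<delta> by (simp add: field_simps)
    qed
    have le': "(\<Sum>k\<in>F. lam k powr s * (inner u (phi k))\<^sup>2) \<le> ln (Y u) / \<delta>" if F: "finite F" "F \<subseteq> kk" for F
      using le[OF F] by (simp add: power_mult_distrib powr_half_sq)
    have sm: "(\<lambda>k. lam k powr s * (inner u (phi k))\<^sup>2) summable_on kk"
      by (rule nonneg_bdd_above_summable_on) (use le' in \<open>auto intro!: bdd_aboveI2[of _ _ "ln (Y u) / \<delta>"]\<close>)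
    have "(Hs_norm s u)\<^sup>2 \<le> ln (Y u) / \<delta>"
      unfolding Hs_norm_def using infsum_le_finite_sums[OF sm le']
      by (subst real_sqrt_pow2) (auto intro: infsum_nonneg)
    then have "\<delta> * (Hs_norm s u)\<^sup>2 \<le> ln (Y u)" using \<delta> by (simp add: field_simps)
    then have "exp (\<delta> * (Hs_norm s u)\<^sup>2) \<le> exp (ln (Y u))" by simp
    also have "\<dots> = Y u" using Y1[of u] by simp
    finally show ?thesis using sm by (simp add: Hs_def)
  qed
  have "AE u in M. u \<in> Hs s \<and> exp (\<delta> * (Hs_norm s u)\<^sup>2) \<le> Y u"
    using ae by eventually_elim (rule main)
  then show ?thesis using that \<delta> Yi Y1 by blast
qed

section \<open>Galerkin truncation\<close>

lemma Hs_mono: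
  assumes u: "u \<in> Hs s" and r: "r \<le> s"
  shows "u \<in> Hs r" and "Hs_norm r u \<le> Hs_norm s u"
proof -
  have le: "lam k powr r * (inner u (phi k))\<^sup>2 \<le> lam k powr s * (inner u (phi k))\<^sup>2" if "k \<in> kk" for k
    using lam_ge_1[OF that] r by (intro mult_right_mono powr_mono) auto
  have s: "(\<lambda>k. lam k powr s * (inner u (phi k))\<^sup>2) summable_on kk" using u by (simp add: Hs_def)
  have sr: "(\<lambda>k. lam k powr r * (inner u (phi k))\<^sup>2) summable_on kk"
    by (rule summable_on_comparison_test[OF s]) (use le in auto)
  then show "u \<in> Hs r" by (simp add: Hs_def)
  show "Hs_norm r u \<le> Hs_norm s u"
    unfolding Hs_norm_def by (intro real_sqrt_le_mono infsum_mono sr s le)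
qed

lemma norm_le_Hs_norm:
  assumes "u \<in> Hs s" "s \<ge> 0" shows "norm u \<le> Hs_norm s u"
proof -
  have "Hs_norm 0 u = sqrt (\<Sum>\<^sub>\<infinity>k\<in>kk. (inner u (phi k))\<^sup>2)"
    unfolding Hs_norm_def using lam_ge_1 by (intro arg_cong[where f = sqrt] infsum_cong) force
  also have "\<dots> = norm u" using infsumI[OF parseval, of u] by simp
  finally show ?thesis using Hs_mono(2)[OF assms] by simp
qed

text \<open>Outside the disc of radius N the eigenvalues exceed N^2, so each discarded squared
  coefficient is smaller than its Sobolev term by the factor
  \<open>real N powr (- (2 * s))\<close>.\<close>

lemma PN_error:
  assumes u: "u \<in> Hs s" and s: "s \<ge> 0" and N: "N \<ge> 1"
  shows "norm (u - PN N u) \<le> real N powr (- s) * Hs_norm s u"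
proof -
  have N0: "real N > 0" using N by simp
  have S: "(\<lambda>k. lam k powr s * (inner u (phi k))\<^sup>2) summable_on kk" using u by (simp add: Hs_def)
  have le: "(inner (u - PN N u) (phi k))\<^sup>2 \<le> real N powr (- (2 * s)) * (lam k powr s * (inner u (phi k))\<^sup>2)" if k: "k \<in> kk" for k
  proof (cases "kabs k \<le> real N")
    case True
    then show ?thesis using k by (simp add: inner_diff_left PN_coefficient)
  next
    case False
    have "(real N)\<^sup>2 \<le> (kabs k)\<^sup>2" using False N by (intro power_mono) auto
    then have "(real N)\<^sup>2 \<le> lam k" using kabs_sq_le_lam[of k] by linarith
    then have "((real N)\<^sup>2) powr s \<le> lam k powr s" using s by (intro powr_mono2) auto
    moreover have "((real N)\<^sup>2) powr s = real N powr (2 * s)"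
      using N0 by (simp add: powr_powr flip: powr_numeral)
    ultimately have "real N powr (- (2 * s)) * real N powr (2 * s) \<le> real N powr (- (2 * s)) * lam k powr s"
      by (intro mult_left_mono) auto
    then have "1 \<le> real N powr (- (2 * s)) * lam k powr s" using N0 by (simp flip: powr_add)
    then have "1 * (inner u (phi k))\<^sup>2 \<le> (real N powr (- (2 * s)) * lam k powr s) * (inner u (phi k))\<^sup>2"
      by (intro mult_right_mono) auto
    then show ?thesis using False k by (simp add: inner_diff_left PN_coefficient mult.assoc)
  qed
  have "(norm (u - PN N u))\<^sup>2 = (\<Sum>\<^sub>\<infinity>k\<in>kk. (inner (u - PN N u) (phi k))\<^sup>2)"
    by (rule infsumI[OF parseval, symmetric])
  also have "\<dots> \<le> (\<Sum>\<^sub>\<infinity>k\<in>kk. real N powr (- (2 * s)) * (lam k powr s * (inner u (phi k))\<^sup>2))"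
    by (intro infsum_mono coefficients_summable summable_on_cmult_right S le)
  also have "\<dots> = real N powr (- (2 * s)) * (Hs_norm s u)\<^sup>2"
    unfolding Hs_norm_def by (subst real_sqrt_pow2) (auto intro: infsum_nonneg simp: infsum_cmult_right')
  also have "\<dots> = (real N powr (- s) * Hs_norm s u)\<^sup>2"
    by (simp add: power_mult_distrib power2_eq_square[of "real N powr _"] flip: powr_add)
  finally show ?thesis by (rule power2_le_imp_le) (simp add: Hs_norm_nonneg)
qed

lemma norm_PN_le: "norm (PN N u) \<le> norm u"
proof -
  have "(norm (PN N u))\<^sup>2 \<le> (norm u)\<^sup>2"
    unfolding PN_eq by (simp add: norm_sum_phi finite_kball kball_subset bessel)
  then show ?thesis by (rule power2_le_imp_le) simp
qed

lemma continuous_on_PN: "continuous_on S (PN N)"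
  unfolding PN_eq[abs_def] by (intro continuous_intros)

section \<open>Perturbation of posterior measures\<close>

lemma inverse_sqrt_diff_le:
  fixes \<zeta> Z Z' :: real
  assumes "\<zeta> > 0" "Z \<ge> \<zeta>" "Z' \<ge> \<zeta>"
  shows "\<bar>1 / sqrt Z - 1 / sqrt Z'\<bar> \<le> \<bar>Z - Z'\<bar> / (2 * \<zeta> * sqrt \<zeta>)"
proof -
  have s: "sqrt Z \<ge> sqrt \<zeta>" "sqrt Z' \<ge> sqrt \<zeta>" "sqrt \<zeta> > 0" using assms by auto
  then have p: "sqrt Z > 0" "sqrt Z' > 0" by linarith+
  have "(sqrt Z' - sqrt Z) * (sqrt Z' + sqrt Z) = Z' - Z"
    using assms by (simp add: algebra_simps)
  moreover have "sqrt Z' + sqrt Z \<noteq> 0" using p by linarith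
  ultimately have "sqrt Z' - sqrt Z = (Z' - Z) / (sqrt Z' + sqrt Z)"
    by (simp only: eq_divide_eq) simp
  then have "1 / sqrt Z - 1 / sqrt Z' = (Z' - Z) / (sqrt Z' + sqrt Z) / (sqrt Z * sqrt Z')"
    using p by (simp add: diff_frac_eq)
  then have "\<bar>1 / sqrt Z - 1 / sqrt Z'\<bar> = \<bar>Z - Z'\<bar> / ((sqrt Z' + sqrt Z) * (sqrt Z * sqrt Z'))"
    using p by (simp add: abs_mult abs_minus_commute)
  also have "\<dots> \<le> \<bar>Z - Z'\<bar> / ((sqrt \<zeta> + sqrt \<zeta>) * (sqrt \<zeta> * sqrt \<zeta>))"
    using s p by (intro divide_left_mono mult_mono add_mono mult_pos_pos add_pos_pos) auto
  also have "(sqrt \<zeta> + sqrt \<zeta>) * (sqrt \<zeta> * sqrt \<zeta>) = 2 * \<zeta> * sqrt \<zeta>" using assms by simp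
  finally show ?thesis .
qed

text \<open>\<open>r\<close> is the rate and \<open>\<zeta>\<close> a common lower bound for both
  normalisation constants. The difference is measured on the square roots of the likelihoods, as the
  Hellinger distance requires, with a quadratic weight that later controls second moments.
  \<open>Y\<close> is square integrable because the Hellinger integrand is itself a square. The
  conditions are symmetric, so estimates for one posterior transfer to the other.\<close>

locale posterior_pair = prob_space M for M :: "hspace measure" +
  fixes \<Phi> \<Phi>' Y :: "hspace \<Rightarrow> real" and \<zeta> r :: real
  assumes M_sets: "sets M = sets borel"
    and \<Phi>: "\<Phi> \<in> borel_measurable M" "\<And>u. 0 \<le> \<Phi> u" and \<Phi>': "\<Phi>' \<in> borel_measurable M" "\<And>u. 0 \<le> \<Phi>' u"
    and \<zeta>: "\<zeta> > 0" "\<zeta> \<le> (\<integral>u. exp (- \<Phi> u) \<partial>M)" "\<zeta> \<le> (\<integral>u. exp (- \<Phi>' u) \<partial>M)"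
    and Y: "Y \<in> borel_measurable M" "integrable M (\<lambda>u. (Y u)\<^sup>2)" and r: "r \<ge> 0"
    and diff: "AE u in M. (1 + norm u)\<^sup>2 * \<bar>exp (- \<Phi> u / 2) - exp (- \<Phi>' u / 2)\<bar> \<le> r * Y u"
    and Y_ge: "AE u in M. (1 + norm u)\<^sup>2 \<le> Y u"
begin

lemma posterior_pair_swap: "posterior_pair M \<Phi>' \<Phi> Y \<zeta> r"
  by unfold_locales (use M_sets \<Phi> \<Phi>' \<zeta> Y r diff Y_ge in \<open>auto simp: abs_minus_commute\<close>)

abbreviation "Z \<equiv> \<integral>u. exp (- \<Phi> u) \<partial>M"
abbreviation "Z' \<equiv> \<integral>u. exp (- \<Phi>' u) \<partial>M"
abbreviation "\<rho> u \<equiv> exp (- \<Phi> u) / Z"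
abbreviation "\<rho>' u \<equiv> exp (- \<Phi>' u) / Z'"
definition E1 where "E1 = (\<integral>u. Y u \<partial>M)"
definition E2 where "E2 = (\<integral>u. (Y u)\<^sup>2 \<partial>M)"

lemma id_measurable [measurable]: "(\<lambda>u. u) \<in> borel_measurable M"
  by (subst measurable_cong_sets[OF M_sets refl]) simp

lemmas meas [measurable] = \<Phi>(1) \<Phi>'(1) Y(1)

lemma Z_pos: "Z > 0" "Z' > 0" using \<zeta> by linarith+

lemma Y_ge_1: "AE u in M. 1 \<le> Y u"
  using Y_ge
proof eventually_elim
  case (elim u)
  have "1 \<le> (1 + norm u)\<^sup>2" by (rule one_le_power) simp
  then show ?case using elim by linarith
qed

lemma Y_integrable: "integrable M Y"
proof (rule Bochner_Integration.integrable_bound[OF Y(2)])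
  show "AE u in M. norm (Y u) \<le> norm ((Y u)\<^sup>2)"
    using Y_ge_1
  proof eventually_elim
    case (elim u)
    then show ?case using mult_right_mono[OF elim, of "Y u"] by (simp add: power2_eq_square)
  qed
qed measurable

lemma E1_nonneg: "E1 \<ge> 0" and E2_nonneg: "E2 \<ge> 0"
  unfolding E1_def E2_def using Y_ge_1 by (auto intro!: integral_nonneg_AE)

lemma exp_integrable: "integrable M (\<lambda>u. exp (- \<Phi> u))" "integrable M (\<lambda>u. exp (- \<Phi>' u))"
  using \<Phi>(2) \<Phi>'(2) by (auto intro!: integrable_const_bound[of _ 1])

lemma diff_weak: "AE u in M. \<bar>exp (- \<Phi> u / 2) - exp (- \<Phi>' u / 2)\<bar> \<le> r * Y u"
  using diff
proof eventually_elim
  case (elim u)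
  have "1 \<le> (1 + norm u)\<^sup>2" by (rule one_le_power) simp
  from mult_right_mono[OF this, of "\<bar>exp (- \<Phi> u / 2) - exp (- \<Phi>' u / 2)\<bar>"]
  show ?case using elim by simp
qed

lemma exp_diff_le: "\<bar>exp (- \<Phi> u) - exp (- \<Phi>' u)\<bar> \<le> 2 * \<bar>exp (- \<Phi> u / 2) - exp (- \<Phi>' u / 2)\<bar>"
proof -
  have e: "exp (- x) = (exp (- x / 2))\<^sup>2" for x :: real by (simp add: power2_eq_square flip: exp_add)
  have "exp (- \<Phi> u) - exp (- \<Phi>' u) = (exp (- \<Phi> u / 2) - exp (- \<Phi>' u / 2)) * (exp (- \<Phi> u / 2) + exp (- \<Phi>' u / 2))"
    unfolding e[of "\<Phi> u"] e[of "\<Phi>' u"] by (simp only: power2_eq_square) (simp add: algebra_simps)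
  then have "\<bar>exp (- \<Phi> u) - exp (- \<Phi>' u)\<bar> = \<bar>exp (- \<Phi> u / 2) - exp (- \<Phi>' u / 2)\<bar> * (exp (- \<Phi> u / 2) + exp (- \<Phi>' u / 2))"
    by (simp add: abs_mult)
  also have "\<dots> \<le> \<bar>exp (- \<Phi> u / 2) - exp (- \<Phi>' u / 2)\<bar> * (1 + 1)"
    using \<Phi>(2)[of u] \<Phi>'(2)[of u] by (intro mult_left_mono add_mono) auto
  finally show ?thesis by simp
qed

lemma Z_diff_le: "\<bar>Z - Z'\<bar> \<le> 2 * r * E1"
proof -
  have "\<bar>Z - Z'\<bar> = \<bar>\<integral>u. exp (- \<Phi> u) - exp (- \<Phi>' u) \<partial>M\<bar>"
    using exp_integrable by simp
  also have "\<dots> \<le> (\<integral>u. \<bar>exp (- \<Phi> u) - exp (- \<Phi>' u)\<bar> \<partial>M)" by (rule integral_abs_bound)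
  also have "\<dots> \<le> (\<integral>u. 2 * (r * Y u) \<partial>M)"
  proof (rule integral_mono_AE)
    show "AE u in M. \<bar>exp (- \<Phi> u) - exp (- \<Phi>' u)\<bar> \<le> 2 * (r * Y u)"
      using diff_weak
    proof eventually_elim
      case (elim u)
      from mult_left_mono[OF this, of 2] show ?case by (intro order_trans[OF exp_diff_le]) simp
    qed
  qed (use exp_integrable Y_integrable in auto)
  finally show ?thesis by (simp add: E1_def)
qed

lemma sqrt_density_diff: "AE u in M. \<bar>sqrt (\<rho> u) - sqrt (\<rho>' u)\<bar> \<le> r * (Y u / sqrt \<zeta> + E1 / (\<zeta> * sqrt \<zeta>))"
  using diff_weak
proof eventually_elim
  case (elim u)
  let ?a = "exp (- \<Phi> u / 2)" and ?a' = "exp (- \<Phi>' u / 2)"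
  have e: "sqrt (exp (- x)) = exp (- x / 2)" for x :: real
    by (rule real_sqrt_unique) (simp_all add: power2_eq_square flip: exp_add)
  have "sqrt (\<rho> u) - sqrt (\<rho>' u) = ?a / sqrt Z - ?a' / sqrt Z'"
    by (simp only: real_sqrt_divide e)
  also have "\<dots> = (?a - ?a') / sqrt Z + ?a' * (1 / sqrt Z - 1 / sqrt Z')"
    by (simp add: diff_divide_distrib right_diff_distrib)
  finally have "\<bar>sqrt (\<rho> u) - sqrt (\<rho>' u)\<bar> \<le> \<bar>(?a - ?a') / sqrt Z\<bar> + \<bar>?a' * (1 / sqrt Z - 1 / sqrt Z')\<bar>"
    by (simp only: abs_triangle_ineq)
  also have "\<bar>(?a - ?a') / sqrt Z\<bar> \<le> (r * Y u) / sqrt \<zeta>"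
    unfolding abs_divide using elim \<zeta> by (intro frac_le) auto
  also have "\<bar>?a' * (1 / sqrt Z - 1 / sqrt Z')\<bar> \<le> 1 * (\<bar>Z - Z'\<bar> / (2 * \<zeta> * sqrt \<zeta>))"
    unfolding abs_mult using \<Phi>'(2)[of u] by (intro mult_mono inverse_sqrt_diff_le \<zeta>) auto
  also have "\<dots> \<le> (2 * r * E1) / (2 * \<zeta> * sqrt \<zeta>)"
    unfolding mult_1 using \<zeta>(1) by (intro divide_right_mono Z_diff_le) simp
  finally show ?case by (simp add: distrib_left)
qed

section \<open>The Hellinger distance\<close>

definition KH where "KH = sqrt (E2 / \<zeta> + (E1 / (\<zeta> * sqrt \<zeta>))\<^sup>2)"

lemma RN_deriv_posterior:
  "AE u in M. enn2real (RN_deriv M (posterior M \<Phi>) u) = \<rho> u"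
proof -
  have "AE u in M. ennreal (\<rho> u) = RN_deriv M (posterior M \<Phi>) u"
    by (rule RN_deriv_unique) (auto simp: posterior_def)
  then show ?thesis
  proof eventually_elim
    case (elim u)
    have "\<rho> u \<ge> 0" using Z_pos by (intro divide_nonneg_nonneg) auto
    then show ?case using elim[symmetric] by simp
  qed
qed

lemma hellinger_le: "hellinger M (posterior M \<Phi>) (posterior M \<Phi>') \<le> r * KH"
proof -
  interpret swap: posterior_pair M \<Phi>' \<Phi> Y \<zeta> r by (rule posterior_pair_swap)
  define h where "h u = (sqrt (enn2real (RN_deriv M (posterior M \<Phi>) u)) - sqrt (enn2real (RN_deriv M (posterior M \<Phi>') u)))\<^sup>2" for u
  define b where "b u = 2 * (r\<^sup>2 * ((Y u)\<^sup>2 / \<zeta>)) + 2 * (r\<^sup>2 * (E1 / (\<zeta> * sqrt \<zeta>))\<^sup>2)" for u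
  have bi: "integrable M b" unfolding b_def[abs_def] using Y(2) by simp
  have le: "AE u in M. h u \<le> b u"
    using RN_deriv_posterior swap.RN_deriv_posterior sqrt_density_diff
  proof eventually_elim
    case (elim u)
    let ?x = "Y u / sqrt \<zeta>" and ?y = "E1 / (\<zeta> * sqrt \<zeta>)"
    have "h u = \<bar>sqrt (\<rho> u) - sqrt (\<rho>' u)\<bar>\<^sup>2" using elim by (simp add: h_def)
    also have "\<dots> \<le> (r * (?x + ?y))\<^sup>2" using elim(3) by (intro power_mono) auto
    also have "\<dots> = r\<^sup>2 * (?x + ?y)\<^sup>2" by (simp add: power_mult_distrib)
    also have "\<dots> \<le> r\<^sup>2 * (2 * ?x\<^sup>2 + 2 * ?y\<^sup>2)"
    proof (rule mult_left_mono)
      show "(?x + ?y)\<^sup>2 \<le> 2 * ?x\<^sup>2 + 2 * ?y\<^sup>2"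
        using zero_le_power2[of "?x - ?y"] unfolding power2_eq_square by (simp only: algebra_simps)
    qed simp
    also have "?x\<^sup>2 = (Y u)\<^sup>2 / \<zeta>" using \<zeta>(1) by (simp add: power_divide)
    finally show ?case unfolding b_def by (simp only: distrib_left mult.left_commute[of "r\<^sup>2" 2])
  qed
  have "(\<integral>u. h u \<partial>M) \<le> (\<integral>u. b u \<partial>M)"
    by (rule integral_mono_AE'[OF bi le]) (use \<zeta>(1) in \<open>simp add: b_def\<close>)
  also have "\<dots> = 2 * (r\<^sup>2 * (E2 / \<zeta>)) + 2 * (r\<^sup>2 * (E1 / (\<zeta> * sqrt \<zeta>))\<^sup>2)"
    unfolding b_def[abs_def] using Y(2) by (simp add: E2_def prob_space)
  also have "\<dots> = 2 * (r * KH)\<^sup>2"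
    unfolding KH_def power_mult_distrib using E2_nonneg \<zeta>(1) by (simp add: distrib_left)
  finally have "1 / 2 * (\<integral>u. h u \<partial>M) \<le> (r * KH)\<^sup>2" by simp
  then have "hellinger M (posterior M \<Phi>) (posterior M \<Phi>') \<le> sqrt ((r * KH)\<^sup>2)"
    unfolding hellinger_def h_def[symmetric] by (rule real_sqrt_le_mono)
  also have "\<dots> = r * KH" using r E2_nonneg \<zeta>(1) by (simp add: KH_def)
  finally show ?thesis .
qed

section \<open>Differences of means and covariance operators\<close>

definition KD where "KD = 2 / \<zeta> + 2 * E1 / \<zeta>\<^sup>2"

lemma KD_nonneg: "KD \<ge> 0" using \<zeta>(1) E1_nonneg by (simp add: KD_def)

lemma density_diff: "AE u in M. (1 + norm u)\<^sup>2 * \<bar>\<rho> u - \<rho>' u\<bar> \<le> r * KD * Y u"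
  using diff Y_ge
proof eventually_elim
  case (elim u)
  let ?n = "(1 + norm u)\<^sup>2"
  have n: "?n \<ge> 0" by simp
  have "\<rho> u - \<rho>' u = (exp (- \<Phi> u) - exp (- \<Phi>' u)) / Z + exp (- \<Phi>' u) * ((Z' - Z) / (Z * Z'))"
    using Z_pos by (simp add: field_simps)
  then have "\<bar>\<rho> u - \<rho>' u\<bar> \<le> \<bar>(exp (- \<Phi> u) - exp (- \<Phi>' u)) / Z\<bar> + \<bar>exp (- \<Phi>' u) * ((Z' - Z) / (Z * Z'))\<bar>"
    by (simp only: abs_triangle_ineq)
  also have "\<bar>(exp (- \<Phi> u) - exp (- \<Phi>' u)) / Z\<bar> \<le> 2 * \<bar>exp (- \<Phi> u / 2) - exp (- \<Phi>' u / 2)\<bar> / \<zeta>"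
    unfolding abs_divide using exp_diff_le[of u] \<zeta> by (intro frac_le) auto
  also have "\<bar>exp (- \<Phi>' u) * ((Z' - Z) / (Z * Z'))\<bar> \<le> 1 * ((2 * r * E1) / (\<zeta> * \<zeta>))"
    unfolding abs_mult abs_divide using \<Phi>'(2)[of u] \<zeta> Z_diff_le r E1_nonneg Z_pos
    by (intro mult_mono frac_le) (auto simp: abs_minus_commute)
  finally have "?n * \<bar>\<rho> u - \<rho>' u\<bar> \<le> ?n * (2 * \<bar>exp (- \<Phi> u / 2) - exp (- \<Phi>' u / 2)\<bar> / \<zeta> + 2 * r * E1 / \<zeta>\<^sup>2)"
    by (intro mult_left_mono n) (simp add: power2_eq_square)
  also have "\<dots> = 2 / \<zeta> * (?n * \<bar>exp (- \<Phi> u / 2) - exp (- \<Phi>' u / 2)\<bar>) + 2 * r * E1 / \<zeta>\<^sup>2 * ?n"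
    by (simp add: distrib_left mult_ac)
  also have "\<dots> \<le> 2 / \<zeta> * (r * Y u) + 2 * r * E1 / \<zeta>\<^sup>2 * Y u"
    using elim \<zeta>(1) r E1_nonneg by (intro add_mono mult_left_mono) auto
  also have "\<dots> = r * KD * Y u" by (simp add: KD_def algebra_simps)
  finally show ?case .
qed

lemma density_bound: "AE u in M. (1 + norm u)\<^sup>2 * \<rho> u \<le> Y u / \<zeta>"
  using Y_ge
proof eventually_elim
  case (elim u)
  have "(1 + norm u)\<^sup>2 * \<rho> u = (1 + norm u)\<^sup>2 * exp (- \<Phi> u) / Z" by simp
  also have "\<dots> \<le> Y u / \<zeta>"
  proof (rule frac_le)
    show "0 \<le> Y u" using elim order_trans[OF zero_le_power2] by blast
    have "(1 + norm u)\<^sup>2 * exp (- \<Phi> u) \<le> (1 + norm u)\<^sup>2 * 1" using \<Phi>(2)[of u] by (intro mult_left_mono) auto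
    then show "(1 + norm u)\<^sup>2 * exp (- \<Phi> u) \<le> Y u" using elim by linarith
  qed (use \<zeta> in auto)
  finally show ?case .
qed

lemma integral_posterior:
  fixes f :: "hspace \<Rightarrow> 'c::{banach, second_countable_topology}"
  assumes "f \<in> borel_measurable M"
  shows "(\<integral>u. f u \<partial>posterior M \<Phi>) = (\<integral>u. \<rho> u *\<^sub>R f u \<partial>M)"
  unfolding posterior_def using assms Z_pos
  by (intro integral_density) (auto intro!: AE_I2 divide_nonneg_nonneg)

lemma norm_power_le: "norm u \<le> (1 + norm u)\<^sup>2" "(norm u)\<^sup>2 \<le> (1 + norm u)\<^sup>2" "1 \<le> (1 + norm u)\<^sup>2" for u :: hspace
proof -
  have "0 \<le> norm u" by simp
  then have "norm u \<le> 1 + 2 * norm u + norm u * norm u" by (metis add_increasing add_increasing2 mult_2 mult_nonneg_nonneg order_refl zero_le_one)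
  then show "norm u \<le> (1 + norm u)\<^sup>2" by (simp add: power2_eq_square algebra_simps)
  show "(norm u)\<^sup>2 \<le> (1 + norm u)\<^sup>2" by (intro power_mono) auto
  show "1 \<le> (1 + norm u)\<^sup>2" by (rule one_le_power) simp
qed

lemma weighted_integrable:
  fixes f :: "hspace \<Rightarrow> 'c::{banach, second_countable_topology}"
  assumes f: "f \<in> borel_measurable M" and le: "\<And>u. norm (f u) \<le> c * (1 + norm u)\<^sup>2" and c: "c \<ge> 0"
  shows "integrable M (\<lambda>u. \<rho> u *\<^sub>R f u)" "norm (\<integral>u. \<rho> u *\<^sub>R f u \<partial>M) \<le> c * E1 / \<zeta>"
proof -
  have bd: "AE u in M. norm (\<rho> u *\<^sub>R f u) \<le> c * Y u / \<zeta>"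
    using density_bound
  proof eventually_elim
    case (elim u)
    have "norm (\<rho> u *\<^sub>R f u) = \<rho> u * norm (f u)" using Z_pos by simp
    also have "\<dots> \<le> \<rho> u * (c * (1 + norm u)\<^sup>2)" using Z_pos by (intro mult_left_mono le) auto
    also have "\<dots> = c * ((1 + norm u)\<^sup>2 * \<rho> u)" by simp
    also have "\<dots> \<le> c * (Y u / \<zeta>)" by (intro mult_left_mono elim c)
    finally show ?case by simp
  qed
  have i: "integrable M (\<lambda>u. c * Y u / \<zeta>)" using Y_integrable by simp
  show "integrable M (\<lambda>u. \<rho> u *\<^sub>R f u)"
  proof (rule Bochner_Integration.integrable_bound[OF i])
    show "(\<lambda>u. \<rho> u *\<^sub>R f u) \<in> borel_measurable M" using f by measurable
    show "AE u in M. norm (\<rho> u *\<^sub>R f u) \<le> norm (c * Y u / \<zeta>)"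
      using bd by eventually_elim (erule order_trans, simp only: real_norm_def abs_ge_self)
  qed
  then have "norm (\<integral>u. \<rho> u *\<^sub>R f u \<partial>M) \<le> (\<integral>u. norm (\<rho> u *\<^sub>R f u) \<partial>M)" by (intro integral_norm_bound)
  also have "\<dots> \<le> (\<integral>u. c * Y u / \<zeta> \<partial>M)"
    by (intro integral_mono_AE integrable_norm \<open>integrable M (\<lambda>u. \<rho> u *\<^sub>R f u)\<close> i bd)
  finally show "norm (\<integral>u. \<rho> u *\<^sub>R f u \<partial>M) \<le> c * E1 / \<zeta>" by (simp add: E1_def)
qed

lemma weighted_diff:
  fixes f :: "hspace \<Rightarrow> 'c::{banach, second_countable_topology}"
  assumes f: "f \<in> borel_measurable M" and le: "\<And>u. norm (f u) \<le> c * (1 + norm u)\<^sup>2" and c: "c \<ge> 0"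
  shows "norm ((\<integral>u. \<rho> u *\<^sub>R f u \<partial>M) - (\<integral>u. \<rho>' u *\<^sub>R f u \<partial>M)) \<le> c * r * KD * E1"
proof -
  interpret swap: posterior_pair M \<Phi>' \<Phi> Y \<zeta> r by (rule posterior_pair_swap)
  have i: "integrable M (\<lambda>u. \<rho> u *\<^sub>R f u)" "integrable M (\<lambda>u. \<rho>' u *\<^sub>R f u)"
    by (rule weighted_integrable[OF f le c], rule swap.weighted_integrable[OF f le c])
  have d: "integrable M (\<lambda>u. \<rho> u *\<^sub>R f u - \<rho>' u *\<^sub>R f u)" using i by simp
  have "(\<integral>u. \<rho> u *\<^sub>R f u \<partial>M) - (\<integral>u. \<rho>' u *\<^sub>R f u \<partial>M) = (\<integral>u. \<rho> u *\<^sub>R f u - \<rho>' u *\<^sub>R f u \<partial>M)"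
    by (rule Bochner_Integration.integral_diff[OF i, symmetric])
  also have "norm \<dots> \<le> (\<integral>u. norm (\<rho> u *\<^sub>R f u - \<rho>' u *\<^sub>R f u) \<partial>M)" by (rule integral_norm_bound)
  also have "\<dots> \<le> (\<integral>u. c * (r * KD * Y u) \<partial>M)"
  proof (rule integral_mono_AE[OF integrable_norm[OF d]])
    show "integrable M (\<lambda>u. c * (r * KD * Y u))" using Y_integrable by simp
    show "AE u in M. norm (\<rho> u *\<^sub>R f u - \<rho>' u *\<^sub>R f u) \<le> c * (r * KD * Y u)"
      using density_diff
    proof eventually_elim
      case (elim u)
      have "norm (\<rho> u *\<^sub>R f u - \<rho>' u *\<^sub>R f u) = \<bar>\<rho> u - \<rho>' u\<bar> * norm (f u)"
        by (simp only: scaleR_left_diff_distrib[symmetric] norm_scaleR)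
      also have "\<dots> \<le> \<bar>\<rho> u - \<rho>' u\<bar> * (c * (1 + norm u)\<^sup>2)" by (intro mult_left_mono le) auto
      also have "\<dots> = c * ((1 + norm u)\<^sup>2 * \<bar>\<rho> u - \<rho>' u\<bar>)" by (simp only: mult_ac)
      also have "\<dots> \<le> c * (r * KD * Y u)" by (intro mult_left_mono elim c)
      finally show ?case .
    qed
  qed
  finally show ?thesis by (simp add: E1_def)
qed

lemma mean_posterior: "mean (posterior M \<Phi>) = (\<integral>u. \<rho> u *\<^sub>R u \<partial>M)"
  unfolding mean_def by (rule integral_posterior) measurable

lemma norm_mean_le: "norm (mean (posterior M \<Phi>)) \<le> E1 / \<zeta>"
  using weighted_integrable(2)[of "\<lambda>u. u" 1] norm_power_le by (simp add: mean_posterior)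

lemma mean_diff_le: "norm (mean (posterior M \<Phi>) - mean (posterior M \<Phi>')) \<le> r * (KD * E1)"
proof -
  interpret swap: posterior_pair M \<Phi>' \<Phi> Y \<zeta> r by (rule posterior_pair_swap)
  show ?thesis unfolding mean_posterior swap.mean_posterior
    using weighted_diff[of "\<lambda>u. u" 1] norm_power_le by (simp add: mult.assoc)
qed

lemma quadratic_le: "norm (inner u h *\<^sub>R u) \<le> norm h * (1 + norm u)\<^sup>2" for u h :: hspace
proof -
  have "norm (inner u h *\<^sub>R u) \<le> (norm u * norm h) * norm u"
    unfolding norm_scaleR by (intro mult_right_mono Cauchy_Schwarz_ineq2) auto
  also have "\<dots> = norm h * (norm u)\<^sup>2" by (simp add: power2_eq_square)
  also have "\<dots> \<le> norm h * (1 + norm u)\<^sup>2" by (intro mult_left_mono norm_power_le) auto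
  finally show ?thesis .
qed

text \<open>Expanding the centred quadratic reduces the comparison of covariances to a second
  moment, to which \<open>weighted_diff\<close> applies, and a rank-one term in the mean.\<close>

lemma cov_op_posterior:
  "cov_op (posterior M \<Phi>) h = (\<integral>u. \<rho> u *\<^sub>R (inner u h *\<^sub>R u) \<partial>M) - inner (mean (posterior M \<Phi>)) h *\<^sub>R mean (posterior M \<Phi>)"
proof -
  define m where "m = mean (posterior M \<Phi>)"
  have m: "m = (\<integral>u. \<rho> u *\<^sub>R u \<partial>M)" by (simp add: m_def mean_posterior)
  have iu: "integrable M (\<lambda>u. \<rho> u *\<^sub>R u)"
    by (rule weighted_integrable[of _ 1]) (use norm_power_le in auto)
  have i2: "integrable M (\<lambda>u. \<rho> u *\<^sub>R (inner u h *\<^sub>R u))"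
    by (rule weighted_integrable[OF _ quadratic_le]) auto
  have i1: "integrable M (\<lambda>u. \<rho> u)" using exp_integrable by simp
  have one: "(\<integral>u. \<rho> u \<partial>M) = 1" using Z_pos by simp
  have iin: "(\<integral>u. inner (\<rho> u *\<^sub>R u) h \<partial>M) = inner m h"
    using integral_inner_left[OF iu, of h] by (simp add: m)
  have "cov_op (posterior M \<Phi>) h = (\<integral>u. \<rho> u *\<^sub>R (inner (u - m) h *\<^sub>R (u - m)) \<partial>M)"
    unfolding cov_op_def m_def[symmetric] by (rule integral_posterior) measurable
  also have "\<dots> = (\<integral>u. (\<rho> u *\<^sub>R (inner u h *\<^sub>R u) - inner m h *\<^sub>R (\<rho> u *\<^sub>R u)) - (inner (\<rho> u *\<^sub>R u) h *\<^sub>R m - \<rho> u *\<^sub>R (inner m h *\<^sub>R m)) \<partial>M)"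
    by (intro Bochner_Integration.integral_cong refl) (simp add: inner_diff_left algebra_simps)
  also have "\<dots> = ((\<integral>u. \<rho> u *\<^sub>R (inner u h *\<^sub>R u) \<partial>M) - inner m h *\<^sub>R m) - (inner m h *\<^sub>R m - inner m h *\<^sub>R m)"
  proof -
    have a: "integrable M (\<lambda>u. inner m h *\<^sub>R (\<rho> u *\<^sub>R u))" by (rule integrable_scaleR_right) (rule iu)
    have b: "integrable M (\<lambda>u. inner (\<rho> u *\<^sub>R u) h *\<^sub>R m)" by (intro integrable_scaleR_left integrable_inner_left iu)
    have c: "integrable M (\<lambda>u. \<rho> u *\<^sub>R (inner m h *\<^sub>R m))" by (intro integrable_scaleR_left i1)
    have a': "(\<integral>u. inner m h *\<^sub>R (\<rho> u *\<^sub>R u) \<partial>M) = inner m h *\<^sub>R m" by (simp only: integral_scaleR_right m)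
    have b': "(\<integral>u. inner (\<rho> u *\<^sub>R u) h *\<^sub>R m \<partial>M) = inner m h *\<^sub>R m"
      by (subst integral_scaleR_left) (auto intro: integrable_inner_left iu simp: iin simp del: inner_scaleR_left)
    have c': "(\<integral>u. \<rho> u *\<^sub>R (inner m h *\<^sub>R m) \<partial>M) = inner m h *\<^sub>R m"
      by (subst integral_scaleR_left) (use i1 one in auto)
    show ?thesis
      by (simp only: Bochner_Integration.integral_diff[OF Bochner_Integration.integrable_diff[OF i2 a] Bochner_Integration.integrable_diff[OF b c]]
          Bochner_Integration.integral_diff[OF i2 a] Bochner_Integration.integral_diff[OF b c] a' b' c')
  qed
  finally show ?thesis by (simp add: m_def)
qed

lemma cov_op_diff_le:
  "onorm (\<lambda>h. cov_op (posterior M \<Phi>) h - cov_op (posterior M \<Phi>') h) \<le> r * (KD * E1 * (1 + 2 * E1 / \<zeta>))"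
proof (rule onorm_bound)
  show "0 \<le> r * (KD * E1 * (1 + 2 * E1 / \<zeta>))" using r KD_nonneg E1_nonneg \<zeta>(1) by simp
  fix h :: hspace
  interpret swap: posterior_pair M \<Phi>' \<Phi> Y \<zeta> r by (rule posterior_pair_swap)
  let ?m = "mean (posterior M \<Phi>)" and ?m' = "mean (posterior M \<Phi>')"
  let ?I = "\<integral>u. \<rho> u *\<^sub>R (inner u h *\<^sub>R u) \<partial>M" and ?I' = "\<integral>u. \<rho>' u *\<^sub>R (inner u h *\<^sub>R u) \<partial>M"
  have I: "norm (?I - ?I') \<le> norm h * r * KD * E1"
    by (rule weighted_diff[OF _ quadratic_le]) auto
  have mm': "norm ?m \<le> E1 / \<zeta>" "norm ?m' \<le> E1 / \<zeta>" by (rule norm_mean_le, rule swap.norm_mean_le)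
  have q: "norm (inner ?m h *\<^sub>R ?m - inner ?m' h *\<^sub>R ?m') \<le> 2 * (E1 / \<zeta>) * (r * (KD * E1)) * norm h"
  proof -
    have "inner ?m h *\<^sub>R ?m - inner ?m' h *\<^sub>R ?m' = inner (?m - ?m') h *\<^sub>R ?m + inner ?m' h *\<^sub>R (?m - ?m')"
      by (simp add: inner_diff_left algebra_simps)
    then have "norm (inner ?m h *\<^sub>R ?m - inner ?m' h *\<^sub>R ?m') \<le> \<bar>inner (?m - ?m') h\<bar> * norm ?m + \<bar>inner ?m' h\<bar> * norm (?m - ?m')"
      by (metis norm_triangle_ineq norm_scaleR)
    also have "\<dots> \<le> (norm (?m - ?m') * norm h) * norm ?m + (norm ?m' * norm h) * norm (?m - ?m')"
      by (intro add_mono mult_right_mono Cauchy_Schwarz_ineq2) auto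
    also have "\<dots> = (norm ?m + norm ?m') * norm (?m - ?m') * norm h" by (simp add: algebra_simps)
    also have "\<dots> \<le> (E1 / \<zeta> + E1 / \<zeta>) * (r * (KD * E1)) * norm h"
      using mm' mean_diff_le E1_nonneg \<zeta>(1) by (intro mult_right_mono mult_mono add_mono) auto
    finally show ?thesis by simp
  qed
  have eq: "cov_op (posterior M \<Phi>) h - cov_op (posterior M \<Phi>') h = (?I - ?I') - (inner ?m h *\<^sub>R ?m - inner ?m' h *\<^sub>R ?m')"
    by (simp add: cov_op_posterior swap.cov_op_posterior)
  have "norm (cov_op (posterior M \<Phi>) h - cov_op (posterior M \<Phi>') h) \<le> norm h * r * KD * E1 + 2 * (E1 / \<zeta>) * (r * (KD * E1)) * norm h"
    unfolding eq by (rule order_trans[OF norm_triangle_ineq4 add_mono[OF I q]])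
  also have "\<dots> = r * (KD * E1 * (1 + 2 * E1 / \<zeta>)) * norm h"
    by (simp only: distrib_left distrib_right mult_1_right times_divide_eq_right mult_ac)
  finally show "norm (cov_op (posterior M \<Phi>) h - cov_op (posterior M \<Phi>') h) \<le> r * (KD * E1 * (1 + 2 * E1 / \<zeta>)) * norm h" .
qed

end

section \<open>The Lagrangian data assimilation problem\<close>

text \<open>Applied to the misfits: with \<Phi> half the squared misfit,
  \<open>exp (- \<Phi> / 2)\<close> has this form. Decay of the exponential beats the linear factor
  of the derivative, so no growing factor in the misfit appears.\<close>

lemma exp_quarter_square_lipschitz:
  fixes a b :: real
  shows "\<bar>exp (- (a\<^sup>2 / 4)) - exp (- (b\<^sup>2 / 4))\<bar> \<le> \<bar>a - b\<bar>"
proof -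
  have "norm (exp (- (a\<^sup>2 / 4)) - exp (- (b\<^sup>2 / 4))) \<le> 1 * norm (a - b)"
  proof (rule field_differentiable_bound[where S = UNIV and f' = "\<lambda>x. exp (- (x\<^sup>2 / 4)) * (- (x / 2))"])
    fix x :: real
    show "((\<lambda>x. exp (- (x\<^sup>2 / 4))) has_field_derivative exp (- (x\<^sup>2 / 4)) * (- (x / 2))) (at x within UNIV)"
      by (auto intro!: derivative_eq_intros)
    have "\<bar>x\<bar> / 2 \<le> 1 + x\<^sup>2 / 4"
    proof -
      have "0 \<le> (\<bar>x\<bar> / 2 - 1 / 2)\<^sup>2" by simp
      then show ?thesis by (simp add: power2_diff power_divide)
    qed
    also have "\<dots> \<le> exp (x\<^sup>2 / 4)" by (rule exp_ge_add_one_self)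
    finally have "exp (- (x\<^sup>2 / 4)) * (\<bar>x\<bar> / 2) \<le> exp (- (x\<^sup>2 / 4)) * exp (x\<^sup>2 / 4)"
      by (intro mult_left_mono) auto
    then show "norm (exp (- (x\<^sup>2 / 4)) * (- (x / 2))) \<le> 1" by (simp add: abs_mult flip: exp_add)
  qed auto
  then show ?thesis by simp
qed

lemma obs_map_diff_le:
  fixes z0 :: "'j::finite \<Rightarrow> real^2" and t :: "'k::finite \<Rightarrow> real"
  assumes "\<And>j k. norm (tracer_pos nu T \<psi> u (z0 j) (t k) - tracer_pos nu T \<psi> u' (z0 j) (t k)) \<le> D"
  shows "norm (obs_map nu T \<psi> z0 t u - obs_map nu T \<psi> z0 t u') \<le> real CARD('j \<times> 'k \<times> 2) * D"
proof -
  have "norm (obs_map nu T \<psi> z0 t u - obs_map nu T \<psi> z0 t u') \<le> (\<Sum>p\<in>UNIV. \<bar>(obs_map nu T \<psi> z0 t u - obs_map nu T \<psi> z0 t u') $ p\<bar>)"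
    by (rule norm_le_l1_cart)
  also have "\<dots> \<le> (\<Sum>p\<in>(UNIV :: ('j \<times> 'k \<times> 2) set). D)"
  proof (rule sum_mono)
    fix p :: "'j \<times> 'k \<times> 2"
    obtain j k i where p: "p = (j, k, i)" by (cases p)
    have "\<bar>(obs_map nu T \<psi> z0 t u - obs_map nu T \<psi> z0 t u') $ p\<bar> =
        \<bar>(tracer_pos nu T \<psi> u (z0 j) (t k) - tracer_pos nu T \<psi> u' (z0 j) (t k)) $ i\<bar>"
      by (simp add: obs_map_def p)
    also have "\<dots> \<le> D" by (rule order_trans[OF component_le_norm_cart assms])
    finally show "\<bar>(obs_map nu T \<psi> z0 t u - obs_map nu T \<psi> z0 t u') $ p\<bar> \<le> D" .
  qed
  finally show ?thesis by simp
qed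

lemma norm_obs_map_le:
  fixes z0 :: "'j::finite \<Rightarrow> real^2" and t :: "'k::finite \<Rightarrow> real"
  assumes "\<And>j k. norm (tracer_pos nu T \<psi> u (z0 j) (t k)) \<le> D"
  shows "norm (obs_map nu T \<psi> z0 t u) \<le> real CARD('j \<times> 'k \<times> 2) * D"
proof -
  have "norm (obs_map nu T \<psi> z0 t u) \<le> (\<Sum>p\<in>UNIV. \<bar>obs_map nu T \<psi> z0 t u $ p\<bar>)"
    by (rule norm_le_l1_cart)
  also have "\<dots> \<le> (\<Sum>p\<in>(UNIV :: ('j \<times> 'k \<times> 2) set). D)"
  proof (rule sum_mono)
    fix p :: "'j \<times> 'k \<times> 2"
    obtain j k i where p: "p = (j, k, i)" by (cases p)
    have "\<bar>obs_map nu T \<psi> z0 t u $ p\<bar> = \<bar>tracer_pos nu T \<psi> u (z0 j) (t k) $ i\<bar>"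
      by (simp add: obs_map_def p)
    also have "\<dots> \<le> D" by (rule order_trans[OF component_le_norm_cart assms])
    finally show "\<bar>obs_map nu T \<psi> z0 t u $ p\<bar> \<le> D" .
  qed
  finally show ?thesis by simp
qed

section \<open>Continuity and growth of the observation map\<close>

context stokes_forcing
begin

text \<open>Supplies the measurability of the misfit, which the posterior densities and the
  existence of their normalisation constants rest on.\<close>

lemma continuous_on_obs_map:
  fixes z0 :: "'j::finite \<Rightarrow> real^2" and t :: "'k::finite \<Rightarrow> real"
  assumes t: "\<And>k. t k \<in> {0<..T}"
  shows "continuous_on UNIV (obs_map nu T \<psi> z0 t)"
  unfolding continuous_on_def
proof
  fix u
  obtain L where L: "L \<ge> 0" "\<And>u' z0 t. t \<in> {0..T} \<Longrightarrow> norm (tracer_pos nu T \<psi> u z0 t - tracer_pos nu T \<psi> u' z0 t) \<le> L * norm (u - u')"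
    using tracer_pos_lipschitz_at[of u] by blast
  have t': "t k \<in> {0..T}" for k using t[of k] by auto
  have le: "norm (obs_map nu T \<psi> z0 t u - obs_map nu T \<psi> z0 t u') \<le> real CARD('j \<times> 'k \<times> 2) * (L * norm (u - u'))" for u'
    by (intro obs_map_diff_le L(2) t')
  have "((\<lambda>u'. real CARD('j \<times> 'k \<times> 2) * (L * norm (u - u'))) \<longlongrightarrow> real CARD('j \<times> 'k \<times> 2) * (L * norm (u - u))) (at u)"
    by (intro tendsto_intros)
  then have "((\<lambda>u'. real CARD('j \<times> 'k \<times> 2) * (L * norm (u - u'))) \<longlongrightarrow> 0) (at u)" by simp
  then have "((\<lambda>u'. obs_map nu T \<psi> z0 t u - obs_map nu T \<psi> z0 t u') \<longlongrightarrow> 0) (at u)"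
    by (rule Lim_null_comparison[OF always_eventually[OF allI[OF le]]])
  from tendsto_diff[OF tendsto_const[of "obs_map nu T \<psi> z0 t u"] this]
  show "(obs_map nu T \<psi> z0 t \<longlongrightarrow> obs_map nu T \<psi> z0 t u) (at u within UNIV)" by simp
qed

text \<open>The growth bound behind the lower estimate of the likelihood: tracers move at a speed
  that is affine in \<open>norm u\<close>.\<close>

lemma norm_obs_map_affine:
  fixes z0 :: "'j::finite \<Rightarrow> real^2" and t :: "'k::finite \<Rightarrow> real"
  assumes t: "\<And>k. t k \<in> {0<..T}"
  shows "\<exists>c1\<ge>0. \<exists>c2\<ge>0. \<forall>u. norm (obs_map nu T \<psi> z0 t u) \<le> c1 + c2 * norm u"
proof -
  define n where "n = real CARD('j \<times> 'k \<times> 2)"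
  define a where "a = (\<Sum>j\<in>UNIV. norm (z0 j)) + 2 * (sqrt 2 * (Cd * sqrt T)) * sqrt T"
  define b where "b = 2 * (sqrt 2 * Ch) * sqrt T"
  have nn: "n \<ge> 0" "a \<ge> 0" "b \<ge> 0"
    using Cd(1) Ch_nonneg T by (auto simp: n_def a_def b_def intro!: add_nonneg_nonneg sum_nonneg)
  have "norm (obs_map nu T \<psi> z0 t u) \<le> n * a + n * b * norm u" for u
  proof -
    have "norm (tracer_pos nu T \<psi> u (z0 j) (t k)) \<le> a + b * norm u" for j k
    proof -
      have "norm (z0 j) \<le> (\<Sum>j\<in>UNIV. norm (z0 j))" by (rule member_le_sum) auto
      moreover have "norm (tracer_pos nu T \<psi> u (z0 j) (t k)) \<le> norm (z0 j) + 2 * Mv u * sqrt T"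
        using t[of k] by (intro norm_tracer_pos_le) auto
      moreover have "2 * Mv u * sqrt T = 2 * (sqrt 2 * (Cd * sqrt T)) * sqrt T + b * norm u"
        unfolding Mv_def b_def by (simp only: distrib_left distrib_right) (simp only: mult_ac add_ac)
      ultimately show ?thesis unfolding a_def by linarith
    qed
    from norm_obs_map_le[OF this] show ?thesis by (simp add: n_def distrib_left mult.assoc)
  qed
  moreover have "n * a \<ge> 0" "n * b \<ge> 0" using nn by simp_all
  ultimately show ?thesis by blast
qed

end

text \<open>Young's inequality, with half the quadratic exponent kept in reserve: the square of the
  right-hand side is then integrable by the exponential moment of the prior.\<close>

lemma exp_growth_le:
  fixes X a \<delta> :: real
  assumes "\<delta> > 0" shows "exp (a * X) \<le> exp (a\<^sup>2 / (2 * \<delta>)) * sqrt (exp (\<delta> * X\<^sup>2))"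
proof -
  have "sqrt (exp (\<delta> * X\<^sup>2)) = exp (\<delta> * X\<^sup>2 / 2)"
    by (rule real_sqrt_unique) (simp_all add: power2_eq_square flip: exp_add)
  moreover have "a * X \<le> a\<^sup>2 / (2 * \<delta>) + \<delta> * X\<^sup>2 / 2"
  proof -
    have "0 \<le> (a - \<delta> * X)\<^sup>2 / (2 * \<delta>)" using assms by simp
    also have "\<dots> = a\<^sup>2 / (2 * \<delta>) + \<delta> * X\<^sup>2 / 2 - a * X"
      using assms by (simp add: power2_eq_square field_simps)
    finally show ?thesis by simp
  qed
  ultimately show ?thesis by (simp flip: exp_add)
qed

theorem theorem4p4:
  fixes nu T \<gamma> \<beta> \<alpha> q :: real
    and \<psi> :: "real \<Rightarrow> hspace"
    and \<mu>0 \<mu> :: "hspace measure" and \<mu>N :: "nat \<Rightarrow> hspace measure"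
    and z0 :: "'j::finite \<Rightarrow> real^2" and t :: "'k::finite \<Rightarrow> real"
    and \<Gamma> :: "real^('j \<times> 'k \<times> 2)^('j \<times> 'k \<times> 2)" and y :: "real^('j \<times> 'k \<times> 2)"
    and G :: "hspace \<Rightarrow> real^('j \<times> 'k \<times> 2)"
  assumes "nu > 0" and "T > 0"
    and "\<gamma> > 0" and "continuous_Hs \<gamma> {0..T} \<psi>"
    and "\<beta> > 0" and "\<alpha> > 1"
    and "gaussian \<mu>0 0 (\<lambda>u. \<beta> *\<^sub>R A_pow (- \<alpha>) u)"
    and "\<And>k. t k \<in> {0<..T}"
    and "G = obs_map nu T \<psi> z0 t"
    and "sym_pos_def \<Gamma>"
    and "\<mu> = posterior \<mu>0 (\<lambda>u. 1/2 * (gamma_norm \<Gamma> (y - G u))\<^sup>2)"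
    and "\<And>N. \<mu>N N = posterior \<mu>0 (\<lambda>u. 1/2 * (gamma_norm \<Gamma> (y - G (PN N u)))\<^sup>2)"
    and "q < \<alpha> - 1"
  shows "(\<exists>c>0. \<forall>N\<ge>1. hellinger \<mu>0 \<mu> (\<mu>N N) \<le> c * real N powr (- q))
    \<and> (\<exists>c>0. \<forall>N\<ge>1. norm (mean \<mu> - mean (\<mu>N N)) \<le> c * real N powr (- q))
    \<and> (\<exists>c>0. \<forall>N\<ge>1. onorm (\<lambda>h. cov_op \<mu> h - cov_op (\<mu>N N) h) \<le> c * real N powr (- q))"
proof -
  interpret stokes_forcing nu T \<gamma> \<psi> by unfold_locales fact+
  have M: "sets \<mu>0 = sets borel" and "prob_space \<mu>0" using assms(7) by (auto simp: gaussian_def)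
  then interpret prob_space \<mu>0 by simp
  \<comment> \<open>Midway between \<open>max q 0\<close> and \<open>\<alpha> - 1\<close>: strictly
    below the regularity of the prior, at least \<open>q\<close>, and positive even if
    \<open>q\<close> is not.\<close>
  define s where "s = (max q 0 + (\<alpha> - 1)) / 2"
  have s: "s > 0" "q \<le> s" "s < \<alpha> - 1" using assms(6,13) by (auto simp: s_def max_def field_simps)
  \<comment> \<open>The stability estimate is available up to regularity 1 only. The convergence
    rate still uses the full \<open>s\<close>, through the projection error.\<close>
  define \<sigma> where "\<sigma> = min s 1"
  have \<sigma>: "0 < \<sigma>" "\<sigma> \<le> 1" "\<sigma> \<le> s" using s by (auto simp: \<sigma>_def)
  obtain \<delta> Y where \<delta>: "\<delta> > 0" and Y: "integrable \<mu>0 Y" "\<And>u. Y u \<ge> 1"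
    and aeY: "AE u in \<mu>0. u \<in> Hs s \<and> exp (\<delta> * (Hs_norm s u)\<^sup>2) \<le> Y u"
    using gaussian_exponential_moment[OF assms(7,5) s(3)] by metis
  obtain C where C: "C \<ge> 0" "\<And>u u' z0 t. u \<in> Hs \<sigma> \<Longrightarrow> t \<in> {0..T} \<Longrightarrow>
      norm (tracer_pos nu T \<psi> u z0 t - tracer_pos nu T \<psi> u' z0 t) \<le> C * exp (C * Hs_norm \<sigma> u) * norm (u - u')"
    using tracer_pos_lipschitz_Hs[OF \<sigma>(1,2)] by blast
  define B where "B = matrix_inv (matrix_sqrt \<Gamma>)"
  have gn: "gamma_norm \<Gamma> x = norm (B *v x)" for x by (simp add: gamma_norm_def B_def)
  have blB: "bounded_linear ((*v) B)" by (rule matrix_vector_mul_bounded_linear)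
  obtain K where K: "K > 0" "\<And>x. norm (B *v x) \<le> norm x * K"
    using bounded_linear.pos_bounded[OF blB] by blast
  define \<Phi> where "\<Phi> u = 1/2 * (gamma_norm \<Gamma> (y - G u))\<^sup>2" for u
  have \<Phi>0: "\<Phi> u \<ge> 0" for u by (simp add: \<Phi>_def)
  have Gc: "continuous_on UNIV G" unfolding assms(9) by (rule continuous_on_obs_map[OF assms(8)])
  have \<Phi>c: "continuous_on UNIV \<Phi>"
    unfolding \<Phi>_def gn by (intro continuous_intros bounded_linear.continuous_on[OF blB] Gc)
  have \<Phi>Nc: "continuous_on UNIV (\<lambda>u. \<Phi> (PN N u))" for N
    by (rule continuous_on_compose2[OF \<Phi>c continuous_on_PN]) auto
  have meas: "\<Phi> \<in> borel_measurable \<mu>0" "(\<lambda>u. \<Phi> (PN N u)) \<in> borel_measurable \<mu>0" for N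
    using borel_measurable_continuous_onI[OF \<Phi>c] borel_measurable_continuous_onI[OF \<Phi>Nc]
    by (simp_all add: measurable_cong_sets[OF M refl])
  have "\<exists>c1\<ge>0. \<exists>c2\<ge>0. \<forall>u. norm (G u) \<le> c1 + c2 * norm u"
    unfolding assms(9) by (rule norm_obs_map_affine[OF assms(8)])
  then obtain c1 c2 where c12: "c1 \<ge> 0" "c2 \<ge> 0" "\<And>u. norm (G u) \<le> c1 + c2 * norm u"
    by blast
  \<comment> \<open>A lower bound for the likelihood that is monotone in the norm. It therefore
    covers \<open>u\<close> and all its projections at once, and its integral \<open>\<zeta>\<close>
    bounds every normalisation constant from below, uniformly in \<open>N\<close>.\<close>
  define m where "m u = exp (- (1/2 * ((norm y + c1 + c2 * norm u) * K)\<^sup>2))" for u :: hspace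
  have m_le: "m u \<le> exp (- \<Phi> u')" if "norm u' \<le> norm u" for u u'
  proof -
    have "norm (B *v (y - G u')) \<le> norm (y - G u') * K" by (rule K(2))
    also have "norm (y - G u') \<le> norm y + (c1 + c2 * norm u')"
      using norm_triangle_ineq4[of y "G u'"] c12(3)[of u'] by linarith
    also have "\<dots> \<le> norm y + c1 + c2 * norm u" using that c12(2) by (simp add: mult_left_mono)
    finally have "norm (B *v (y - G u')) \<le> (norm y + c1 + c2 * norm u) * K" using K(1) by (simp add: mult_right_mono)
    then have "(norm (B *v (y - G u')))\<^sup>2 \<le> ((norm y + c1 + c2 * norm u) * K)\<^sup>2" by (intro power_mono) auto
    then show ?thesis by (simp add: m_def \<Phi>_def gn)
  qed
  have mm: "m \<in> borel_measurable \<mu>0"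
    by (subst measurable_cong_sets[OF M refl], unfold m_def[abs_def])
      (intro borel_measurable_continuous_onI continuous_intros)
  have mi: "integrable \<mu>0 m"
    by (rule integrable_const_bound[of _ 1, OF _ mm]) (auto simp: m_def)
  define \<zeta> where "\<zeta> = (\<integral>u. m u \<partial>\<mu>0)"
  have \<zeta>: "\<zeta> > 0"
  proof -
    have "\<zeta> \<noteq> 0"
    proof
      assume "\<zeta> = 0"
      then have "AE u in \<mu>0. m u = 0"
        unfolding \<zeta>_def using integral_nonneg_eq_0_iff_AE[OF mi] by (simp add: m_def)
      then show False by (simp add: m_def)
    qed
    moreover have "\<zeta> \<ge> 0" unfolding \<zeta>_def by (intro integral_nonneg_AE) (simp add: m_def)
    ultimately show ?thesis by simp
  qed
  have Zge: "\<zeta> \<le> (\<integral>u. exp (- \<Phi> (f u)) \<partial>\<mu>0)" if "(\<lambda>u. \<Phi> (f u)) \<in> borel_measurable \<mu>0" "\<And>u. norm (f u) \<le> norm u" for f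
    unfolding \<zeta>_def
  proof (rule integral_mono[OF mi])
    show "integrable \<mu>0 (\<lambda>u. exp (- \<Phi> (f u)))"
      using that(1) \<Phi>0 by (intro integrable_const_bound[of _ 1]) auto
  qed (use m_le that in auto)
  define n where "n = real CARD('j \<times> 'k \<times> 2)"
  have n: "n \<ge> 0" by (simp add: n_def)
  define C3 where "C3 = K * n * C"
  have C3: "C3 \<ge> 0" using K(1) n C(1) by (simp add: C3_def)
  \<comment> \<open>The exponent \<open>C + 3\<close> collects \<open>C\<close> from the stability
    constant, 2 from the quadratic weight and 1 from the factor \<open>Hs_norm s u\<close>. With
    \<open>C3 + 1\<close> in place of \<open>C3\<close> the same majorant dominates the weight
    itself. Taking the square root of \<open>Y\<close> in \<open>Y1\<close> makes the square of the
    majorant integrable.\<close>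
  define C4 where "C4 = (C3 + 1) * exp ((C + 3)\<^sup>2 / (2 * \<delta>))"
  define Y1 where "Y1 u = C4 * sqrt (Y u)" for u
  have Ym: "Y \<in> borel_measurable \<mu>0" using Y(1) by (rule borel_measurable_integrable)
  have Y1: "Y1 \<in> borel_measurable \<mu>0" "integrable \<mu>0 (\<lambda>u. (Y1 u)\<^sup>2)"
  proof -
    show "Y1 \<in> borel_measurable \<mu>0" unfolding Y1_def[abs_def] using Ym by measurable
    have "(Y1 u)\<^sup>2 = C4\<^sup>2 * Y u" for u using Y(2)[of u] by (simp add: Y1_def power_mult_distrib)
    then show "integrable \<mu>0 (\<lambda>u. (Y1 u)\<^sup>2)" using Y(1) by simp
  qed
  have grow: "(1 + norm u)\<^sup>2 * (C3 * exp (C * Hs_norm s u) * Hs_norm s u) \<le> Y1 u" "(1 + norm u)\<^sup>2 \<le> Y1 u"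
    if u: "u \<in> Hs s" "exp (\<delta> * (Hs_norm s u)\<^sup>2) \<le> Y u" for u
  proof -
    let ?X = "Hs_norm s u"
    have X: "?X \<ge> 0" by (rule Hs_norm_nonneg)
    have "1 + norm u \<le> 1 + ?X" using norm_le_Hs_norm[OF u(1)] s by simp
    also have "\<dots> \<le> exp ?X" by (rule exp_ge_add_one_self)
    finally have "(1 + norm u)\<^sup>2 \<le> (exp ?X)\<^sup>2" by (intro power_mono) auto
    then have 1: "(1 + norm u)\<^sup>2 \<le> exp (2 * ?X)" by (simp add: exp_double)
    have "exp ((C + 3) * ?X) \<le> exp ((C + 3)\<^sup>2 / (2 * \<delta>)) * sqrt (exp (\<delta> * ?X\<^sup>2))"
      by (rule exp_growth_le[OF \<delta>])
    also have "\<dots> \<le> exp ((C + 3)\<^sup>2 / (2 * \<delta>)) * sqrt (Y u)"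
      using u(2) by (intro mult_left_mono real_sqrt_le_mono) auto
    finally have 2: "exp ((C + 3) * ?X) \<le> exp ((C + 3)\<^sup>2 / (2 * \<delta>)) * sqrt (Y u)" .
    have "?X \<le> exp ?X" using exp_ge_add_one_self[of ?X] by linarith
    then have "(1 + norm u)\<^sup>2 * (C3 * exp (C * ?X) * ?X) \<le> exp (2 * ?X) * (C3 * exp (C * ?X) * exp ?X)"
      using 1 C3 X by (intro mult_mono mult_nonneg_nonneg) auto
    also have "\<dots> = C3 * exp ((C + 3) * ?X)"
    proof -
      have "exp ((C + 3) * ?X) = exp (2 * ?X) * (exp (C * ?X) * exp ?X)"
        by (simp flip: exp_add) (simp add: algebra_simps)
      then show ?thesis by (simp only: mult_ac)
    qed
    also have "\<dots> \<le> (C3 + 1) * exp ((C + 3) * ?X)" by (intro mult_right_mono) auto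
    also have "\<dots> \<le> (C3 + 1) * (exp ((C + 3)\<^sup>2 / (2 * \<delta>)) * sqrt (Y u))" using C3 by (intro mult_left_mono 2) auto
    finally show "(1 + norm u)\<^sup>2 * (C3 * exp (C * ?X) * ?X) \<le> Y1 u" by (simp add: Y1_def C4_def mult.assoc)
    have "(1 + norm u)\<^sup>2 \<le> 1 * exp (2 * ?X)" using 1 by simp
    also have "\<dots> \<le> (C3 + 1) * exp ((C + 3) * ?X)"
      using C3 C(1) X by (intro mult_mono) (auto intro!: mult_right_mono)
    also have "\<dots> \<le> (C3 + 1) * (exp ((C + 3)\<^sup>2 / (2 * \<delta>)) * sqrt (Y u))" using C3 by (intro mult_left_mono 2) auto
    finally show "(1 + norm u)\<^sup>2 \<le> Y1 u" by (simp add: Y1_def C4_def mult.assoc)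
  qed
  have diff: "\<bar>exp (- \<Phi> u / 2) - exp (- \<Phi> (PN N u) / 2)\<bar> \<le> real N powr (- s) * (C3 * exp (C * Hs_norm s u) * Hs_norm s u)"
    if u: "u \<in> Hs s" and N: "N \<ge> 1" for u N
  proof -
    let ?a = "norm (B *v (y - G u))" and ?b = "norm (B *v (y - G (PN N u)))"
    have "\<bar>exp (- \<Phi> u / 2) - exp (- \<Phi> (PN N u) / 2)\<bar> = \<bar>exp (- (?a\<^sup>2 / 4)) - exp (- (?b\<^sup>2 / 4))\<bar>"
      by (simp add: \<Phi>_def gn)
    also have "\<dots> \<le> \<bar>?a - ?b\<bar>" by (rule exp_quarter_square_lipschitz)
    also have "\<dots> \<le> norm (B *v (y - G u) - B *v (y - G (PN N u)))" by (rule norm_triangle_ineq3)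
    also have "B *v (y - G u) - B *v (y - G (PN N u)) = B *v (G (PN N u) - G u)"
      by (simp add: matrix_vector_mult_diff_distrib)
    also have "norm \<dots> \<le> norm (G (PN N u) - G u) * K" by (rule K(2))
    also have "\<dots> \<le> (n * (C * exp (C * Hs_norm \<sigma> u) * norm (u - PN N u))) * K"
    proof (rule mult_right_mono)
      have "norm (G u - G (PN N u)) \<le> n * (C * exp (C * Hs_norm \<sigma> u) * norm (u - PN N u))"
        unfolding assms(9) n_def using assms(8)
        by (intro obs_map_diff_le C(2) Hs_mono(1)[OF u \<sigma>(3)]) (auto simp: less_imp_le)
      then show "norm (G (PN N u) - G u) \<le> n * (C * exp (C * Hs_norm \<sigma> u) * norm (u - PN N u))"
        by (simp only: norm_minus_commute)
    qed (use K(1) in simp)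
    also have "\<dots> \<le> (n * (C * exp (C * Hs_norm s u) * (real N powr (- s) * Hs_norm s u))) * K"
      using K(1) n C(1) Hs_mono(2)[OF u \<sigma>(3)] PN_error[OF u _ N] s
      by (intro mult_right_mono mult_left_mono mult_mono) (auto intro: mult_left_mono)
    also have "\<dots> = real N powr (- s) * (C3 * exp (C * Hs_norm s u) * Hs_norm s u)"
      by (simp add: C3_def mult_ac)
    finally show ?thesis .
  qed
  have pair: "posterior_pair \<mu>0 \<Phi> (\<lambda>u. \<Phi> (PN N u)) Y1 \<zeta> (real N powr (- s))" if N: "N \<ge> 1" for N
  proof unfold_locales
    show "\<zeta> \<le> (\<integral>u. exp (- \<Phi> u) \<partial>\<mu>0)" using Zge[of "\<lambda>u. u"] meas(1) by simp
    show "\<zeta> \<le> (\<integral>u. exp (- \<Phi> (PN N u)) \<partial>\<mu>0)" using Zge[of "PN N"] meas(2) norm_PN_le by simp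
    show "AE u in \<mu>0. (1 + norm u)\<^sup>2 * \<bar>exp (- \<Phi> u / 2) - exp (- \<Phi> (PN N u) / 2)\<bar> \<le> real N powr (- s) * Y1 u"
      using aeY
    proof eventually_elim
      case (elim u)
      have "(1 + norm u)\<^sup>2 * \<bar>exp (- \<Phi> u / 2) - exp (- \<Phi> (PN N u) / 2)\<bar>
          \<le> (1 + norm u)\<^sup>2 * (real N powr (- s) * (C3 * exp (C * Hs_norm s u) * Hs_norm s u))"
        using elim by (intro mult_left_mono diff N) auto
      also have "\<dots> = real N powr (- s) * ((1 + norm u)\<^sup>2 * (C3 * exp (C * Hs_norm s u) * Hs_norm s u))"
        by (simp only: mult_ac)
      also have "\<dots> \<le> real N powr (- s) * Y1 u" using elim by (intro mult_left_mono grow) auto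
      finally show ?case .
    qed
    show "AE u in \<mu>0. (1 + norm u)\<^sup>2 \<le> Y1 u" using aeY by eventually_elim (rule grow(2), auto)
  qed (use M meas \<Phi>0 \<zeta> Y1 in auto)
  have \<mu>: "\<mu> = posterior \<mu>0 \<Phi>" and \<mu>N: "\<mu>N N = posterior \<mu>0 (\<lambda>u. \<Phi> (PN N u))" for N
    using assms(11,12) by (simp_all add: \<Phi>_def[abs_def])
  \<comment> \<open>The rate obtained is \<open>s\<close>; it implies the rate \<open>q\<close>
    because \<open>q \<le> s\<close> and \<open>N \<ge> 1\<close>. The summand 1 makes the constant
    positive.\<close>
  have rate: "\<exists>c>0. \<forall>N\<ge>1. f N \<le> c * real N powr (- q)" if "\<And>N. N \<ge> 1 \<Longrightarrow> f N \<le> real N powr (- s) * k" for f :: "nat \<Rightarrow> real" and k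
  proof (intro exI[of _ "\<bar>k\<bar> + 1"] conjI allI impI)
    fix N :: nat assume N: "N \<ge> 1"
    have "f N \<le> real N powr (- s) * k" by (rule that[OF N])
    also have "\<dots> \<le> real N powr (- s) * (\<bar>k\<bar> + 1)" by (intro mult_left_mono) auto
    also have "\<dots> \<le> real N powr (- q) * (\<bar>k\<bar> + 1)" using s N by (intro mult_right_mono powr_mono) auto
    finally show "f N \<le> (\<bar>k\<bar> + 1) * real N powr (- q)" by (simp only: mult.commute)
  qed simp
  show ?thesis unfolding \<mu> \<mu>N
    using rate[OF posterior_pair.hellinger_le[OF pair]] rate[OF posterior_pair.mean_diff_le[OF pair]]
      rate[OF posterior_pair.cov_op_diff_le[OF pair]] by blast
qed

end
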